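(* Assume that $f(t,u,p)=f(t,u,-p)$ for all $(t,u,p)\in\mathbb{R}\times\mathbb{R}\times\mathbb{R}$. Let $M\subset X\times H(f)$ be a minimal set of the skew-product semiflow $\Pi_t$ generated by $u_t=u_{xx}+f(t,u,u_x)$ on $S^1=\mathbb{R}/L\mathbb{Z}$. Then there is $x_0\in S^1$ such that the mapping $$\bar h:M\to\bar M:=\{(u(x_0),g):(u,g)\in M\},\qquad \bar h(u(\cdot),g)=(u(x_0),g),$$ is a homeomorphism, and $$\bar\Pi_t:\bar M\to\bar M,\qquad \bar\Pi_t(u(x_0),g)=(\varphi(t,x_0;u,g),g\cdot t),$$ is a minimal flow satisfying $\bar h(\Pi_t(u,g))=\bar\Pi_t\,\bar h(u,g)$.
   Context: Standing assumption on $f$: $f=f(t,u,p)\in C^1(\mathbb{R}\times\mathbb{R}\times\mathbb{R},\mathbb{R})$, and $f$ and all its first-order partial derivatives are uniformly almost periodic in $t$. Here a function $F\in C(\mathbb{R}\times D,\mathbb{R})$, $D\subset\mathbb{R}^m$, is admissible if for every compact $K\subset D$ it is bounded and uniformly continuous on $\mathbb{R}\times K$; it is uniformly almost periodic in $t$ if it is admissible and $F(\cdot,d)$ is almost periodic for each fixed $d\in D$. The hull $H(f)$ is the closure of $\{f(\cdot+\tau,\cdot,\cdot):\tau\in\mathbb{R}\}$ in the compact-open topology; it is a compact metric space, on which $(g\cdot t)(s,u,p)=g(s+t,u,p)$ defines a minimal flow. Semiflow: $L>0$, $S^1=\mathbb{R}/L\mathbb{Z}$, and $X$ is a fractional power space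 associated with the operator $u\mapsto -u_{xx}:H^2(S^1)\to L^2(S^1)$ such that $X$ is compactly embedded into $C^1(S^1)$. For $(u,g)\in X\times H(f)$, $\varphi(t,\cdot;u,g)$ denotes the (local) solution in $X$ of $u_t=u_{xx}+g(t,u,u_x)$, $t>0$, $x\in S^1$, with $\varphi(0,\cdot;u,g)=u$. The (local) skew-product semiflow is $\Pi_t(u,g)=(\varphi(t,\cdot;u,g),g\cdot t)$, $t\ge0$. A minimal set of $\Pi_t$ is a nonempty compact positively invariant set containing no other nonempty compact positively invariant set. On a minimal set the semiflow extends to a flow (unique backward orbits in $M$), and $\Pi_t$, $\varphi(t,\cdot;u,g)$ for $t<0$ on $M$ refer to this flow. $\bar M$ carries the topology of $\mathbb{R}\times H(f)$; a flow on a compact space is minimal if the only nonempty compact invariant subset is the whole space. *)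

theory Defs
  imports "HOL-Analysis.Analysis"
begin

section \<open>Almost periodicity and hulls\<close>

definition almost_periodic :: "(real \<Rightarrow> real) \<Rightarrow> bool" where
  "almost_periodic h \<longleftrightarrow> continuous_on UNIV h \<and>
     (\<forall>\<epsilon>>0. \<exists>l>0. \<forall>a. \<exists>\<tau>\<in>{a..a + l}. \<forall>t. \<bar>h (t + \<tau>) - h t\<bar> < \<epsilon>)"

definition admissible :: "'d set \<Rightarrow> (real \<times> 'd::euclidean_space \<Rightarrow> real) \<Rightarrow> bool" where
  "admissible D F \<longleftrightarrow> continuous_on (UNIV \<times> D) F \<and>
     (\<forall>K. compact K \<and> K \<subseteq> D \<longrightarrow>
        bounded (F ` (UNIV \<times> K)) \<and> uniformly_continuous_on (UNIV \<times> K) F)"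

definition uniformly_almost_periodic :: "'d set \<Rightarrow> (real \<times> 'd::euclidean_space \<Rightarrow> real) \<Rightarrow> bool" where
  "uniformly_almost_periodic D F \<longleftrightarrow> admissible D F \<and> (\<forall>d\<in>D. almost_periodic (\<lambda>t. F (t, d)))"

definition C1_fun :: "('a::euclidean_space \<Rightarrow> real) \<Rightarrow> bool" where
  "C1_fun f \<longleftrightarrow> (\<forall>z. f differentiable at z) \<and>
     (\<forall>b\<in>Basis. continuous_on UNIV (\<lambda>z. frechet_derivative f (at z) b))"

text \<open>The standing assumption on the nonlinearity; the basis vectors of
  \<^typ>\<open>real \<times> real \<times> real\<close> give the three first-order partial derivatives.\<close>

definition standing_assumption :: "(real \<times> real \<times> real \<Rightarrow> real) \<Rightarrow> bool" where
  "standing_assumption f \<longleftrightarrow> C1_fun f \<and> uniformly_almost_periodic UNIV f \<and>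
     (\<forall>b\<in>Basis. uniformly_almost_periodic UNIV (\<lambda>z. frechet_derivative f (at z) b))"

definition compact_open_topology :: "('a::topological_space \<Rightarrow> 'b::topological_space) topology" where
  "compact_open_topology = topology_generated_by
     {{g. continuous_on UNIV g \<and> g ` K \<subseteq> U} | K U. compact K \<and> open U}"

definition shift :: "real \<Rightarrow> (real \<times> 'd \<Rightarrow> real) \<Rightarrow> real \<times> 'd \<Rightarrow> real" where
  "shift t g = (\<lambda>(s, d). g (s + t, d))"

definition time_hull :: "(real \<times> 'd::euclidean_space \<Rightarrow> real) \<Rightarrow> (real \<times> 'd \<Rightarrow> real) set" where
  "time_hull f = compact_open_topology closure_of (range (\<lambda>\<tau>. shift \<tau> f))"

definition hull_topology ::
    "(real \<times> 'd::euclidean_space \<Rightarrow> real) \<Rightarrow> (real \<times> 'd \<Rightarrow> real) topology" where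
  "hull_topology f = subtopology compact_open_topology (time_hull f)"


section \<open>Function spaces on the circle\<close>

text \<open>Functions on the circle of length \<open>L\<close> are \<open>L\<close>-periodic functions on the real line.\<close>

definition L2_per :: "real \<Rightarrow> (real \<Rightarrow> real) set" where
  "L2_per L = {u. (\<forall>x. u (x + L) = u x) \<and> u \<in> borel_measurable lebesgue \<and>
     set_integrable lebesgue {0..L} (\<lambda>x. (u x)\<^sup>2)}"

definition L2_norm_per :: "real \<Rightarrow> (real \<Rightarrow> real) \<Rightarrow> real" where
  "L2_norm_per L u = sqrt (LINT x:{0..L}|lebesgue. (u x)\<^sup>2)"

definition C1_per :: "real \<Rightarrow> (real \<Rightarrow> real) set" where
  "C1_per L = {u. (\<forall>x. u (x + L) = u x) \<and> u C1_differentiable_on UNIV}"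

text \<open>\<open>v\<close> is the second (weak) derivative of \<open>u\<close>, where \<open>u\<close> is the \<open>C\<^sup>1\<close>
  representative of an element of \<open>H\<^sup>2(S\<^sup>1)\<close>: \<open>u'\<close> is absolutely continuous with
  derivative \<open>v \<in> L\<^sup>2\<close>.\<close>

definition H2_second_deriv :: "real \<Rightarrow> (real \<Rightarrow> real) \<Rightarrow> (real \<Rightarrow> real) \<Rightarrow> bool" where
  "H2_second_deriv L u v \<longleftrightarrow> u \<in> C1_per L \<and> v \<in> L2_per L \<and>
     (\<forall>x\<in>{0..L}. deriv u x = deriv u 0 + (LINT y:{0..x}|lebesgue. v y))"

text \<open>The operator \<open>A u = - u\<^sub>x\<^sub>x\<close>, with domain \<open>H\<^sup>2(S\<^sup>1)\<close> in \<open>L\<^sup>2(S\<^sup>1)\<close>, is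
  self-adjoint with orthonormal eigenbasis \<open>circle_char L k\<close> (\<open>k\<close> an integer) and
  eigenvalues \<open>circle_eigenvalue L k\<close>. Since \<open>0\<close> is an eigenvalue, the fractional powers are
  taken of \<open>A + 1\<close> (another positive shift gives the same space with an equivalent norm):
  \<open>(A + 1)\<^sup>\<alpha>\<close> multiplies the \<open>k\<close>-th Fourier coefficient by \<open>(1 + circle_eigenvalue L k)\<^sup>\<alpha>\<close>,
  and the fractional power space is its domain with the norm of \<open>(A + 1)\<^sup>\<alpha> u\<close> in \<open>L\<^sup>2\<close>.\<close>

definition circle_char :: "real \<Rightarrow> int \<Rightarrow> real \<Rightarrow> complex" where
  "circle_char L k x = cis (2 * pi * of_int k * x / L) / of_real (sqrt L)"

definition circle_eigenvalue :: "real \<Rightarrow> int \<Rightarrow> real" where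
  "circle_eigenvalue L k = (2 * pi * of_int k / L)\<^sup>2"

lemma circle_char_deriv:
  "(circle_char L k has_vector_derivative
      \<i> * of_real (2 * pi * of_int k / L) * circle_char L k x) (at x)"
proof -
  define c where "c = 2 * pi * of_int k / L"
  have eq: "circle_char L k = (\<lambda>x. (\<lambda>z. exp (\<i> * of_real c * z) / of_real (sqrt L)) (of_real x))"
    by (rule ext) (simp add: circle_char_def cis_conv_exp c_def field_simps)
  have "((\<lambda>z. exp (\<i> * of_real c * z) / of_real (sqrt L)) has_field_derivative
          \<i> * of_real c * (exp (\<i> * of_real c * of_real x) / of_real (sqrt L))) (at (of_real x))"
    unfolding divide_inverse by (auto intro!: derivative_eq_intros)
  then have "((\<lambda>x. (\<lambda>z. exp (\<i> * of_real c * z) / of_real (sqrt L)) (of_real x)) has_vector_derivative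
          \<i> * of_real c * (exp (\<i> * of_real c * of_real x) / of_real (sqrt L))) (at x)"
    by (rule has_vector_derivative_real_field)
  then show ?thesis
    unfolding eq by (simp add: c_def)
qed

lemma circle_char_eigenfunction:
  "((\<lambda>x. vector_derivative (circle_char L k) (at x)) has_vector_derivative
      - (of_real (circle_eigenvalue L k) * circle_char L k x)) (at x)"
proof -
  let ?c = "\<i> * of_real (2 * pi * of_int k / L) :: complex"
  have "(\<lambda>x. vector_derivative (circle_char L k) (at x)) = (\<lambda>x. ?c * circle_char L k x)"
    by (rule ext) (rule vector_derivative_at [OF circle_char_deriv])
  moreover have "((\<lambda>x. ?c * circle_char L k x) has_vector_derivative
      ?c * (?c * circle_char L k x)) (at x)"
    by (rule has_vector_derivative_mult_right [OF circle_char_deriv])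
  moreover have "?c * ?c = - of_real (circle_eigenvalue L k)"
  proof -
    have "?c * ?c = (\<i> * \<i>) * of_real ((2 * pi * of_int k / L) * (2 * pi * of_int k / L))"
      by (simp only: of_real_mult ac_simps)
    then show ?thesis
      by (simp only: circle_eigenvalue_def power2_eq_square i_squared) simp
  qed
  ultimately show ?thesis
    by (metis (no_types, lifting) mult.assoc mult_minus_left)
qed

definition fourier_coeff :: "real \<Rightarrow> (real \<Rightarrow> real) \<Rightarrow> int \<Rightarrow> complex" where
  "fourier_coeff L u k = (LINT x:{0..L}|lebesgue. of_real (u x) * cnj (circle_char L k x))"

definition frac_domain :: "real \<Rightarrow> real \<Rightarrow> (real \<Rightarrow> real) set" where
  "frac_domain L \<alpha> = {u \<in> L2_per L.
     (\<lambda>k. ((1 + circle_eigenvalue L k) powr \<alpha> * cmod (fourier_coeff L u k))\<^sup>2) summable_on UNIV}"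

definition frac_norm :: "real \<Rightarrow> real \<Rightarrow> (real \<Rightarrow> real) \<Rightarrow> real" where
  "frac_norm L \<alpha> u = sqrt
     (\<Sum>\<^sub>\<infinity>k. ((1 + circle_eigenvalue L k) powr \<alpha> * cmod (fourier_coeff L u k))\<^sup>2)"

text \<open>\<open>frac_domain\<close> consists of all representatives of the \<open>L\<^sup>2\<close>-classes in the fractional
  power space. Once that space embeds into \<open>C\<^sup>1(S\<^sup>1)\<close>, every class has exactly one \<open>C\<^sup>1\<close>
  representative, and \<open>frac_space\<close> collects these.\<close>

definition frac_space :: "real \<Rightarrow> real \<Rightarrow> (real \<Rightarrow> real) set" where
  "frac_space L \<alpha> = frac_domain L \<alpha> \<inter> C1_per L"

definition frac_topology :: "real \<Rightarrow> real \<Rightarrow> (real \<Rightarrow> real) topology" where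
  "frac_topology L \<alpha> =
     Metric_space.mtopology (frac_space L \<alpha>) (\<lambda>u v. frac_norm L \<alpha> (\<lambda>x. u x - v x))"

definition compactly_embedded_C1 :: "real \<Rightarrow> real \<Rightarrow> bool" where
  "compactly_embedded_C1 L \<alpha> \<longleftrightarrow>
     (\<forall>u\<in>frac_domain L \<alpha>. \<exists>v\<in>C1_per L. AE x in lebesgue. u x = v x) \<and>
     (\<forall>w. (\<forall>n. w n \<in> frac_space L \<alpha>) \<and> (\<exists>B. \<forall>n. frac_norm L \<alpha> (w n) \<le> B) \<longrightarrow>
        (\<exists>r v. strict_mono (r :: nat \<Rightarrow> nat) \<and> v \<in> C1_per L \<and>
           uniform_limit UNIV (\<lambda>n. w (r n)) v sequentially \<and>
           uniform_limit UNIV (\<lambda>n. deriv (w (r n))) (deriv v) sequentially))"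


section \<open>The skew-product semiflow\<close>

text \<open>\<open>w\<close> is a solution in the fractional power space, on the time interval \<open>[0, T)\<close>, of
  \<open>u\<^sub>t = u\<^sub>x\<^sub>x + g(t, u, u\<^sub>x)\<close> with initial value \<open>u0\<close>: it is continuous into that space, and
  for \<open>t > 0\<close> it lies in \<open>H\<^sup>2\<close>, is differentiable in time as a map into \<open>L\<^sup>2\<close>, and satisfies
  the equation in \<open>L\<^sup>2\<close>.\<close>

definition solves :: "real \<Rightarrow> real \<Rightarrow> (real \<times> real \<times> real \<Rightarrow> real) \<Rightarrow> (real \<Rightarrow> real) \<Rightarrow> real
    \<Rightarrow> (real \<Rightarrow> real \<Rightarrow> real) \<Rightarrow> bool" where
  "solves L \<alpha> g u0 T w \<longleftrightarrow> 0 < T \<and> w 0 = u0 \<and>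
     continuous_map (top_of_set {0..<T}) (frac_topology L \<alpha>) w \<and>
     (\<forall>t\<in>{0<..<T}. \<exists>v. H2_second_deriv L (w t) v \<and>
        ((\<lambda>h. L2_norm_per L (\<lambda>x. (w (t + h) x - w t x) / h
                - (v x + g (t, w t x, deriv (w t) x)))) \<longlongrightarrow> 0) (at 0))"

definition sol_exists ::
    "real \<Rightarrow> real \<Rightarrow> (real \<times> real \<times> real \<Rightarrow> real) \<Rightarrow> (real \<Rightarrow> real) \<Rightarrow> real \<Rightarrow> bool" where
  "sol_exists L \<alpha> g u t \<longleftrightarrow> (\<exists>T w. t < T \<and> solves L \<alpha> g u T w)"

definition phi ::
    "real \<Rightarrow> real \<Rightarrow> real \<Rightarrow> (real \<Rightarrow> real) \<Rightarrow> (real \<times> real \<times> real \<Rightarrow> real) \<Rightarrow> real \<Rightarrow> real" where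
  "phi L \<alpha> t u g = (THE v. \<exists>T w. t < T \<and> solves L \<alpha> g u T w \<and> v = w t)"

type_synonym state = "(real \<Rightarrow> real) \<times> (real \<times> real \<times> real \<Rightarrow> real)"

definition skew_product :: "real \<Rightarrow> real \<Rightarrow> real \<Rightarrow> state \<Rightarrow> state" where
  "skew_product L \<alpha> t = (\<lambda>(u, g). (phi L \<alpha> t u g, shift t g))"

definition phase_topology ::
    "real \<Rightarrow> real \<Rightarrow> (real \<times> real \<times> real \<Rightarrow> real) \<Rightarrow> state topology" where
  "phase_topology L \<alpha> f = prod_topology (frac_topology L \<alpha>) (hull_topology f)"

definition positively_invariant :: "real \<Rightarrow> real \<Rightarrow> state set \<Rightarrow> bool" where
  "positively_invariant L \<alpha> N \<longleftrightarrow>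
     (\<forall>(u, g)\<in>N. \<forall>t\<ge>0. sol_exists L \<alpha> g u t \<and> skew_product L \<alpha> t (u, g) \<in> N)"

definition minimal_set ::
    "real \<Rightarrow> real \<Rightarrow> (real \<times> real \<times> real \<Rightarrow> real) \<Rightarrow> state set \<Rightarrow> bool" where
  "minimal_set L \<alpha> f M \<longleftrightarrow>
     M \<noteq> {} \<and> compactin (phase_topology L \<alpha> f) M \<and> positively_invariant L \<alpha> M \<and>
     (\<forall>N\<subseteq>M. N \<noteq> {} \<and> compactin (phase_topology L \<alpha> f) N \<and> positively_invariant L \<alpha> N
        \<longrightarrow> N = M)"

text \<open>The flow on a minimal set \<open>M\<close>; for negative times it follows the unique backward orbit
  in \<open>M\<close>.\<close>

definition skew_product_on :: "real \<Rightarrow> real \<Rightarrow> state set \<Rightarrow> real \<Rightarrow> state \<Rightarrow> state" where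
  "skew_product_on L \<alpha> M t z =
     (if t \<ge> 0 then skew_product L \<alpha> t z
      else THE y. y \<in> M \<and> skew_product L \<alpha> (- t) y = z)"

definition phi_on :: "real \<Rightarrow> real \<Rightarrow> state set \<Rightarrow> real \<Rightarrow> (real \<Rightarrow> real)
    \<Rightarrow> (real \<times> real \<times> real \<Rightarrow> real) \<Rightarrow> real \<Rightarrow> real" where
  "phi_on L \<alpha> M t u g = fst (skew_product_on L \<alpha> M t (u, g))"


section \<open>Minimal flows\<close>

definition flow :: "'a topology \<Rightarrow> (real \<Rightarrow> 'a \<Rightarrow> 'a) \<Rightarrow> bool" where
  "flow Y \<Phi> \<longleftrightarrow>
     continuous_map (prod_topology euclideanreal Y) Y (\<lambda>(t, y). \<Phi> t y) \<and>
     (\<forall>y\<in>topspace Y. \<Phi> 0 y = y) \<and>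
     (\<forall>s t. \<forall>y\<in>topspace Y. \<Phi> (s + t) y = \<Phi> s (\<Phi> t y))"

definition minimal_flow :: "'a topology \<Rightarrow> (real \<Rightarrow> 'a \<Rightarrow> 'a) \<Rightarrow> bool" where
  "minimal_flow Y \<Phi> \<longleftrightarrow> compact_space Y \<and> flow Y \<Phi> \<and>
     (\<forall>A. A \<noteq> {} \<and> compactin Y A \<and> (\<forall>t. \<Phi> t ` A = A) \<longrightarrow> A = topspace Y)"


definition eval_map :: "real \<Rightarrow> state \<Rightarrow> real \<times> (real \<times> real \<times> real \<Rightarrow> real)" where
  "eval_map x0 = (\<lambda>(u, g). (u x0, g))"

end

theory Submission
  imports Defs
begin

text \<open>Since \<open>f\<close> is even in \<open>u\<^sub>x\<close>, reflections and translations of solutions are solutions, and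
  their differences \<open>w\<close> satisfy \<open>\<bar>w\<^sub>t - w\<^sub>x\<^sub>x\<bar> \<le> K (\<bar>w\<bar> + \<bar>w\<^sub>x\<bar>)\<close>. For these the number of sign changes does
  not increase in time, and it is bounded along complete orbits that vanish at the ends of an interval.

  Applied to \<open>u(2a - x) - u(x)\<close>, this together with the Hopf lemma and the minimality of \<open>M\<close> shows
  that for every \<open>a\<close> either all members of \<open>M\<close> are symmetric about \<open>a\<close>, or \<open>u\<^sub>x(a)\<close> has the same
  nonzero sign on all of \<open>M\<close>. So either \<open>M\<close> consists of constants, or all its members
  are symmetric about \<open>x\<^sub>0\<close> and \<open>x\<^sub>0 + l\<close> and increase strictly from \<open>x\<^sub>0\<close> to \<open>x\<^sub>0 + l\<close>.

  Let \<open>u\<close>, \<open>v\<close> lie over the same \<open>g\<close>. The difference \<open>u - v(\<cdot> + l)\<close> has only two sign changes per period.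
  Lowering the shift from \<open>l\<close> to \<open>0\<close> cannot create more of them, because at a dense set of times all zeros
  of a difference with two sign changes are simple. If now \<open>u(x\<^sub>0) = v(x\<^sub>0)\<close> and \<open>u \<noteq> v\<close>, then by
  symmetry \<open>u - v\<close> keeps one sign near \<open>x\<^sub>0\<close> for a while, which contradicts the strong maximum principle.
  Hence evaluation at \<open>x\<^sub>0\<close> is injective on the compact set \<open>M\<close>.\<close>

section \<open>Mean-square calculus for functions of time and space\<close>

section \<open>Locally square integrable functions\<close>

text \<open>The obstacle is regularity. Signs are therefore read off from integrals of fourth powers
  of positive parts: such integrals are differentiable in time, and they are positive exactly when
  the sign occurs. Nesting them with alternating signs detects alternating chains. The bound along
  complete orbits comes from a free parameter in the energy inequality: for long chains dissipation
  wins, the nested integral decays exponentially, and being bounded in the distant past it must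
  vanish. Reflection at \<open>a\<close> supplies the boundary conditions that this needs, since
  \<open>u(2a - x) - u(x)\<close> is zero at \<open>a\<close> and at the opposite point of the
  circle. Complete orbits have to be constructed too: forward maps on \<open>M\<close> are onto by
  minimality and injective by backward uniqueness, the latter proved with the Dirichlet
  quotient.\<close>

definition L2_loc :: "(real \<Rightarrow> real) \<Rightarrow> bool" where
  "L2_loc f \<longleftrightarrow> f \<in> borel_measurable lebesgue \<and> (\<forall>a b. (\<lambda>x. (f x)\<^sup>2) integrable_on {a..b})"

lemma L2_loc_mult_abs_integrable:
  assumes "L2_loc f" "L2_loc g"
  shows "(\<lambda>x. f x * g x) absolutely_integrable_on {a..b}"
proof (rule measurable_bounded_by_integrable_imp_absolutely_integrable)
  have [measurable]: "f \<in> borel_measurable lebesgue" "g \<in> borel_measurable lebesgue"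
    using assms by (auto simp: L2_loc_def)
  show "(\<lambda>x. f x * g x) \<in> borel_measurable (lebesgue_on {a..b})"
    by (intro measurable_restrict_space1) measurable
  show "(\<lambda>x. (f x)\<^sup>2 + (g x)\<^sup>2) integrable_on {a..b}"
    using assms by (auto simp: L2_loc_def intro!: integrable_add)
  show "norm (f x * g x) \<le> (f x)\<^sup>2 + (g x)\<^sup>2" for x
  proof -
    have "2 * (\<bar>f x\<bar> * \<bar>g x\<bar>) \<le> (f x)\<^sup>2 + (g x)\<^sup>2"
      using sum_squares_bound[of "\<bar>f x\<bar>" "\<bar>g x\<bar>"] by simp
    moreover have "0 \<le> \<bar>f x\<bar> * \<bar>g x\<bar>" by simp
    ultimately show ?thesis unfolding real_norm_def abs_mult by linarith
  qed
qed auto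

lemma L2_loc_continuous:
  assumes "continuous_on UNIV f"
  shows "L2_loc f"
  unfolding L2_loc_def
proof (intro conjI allI)
  show "f \<in> borel_measurable lebesgue"
    using borel_measurable_continuous_onI[OF assms] by (simp add: measurable_completion)
  show "(\<lambda>x. (f x)\<^sup>2) integrable_on {a..b}" for a b
    by (intro integrable_continuous_real continuous_intros continuous_on_subset[OF assms]) auto
qed

lemma L2_loc_abs_integrable:
  assumes "L2_loc f"
  shows "f absolutely_integrable_on {a..b}"
  using L2_loc_mult_abs_integrable[OF assms L2_loc_continuous[of "\<lambda>_. 1"], of a b]
  by (simp add: continuous_on_const)

lemma L2_loc_integrable: "L2_loc f \<Longrightarrow> f integrable_on {a..b}"
  using L2_loc_abs_integrable set_lebesgue_integral_eq_integral(1) by blast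

lemma L2_loc_mult_integrable:
  "L2_loc f \<Longrightarrow> L2_loc g \<Longrightarrow> (\<lambda>x. f x * g x) integrable_on {a..b}"
  using L2_loc_mult_abs_integrable set_lebesgue_integral_eq_integral(1) by blast

lemma L2_loc_square_integrable: "L2_loc f \<Longrightarrow> (\<lambda>x. (f x)\<^sup>2) integrable_on {a..b}"
  by (simp add: L2_loc_def)

lemma L2_loc_add:
  assumes "L2_loc f" "L2_loc g"
  shows "L2_loc (\<lambda>x. f x + g x)"
proof -
  have "(\<lambda>x. (f x)\<^sup>2 + 2 * (f x * g x) + (g x)\<^sup>2) integrable_on {a..b}" for a b
    by (intro integrable_add integrable_on_mult_right) (use assms in \<open>simp_all add: L2_loc_mult_integrable L2_loc_square_integrable\<close>)
  then have "(\<lambda>x. (f x + g x)\<^sup>2) integrable_on {a..b}" for a b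
    by (rule integrable_eq) (simp add: power2_eq_square algebra_simps)
  then show ?thesis using assms by (auto simp: L2_loc_def)
qed

lemma L2_loc_cmult: "L2_loc f \<Longrightarrow> L2_loc (\<lambda>x. c * f x)"
  by (auto simp: L2_loc_def power_mult_distrib intro!: integrable_on_mult_right)

lemma L2_loc_minus: "L2_loc f \<Longrightarrow> L2_loc (\<lambda>x. - f x)"
  by (auto simp: L2_loc_def)

lemma L2_loc_diff:
  assumes "L2_loc f" "L2_loc g"
  shows "L2_loc (\<lambda>x. f x - g x)"
  using L2_loc_add[OF assms(1) L2_loc_minus[OF assms(2)]] by simp

lemma has_integral_reflect_translate:
  fixes f :: "real \<Rightarrow> real"
  assumes "s = 1 \<or> s = -1" "(f has_integral i) {min (s * a + c) (s * b + c)..max (s * a + c) (s * b + c)}" "a \<le> b"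
  shows "((\<lambda>x. f (s * x + c)) has_integral i) {a..b}"
  using assms(1)
proof
  assume s: "s = 1"
  have "(f has_integral i) (cbox (a + c) (b + c))"
    using assms(2,3) s by (simp add: min_absorb1 max_absorb2)
  from has_integral_affinity'[OF this, of 1 c] show ?thesis using s by simp
next
  assume s: "s = -1"
  have "(f has_integral i) (cbox (c - b) (c - a))"
    using assms(2,3) s by (simp add: min_absorb2 max_absorb1)
  from has_integral_affinity'[OF this, of 1 c] have "((\<lambda>x. f (x + c)) has_integral i) {- b.. - a}" by simp
  then have "((\<lambda>x. f (- x + c)) has_integral i) {a..b}"
    by (subst (asm) has_integral_reflect_real[symmetric]) simp
  then show ?thesis using s by simp
qed

lemma integral_reflect_translate:
  fixes f :: "real \<Rightarrow> real"
  assumes "s = 1 \<or> s = -1" "a \<le> b" "f integrable_on {min (s * a + c) (s * b + c)..max (s * a + c) (s * b + c)}"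
  shows "integral {a..b} (\<lambda>x. f (s * x + c)) =
    integral {min (s * a + c) (s * b + c)..max (s * a + c) (s * b + c)} f"
  using assms by (intro integral_unique has_integral_reflect_translate) (auto simp: integrable_integral)

lemma L2_loc_affine:
  assumes "L2_loc f" "s = 1 \<or> s = -1"
  shows "L2_loc (\<lambda>x. f (s * x + c))"
  unfolding L2_loc_def
proof (intro conjI allI)
  have "(\<lambda>x. c + s * x) \<in> lebesgue \<rightarrow>\<^sub>M lebesgue"
    using lebesgue_affine_measurable[of "\<lambda>_. s" c] assms(2) by (auto simp: Basis_real_def)
  then have m: "(\<lambda>x. s * x + c) \<in> lebesgue \<rightarrow>\<^sub>M lebesgue"
    by (simp add: add.commute)
  show "(\<lambda>x. f (s * x + c)) \<in> borel_measurable lebesgue"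
    using measurable_compose[OF m] assms(1) by (auto simp: L2_loc_def)
  show "(\<lambda>x. (f (s * x + c))\<^sup>2) integrable_on {a..b}" for a b
  proof (cases "a \<le> b")
    case True
    have "(\<lambda>x. (f x)\<^sup>2) integrable_on {min (s * a + c) (s * b + c)..max (s * a + c) (s * b + c)}"
      using assms(1) by (rule L2_loc_square_integrable)
    then show ?thesis
      using has_integral_reflect_translate[OF assms(2) _ True] unfolding integrable_on_def by blast
  qed auto
qed

section \<open>Integration by parts against an absolutely continuous function\<close>

text \<open>A bound by a product of two quantities that both shrink is of higher order than
  \<open>d - c\<close>. By uniform continuity of \<open>V\<close> the increments are at most
  \<open>e * (d - c)\<close> on short intervals, and estimates of this form add up, so Bolzano
  bisection extends them to the whole interval. With \<open>e\<close> equal to half the mean slope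
  this is absurd unless the slope is 0.\<close>

lemma constant_of_small_increments:
  fixes \<Phi> V :: "real \<Rightarrow> real"
  assumes "a \<le> b" "0 \<le> C" "continuous_on {a..b} V"
    and inc: "\<And>c d. a \<le> c \<Longrightarrow> c \<le> d \<Longrightarrow> d \<le> b \<Longrightarrow> \<bar>\<Phi> d - \<Phi> c\<bar> \<le> C * (d - c) * \<bar>V d - V c\<bar>"
  shows "\<Phi> b = \<Phi> a"
proof (rule ccontr)
  assume ne: "\<Phi> b \<noteq> \<Phi> a"
  then have "a < b" using assms(1) by (cases "a = b") auto
  define e where "e = \<bar>\<Phi> b - \<Phi> a\<bar> / (2 * (b - a))"
  have e: "e > 0" using ne \<open>a < b\<close> by (simp add: e_def)
  have uc: "uniformly_continuous_on {a..b} V"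
    using assms(3) by (intro compact_uniformly_continuous) auto
  then obtain \<delta> where \<delta>: "\<delta> > 0"
    "\<And>x y. x \<in> {a..b} \<Longrightarrow> y \<in> {a..b} \<Longrightarrow> dist y x < \<delta> \<Longrightarrow> dist (V y) (V x) < e / (C + 1)"
    using e \<open>0 \<le> C\<close> unfolding uniformly_continuous_on_def by (metis add_nonneg_pos divide_pos_pos zero_less_one)
  have "a \<le> a \<and> b \<le> b \<longrightarrow> \<bar>\<Phi> b - \<Phi> a\<bar> \<le> e * (b - a)"
  proof (rule Bolzano[of a b "\<lambda>c d. a \<le> c \<and> d \<le> b \<longrightarrow> \<bar>\<Phi> d - \<Phi> c\<bar> \<le> e * (d - c)"])
    fix x y z assume *: "a \<le> x \<and> y \<le> b \<longrightarrow> \<bar>\<Phi> y - \<Phi> x\<bar> \<le> e * (y - x)"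
      "a \<le> y \<and> z \<le> b \<longrightarrow> \<bar>\<Phi> z - \<Phi> y\<bar> \<le> e * (z - y)" "x \<le> y" "y \<le> z"
    then show "a \<le> x \<and> z \<le> b \<longrightarrow> \<bar>\<Phi> z - \<Phi> x\<bar> \<le> e * (z - x)"
      by (auto simp: algebra_simps)
  next
    fix x assume x: "a \<le> x" "x \<le> b"
    have "\<bar>\<Phi> d - \<Phi> c\<bar> \<le> e * (d - c)" if "c \<le> x" "x \<le> d" "d - c < \<delta>" "a \<le> c" "d \<le> b" for c d
    proof -
      have "\<bar>V d - V c\<bar> \<le> e / (C + 1)"
        using \<delta>(2)[of c d] that x by (simp add: dist_real_def)
      then have "C * \<bar>V d - V c\<bar> \<le> C * (e / (C + 1))"
        using \<open>0 \<le> C\<close> by (rule mult_left_mono)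
      also have "\<dots> \<le> e" using \<open>0 \<le> C\<close> e by (simp add: field_simps)
      finally have "(d - c) * (C * \<bar>V d - V c\<bar>) \<le> (d - c) * e"
        using that by (intro mult_left_mono) auto
      then show ?thesis using inc[of c d] that x by (simp add: ac_simps)
    qed
    then show "\<exists>\<delta>>0. \<forall>c d. c \<le> x \<and> x \<le> d \<and> d - c < \<delta> \<longrightarrow> (a \<le> c \<and> d \<le> b \<longrightarrow> \<bar>\<Phi> d - \<Phi> c\<bar> \<le> e * (d - c))"
      using \<delta>(1) by blast
  qed (use assms in auto)
  moreover have "e * (b - a) = \<bar>\<Phi> b - \<Phi> a\<bar> / 2" using \<open>a < b\<close> by (simp add: e_def divide_simps)
  ultimately show False using ne by simp
qed

text \<open>\<open>h\<close> is a primitive of a merely integrable \<open>v\<close>, so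
  \<open>f * h\<close> need not be differentiable everywhere. Instead the defect
  \<open>\<Phi>\<close> of the formula, as a function of the right end, is shown to be constant: its
  increment over \<open>{c..d}\<close> is the sum of the integrals of
  \<open>(f c - f x) * v x\<close> and \<open>f' x * (h d - h x)\<close>, each at most
  \<open>C * (d - c)\<close> times the integral of \<open>\<bar>v x\<bar>\<close>.\<close>

lemma integration_by_parts_AC:
  fixes f f' h v :: "real \<Rightarrow> real"
  assumes "a \<le> b"
    and f: "\<And>x. x \<in> {a..b} \<Longrightarrow> (f has_real_derivative f' x) (at x within {a..b})"
    and f': "continuous_on {a..b} f'" and h: "continuous_on {a..b} h"
    and v: "v absolutely_integrable_on {a..b}"
    and hv: "\<And>c d. a \<le> c \<Longrightarrow> c \<le> d \<Longrightarrow> d \<le> b \<Longrightarrow> integral {c..d} v = h d - h c"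
  shows "(\<lambda>x. f x * v x) absolutely_integrable_on {a..b}"
    and "integral {a..b} (\<lambda>x. f x * v x) = f b * h b - f a * h a - integral {a..b} (\<lambda>x. f' x * h x)"
proof -
  have fc: "continuous_on {a..b} f"
    using f by (meson DERIV_continuous continuous_on_eq_continuous_within)
  show fv: "(\<lambda>x. f x * v x) absolutely_integrable_on {a..b}"
  proof (rule absolutely_integrable_bounded_measurable_product_real[OF _ _ _ v])
    show "f \<in> borel_measurable (lebesgue_on {a..b})"
      using fc by (intro continuous_imp_measurable_on_sets_lebesgue) auto
    show "bounded (f ` {a..b})"
      using fc by (intro compact_imp_bounded compact_continuous_image) auto
  qed auto
  obtain C where C: "C \<ge> 0" "\<And>x. x \<in> {a..b} \<Longrightarrow> \<bar>f' x\<bar> \<le> C"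
  proof -
    have "bounded (f' ` {a..b})"
      using f' by (intro compact_imp_bounded compact_continuous_image) auto
    then show ?thesis using that unfolding bounded_real by (metis abs_ge_zero image_eqI order_trans assms(1) atLeastAtMost_iff order_refl)
  qed
  have va: "(\<lambda>x. \<bar>v x\<bar>) integrable_on {a..b}"
    using v by (simp add: absolutely_integrable_on_def)
  have f'h: "(\<lambda>x. f' x * h x) integrable_on {a..b}"
    by (intro integrable_continuous_real continuous_intros f' h)
  have fvi: "(\<lambda>x. f x * v x) integrable_on {a..b}"
    using fv set_lebesgue_integral_eq_integral(1) by blast
  have vi: "v integrable_on {a..b}"
    using v set_lebesgue_integral_eq_integral(1) by blast
  define V where "V s = integral {a..s} (\<lambda>x. \<bar>v x\<bar>)" for s
  define \<Phi> where "\<Phi> s = f s * h s - integral {a..s} (\<lambda>x. f' x * h x) - integral {a..s} (\<lambda>x. f x * v x)" for s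
  have "\<Phi> b = \<Phi> a"
  proof (rule constant_of_small_increments[where \<Phi> = \<Phi> and a = a and b = b and C = "2 * C" and V = V])
    show "continuous_on {a..b} V"
      unfolding V_def by (rule indefinite_integral_continuous_1[OF va])
    fix c d assume cd: "a \<le> c" "c \<le> d" "d \<le> b"
    have sub: "{c..d} \<subseteq> {a..b}" using cd by auto
    have comb: "integral {a..d} g - integral {a..c} g = integral {c..d} g" if "g integrable_on {a..b}" for g :: "real \<Rightarrow> real"
      using Henstock_Kurzweil_Integration.integral_combine[of a c d g] cd integrable_on_subinterval[OF that, of a d] by auto
    have Lf: "\<bar>f y - f x\<bar> \<le> C * \<bar>y - x\<bar>" if "x \<in> {a..b}" "y \<in> {a..b}" for x y
      using field_differentiable_bound[of "{a..b}" f f' C y x] f C(2) that by auto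
    have vcd: "(\<lambda>x. \<bar>v x\<bar>) integrable_on {c..d}"
      using integrable_on_subinterval[OF va sub] .
    have vcd': "v integrable_on {c..d}" using integrable_on_subinterval[OF vi sub] .
    have Lh: "\<bar>h y - h x\<bar> \<le> integral {c..d} (\<lambda>x. \<bar>v x\<bar>)" if "c \<le> x" "x \<le> y" "y \<le> d" for x y
    proof -
      have s: "{x..y} \<subseteq> {c..d}" using that by auto
      have "h y - h x = integral {x..y} v" using hv[of x y] that cd by simp
      moreover have "\<bar>integral {x..y} v\<bar> \<le> integral {x..y} (\<lambda>x. \<bar>v x\<bar>)"
        using integral_norm_bound_integral[OF integrable_on_subinterval[OF vcd' s] integrable_on_subinterval[OF vcd s]] by simp
      moreover have "integral {x..y} (\<lambda>x. \<bar>v x\<bar>) \<le> integral {c..d} (\<lambda>x. \<bar>v x\<bar>)"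
        using integral_subset_le[OF s integrable_on_subinterval[OF vcd s] vcd] by simp
      ultimately show ?thesis by simp
    qed
    define I where "I = integral {c..d} (\<lambda>x. \<bar>v x\<bar>)"
    have I: "I = V d - V c" unfolding I_def V_def using comb[OF va] by simp
    have I0: "0 \<le> I" unfolding I_def by (rule Henstock_Kurzweil_Integration.integral_nonneg[OF vcd]) simp
    have fvcd: "(\<lambda>x. f x * v x) integrable_on {c..d}" and f'hcd: "(\<lambda>x. f' x * h x) integrable_on {c..d}"
      using integrable_on_subinterval[OF fvi sub] integrable_on_subinterval[OF f'h sub] .
    have f'cd: "f' integrable_on {c..d}"
      using f' sub by (intro integrable_continuous_real continuous_on_subset[OF f'])
    have f'int: "integral {c..d} f' = f d - f c"
      using cd by (intro integral_unique fundamental_theorem_of_calculus)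
        (auto simp: has_real_derivative_iff_has_vector_derivative[symmetric] intro!: DERIV_subset[OF f])
    have "\<Phi> d - \<Phi> c = f d * h d - f c * h c - integral {c..d} (\<lambda>x. f' x * h x) - integral {c..d} (\<lambda>x. f x * v x)"
      using comb[OF f'h] comb[OF fvi] by (simp add: \<Phi>_def)
    also have "\<dots> = integral {c..d} (\<lambda>x. (f c - f x) * v x) + integral {c..d} (\<lambda>x. f' x * (h d - h x))"
    proof -
      have "integral {c..d} (\<lambda>x. (f c - f x) * v x) = f c * (h d - h c) - integral {c..d} (\<lambda>x. f x * v x)"
        using hv[of c d] cd vcd' fvcd by (simp add: left_diff_distrib integral_diff integrable_on_mult_right)
      moreover have "integral {c..d} (\<lambda>x. f' x * (h d - h x)) = (f d - f c) * h d - integral {c..d} (\<lambda>x. f' x * h x)"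
        using f'cd f'hcd f'int by (simp add: right_diff_distrib integral_diff integrable_on_mult_left)
      ultimately show ?thesis by (simp add: algebra_simps)
    qed
    finally have eq: "\<Phi> d - \<Phi> c = \<dots>" .
    have i1: "(\<lambda>x. (f c - f x) * v x) integrable_on {c..d}"
      using vcd' fvcd by (simp add: left_diff_distrib integrable_diff integrable_on_mult_right)
    have i2: "(\<lambda>x. f' x * (h d - h x)) integrable_on {c..d}"
      using f'cd f'hcd by (simp add: right_diff_distrib integrable_diff integrable_on_mult_left)
    have "\<bar>integral {c..d} (\<lambda>x. (f c - f x) * v x)\<bar> \<le> integral {c..d} (\<lambda>x. C * (d - c) * \<bar>v x\<bar>)"
    proof (rule integral_norm_bound_integral[OF i1, unfolded real_norm_def])
      show "(\<lambda>x. C * (d - c) * \<bar>v x\<bar>) integrable_on {c..d}"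
        using vcd by (rule integrable_on_mult_right)
      fix x assume x: "x \<in> {c..d}"
      have "\<bar>f c - f x\<bar> \<le> C * (d - c)"
        using Lf[of x c] x cd C(1) mult_left_mono[of "\<bar>c - x\<bar>" "d - c" C] by auto
      then show "\<bar>(f c - f x) * v x\<bar> \<le> C * (d - c) * \<bar>v x\<bar>"
        by (simp add: abs_mult mult_right_mono)
    qed
    then have b1: "\<bar>integral {c..d} (\<lambda>x. (f c - f x) * v x)\<bar> \<le> C * (d - c) * I"
      by (simp add: I_def)
    have "\<bar>integral {c..d} (\<lambda>x. f' x * (h d - h x))\<bar> \<le> integral {c..d} (\<lambda>x. C * I)"
    proof (rule integral_norm_bound_integral[OF i2, unfolded real_norm_def])
      fix x assume x: "x \<in> {c..d}"
      have "\<bar>f' x\<bar> \<le> C" "\<bar>h d - h x\<bar> \<le> I"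
        using C(2)[of x] Lh[of x d] x cd by (auto simp: I_def)
      then show "\<bar>f' x * (h d - h x)\<bar> \<le> C * I"
        using C(1) by (simp add: abs_mult mult_mono)
    qed auto
    also have "\<dots> = C * (d - c) * I" using cd by simp
    finally have "\<bar>\<Phi> d - \<Phi> c\<bar> \<le> 2 * C * (d - c) * I" using b1 eq by linarith
    then show "\<bar>\<Phi> d - \<Phi> c\<bar> \<le> 2 * C * (d - c) * \<bar>V d - V c\<bar>" using I I0 by simp
  qed (use C assms(1) in auto)
  then show "integral {a..b} (\<lambda>x. f x * v x) = f b * h b - f a * h a - integral {a..b} (\<lambda>x. f' x * h x)"
    unfolding \<Phi>_def by simp
qed

section \<open>Continuation of local estimates\<close>

text \<open>Adding \<open>c / k\<close> turns the inequality into a homogeneous one. The rate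
  \<open>k\<close> may be negative: this yields decay in \<open>achain_bounded_length\<close> and,
  applied to a negated energy, a lower bound in \<open>backward_uniqueness\<close>. The derivative
  is asked for only at interior times because solutions need not be differentiable at their initial
  time.\<close>

lemma Gronwall_within:
  fixes E E' :: "real \<Rightarrow> real"
  assumes "s \<le> t" "continuous_on {s..t} E"
    and d: "\<And>\<tau>. s < \<tau> \<Longrightarrow> \<tau> < t \<Longrightarrow> (E has_real_derivative E' \<tau>) (at \<tau>)"
    and le: "\<And>\<tau>. s < \<tau> \<Longrightarrow> \<tau> < t \<Longrightarrow> E' \<tau> \<le> k * E \<tau> + c"
    and "k \<noteq> 0"
  shows "E t + c / k \<le> exp (k * (t - s)) * (E s + c / k)"
proof (cases "s = t")
  case False
  then have st: "s < t" using assms(1) by simp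
  define \<phi> where "\<phi> \<tau> = exp (- k * \<tau>) * (E \<tau> + c / k)" for \<tau>
  have "\<phi> t \<le> \<phi> s"
  proof (rule DERIV_nonpos_imp_decreasing_open[OF assms(1)])
    show "continuous_on {s..t} \<phi>" unfolding \<phi>_def by (intro continuous_intros assms(2))
    fix \<tau> assume \<tau>: "s < \<tau>" "\<tau> < t"
    have "(\<phi> has_real_derivative (exp (- k * \<tau>) * E' \<tau> + (- k * exp (- k * \<tau>)) * (E \<tau> + c / k))) (at \<tau>)"
      unfolding \<phi>_def by (auto intro!: derivative_eq_intros d[OF \<tau>] simp: algebra_simps)
    moreover have "exp (- k * \<tau>) * E' \<tau> + (- k * exp (- k * \<tau>)) * (E \<tau> + c / k) = exp (- k * \<tau>) * (E' \<tau> - (k * E \<tau> + c))"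
      using \<open>k \<noteq> 0\<close> by (simp add: algebra_simps)
    moreover have "exp (- k * \<tau>) * (E' \<tau> - (k * E \<tau> + c)) \<le> 0"
      using le[OF \<tau>] by (intro mult_nonneg_nonpos) auto
    ultimately show "\<exists>y. (\<phi> has_real_derivative y) (at \<tau>) \<and> y \<le> 0" by auto
  qed
  then have "exp (k * t) * \<phi> t \<le> exp (k * t) * \<phi> s" by simp
  moreover have "exp (k * t) * \<phi> t = E t + c / k"
    unfolding \<phi>_def mult.assoc[symmetric] exp_add[symmetric] by simp
  moreover have "exp (k * t) * \<phi> s = exp (k * (t - s)) * (E s + c / k)"
    unfolding \<phi>_def mult.assoc[symmetric] exp_add[symmetric] by (simp add: right_diff_distrib)
  ultimately show ?thesis by simp
qed auto

section \<open>Functions with a second space derivative and a time derivative in the square mean\<close>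

text \<open>\<open>v\<close> stands for the second space derivative and \<open>r\<close> for the
  time derivative; the equation linking them is left out, so that solutions, their differences,
  reflections and barriers are all instances. Both exist only in the mean: \<open>v\<close> through
  its integrals, \<open>r\<close> as a limit of difference quotients in the square mean. Bounded
  intervals replace the circle because exponential barriers are not periodic.\<close>

definition evol :: "real set \<Rightarrow> (real \<Rightarrow> real \<Rightarrow> real) \<Rightarrow> (real \<Rightarrow> real \<Rightarrow> real)
    \<Rightarrow> (real \<Rightarrow> real \<Rightarrow> real) \<Rightarrow> (real \<Rightarrow> real \<Rightarrow> real) \<Rightarrow> bool" where
  "evol I u ux v r \<longleftrightarrow> open I \<and>
     continuous_on (I \<times> UNIV) (\<lambda>(t, x). u t x) \<and> continuous_on (I \<times> UNIV) (\<lambda>(t, x). ux t x) \<and>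
     (\<forall>t\<in>I. (\<forall>x. (u t has_real_derivative ux t x) (at x)) \<and> L2_loc (v t) \<and> L2_loc (r t) \<and>
        (\<forall>a b. a \<le> b \<longrightarrow> integral {a..b} (v t) = ux t b - ux t a) \<and>
        (\<forall>a b. ((\<lambda>h. integral {a..b} (\<lambda>x. ((u (t + h) x - u t x) / h - r t x)\<^sup>2)) \<longlongrightarrow> 0) (at 0)))"

lemma continuous_on_slice:
  assumes "continuous_on (I \<times> UNIV) (\<lambda>(t, x). u t x)" "t \<in> I"
  shows "continuous_on S (u t)"
proof -
  have "continuous_on S (\<lambda>x. (\<lambda>(t, x). u t x) (t, x))"
    by (rule continuous_on_compose2[OF assms(1)]) (use assms(2) in \<open>auto intro!: continuous_intros\<close>)
  then show ?thesis by simp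
qed

lemma evolD:
  assumes "evol I u ux v r"
  shows "open I"
    and "continuous_on (I \<times> UNIV) (\<lambda>(t, x). u t x)"
    and "continuous_on (I \<times> UNIV) (\<lambda>(t, x). ux t x)"
    and "t \<in> I \<Longrightarrow> (u t has_real_derivative ux t x) (at x within S)"
    and "t \<in> I \<Longrightarrow> L2_loc (v t)" and "t \<in> I \<Longrightarrow> L2_loc (r t)"
    and "t \<in> I \<Longrightarrow> a \<le> b \<Longrightarrow> integral {a..b} (v t) = ux t b - ux t a"
    and "t \<in> I \<Longrightarrow> ((\<lambda>h. integral {a..b} (\<lambda>x. ((u (t + h) x - u t x) / h - r t x)\<^sup>2)) \<longlongrightarrow> 0) (at 0)"
    and "t \<in> I \<Longrightarrow> continuous_on S (u t)"
    and "t \<in> I \<Longrightarrow> continuous_on S (ux t)"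
  using assms by (auto simp: evol_def intro: has_field_derivative_at_within continuous_on_slice)

lemma eventually_at_0_shift:
  fixes t :: real
  assumes "open I" "t \<in> I"
  shows "\<forall>\<^sub>F h in at 0. t + h \<in> I"
proof -
  have "((\<lambda>h. t + h) \<longlongrightarrow> t + 0) (at 0)" by (intro tendsto_intros)
  then show ?thesis using topological_tendstoD[OF _ assms(1)] assms(2) by fastforce
qed

text \<open>Time and space point move together, which is what a frame moving with constant speed
  needs in \<open>evol_affine\<close>.\<close>

lemma uniform_shift_limit:
  fixes u :: "real \<Rightarrow> real \<Rightarrow> real"
  assumes "continuous_on (I \<times> UNIV) (\<lambda>(t, x). u t x)" "open I" "t \<in> I" "e > 0"
  shows "\<exists>d>0. \<forall>h. \<bar>h\<bar> < d \<longrightarrow> t + h \<in> I \<and> (\<forall>x\<in>{a..b}. \<forall>y. \<bar>y - x\<bar> < d \<longrightarrow> \<bar>u (t + h) y - u t x\<bar> < e)"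
proof -
  obtain d0 where d0: "d0 > 0" "cball t d0 \<subseteq> I"
    using assms(2,3) open_contains_cball by blast
  have "continuous_on (cball t d0 \<times> {a - 1..b + 1}) (\<lambda>(t, x). u t x)"
    by (rule continuous_on_subset[OF assms(1)]) (use d0 in auto)
  then have "uniformly_continuous_on (cball t d0 \<times> {a - 1..b + 1}) (\<lambda>(t, x). u t x)"
    by (rule compact_uniformly_continuous) (auto intro!: compact_Times)
  then obtain d1 where d1: "d1 > 0"
    "\<And>p q. p \<in> cball t d0 \<times> {a - 1..b + 1} \<Longrightarrow> q \<in> cball t d0 \<times> {a - 1..b + 1} \<Longrightarrow> dist q p < d1 \<Longrightarrow>
      dist ((\<lambda>(t, x). u t x) q) ((\<lambda>(t, x). u t x) p) < e"
    unfolding uniformly_continuous_on_def using assms(4) by blast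
  define d where "d = min (min d0 1) (d1 / 2)"
  have d: "d > 0" using d0 d1 by (simp add: d_def)
  show ?thesis
  proof (intro exI[of _ d] conjI allI impI ballI d)
    fix h assume h: "\<bar>h\<bar> < d"
    then show "t + h \<in> I" using d0 by (auto simp: d_def dist_real_def subset_iff)
    fix x y assume x: "x \<in> {a..b}" and y: "\<bar>y - x\<bar> < d"
    have "dist (t + h, y) (t, x) \<le> \<bar>h\<bar> + \<bar>y - x\<bar>"
      unfolding dist_prod_def by (simp add: dist_real_def) (metis sqrt_sum_squares_le_sum_abs)
    then have "dist (t + h, y) (t, x) < d1" using h y by (simp add: d_def)
    moreover have "(t + h, y) \<in> cball t d0 \<times> {a - 1..b + 1}" "(t, x) \<in> cball t d0 \<times> {a - 1..b + 1}"
      using h x y d0 by (auto simp: d_def dist_real_def)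
    ultimately show "\<bar>u (t + h) y - u t x\<bar> < e"
      using d1(2)[of "(t, x)" "(t + h, y)"] by (simp add: dist_real_def)
  qed
qed

text \<open>A weighted inequality between the means. Integrated over an interval it stands in for
  the Cauchy-Schwarz inequality: with \<open>s\<close> close to the root of the mean square, both
  terms are small.\<close>

lemma abs_le_quadratic: "\<bar>D :: real\<bar> \<le> s / 2 + D\<^sup>2 / (2 * s)" if "s > 0"
proof -
  have "0 \<le> (\<bar>D\<bar> - s)\<^sup>2" by simp
  then have "2 * s * \<bar>D\<bar> \<le> s\<^sup>2 + D\<^sup>2" by (simp add: power2_diff ac_simps)
  then show ?thesis using that by (simp add: field_simps power2_eq_square)
qed

lemma second_order_remainder:
  fixes \<beta> \<beta>' \<beta>'' :: "real \<Rightarrow> real"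
  assumes "\<And>s. (\<beta> has_real_derivative \<beta>' s) (at s)" "\<And>s. (\<beta>' has_real_derivative \<beta>'' s) (at s)"
    and "continuous_on UNIV \<beta>''"
  shows "\<exists>C\<ge>0. \<forall>x\<in>{-R..R}. \<forall>y\<in>{-R..R}. \<bar>\<beta> y - \<beta> x - \<beta>' x * (y - x)\<bar> \<le> C * (y - x)\<^sup>2"
proof -
  have "bounded (\<beta>'' ` {-R..R})"
    by (intro compact_imp_bounded compact_continuous_image continuous_on_subset[OF assms(3)]) auto
  then obtain C where C: "C > 0" "\<And>s. s \<in> {-R..R} \<Longrightarrow> \<bar>\<beta>'' s\<bar> \<le> C"
    unfolding bounded_pos by auto
  have L: "\<bar>\<beta>' y - \<beta>' x\<bar> \<le> C * \<bar>y - x\<bar>" if "x \<in> {-R..R}" "y \<in> {-R..R}" for x y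
    using field_differentiable_bound[of "{-R..R}" \<beta>' \<beta>'' C y x] that C(2) assms(2)
    by (auto intro: DERIV_subset)
  have "\<bar>\<beta> y - \<beta> x - \<beta>' x * (y - x)\<bar> \<le> C * (y - x)\<^sup>2" if xy: "x \<in> {-R..R}" "y \<in> {-R..R}" for x y
  proof -
    have "\<bar>(\<lambda>s. \<beta> s - \<beta>' x * s) y - (\<lambda>s. \<beta> s - \<beta>' x * s) x\<bar> \<le> (C * \<bar>y - x\<bar>) * \<bar>y - x\<bar>"
    proof (rule field_differentiable_bound[of "{min x y..max x y}" _ "\<lambda>s. \<beta>' s - \<beta>' x", unfolded real_norm_def])
      fix s assume s: "s \<in> {min x y..max x y}"
      show "((\<lambda>s. \<beta> s - \<beta>' x * s) has_real_derivative \<beta>' s - \<beta>' x) (at s within {min x y..max x y})"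
        by (rule DERIV_subset[of _ _ _ UNIV]) (auto intro!: derivative_eq_intros assms(1))
      have "\<bar>\<beta>' s - \<beta>' x\<bar> \<le> C * \<bar>s - x\<bar>" using L[of x s] xy s by (auto simp: min_def max_def split: if_splits)
      also have "\<dots> \<le> C * \<bar>y - x\<bar>" using s C(1) by (intro mult_left_mono) auto
      finally show "\<bar>\<beta>' s - \<beta>' x\<bar> \<le> C * \<bar>y - x\<bar>" .
    qed auto
    then show ?thesis by (simp add: power2_eq_square algebra_simps)
  qed
  then show ?thesis using C(1) less_imp_le by blast
qed

text \<open>A chain rule in the mean. The error \<open>D\<close> of the difference quotient is small
  only in the square mean. The Taylor remainder, quadratic in \<open>D + r t x\<close>, carries a
  factor \<open>\<bar>h\<bar>\<close>; the linear term \<open>\<beta>' (u t x) * D\<close> is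
  estimated with \<open>abs_le_quadratic\<close>. What results is convergence in the first-order
  mean, enough for derivatives of integrals.\<close>

lemma mean_derivative_compose:
  fixes \<beta> \<beta>' \<beta>'' :: "real \<Rightarrow> real"
  assumes ev: "evol I u ux v r" and t: "t \<in> I" and ab: "a \<le> b"
    and \<beta>: "\<And>s. (\<beta> has_real_derivative \<beta>' s) (at s)" "\<And>s. (\<beta>' has_real_derivative \<beta>'' s) (at s)"
      "continuous_on UNIV \<beta>''"
  shows "((\<lambda>h. integral {a..b} (\<lambda>x. \<bar>(\<beta> (u (t + h) x) - \<beta> (u t x)) / h - \<beta>' (u t x) * r t x\<bar>)) \<longlongrightarrow> 0) (at 0)"
proof -
  note evD = evolD[OF ev]
  have \<beta>c: "continuous_on UNIV \<beta>" "continuous_on UNIV \<beta>'"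
    using \<beta>(1,2) by (meson DERIV_continuous_on DERIV_subset has_field_derivative_at_within)+
  have L2r: "L2_loc (r t)" using evD(6)[OF t] .
  define q where "q h = integral {a..b} (\<lambda>x. ((u (t + h) x - u t x) / h - r t x)\<^sup>2)" for h
  have q0: "(q \<longlongrightarrow> 0) (at 0)" unfolding q_def by (rule evD(8)[OF t])
  obtain d where d: "d > 0" "\<And>h. \<bar>h\<bar> < d \<Longrightarrow> t + h \<in> I"
    "\<And>h x y. \<bar>h\<bar> < d \<Longrightarrow> x \<in> {a..b} \<Longrightarrow> \<bar>y - x\<bar> < d \<Longrightarrow> \<bar>u (t + h) y - u t x\<bar> < 1"
    using uniform_shift_limit[OF evD(2,1) t, of 1 a b] by auto
  have "bounded (u t ` {a..b})"
    by (intro compact_imp_bounded compact_continuous_image evD(9)[OF t]) auto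
  then obtain R0 where R0: "\<And>x. x \<in> {a..b} \<Longrightarrow> \<bar>u t x\<bar> \<le> R0" unfolding bounded_pos by (metis imageI real_norm_def)
  define R where "R = R0 + 1"
  obtain C where C: "C \<ge> 0" "\<And>x y. x \<in> {-R..R} \<Longrightarrow> y \<in> {-R..R} \<Longrightarrow> \<bar>\<beta> y - \<beta> x - \<beta>' x * (y - x)\<bar> \<le> C * (y - x)\<^sup>2"
    using second_order_remainder[OF \<beta>, of R] by blast
  have "bounded (\<beta>' ` {-R..R})"
    by (intro compact_imp_bounded compact_continuous_image continuous_on_subset[OF \<beta>c(2)]) auto
  then obtain C1 where C1: "C1 > 0" "\<And>s. s \<in> {-R..R} \<Longrightarrow> \<bar>\<beta>' s\<bar> \<le> C1" unfolding bounded_pos by auto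
  define J where "J = integral {a..b} (\<lambda>x. (r t x)\<^sup>2)"
  \<comment> \<open>The choice \<open>s = sqrt (q h)\<close> would balance the terms
    \<open>s / 2\<close> and \<open>q h / (2 * s)\<close>; the summand \<open>\<bar>h\<bar>\<close>
    keeps \<open>s\<close> positive when \<open>q h = 0\<close>.\<close>
  define s where "s h = sqrt (q h) + \<bar>h\<bar>" for h
  define B where "B h = 2 * C * \<bar>h\<bar> * (q h + J) + C1 * (s h / 2 * (b - a) + sqrt (q h) / 2)" for h
  have s0: "(s \<longlongrightarrow> 0) (at 0)"
  proof -
    have "(s \<longlongrightarrow> sqrt 0 + \<bar>0\<bar>) (at 0)" unfolding s_def by (intro tendsto_intros q0)
    then show ?thesis by simp
  qed
  have B0: "(B \<longlongrightarrow> 0) (at 0)"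
  proof -
    have "(B \<longlongrightarrow> 2 * C * \<bar>0\<bar> * (0 + J) + C1 * (0 / 2 * (b - a) + sqrt 0 / 2)) (at 0)"
      unfolding B_def by (intro tendsto_intros q0 s0) simp_all
    then show ?thesis by simp
  qed
  have main: "0 \<le> integral {a..b} (\<lambda>x. \<bar>(\<beta> (u (t + h) x) - \<beta> (u t x)) / h - \<beta>' (u t x) * r t x\<bar>)
     \<and> integral {a..b} (\<lambda>x. \<bar>(\<beta> (u (t + h) x) - \<beta> (u t x)) / h - \<beta>' (u t x) * r t x\<bar>) \<le> B h"
    if h: "h \<noteq> 0" "\<bar>h\<bar> < d" for h
  proof -
    have thI: "t + h \<in> I" using d(2) h by simp
    have cu: "continuous_on UNIV (u t)" "continuous_on UNIV (u (t + h))" using evD(9) t thI by auto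
    have L1: "L2_loc (\<lambda>x. (\<beta> (u (t + h) x) - \<beta> (u t x)) / h)"
      by (intro L2_loc_continuous continuous_intros continuous_on_compose2[OF \<beta>c(1)] cu) (use h(1) in auto)
    have L2: "L2_loc (\<lambda>x. \<beta>' (u t x))"
      by (intro L2_loc_continuous continuous_on_compose2[OF \<beta>c(2)] cu) auto
    have L3: "L2_loc (\<lambda>x. (u (t + h) x - u t x) / h - r t x)"
      by (intro L2_loc_diff L2r L2_loc_continuous continuous_intros cu) (use h(1) in auto)
    have A: "(\<lambda>x. (\<beta> (u (t + h) x) - \<beta> (u t x)) / h - \<beta>' (u t x) * r t x) absolutely_integrable_on {a..b}"
      by (intro set_integral_diff L2_loc_abs_integrable[OF L1] L2_loc_mult_abs_integrable[OF L2 L2r])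
    then have i1: "(\<lambda>x. \<bar>(\<beta> (u (t + h) x) - \<beta> (u t x)) / h - \<beta>' (u t x) * r t x\<bar>) integrable_on {a..b}"
      by (simp add: absolutely_integrable_on_def)
    have iq: "(\<lambda>x. ((u (t + h) x - u t x) / h - r t x)\<^sup>2) integrable_on {a..b}"
      using L3 by (rule L2_loc_square_integrable)
    have ir: "(\<lambda>x. (r t x)\<^sup>2) integrable_on {a..b}" using L2r by (rule L2_loc_square_integrable)
    have qh: "0 \<le> q h" unfolding q_def by (rule Henstock_Kurzweil_Integration.integral_nonneg[OF iq]) simp
    have sh: "s h > 0" using h(1) qh by (simp add: s_def add_nonneg_pos)
    let ?g = "\<lambda>x. 2 * C * \<bar>h\<bar> * (((u (t + h) x - u t x) / h - r t x)\<^sup>2 + (r t x)\<^sup>2)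
        + C1 * (s h / 2 + ((u (t + h) x - u t x) / h - r t x)\<^sup>2 / (2 * s h))"
    have hg: "(?g has_integral (2 * C * \<bar>h\<bar> * (q h + J) + C1 * (s h / 2 * (b - a) + q h / (2 * s h)))) {a..b}"
    proof -
      have c: "((\<lambda>x. s h / 2) has_integral (s h / 2 * (b - a))) {a..b}"
        using has_integral_const_real[of "s h / 2" a b] ab by (simp add: mult.commute)
      show ?thesis unfolding q_def J_def
        by (intro has_integral_add has_integral_mult_right has_integral_divide c integrable_integral iq ir)
    qed
    have "integral {a..b} (\<lambda>x. \<bar>(\<beta> (u (t + h) x) - \<beta> (u t x)) / h - \<beta>' (u t x) * r t x\<bar>) \<le> integral {a..b} ?g"
    proof (rule Henstock_Kurzweil_Integration.integral_le[OF i1])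
      show "?g integrable_on {a..b}" using hg by blast
      fix x assume x: "x \<in> {a..b}"
      define D where "D = (u (t + h) x - u t x) / h - r t x"
      have uu: "u (t + h) x - u t x = h * (D + r t x)" using h(1) by (simp add: D_def field_simps)
      have in1: "u t x \<in> {-R..R}" using R0[OF x] by (simp add: R_def abs_le_iff)
      have in2: "u (t + h) x \<in> {-R..R}" using R0[OF x] d(3)[OF h(2) x, of x] d(1) by (simp add: R_def abs_le_iff abs_less_iff)
      have "\<bar>\<beta> (u (t + h) x) - \<beta> (u t x) - \<beta>' (u t x) * (h * (D + r t x))\<bar> \<le> C * (h * (D + r t x))\<^sup>2"
        using C(2)[OF in1 in2] unfolding uu .
      then have div: "\<bar>(\<beta> (u (t + h) x) - \<beta> (u t x) - \<beta>' (u t x) * (h * (D + r t x))) / h\<bar> \<le> C * \<bar>h\<bar> * (D + r t x)\<^sup>2"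
        using h(1) by (simp add: abs_divide divide_le_eq power_mult_distrib power2_eq_square[of h] mult.assoc ac_simps abs_mult_self_eq)
      have 0: "\<bar>((\<beta> (u (t + h) x) - \<beta> (u t x)) / h - \<beta>' (u t x) * r t x) - \<beta>' (u t x) * D\<bar> \<le> C * \<bar>h\<bar> * (D + r t x)\<^sup>2"
      proof -
        have "(\<beta> (u (t + h) x) - \<beta> (u t x) - \<beta>' (u t x) * (h * (D + r t x))) / h
          = ((\<beta> (u (t + h) x) - \<beta> (u t x)) / h - \<beta>' (u t x) * r t x) - \<beta>' (u t x) * D"
          using h(1) by (simp add: field_simps)
        with div show ?thesis by (simp only:)
      qed
      have abs_le: "\<bar>a :: real\<bar> \<le> c + \<bar>b\<bar>" if "\<bar>a - b\<bar> \<le> c" for a b c using that by linarith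
      have 1: "\<bar>((\<beta> (u (t + h) x) - \<beta> (u t x)) / h - \<beta>' (u t x) * r t x)\<bar> \<le> C * \<bar>h\<bar> * (D + r t x)\<^sup>2 + \<bar>\<beta>' (u t x) * D\<bar>"
        by (rule abs_le[OF 0])
      have "(D + r t x)\<^sup>2 \<le> 2 * (D\<^sup>2 + (r t x)\<^sup>2)"
        using sum_squares_bound[of D "r t x"] by (simp add: power2_sum)
      then have 2: "C * \<bar>h\<bar> * (D + r t x)\<^sup>2 \<le> C * \<bar>h\<bar> * (2 * (D\<^sup>2 + (r t x)\<^sup>2))"
        using C(1) by (intro mult_left_mono) auto
      have "\<bar>\<beta>' (u t x) * D\<bar> \<le> C1 * \<bar>D\<bar>"
        using C1(2)[OF in1] by (simp add: abs_mult mult_right_mono)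
      also have "\<dots> \<le> C1 * (s h / 2 + D\<^sup>2 / (2 * s h))"
        using abs_le_quadratic[OF sh, of D] C1(1) by (intro mult_left_mono) auto
      finally have 3: "\<bar>\<beta>' (u t x) * D\<bar> \<le> C1 * (s h / 2 + D\<^sup>2 / (2 * s h))" .
      show "\<bar>(\<beta> (u (t + h) x) - \<beta> (u t x)) / h - \<beta>' (u t x) * r t x\<bar> \<le> ?g x"
      proof -
        have "C * \<bar>h\<bar> * (2 * (D\<^sup>2 + (r t x)\<^sup>2)) = 2 * C * \<bar>h\<bar> * (D\<^sup>2 + (r t x)\<^sup>2)" by simp
        with 1 2 3 show ?thesis unfolding D_def[symmetric] by (smt (verit))
      qed
    qed
    also have "\<dots> = 2 * C * \<bar>h\<bar> * (q h + J) + C1 * (s h / 2 * (b - a) + q h / (2 * s h))"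
      using hg by (rule integral_unique)
    also have "\<dots> \<le> B h"
    proof -
      have "q h = sqrt (q h) * sqrt (q h)" using qh by simp
      also have "\<dots> \<le> sqrt (q h) * s h" using qh by (intro mult_left_mono) (auto simp: s_def)
      finally have "q h / (2 * s h) \<le> sqrt (q h) / 2" using sh by (simp add: field_simps)
      then show ?thesis using C1(1) unfolding B_def by (intro add_left_mono mult_left_mono) auto
    qed
    finally show ?thesis
      using Henstock_Kurzweil_Integration.integral_nonneg[OF i1] by simp
  qed
  have "\<forall>\<^sub>F h in at 0. h \<noteq> 0 \<and> \<bar>h\<bar> < d"
    using d(1) by (auto simp: eventually_at dist_real_def)
  then have ev1: "\<forall>\<^sub>F h in at 0. 0 \<le> integral {a..b} (\<lambda>x. \<bar>(\<beta> (u (t + h) x) - \<beta> (u t x)) / h - \<beta>' (u t x) * r t x\<bar>)"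
    and ev2: "\<forall>\<^sub>F h in at 0. integral {a..b} (\<lambda>x. \<bar>(\<beta> (u (t + h) x) - \<beta> (u t x)) / h - \<beta>' (u t x) * r t x\<bar>) \<le> B h"
    by (eventually_elim; use main in blast)+
  show ?thesis by (rule tendsto_sandwich[OF ev1 ev2 tendsto_const B0])
qed

text \<open>Uniformity in the space variable is built in because \<open>F\<close> becomes a factor
  under the next integral, where it is multiplied by a function that is controlled only in the
  mean.\<close>

definition utd :: "(real \<Rightarrow> real \<Rightarrow> real) \<Rightarrow> (real \<Rightarrow> real) \<Rightarrow> real \<Rightarrow> real set \<Rightarrow> bool" where
  "utd F G t S \<longleftrightarrow> uniform_limit S (\<lambda>h y. (F (t + h) y - F t y) / h) G (at 0)"

lemma utd_imp_derivative:
  assumes "utd F G t S" "y \<in> S"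
  shows "((\<lambda>t. F t y) has_real_derivative G y) (at t)"
  using tendsto_uniform_limitI[OF assms(1)[unfolded utd_def] assms(2)] by (simp add: DERIV_def)

text \<open>A product rule for iterated integrals. One factor is differentiable in time only in the
  mean, the other uniformly; the integral up to \<open>y\<close> is again uniformly differentiable,
  so the lemma can be applied to its own result. This is the induction step for
  \<open>nest\<close>.\<close>

lemma utd_integral:
  fixes \<rho> :: "real \<Rightarrow> real \<Rightarrow> real"
  assumes I: "open I" "t \<in> I" and pq: "p \<le> q"
    and \<rho>c: "\<And>t'. t' \<in> I \<Longrightarrow> continuous_on UNIV (\<rho> t')"
    and \<rho>': "\<rho>' absolutely_integrable_on {p..q}"
    and \<rho>d: "((\<lambda>h. integral {p..q} (\<lambda>x. \<bar>(\<rho> (t + h) x - \<rho> t x) / h - \<rho>' x\<bar>)) \<longlongrightarrow> 0) (at 0)"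
    and Fc: "\<And>t'. t' \<in> I \<Longrightarrow> continuous_on {p..q} (F t')"
    and Gc: "continuous_on {p..q} G" and FG: "utd F G t {p..q}"
  shows "utd (\<lambda>t y. integral {p..y} (\<lambda>x. \<rho> t x * F t x)) (\<lambda>y. integral {p..y} (\<lambda>x. \<rho>' x * F t x + \<rho> t x * G x)) t {p..q}"
    and "(\<lambda>x. \<rho>' x * F t x + \<rho> t x * G x) absolutely_integrable_on {p..q}"
proof -
  have bd: "\<exists>M>0. \<forall>x\<in>{p..q}. \<bar>f x\<bar> \<le> M" if "continuous_on {p..q} f" for f :: "real \<Rightarrow> real"
    using compact_imp_bounded[OF compact_continuous_image[OF that]] unfolding bounded_pos by auto
  obtain MF where MF: "MF > 0" "\<And>x. x \<in> {p..q} \<Longrightarrow> \<bar>F t x\<bar> \<le> MF" using bd[OF Fc[OF I(2)]] by blast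
  obtain MG where MG: "MG > 0" "\<And>x. x \<in> {p..q} \<Longrightarrow> \<bar>G x\<bar> \<le> MG" using bd[OF Gc] by blast
  have \<rho>t: "continuous_on {p..q} (\<rho> t)" using \<rho>c[OF I(2)] continuous_on_subset by blast
  obtain M\<rho> where M\<rho>: "M\<rho> > 0" "\<And>x. x \<in> {p..q} \<Longrightarrow> \<bar>\<rho> t x\<bar> \<le> M\<rho>" using bd[OF \<rho>t] by blast
  have prod: "(\<lambda>x. f x * g x) absolutely_integrable_on {p..q}"
    if "continuous_on {p..q} g" "f absolutely_integrable_on {p..q}" for f g :: "real \<Rightarrow> real"
  proof -
    have "(\<lambda>x. g x * f x) absolutely_integrable_on {p..q}"
      using that by (intro absolutely_integrable_bounded_measurable_product_real continuous_imp_measurable_on_sets_lebesgue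
        compact_imp_bounded compact_continuous_image) auto
    then show ?thesis by (simp add: mult.commute)
  qed
  have cont_ai: "f absolutely_integrable_on {p..q}" if "continuous_on {p..q} f" for f :: "real \<Rightarrow> real"
    using that by (rule absolutely_integrable_continuous_real)
  show ai: "(\<lambda>x. \<rho>' x * F t x + \<rho> t x * G x) absolutely_integrable_on {p..q}"
    by (intro set_integral_add prod Fc I \<rho>' Gc cont_ai \<rho>t)
  define J where "J = integral {p..q} (\<lambda>x. \<bar>\<rho>' x\<bar>)"
  have \<rho>'a: "(\<lambda>x. \<bar>\<rho>' x\<bar>) integrable_on {p..q}" using \<rho>' by (simp add: absolutely_integrable_on_def)
  have J: "J \<ge> 0" unfolding J_def using \<rho>'a by (rule Henstock_Kurzweil_Integration.integral_nonneg) simp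
  show "utd (\<lambda>t y. integral {p..y} (\<lambda>x. \<rho> t x * F t x)) (\<lambda>y. integral {p..y} (\<lambda>x. \<rho>' x * F t x + \<rho> t x * G x)) t {p..q}"
    unfolding utd_def
  proof (rule uniform_limitI)
    fix e :: real assume e: "e > 0"
    \<comment> \<open>The error terms below add up to at most
      \<open>\<eta> * (MF + 1 + J + M\<rho> * (q - p))\<close>; the denominator makes this less than
      \<open>e\<close>, and its last summand keeps it positive.\<close>
    define \<eta> where "\<eta> = e / (2 * (MF + 1 + J + M\<rho> * (q - p)) + 1)"
    have den: "2 * (MF + 1 + J + M\<rho> * (q - p)) + 1 > 0"
      using MF(1) J M\<rho>(1) pq by (intro add_nonneg_pos mult_nonneg_nonneg add_nonneg_nonneg) auto
    have \<eta>: "\<eta> > 0" using e den by (simp add: \<eta>_def)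
    define \<eta>' where "\<eta>' = min \<eta> 1"
    have \<eta>': "\<eta>' > 0" "\<eta>' \<le> 1" "\<eta>' \<le> \<eta>" using \<eta> by (auto simp: \<eta>'_def)
    have e1: "\<forall>\<^sub>F h in at 0. integral {p..q} (\<lambda>x. \<bar>(\<rho> (t + h) x - \<rho> t x) / h - \<rho>' x\<bar>) < \<eta>"
      using order_tendstoD(2)[OF \<rho>d \<eta>] .
    have e2: "\<forall>\<^sub>F h in at 0. \<forall>y\<in>{p..q}. dist ((F (t + h) y - F t y) / h) (G y) < \<eta>'"
      using uniform_limitD[OF FG[unfolded utd_def] \<eta>'(1)] .
    have e3: "\<forall>\<^sub>F h in at 0. h \<noteq> 0 \<and> \<bar>h\<bar> < \<eta>' / (MG + 1)"
      using \<eta>'(1) MG(1) by (auto simp: eventually_at dist_real_def intro!: exI[of _ "\<eta>' / (MG + 1)"])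
    have e4: "\<forall>\<^sub>F h in at 0. t + h \<in> I" using eventually_at_0_shift[OF I] .
    show "\<forall>\<^sub>F h in at 0. \<forall>y\<in>{p..q}. dist ((integral {p..y} (\<lambda>x. \<rho> (t + h) x * F (t + h) x) - integral {p..y} (\<lambda>x. \<rho> t x * F t x)) / h)
        (integral {p..y} (\<lambda>x. \<rho>' x * F t x + \<rho> t x * G x)) < e"
      using e1 e2 e3 e4
    proof eventually_elim
      case (elim h)
      then have h: "h \<noteq> 0" "\<bar>h\<bar> < \<eta>' / (MG + 1)" and thI: "t + h \<in> I" by auto
      have Q: "\<bar>(F (t + h) x - F t x) / h - G x\<bar> < \<eta>'" if "x \<in> {p..q}" for x
        using elim(2) that by (simp add: dist_real_def)
      have dF: "\<bar>F (t + h) x - F t x\<bar> \<le> \<eta>'" if x: "x \<in> {p..q}" for x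
      proof -
        have "\<bar>(F (t + h) x - F t x) / h\<bar> \<le> MG + 1" using Q[OF x] MG(2)[OF x] \<eta>'(2) by linarith
        then have "\<bar>F (t + h) x - F t x\<bar> \<le> (MG + 1) * \<bar>h\<bar>" using h(1) by (simp add: abs_divide divide_le_eq)
        also have "\<dots> \<le> (MG + 1) * (\<eta>' / (MG + 1))" using h(2) MG(1) by (intro mult_left_mono) auto
        finally show ?thesis using MG(1) by simp
      qed
      have \<rho>h: "continuous_on {p..q} (\<rho> (t + h))" using \<rho>c[OF thI] continuous_on_subset by blast
      define D where "D x = (\<rho> (t + h) x - \<rho> t x) / h - \<rho>' x" for x
      have Dai: "D absolutely_integrable_on {p..q}"
        unfolding D_def by (intro set_integral_diff \<rho>' cont_ai continuous_intros \<rho>h \<rho>t ballI h(1))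
      then have Da: "(\<lambda>x. \<bar>D x\<bar>) integrable_on {p..q}" by (simp add: absolutely_integrable_on_def)
      have "dist ((integral {p..y} (\<lambda>x. \<rho> (t + h) x * F (t + h) x) - integral {p..y} (\<lambda>x. \<rho> t x * F t x)) / h)
        (integral {p..y} (\<lambda>x. \<rho>' x * F t x + \<rho> t x * G x)) < e" if y: "y \<in> {p..q}" for y
      proof -
        have sub: "{p..y} \<subseteq> {p..q}" using y by auto
        \<comment> \<open>The splitting of a quotient of products: the error of
          \<open>\<rho>'\<close> against \<open>F\<close>, \<open>\<rho>'\<close> against the
          increment of \<open>F\<close>, and \<open>\<rho>\<close> against the error of the quotient
          of \<open>F\<close>.\<close>
        let ?f = "\<lambda>x. D x * F (t + h) x + \<rho>' x * (F (t + h) x - F t x) + \<rho> t x * ((F (t + h) x - F t x) / h - G x)"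
        have fai: "?f absolutely_integrable_on {p..q}"
          by (intro set_integral_add prod Dai \<rho>' cont_ai continuous_intros Fc I thI Gc \<rho>t ballI h(1))
        have fq: "?f integrable_on {p..q}" and faq: "(\<lambda>x. \<bar>?f x\<bar>) integrable_on {p..q}"
          using fai by (auto simp: absolutely_integrable_on_def)
        have fy: "?f integrable_on {p..y}" and fay: "(\<lambda>x. \<bar>?f x\<bar>) integrable_on {p..y}"
          using integrable_on_subinterval[OF fq sub] integrable_on_subinterval[OF faq sub] .
        have i1: "(\<lambda>x. \<rho> (t + h) x * F (t + h) x) integrable_on {p..y}" "(\<lambda>x. \<rho> t x * F t x) integrable_on {p..y}"
          by (intro integrable_continuous_real continuous_intros continuous_on_subset[OF _ sub] \<rho>h \<rho>t Fc I thI)+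
        have i2: "(\<lambda>x. \<rho>' x * F t x + \<rho> t x * G x) integrable_on {p..y}"
          using integrable_on_subinterval[OF set_lebesgue_integral_eq_integral(1)[OF ai] sub] .
        have "(integral {p..y} (\<lambda>x. \<rho> (t + h) x * F (t + h) x) - integral {p..y} (\<lambda>x. \<rho> t x * F t x)) / h
            - integral {p..y} (\<lambda>x. \<rho>' x * F t x + \<rho> t x * G x)
          = integral {p..y} (\<lambda>x. (\<rho> (t + h) x * F (t + h) x - \<rho> t x * F t x) / h - (\<rho>' x * F t x + \<rho> t x * G x))"
          using i1 i2 by (simp add: integral_diff integrable_diff integrable_on_divide)
        also have "\<dots> = integral {p..y} ?f"
          by (rule integral_cong) (use h(1) in \<open>simp add: D_def field_simps\<close>)
        finally have eqf: "(integral {p..y} (\<lambda>x. \<rho> (t + h) x * F (t + h) x) - integral {p..y} (\<lambda>x. \<rho> t x * F t x)) / h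
            - integral {p..y} (\<lambda>x. \<rho>' x * F t x + \<rho> t x * G x) = integral {p..y} ?f" .
        have "\<bar>integral {p..y} ?f\<bar> \<le> integral {p..y} (\<lambda>x. \<bar>?f x\<bar>)"
          by (rule integral_norm_bound_integral[OF fy fay, unfolded real_norm_def]) (rule order_refl)
        also have "\<dots> \<le> integral {p..q} (\<lambda>x. \<bar>?f x\<bar>)"
          by (rule integral_subset_le[OF sub fay faq]) simp
        also have "\<dots> \<le> integral {p..q} (\<lambda>x. (MF + 1) * \<bar>D x\<bar> + \<eta>' * \<bar>\<rho>' x\<bar> + M\<rho> * \<eta>')"
        proof (rule Henstock_Kurzweil_Integration.integral_le)
          show "(\<lambda>x. \<bar>?f x\<bar>) integrable_on {p..q}" using fai by (simp add: absolutely_integrable_on_def)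
          show "(\<lambda>x. (MF + 1) * \<bar>D x\<bar> + \<eta>' * \<bar>\<rho>' x\<bar> + M\<rho> * \<eta>') integrable_on {p..q}"
            by (intro integrable_add integrable_on_mult_right Da \<rho>'a) auto
          fix x assume x: "x \<in> {p..q}"
          have Fb: "\<bar>F (t + h) x\<bar> \<le> MF + 1" using dF[OF x] MF(2)[OF x] \<eta>'(2) by linarith
          have "\<bar>D x * F (t + h) x\<bar> \<le> (MF + 1) * \<bar>D x\<bar>"
            unfolding abs_mult mult.commute[of "MF + 1"] by (rule mult_left_mono[OF Fb]) simp
          moreover have "\<bar>\<rho>' x * (F (t + h) x - F t x)\<bar> \<le> \<eta>' * \<bar>\<rho>' x\<bar>"
            unfolding abs_mult mult.commute[of \<eta>'] by (rule mult_left_mono[OF dF[OF x]]) simp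
          moreover have "\<bar>\<rho> t x * ((F (t + h) x - F t x) / h - G x)\<bar> \<le> M\<rho> * \<eta>'"
            unfolding abs_mult using Q[OF x] M\<rho>(2)[OF x] M\<rho>(1) by (intro mult_mono) auto
          ultimately show "\<bar>?f x\<bar> \<le> (MF + 1) * \<bar>D x\<bar> + \<eta>' * \<bar>\<rho>' x\<bar> + M\<rho> * \<eta>'" by linarith
        qed
        also have "\<dots> = (MF + 1) * integral {p..q} (\<lambda>x. \<bar>D x\<bar>) + \<eta>' * J + M\<rho> * \<eta>' * (q - p)"
        proof (rule integral_unique)
          have c: "((\<lambda>x. M\<rho> * \<eta>') has_integral (M\<rho> * \<eta>' * (q - p))) {p..q}"
            using has_integral_const_real[of "M\<rho> * \<eta>'" p q] pq by (simp add: mult.commute)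
          show "((\<lambda>x. (MF + 1) * \<bar>D x\<bar> + \<eta>' * \<bar>\<rho>' x\<bar> + M\<rho> * \<eta>') has_integral
            ((MF + 1) * integral {p..q} (\<lambda>x. \<bar>D x\<bar>) + \<eta>' * J + M\<rho> * \<eta>' * (q - p))) {p..q}"
            unfolding J_def by (intro has_integral_add has_integral_mult_right c integrable_integral Da \<rho>'a)
        qed
        also have "\<dots> \<le> (MF + 1) * \<eta> + \<eta> * J + M\<rho> * \<eta> * (q - p)"
          using elim(1) MF(1) J M\<rho>(1) \<eta>'(3) pq unfolding D_def[symmetric]
          by (intro add_mono mult_left_mono mult_right_mono) auto
        also have "\<dots> = \<eta> * (MF + 1 + J + M\<rho> * (q - p))" by (simp add: algebra_simps)
        also have "\<dots> < e"
        proof -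
          have "e = \<eta> * (2 * (MF + 1 + J + M\<rho> * (q - p)) + 1)" using den by (simp add: \<eta>_def)
          moreover have "MF + 1 + J + M\<rho> * (q - p) \<ge> 0"
            using MF(1) J M\<rho>(1) pq by (intro add_nonneg_nonneg mult_nonneg_nonneg) auto
          ultimately show ?thesis using \<eta> by (auto intro!: mult_strict_left_mono)
        qed
        finally show ?thesis unfolding dist_real_def eqf .
      qed
      then show ?case by blast
    qed
  qed
qed

section \<open>Linear parabolic inequalities: energies, maximum principles, sign changes\<close>

section \<open>A weighted energy inequality\<close>

lemma max0_power_has_derivative:
  assumes "n \<ge> 1"
  shows "((\<lambda>s::real. (max 0 s) ^ Suc n) has_real_derivative of_nat (Suc n) * (max 0 s) ^ n) (at s)"
proof -
  consider "s > 0" | "s < 0" | "s = 0" by linarith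
  then show ?thesis
  proof cases
    case 1
    have "((\<lambda>s::real. s ^ Suc n) has_real_derivative of_nat (Suc n) * s ^ n) (at s)"
      using DERIV_pow[of "Suc n" s] by simp
    then have "((\<lambda>s::real. (max 0 s) ^ Suc n) has_real_derivative of_nat (Suc n) * s ^ n) (at s)"
      by (rule has_field_derivative_transform_within_open[where S = "{0<..}"]) (use 1 in auto)
    then show ?thesis using 1 by simp
  next
    case 2
    have "((\<lambda>s::real. 0) has_real_derivative 0) (at s)" by simp
    then have "((\<lambda>s::real. (max 0 s) ^ Suc n) has_real_derivative 0) (at s)"
      by (rule has_field_derivative_transform_within_open[where S = "{..<0}"]) (use 2 in auto)
    moreover have "of_nat (Suc n) * (max 0 s) ^ n = 0" using 2 assms by simp
    ultimately show ?thesis by (simp only:)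
  next
    case 3
    have "((\<lambda>h::real. (max 0 h) ^ Suc n / h) \<longlongrightarrow> 0) (at 0)"
    proof (rule Lim_null_comparison)
      show "\<forall>\<^sub>F h in at (0::real). norm ((max 0 h) ^ Suc n / h) \<le> \<bar>h\<bar> ^ n"
      proof (rule always_eventually, rule allI)
        fix h :: real
        show "norm ((max 0 h) ^ Suc n / h) \<le> \<bar>h\<bar> ^ n"
          by (cases "h > 0") (auto simp: max_def)
      qed
      have "((\<lambda>h::real. \<bar>h\<bar> ^ n) \<longlongrightarrow> \<bar>0\<bar> ^ n) (at 0)" by (intro tendsto_intros)
      moreover have "\<bar>0 :: real\<bar> ^ n = 0" using assms by simp
      ultimately show "((\<lambda>h::real. \<bar>h\<bar> ^ n) \<longlongrightarrow> 0) (at 0)" by (simp only:)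
    qed
    then show ?thesis using 3 assms by (simp add: DERIV_def power_0_left del: power_Suc)
  qed
qed

text \<open>The fourth power of the positive part is smooth enough for
  \<open>mean_derivative_compose\<close> and vanishes exactly where the sign is wrong; its second
  derivative supplies the dissipation in the energy estimates.\<close>

lemma max0_power4_has_derivative:
  "((\<lambda>s::real. (max 0 s) ^ 4) has_real_derivative 4 * (max 0 s) ^ 3) (at s)"
  "((\<lambda>s::real. 4 * (max 0 s) ^ 3) has_real_derivative 12 * (max 0 s) ^ 2) (at s)"
proof -
  show "((\<lambda>s::real. (max 0 s) ^ 4) has_real_derivative 4 * (max 0 s) ^ 3) (at s)"
    using max0_power_has_derivative[of 3 s] by (simp add: numeral_eq_Suc)
  have "((\<lambda>s::real. (max 0 s) ^ 3) has_real_derivative 3 * (max 0 s) ^ 2) (at s)"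
    using max0_power_has_derivative[of 2 s] by (simp add: numeral_eq_Suc)
  from DERIV_cmult[OF this, of 4] show "((\<lambda>s::real. 4 * (max 0 s) ^ 3) has_real_derivative 12 * (max 0 s) ^ 2) (at s)"
    by simp
qed

lemma max0_power_compose_has_derivative:
  assumes "(s has_real_derivative s') (at x within A)"
  shows "((\<lambda>x. (max 0 (s x)) ^ 4) has_real_derivative 4 * (max 0 (s x)) ^ 3 * s') (at x within A)"
    and "((\<lambda>x. 4 * (max 0 (s x)) ^ 3) has_real_derivative 12 * (max 0 (s x)) ^ 2 * s') (at x within A)"
  using DERIV_chain2[OF max0_power4_has_derivative(1) assms] DERIV_chain2[OF max0_power4_has_derivative(2) assms]
  by auto

text \<open>The parameter \<open>b\<close> trades dissipation for a first moment: it comes from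
  completing the square in \<open>F s\<^sub>x\<^sup>2\<close> against \<open>b S\<close>, where \<open>S' = F\<close>.\<close>

lemma weighted_energy:
  fixes s sx V R F F' S :: "real \<Rightarrow> real"
  defines "m \<equiv> \<lambda>x. max 0 (s x)"
  assumes py: "p \<le> y"
    and s: "\<And>x. x \<in> {p..y} \<Longrightarrow> (s has_real_derivative sx x) (at x within {p..y})"
    and sx: "continuous_on {p..y} sx"
    and V: "V absolutely_integrable_on {p..y}"
    and VI: "\<And>c d. p \<le> c \<Longrightarrow> c \<le> d \<Longrightarrow> d \<le> y \<Longrightarrow> integral {c..d} V = sx d - sx c"
    and R: "R absolutely_integrable_on {p..y}"
    and RV: "\<And>x. x \<in> {p..y} \<Longrightarrow> s x > 0 \<Longrightarrow> R x \<le> V x + K * (\<bar>s x\<bar> + \<bar>sx x\<bar>) + e"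
    and F: "\<And>x. x \<in> {p..y} \<Longrightarrow> (F has_real_derivative F' x) (at x within {p..y})"
    and F'c: "continuous_on {p..y} F'" and F0: "\<And>x. x \<in> {p..y} \<Longrightarrow> 0 \<le> F x"
    and mF': "\<And>x. x \<in> {p..y} \<Longrightarrow> m x * F' x = 0"
    and S: "\<And>x. x \<in> {p..y} \<Longrightarrow> (S has_real_derivative F x) (at x within {p..y})"
    and S0: "\<And>x. x \<in> {p..y} \<Longrightarrow> 0 \<le> S x" and SF: "\<And>x. x \<in> {p..y} \<Longrightarrow> S x \<le> l * F x"
    and bd1: "m y ^ 3 * F y * sx y \<le> m p ^ 3 * F p * sx p"
    and bd2: "b = 0 \<or> S y * m y ^ 4 \<le> S p * m p ^ 4"
    and l: "l > 0" and b: "b \<ge> 0"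
  shows "(\<lambda>x. 4 * m x ^ 3 * R x * F x) absolutely_integrable_on {p..y}"
    and "integral {p..y} (\<lambda>x. 4 * m x ^ 3 * R x * F x)
      \<le> integral {p..y} (\<lambda>x. m x ^ 4 * ((K\<^sup>2 / 2 + 4 * K - b) * F x + b\<^sup>2 * l * S x) + 4 * e * m x ^ 3 * F x)"
proof -
  have sc: "continuous_on {p..y} s" using s by (meson DERIV_continuous continuous_on_eq_continuous_within)
  have Fc: "continuous_on {p..y} F" using F by (meson DERIV_continuous continuous_on_eq_continuous_within)
  have Sc: "continuous_on {p..y} S" using S by (meson DERIV_continuous continuous_on_eq_continuous_within)
  have mc: "continuous_on {p..y} m" unfolding m_def by (intro continuous_intros sc)
  note cont = sc Fc Sc mc sx F'c
  have prod: "(\<lambda>x. g x * f x) absolutely_integrable_on {p..y}"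
    if "continuous_on {p..y} g" "f absolutely_integrable_on {p..y}" for f g :: "real \<Rightarrow> real"
    using that by (intro absolutely_integrable_bounded_measurable_product_real continuous_imp_measurable_on_sets_lebesgue
        compact_imp_bounded compact_continuous_image) auto
  have "(\<lambda>x. (4 * m x ^ 3 * F x) * R x) absolutely_integrable_on {p..y}"
    by (intro prod R continuous_intros cont)
  then show ai: "(\<lambda>x. 4 * m x ^ 3 * R x * F x) absolutely_integrable_on {p..y}"
    by (simp add: ac_simps)
  \<comment> \<open>The multiplier is the derivative of the fourth power times the weight. Its
    derivative contains no term with \<open>F'\<close>, because by \<open>mF'\<close> that
    derivative is 0 wherever \<open>m\<close> is not.\<close>
  define f where "f x = (4 * m x ^ 3) * F x" for x
  define f' where "f' x = 12 * m x ^ 2 * sx x * F x" for x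
  have f: "(f has_real_derivative f' x) (at x within {p..y})" if x: "x \<in> {p..y}" for x
  proof -
    have "(f has_real_derivative (12 * m x ^ 2 * sx x) * F x + F' x * (4 * m x ^ 3)) (at x within {p..y})"
      unfolding f_def m_def by (rule DERIV_mult[OF max0_power_compose_has_derivative(2)[OF s[OF x]] F[OF x]])
    moreover have "F' x * (4 * m x ^ 3) = (m x * F' x) * (4 * m x ^ 2)" by (simp add: power2_eq_square power3_eq_cube)
    ultimately show ?thesis using mF'[OF x] by (simp add: f'_def)
  qed
  have f'c: "continuous_on {p..y} f'" unfolding f'_def by (intro continuous_intros cont)
  note ibp = integration_by_parts_AC[OF py f f'c sx V VI]
  have ibp1: "(\<lambda>x. f x * V x) integrable_on {p..y}"
    using set_lebesgue_integral_eq_integral(1)[OF ibp(1)] .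
  have ibp2: "integral {p..y} (\<lambda>x. f x * V x) \<le> - integral {p..y} (\<lambda>x. f' x * sx x)"
  proof -
    have "f y * sx y \<le> f p * sx p" using bd1 unfolding f_def by (simp add: mult.assoc)
    then show ?thesis using ibp(2) by linarith
  qed
  \<comment> \<open>The derivative of \<open>S * m ^ 4\<close>. By \<open>bd2\<close> its integral
    times \<open>b\<close> is not positive, so adding \<open>b * g\<close> to the upper bound inside
    the integral does no harm.\<close>
  define g where "g x = F x * m x ^ 4 + 4 * m x ^ 3 * sx x * S x" for x
  have g: "(g has_integral (S y * m y ^ 4 - S p * m p ^ 4)) {p..y}"
  proof (rule fundamental_theorem_of_calculus[OF py])
    fix x assume x: "x \<in> {p..y}"
    have "((\<lambda>x. S x * m x ^ 4) has_real_derivative F x * m x ^ 4 + 4 * m x ^ 3 * sx x * S x) (at x within {p..y})"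
      unfolding m_def by (rule DERIV_mult[OF S[OF x] max0_power_compose_has_derivative(1)[OF s[OF x]]])
    then show "((\<lambda>x. S x * m x ^ 4) has_vector_derivative g x) (at x within {p..y})"
      by (simp add: g_def has_real_derivative_iff_has_vector_derivative)
  qed
  have gb: "b * integral {p..y} g \<le> 0"
    using bd2 b integral_unique[OF g] by (auto intro: mult_nonneg_nonpos)
  let ?L = "\<lambda>x. m x ^ 4 * ((K\<^sup>2 / 2 + 4 * K - b) * F x + b\<^sup>2 * l * S x) + 4 * e * m x ^ 3 * F x"
  have L: "?L integrable_on {p..y}" by (intro integrable_continuous_real continuous_intros cont)
  have i1: "(\<lambda>x. f' x * sx x) integrable_on {p..y}"
    by (intro integrable_continuous_real continuous_intros cont f'c)
  have gi: "g integrable_on {p..y}" using g by blast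
  have "integral {p..y} (\<lambda>x. 4 * m x ^ 3 * R x * F x)
      \<le> integral {p..y} (\<lambda>x. ?L x + f x * V x + f' x * sx x + b * g x)"
  proof (rule Henstock_Kurzweil_Integration.integral_le)
    show "(\<lambda>x. 4 * m x ^ 3 * R x * F x) integrable_on {p..y}"
      using set_lebesgue_integral_eq_integral(1)[OF ai] .
    show "(\<lambda>x. ?L x + f x * V x + f' x * sx x + b * g x) integrable_on {p..y}"
      by (intro integrable_add L ibp1 i1 integrable_on_mult_right gi)
    fix x assume x: "x \<in> {p..y}"
    have m0: "m x \<ge> 0" by (simp add: m_def)
    have c0: "0 \<le> 4 * m x ^ 3 * F x" using m0 F0[OF x] by simp
    have "4 * m x ^ 3 * R x * F x \<le> 4 * m x ^ 3 * F x * (V x + K * (m x + \<bar>sx x\<bar>) + e)"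
    proof (cases "s x > 0")
      case True
      then have "R x \<le> V x + K * (m x + \<bar>sx x\<bar>) + e" using RV[OF x True] by (simp add: m_def)
      then have "4 * m x ^ 3 * F x * R x \<le> 4 * m x ^ 3 * F x * (V x + K * (m x + \<bar>sx x\<bar>) + e)"
        using c0 by (rule mult_left_mono)
      then show ?thesis by (simp only: ac_simps)
    qed (simp add: m_def)
    also have "\<dots> \<le> ?L x + f x * V x + f' x * sx x + b * g x"
    proof -
      \<comment> \<open>The dissipation is \<open>12 * m x ^ 2 * F x\<close> times the square of
        \<open>sx x\<close>. Of the 12 units, 8 absorb the gradient term with \<open>K\<close>, and
        the other 4 absorb the mixed term of \<open>b * g\<close> by means of
        \<open>S x \<le> l * F x\<close>.\<close>
      have 1: "0 \<le> 8 * m x ^ 2 * F x * (\<bar>sx x\<bar> - K * m x / 4)\<^sup>2" using F0[OF x] by simp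
      have 2: "0 \<le> (S x / l) * (m x ^ 2 * (2 * sx x + b * l * m x)\<^sup>2)" using S0[OF x] l by simp
      have 3: "4 * m x ^ 2 * (sx x)\<^sup>2 * (S x / l) \<le> 4 * m x ^ 2 * (sx x)\<^sup>2 * F x"
        using SF[OF x] l by (intro mult_left_mono) (auto simp: field_simps)
      have 4: "(S x / l) * (m x ^ 2 * (2 * sx x + b * l * m x)\<^sup>2)
          = 4 * m x ^ 2 * (sx x)\<^sup>2 * (S x / l) + 4 * b * S x * m x ^ 3 * sx x + b\<^sup>2 * l * S x * m x ^ 4"
        using l by (simp add: field_simps power2_eq_square power3_eq_cube power4_eq_xxxx)
      have 5: "8 * m x ^ 2 * F x * (\<bar>sx x\<bar> - K * m x / 4)\<^sup>2
          = 8 * m x ^ 2 * F x * (sx x)\<^sup>2 - 4 * K * m x ^ 3 * F x * \<bar>sx x\<bar> + K\<^sup>2 / 2 * m x ^ 4 * F x"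
        by (simp add: power2_diff power_mult_distrib) (simp add: field_simps power2_eq_square power3_eq_cube power4_eq_xxxx)
      have 6: "?L x + f x * V x + f' x * sx x + b * g x - 4 * m x ^ 3 * F x * (V x + K * (m x + \<bar>sx x\<bar>) + e)
        = 12 * m x ^ 2 * F x * (sx x)\<^sup>2 - 4 * K * m x ^ 3 * F x * \<bar>sx x\<bar> + K\<^sup>2 / 2 * m x ^ 4 * F x
          + b\<^sup>2 * l * S x * m x ^ 4 + 4 * b * S x * m x ^ 3 * sx x"
        unfolding f_def f'_def g_def
        by (simp add: algebra_simps) (simp add: algebra_simps power2_eq_square power3_eq_cube power4_eq_xxxx)
      show ?thesis using 1 2 3 4 5 6 by (simp add: algebra_simps)
    qed
    finally show "4 * m x ^ 3 * R x * F x \<le> ?L x + f x * V x + f' x * sx x + b * g x" .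
  qed
  also have "\<dots> = integral {p..y} ?L + integral {p..y} (\<lambda>x. f x * V x) + integral {p..y} (\<lambda>x. f' x * sx x) + b * integral {p..y} g"
    by (intro integral_unique has_integral_add has_integral_mult_right integrable_integral L ibp1 i1 gi)
  also have "\<dots> \<le> integral {p..y} ?L" using ibp2 gb by linarith
  finally show "integral {p..y} (\<lambda>x. 4 * m x ^ 3 * R x * F x) \<le> integral {p..y} ?L" .
qed

text \<open>What survives, for a difference of two solutions, when only the Lipschitz continuity of
  the nonlinearity is used. The error \<open>e\<close> allows two different nonlinearities to be
  compared; for two states over the same nonlinearity it is 0.\<close>

definition lsol :: "real \<Rightarrow> real \<Rightarrow> real set \<Rightarrow> (real \<Rightarrow> real \<Rightarrow> real) \<Rightarrow> (real \<Rightarrow> real \<Rightarrow> real)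
    \<Rightarrow> (real \<Rightarrow> real \<Rightarrow> real) \<Rightarrow> (real \<Rightarrow> real \<Rightarrow> real) \<Rightarrow> bool" where
  "lsol K e I w wx v r \<longleftrightarrow> evol I w wx v r \<and>
     (\<forall>t\<in>I. \<forall>x. \<bar>r t x - v t x\<bar> \<le> K * (\<bar>w t x\<bar> + \<bar>wx t x\<bar>) + e)"

section \<open>Alternating chains and the zero number\<close>

text \<open>An analytic substitute for the zero number: \<open>nest w \<sigma> p m y\<close> is positive exactly if \<open>w\<close> has an
  alternating chain of \<open>m\<close> points in \<open>(p, y)\<close>, and it satisfies a differential inequality in time.\<close>

primrec nest :: "(real \<Rightarrow> real) \<Rightarrow> real \<Rightarrow> real \<Rightarrow> nat \<Rightarrow> real \<Rightarrow> real" where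
  "nest w \<sigma> p 0 y = 1"
| "nest w \<sigma> p (Suc m) y = integral {p..y} (\<lambda>x. (max 0 (\<sigma> * (-1) ^ m * w x)) ^ 4 * nest w \<sigma> p m x)"

text \<open>The extra weight \<open>x - p\<close> is chosen so that
  \<open>(y - p) * nest w \<sigma> p m y - nmom w \<sigma> p m y\<close> has the derivative
  \<open>nest w \<sigma> p m y\<close>. This difference serves as the weight \<open>S\<close> in
  \<open>weighted_energy\<close>.\<close>

primrec nmom :: "(real \<Rightarrow> real) \<Rightarrow> real \<Rightarrow> real \<Rightarrow> nat \<Rightarrow> real \<Rightarrow> real" where
  "nmom w \<sigma> p 0 y = 0"
| "nmom w \<sigma> p (Suc m) y =
    integral {p..y} (\<lambda>x. (max 0 (\<sigma> * (-1) ^ m * w x)) ^ 4 * ((x - p) * nest w \<sigma> p m x))"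

text \<open>\<open>achain w \<sigma> p m y\<close>: there are \<open>p < x\<^sub>0 < \<dots> < x\<^bsub>m-1\<^esub> < y\<close> at which \<open>w\<close> has alternating
  signs, starting with the sign of \<open>\<sigma>\<close>.\<close>

primrec achain :: "(real \<Rightarrow> real) \<Rightarrow> real \<Rightarrow> real \<Rightarrow> nat \<Rightarrow> real \<Rightarrow> bool" where
  "achain w \<sigma> p 0 y = True"
| "achain w \<sigma> p (Suc m) y = (\<exists>x. p < x \<and> x < y \<and> \<sigma> * (-1) ^ m * w x > 0 \<and> achain w \<sigma> p m x)"

lemma nest_continuous:
  assumes "continuous_on UNIV w"
  shows "continuous_on {p..q} (nest w \<sigma> p m)"
proof (induction m)
  case 0
  then show ?case by (simp add: continuous_on_const)
next
  case (Suc m)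
  have "(\<lambda>x. (max 0 (\<sigma> * (-1) ^ m * w x)) ^ 4 * nest w \<sigma> p m x) integrable_on {p..q}"
    by (intro integrable_continuous_real continuous_intros Suc continuous_on_subset[OF assms]) auto
  from indefinite_integral_continuous_1[OF this] show ?case by simp
qed

lemma nest_has_derivative:
  assumes "continuous_on UNIV w" "y \<in> {p..q}"
  shows "(nest w \<sigma> p (Suc m) has_real_derivative (max 0 (\<sigma> * (-1) ^ m * w y)) ^ 4 * nest w \<sigma> p m y) (at y within {p..q})"
proof -
  have eq: "nest w \<sigma> p (Suc m) = (\<lambda>y. integral {p..y} (\<lambda>x. (max 0 (\<sigma> * (-1) ^ m * w x)) ^ 4 * nest w \<sigma> p m x))"
    by (rule ext) simp
  show ?thesis unfolding eq
    by (rule integral_has_real_derivative)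
      (use assms(2) in \<open>auto intro!: continuous_intros nest_continuous assms continuous_on_subset[OF assms(1)]\<close>)
qed

lemma nmom_has_derivative:
  assumes "continuous_on UNIV w" "y \<in> {p..q}"
  shows "(nmom w \<sigma> p (Suc m) has_real_derivative (max 0 (\<sigma> * (-1) ^ m * w y)) ^ 4 * ((y - p) * nest w \<sigma> p m y)) (at y within {p..q})"
proof -
  have eq: "nmom w \<sigma> p (Suc m) = (\<lambda>y. integral {p..y} (\<lambda>x. (max 0 (\<sigma> * (-1) ^ m * w x)) ^ 4 * ((x - p) * nest w \<sigma> p m x)))"
    by (rule ext) simp
  show ?thesis unfolding eq
    by (rule integral_has_real_derivative)
      (use assms(2) in \<open>auto intro!: continuous_intros nest_continuous assms continuous_on_subset[OF assms(1)]\<close>)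
qed

lemma nest_nonneg:
  assumes "continuous_on UNIV w"
  shows "0 \<le> nest w \<sigma> p m y"
proof (induction m arbitrary: y)
  case (Suc m)
  have "(\<lambda>x. (max 0 (\<sigma> * (-1) ^ m * w x)) ^ 4 * nest w \<sigma> p m x) integrable_on {p..y}"
    by (intro integrable_continuous_real continuous_intros nest_continuous assms continuous_on_subset[OF assms]) auto
  then show ?case by (simp add: Henstock_Kurzweil_Integration.integral_nonneg Suc)
qed simp

lemma nmom_integrand_integrable:
  assumes "continuous_on UNIV w"
  shows "(\<lambda>x. (max 0 (\<sigma> * (-1) ^ m * w x)) ^ 4 * ((x - p) * nest w \<sigma> p m x)) integrable_on {p..y}"
  by (intro integrable_continuous_real continuous_intros nest_continuous assms continuous_on_subset[OF assms]) auto

lemma nmom_nonneg: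
  assumes "continuous_on UNIV w"
  shows "0 \<le> nmom w \<sigma> p m y"
proof (cases m)
  case (Suc n)
  then show ?thesis
    using nmom_integrand_integrable[OF assms] nest_nonneg[OF assms]
    by (auto intro!: Henstock_Kurzweil_Integration.integral_nonneg)
qed simp

lemma nmom_le:
  assumes "continuous_on UNIV w" "y \<in> {p..q}"
  shows "nmom w \<sigma> p m y \<le> (y - p) * nest w \<sigma> p m y"
proof (cases m)
  case (Suc n)
  have "(\<lambda>x. (max 0 (\<sigma> * (-1) ^ n * w x)) ^ 4 * nest w \<sigma> p n x) integrable_on {p..y}"
    by (intro integrable_continuous_real continuous_intros nest_continuous assms continuous_on_subset[OF assms(1)]) auto
  then have "integral {p..y} (\<lambda>x. (max 0 (\<sigma> * (-1) ^ n * w x)) ^ 4 * ((x - p) * nest w \<sigma> p n x))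
    \<le> integral {p..y} (\<lambda>x. (y - p) * ((max 0 (\<sigma> * (-1) ^ n * w x)) ^ 4 * nest w \<sigma> p n x))"
  proof (intro Henstock_Kurzweil_Integration.integral_le nmom_integrand_integrable[OF assms(1)] integrable_on_mult_right)
    fix x assume "x \<in> {p..y}"
    then have "(x - p) * ((max 0 (\<sigma> * (-1) ^ n * w x)) ^ 4 * nest w \<sigma> p n x)
        \<le> (y - p) * ((max 0 (\<sigma> * (-1) ^ n * w x)) ^ 4 * nest w \<sigma> p n x)"
      using nest_nonneg[OF assms(1)] by (intro mult_right_mono) auto
    then show "(max 0 (\<sigma> * (-1) ^ n * w x)) ^ 4 * ((x - p) * nest w \<sigma> p n x)
        \<le> (y - p) * ((max 0 (\<sigma> * (-1) ^ n * w x)) ^ 4 * nest w \<sigma> p n x)"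
      by (simp only: mult.left_commute)
  qed
  then show ?thesis by (simp add: Suc)
qed (use assms in simp)

lemma nest_pos_iff:
  assumes "continuous_on UNIV w"
  shows "p \<le> y \<Longrightarrow> nest w \<sigma> p m y > 0 \<longleftrightarrow> achain w \<sigma> p m y"
proof (induction m arbitrary: y)
  case (Suc m)
  let ?f = "\<lambda>x. (max 0 (\<sigma> * (-1) ^ m * w x)) ^ 4 * nest w \<sigma> p m x"
  have fc: "continuous_on {p..y} ?f"
    by (intro continuous_intros nest_continuous assms continuous_on_subset[OF assms]) auto
  have f0: "0 \<le> ?f x" for x using nest_nonneg[OF assms] by simp
  have fpos: "?f x > 0 \<longleftrightarrow> \<sigma> * (-1) ^ m * w x > 0 \<and> achain w \<sigma> p m x" if "p \<le> x" for x
  proof -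
    have "max 0 a ^ 4 * n > 0 \<longleftrightarrow> a > 0 \<and> n > 0" if "n \<ge> 0" for a n :: real
      using that by (cases "a > 0") (auto simp: max_def zero_less_mult_iff)
    then show ?thesis using Suc.IH[OF that] nest_nonneg[OF assms, of \<sigma> p m x] by simp
  qed
  have "nest w \<sigma> p (Suc m) y \<noteq> 0 \<longleftrightarrow> (\<exists>x\<in>{p<..<y}. ?f x > 0)"
  proof
    assume n: "nest w \<sigma> p (Suc m) y \<noteq> 0"
    show "\<exists>x\<in>{p<..<y}. ?f x > 0"
    proof (rule ccontr)
      assume "\<not> ?thesis"
      then have "?f x = 0" if "x \<in> {p<..<y}" for x using f0[of x] that by (meson antisym not_le_imp_less)
      then have "integral {p<..<y} ?f = integral {p<..<y} (\<lambda>_. 0)" by (rule integral_cong)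
      then show False using n by (simp add: integral_open_interval_real)
    qed
  next
    assume "\<exists>x\<in>{p<..<y}. ?f x > 0"
    then obtain x where x: "x \<in> {p<..<y}" "?f x > 0" by blast
    show "nest w \<sigma> p (Suc m) y \<noteq> 0"
    proof
      assume "nest w \<sigma> p (Suc m) y = 0"
      then have "integral (cbox p y) ?f = 0" by simp
      moreover have "integral (cbox p y) ?f = 0 \<longleftrightarrow> (\<forall>x\<in>cbox p y. ?f x = 0)"
        by (rule integral_cbox_eq_0_iff) (use fc f0 x in auto)
      ultimately have "?f x = 0" using x(1) by auto
      then show False using x(2) by (simp only: less_irrefl)
    qed
  qed
  moreover have "nest w \<sigma> p (Suc m) y > 0 \<longleftrightarrow> nest w \<sigma> p (Suc m) y \<noteq> 0"
    using nest_nonneg[OF assms, of \<sigma> p "Suc m" y] by linarith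
  moreover have "(\<exists>x\<in>{p<..<y}. ?f x > 0) \<longleftrightarrow> achain w \<sigma> p (Suc m) y"
    using fpos unfolding achain.simps by (meson greaterThanLessThan_iff less_imp_le)
  ultimately show ?case by (simp only:)
qed simp

text \<open>Induction on the chain length: each nested factor contributes the rate
  \<open>K\<^sup>2 / 2 + 4 * K - b\<close> once. The moment on the right is the price of the gain
  \<open>- b\<close>, and it does not accumulate: the moment inherited from the shorter chain
  cancels against part of the weight of the new factor. The sign conditions at \<open>p\<close> and
  \<open>y\<close> remove the boundary terms.\<close>

lemma nest_time_derivative:
  fixes w wx v r :: "real \<Rightarrow> real \<Rightarrow> real"
  assumes ls: "lsol K 0 I w wx v r" and t: "t \<in> I" and pq: "p < q" and K: "K \<ge> 0"
    and \<sigma>: "\<sigma> = 1 \<or> \<sigma> = -1" and left: "\<sigma> * w t p \<le> 0"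
  shows "\<exists>G. continuous_on {p..q} G \<and> utd (\<lambda>t. nest (w t) \<sigma> p m) G t {p..q} \<and>
    (\<forall>y\<in>{p..q}. (m = 0 \<or> \<sigma> * (-1) ^ (m - 1) * w t y \<le> 0) \<longrightarrow> (\<forall>b\<ge>0.
       G y \<le> (K\<^sup>2 / 2 + 4 * K - b) * real m * nest (w t) \<sigma> p m y + b\<^sup>2 * (q - p) * nmom (w t) \<sigma> p m y))"
proof (induction m)
  case 0
  show ?case
    by (intro exI[of _ "\<lambda>_. 0"]) (auto simp: utd_def intro!: continuous_on_const uniform_limit_const)
next
  case (Suc m)
  have ev: "evol I w wx v r" using ls by (simp add: lsol_def)
  note evD = evolD[OF ev]
  define s where "s = \<sigma> * (-1) ^ m"
  have s1: "s = 1 \<or> s = -1" using \<sigma> by (auto simp: s_def power_minus_odd uminus_power_if)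
  obtain G where G: "continuous_on {p..q} G" "utd (\<lambda>t. nest (w t) \<sigma> p m) G t {p..q}"
    and Gle: "\<And>y b. y \<in> {p..q} \<Longrightarrow> m = 0 \<or> \<sigma> * (-1) ^ (m - 1) * w t y \<le> 0 \<Longrightarrow> b \<ge> 0 \<Longrightarrow>
       G y \<le> (K\<^sup>2 / 2 + 4 * K - b) * real m * nest (w t) \<sigma> p m y + b\<^sup>2 * (q - p) * nmom (w t) \<sigma> p m y"
    using Suc.IH by blast
  define F where "F = nest (w t) \<sigma> p m"
  define \<rho> where "\<rho> t' x = (max 0 (s * w t' x)) ^ 4" for t' x
  define \<rho>' where "\<rho>' x = 4 * (max 0 (s * w t x)) ^ 3 * (s * r t x)" for x
  have wc: "continuous_on A (w t')" if "t' \<in> I" for t' A using evD(9)[OF that] .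
  have \<rho>d: "((\<lambda>h. integral {p..q} (\<lambda>x. \<bar>(\<rho> (t + h) x - \<rho> t x) / h - \<rho>' x\<bar>)) \<longlongrightarrow> 0) (at 0)"
  proof -
    have d1: "((\<lambda>y. (max 0 (s * y)) ^ 4) has_real_derivative 4 * (max 0 (s * y)) ^ 3 * s) (at y)" for y
      by (rule max0_power_compose_has_derivative) (auto intro!: derivative_eq_intros)
    have d2: "((\<lambda>y. 4 * (max 0 (s * y)) ^ 3 * s) has_real_derivative 12 * (max 0 (s * y)) ^ 2 * s * s) (at y)" for y
      by (intro DERIV_cmult_right max0_power_compose_has_derivative) (auto intro!: derivative_eq_intros)
    have d3: "continuous_on UNIV (\<lambda>y. 12 * (max 0 (s * y)) ^ 2 * s * s)" by (intro continuous_intros)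
    show ?thesis using mean_derivative_compose[OF ev t less_imp_le[OF pq] d1 d2 d3]
      by (simp add: \<rho>_def \<rho>'_def mult.assoc)
  qed
  have \<rho>'ai: "\<rho>' absolutely_integrable_on {p..q}"
  proof -
    have "(\<lambda>x. (4 * (max 0 (s * w t x)) ^ 3 * s) * r t x) absolutely_integrable_on {p..q}"
      by (intro L2_loc_mult_abs_integrable evD(6)[OF t] L2_loc_continuous continuous_intros wc t)
    then show ?thesis by (simp add: \<rho>'_def[abs_def] mult.assoc)
  qed
  note u = utd_integral[OF evD(1) t less_imp_le[OF pq], of \<rho> \<rho>' "\<lambda>t. nest (w t) \<sigma> p m" G]
  have \<rho>c: "continuous_on UNIV (\<rho> t')" if "t' \<in> I" for t'
    unfolding \<rho>_def by (intro continuous_intros wc that)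
  note u1 = u(1)[OF \<rho>c \<rho>'ai \<rho>d nest_continuous[OF wc] G] and u2 = u(2)[OF \<rho>c \<rho>'ai \<rho>d nest_continuous[OF wc] G]
  define G' where "G' y = integral {p..y} (\<lambda>x. \<rho>' x * F x + \<rho> t x * G x)" for y
  have Fc: "continuous_on A F" if "A \<subseteq> {p..q}" for A
    unfolding F_def using nest_continuous[OF wc[OF t]] that continuous_on_subset by blast
  have main: "G' y \<le> (K\<^sup>2 / 2 + 4 * K - b) * real (Suc m) * nest (w t) \<sigma> p (Suc m) y + b\<^sup>2 * (q - p) * nmom (w t) \<sigma> p (Suc m) y"
    if y: "y \<in> {p..q}" and sy: "s * w t y \<le> 0" and b: "b \<ge> 0" for y b
  proof -
    have sub: "{p..y} \<subseteq> {p..q}" and py: "p \<le> y" using y by auto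
    define H where "H = nmom (w t) \<sigma> p m"
    define S where "S x = (x - p) * F x - H x" for x
    define F' where "F' x = (if m = 0 then 0 else (max 0 (\<sigma> * (-1) ^ (m - 1) * w t x)) ^ 4 * nest (w t) \<sigma> p (m - 1) x)" for x
    have Fd: "(F has_real_derivative F' x) (at x within {p..y})" if "x \<in> {p..y}" for x
    proof (cases m)
      case 0
      have F1: "F = (\<lambda>_. 1)" by (rule ext) (simp add: F_def 0)
      show ?thesis unfolding F1 by (simp add: F'_def 0)
    next
      case (Suc n)
      then show ?thesis using nest_has_derivative[OF wc[OF t] that, of \<sigma> n] by (simp add: F_def F'_def del: nest.simps)
    qed
    have Hd: "(H has_real_derivative (x - p) * F' x) (at x within {p..y})" if "x \<in> {p..y}" for x
    proof (cases m)
      case 0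
      have H1: "H = (\<lambda>_. 0)" by (rule ext) (simp add: H_def 0)
      show ?thesis unfolding H1 by (simp add: F'_def 0)
    next
      case (Suc n)
      then show ?thesis using nmom_has_derivative[OF wc[OF t] that, of \<sigma> n]
        by (simp add: H_def F'_def mult.left_commute del: nmom.simps)
    qed
    have F'c: "continuous_on {p..y} F'"
    proof (cases m)
      case 0
      then show ?thesis by (simp add: F'_def[abs_def] continuous_on_const)
    next
      case (Suc n)
      then show ?thesis unfolding F'_def[abs_def] by (auto intro!: continuous_intros wc t nest_continuous)
    qed
    have F0: "0 \<le> F x" for x unfolding F_def by (rule nest_nonneg[OF wc[OF t]])
    have Sd: "(S has_real_derivative F x) (at x within {p..y})" if "x \<in> {p..y}" for x
      unfolding S_def using Fd[OF that] Hd[OF that] by (auto intro!: derivative_eq_intros)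
    have S0: "0 \<le> S x" if "x \<in> {p..y}" for x
      using nmom_le[OF wc[OF t], of x p q \<sigma> m] that sub by (auto simp: S_def F_def H_def)
    have SF: "S x \<le> (q - p) * F x" if "x \<in> {p..y}" for x
    proof -
      have "(x - p) * F x \<le> (q - p) * F x" using that sub F0[of x] by (intro mult_right_mono) auto
      then show ?thesis using nmom_nonneg[OF wc[OF t], of \<sigma> p m x] by (simp add: S_def H_def)
    qed
    have neg: "m \<noteq> 0 \<Longrightarrow> \<sigma> * (-1) ^ (m - 1) = - s" by (cases m) (auto simp: s_def)
    \<comment> \<open>Consecutive factors carry opposite signs, so they are never positive at the
      same point.\<close>
    have mF': "max 0 (s * w t x) * F' x = 0" for x
      using neg by (auto simp: F'_def max_def)
    have rv: "s * r t x \<le> s * v t x + K * (\<bar>s * w t x\<bar> + \<bar>s * wx t x\<bar>) + 0" for x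
    proof -
      have "\<bar>r t x - v t x\<bar> \<le> K * (\<bar>w t x\<bar> + \<bar>wx t x\<bar>)" using ls t by (auto simp: lsol_def)
      then show ?thesis using s1 by auto
    qed
    have my: "max 0 (s * w t y) = 0" using sy by simp
    \<comment> \<open>The left boundary term: for \<open>m = 0\<close> the sign condition at
      \<open>p\<close> kills the positive part; otherwise the inner integral runs over a single
      point.\<close>
    have mp: "max 0 (s * w t p) = 0 \<or> F p = 0"
    proof (cases m)
      case 0
      then show ?thesis using left by (simp add: s_def)
    next
      case (Suc n)
      then show ?thesis by (simp add: F_def)
    qed
    have rai: "(\<lambda>x. s * r t x) absolutely_integrable_on {p..y}" "(\<lambda>x. s * v t x) absolutely_integrable_on {p..y}"
      by (intro L2_loc_abs_integrable L2_loc_cmult evD t)+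
    have we: "integral {p..y} (\<lambda>x. 4 * max 0 (s * w t x) ^ 3 * (s * r t x) * F x)
      \<le> integral {p..y} (\<lambda>x. max 0 (s * w t x) ^ 4 * ((K\<^sup>2 / 2 + 4 * K - b) * F x + b\<^sup>2 * (q - p) * S x) + 4 * 0 * max 0 (s * w t x) ^ 3 * F x)"
    proof (rule weighted_energy(2)[where s = "\<lambda>x. s * w t x" and sx = "\<lambda>x. s * wx t x" and V = "\<lambda>x. s * v t x" and F' = F'])
      show "((\<lambda>x. s * w t x) has_real_derivative s * wx t x) (at x within {p..y})" for x
        by (intro DERIV_cmult evD t)
      show "integral {c..d} (\<lambda>x. s * v t x) = s * wx t d - s * wx t c" if "c \<le> d" for c d
        using evD(7)[OF t that] by (simp add: right_diff_distrib)
      show "max 0 (s * w t y) ^ 3 * F y * (s * wx t y) \<le> max 0 (s * w t p) ^ 3 * F p * (s * wx t p)"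
        unfolding my using mp by auto
      have "S p = 0" using S0[of p] SF[of p] py nmom_nonneg[OF wc[OF t], of \<sigma> p m p]
        by (auto simp: S_def H_def)
      then show "b = 0 \<or> S y * max 0 (s * w t y) ^ 4 \<le> S p * max 0 (s * w t p) ^ 4"
        unfolding my by simp
      show "s * r t x \<le> s * v t x + K * (\<bar>s * w t x\<bar> + \<bar>s * wx t x\<bar>) + 0" for x by (rule rv)
    qed (use py rai Fd F'c F0 mF' Sd S0 SF pq b in \<open>auto intro!: continuous_intros evD t\<close>)
    have i\<rho>G: "(\<lambda>x. \<rho> t x * G x) integrable_on {p..y}"
      by (intro integrable_continuous_real continuous_intros continuous_on_subset[OF \<rho>c[OF t]] continuous_on_subset[OF G(1) sub]) auto
    have i\<rho>F: "(\<lambda>x. \<rho>' x * F x) integrable_on {p..y}"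
    proof -
      have "(\<lambda>x. \<rho>' x * F x + \<rho> t x * G x) integrable_on {p..y}"
        using integrable_on_subinterval[OF set_lebesgue_integral_eq_integral(1)[OF u2] sub] by (simp add: F_def)
      from integrable_diff[OF this i\<rho>G] show ?thesis by simp
    qed
    have c1: "continuous_on {p..y} (\<lambda>x. max 0 (s * w t x) ^ 4 * ((K\<^sup>2 / 2 + 4 * K - b) * F x + b\<^sup>2 * (q - p) * S x))"
    proof -
      have "continuous_on {p..y} S" using Sd by (meson DERIV_continuous continuous_on_eq_continuous_within)
      then show ?thesis by (intro continuous_intros wc t Fc sub)
    qed
    let ?B = "\<lambda>x. max 0 (s * w t x) ^ 4 * ((K\<^sup>2 / 2 + 4 * K - b) * real m * F x + b\<^sup>2 * (q - p) * H x)"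
    have Hc: "continuous_on {p..y} H" using Hd by (meson DERIV_continuous continuous_on_eq_continuous_within)
    have c2: "continuous_on {p..y} ?B" by (intro continuous_intros wc t Fc sub Hc)
    have "integral {p..y} (\<lambda>x. \<rho> t x * G x) \<le> integral {p..y} ?B"
    proof (rule Henstock_Kurzweil_Integration.integral_le[OF i\<rho>G integrable_continuous_real[OF c2]])
      fix x assume x: "x \<in> {p..y}"
      show "\<rho> t x * G x \<le> ?B x"
      \<comment> \<open>Where the new factor is positive, \<open>w\<close> has the wrong sign for
        the factor before it; this is the sign condition under which the induction hypothesis holds
        with \<open>x\<close> as right end.\<close>
      proof (cases "s * w t x > 0")
        case True
        from True have "m = 0 \<or> \<sigma> * (-1) ^ (m - 1) * w t x \<le> 0"
        proof (cases "m = 0")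
          case False
          show ?thesis unfolding neg[OF False] using True by simp
        qed simp
        then have "G x \<le> (K\<^sup>2 / 2 + 4 * K - b) * real m * F x + b\<^sup>2 * (q - p) * H x"
          using Gle[of x b] x sub b by (auto simp: F_def H_def)
        then show ?thesis unfolding \<rho>_def by (intro mult_left_mono) auto
      qed (simp add: \<rho>_def)
    qed
    moreover have "G' y = integral {p..y} (\<lambda>x. \<rho>' x * F x) + integral {p..y} (\<lambda>x. \<rho> t x * G x)"
      unfolding G'_def by (rule integral_add[OF i\<rho>F i\<rho>G])
    moreover have "integral {p..y} (\<lambda>x. \<rho>' x * F x) \<le> integral {p..y} (\<lambda>x. max 0 (s * w t x) ^ 4 * ((K\<^sup>2 / 2 + 4 * K - b) * F x + b\<^sup>2 * (q - p) * S x))"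
      using we by (simp add: \<rho>'_def)
    ultimately have "G' y \<le> integral {p..y} (\<lambda>x. max 0 (s * w t x) ^ 4 * ((K\<^sup>2 / 2 + 4 * K - b) * F x + b\<^sup>2 * (q - p) * S x))
       + integral {p..y} ?B" by linarith
    also have "\<dots> = integral {p..y} (\<lambda>x. max 0 (s * w t x) ^ 4 * ((K\<^sup>2 / 2 + 4 * K - b) * F x + b\<^sup>2 * (q - p) * S x) + ?B x)"
      by (rule integral_add[symmetric, OF integrable_continuous_real[OF c1] integrable_continuous_real[OF c2]])
    \<comment> \<open>Since \<open>S x + H x = (x - p) * F x\<close>, the two moment terms merge
      into the integrand of the next moment, and the rates with weights 1 and \<open>m\<close> add
      up to \<open>Suc m\<close>.\<close>
    also have "\<dots> = integral {p..y} (\<lambda>x. (K\<^sup>2 / 2 + 4 * K - b) * real (Suc m) * (max 0 (s * w t x) ^ 4 * F x)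
        + b\<^sup>2 * (q - p) * (max 0 (s * w t x) ^ 4 * ((x - p) * F x)))"
      by (rule integral_cong) (simp add: S_def algebra_simps)
    also have "\<dots> = (K\<^sup>2 / 2 + 4 * K - b) * real (Suc m) * nest (w t) \<sigma> p (Suc m) y + b\<^sup>2 * (q - p) * nmom (w t) \<sigma> p (Suc m) y"
    proof (rule integral_unique)
      have "(\<lambda>x. max 0 (s * w t x) ^ 4 * F x) integrable_on {p..y}"
        by (intro integrable_continuous_real continuous_intros wc t Fc sub)
      moreover have "(\<lambda>x. max 0 (s * w t x) ^ 4 * ((x - p) * F x)) integrable_on {p..y}"
        by (intro integrable_continuous_real continuous_intros wc t Fc sub)
      ultimately show "((\<lambda>x. (K\<^sup>2 / 2 + 4 * K - b) * real (Suc m) * (max 0 (s * w t x) ^ 4 * F x)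
        + b\<^sup>2 * (q - p) * (max 0 (s * w t x) ^ 4 * ((x - p) * F x))) has_integral
        ((K\<^sup>2 / 2 + 4 * K - b) * real (Suc m) * nest (w t) \<sigma> p (Suc m) y + b\<^sup>2 * (q - p) * nmom (w t) \<sigma> p (Suc m) y)) {p..y}"
        unfolding nest.simps nmom.simps F_def[symmetric] s_def[symmetric]
        by (intro has_integral_add has_integral_mult_right integrable_integral)
    qed
    finally show ?thesis .
  qed
  have G'c: "continuous_on {p..q} G'"
    unfolding G'_def F_def by (rule indefinite_integral_continuous_1[OF set_lebesgue_integral_eq_integral(1)[OF u2]])
  have "utd (\<lambda>t. nest (w t) \<sigma> p (Suc m)) G' t {p..q}"
    using u1 unfolding G'_def F_def nest.simps \<rho>_def s_def by simp
  then show ?case using G'c main by (intro exI[of _ G']) (simp add: s_def del: nest.simps nmom.simps of_nat_Suc)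
qed

section \<open>Operations on evolutions\<close>

lemma evol_subset:
  assumes "evol I u ux v r" "open J" "J \<subseteq> I"
  shows "evol J u ux v r"
  using assms unfolding evol_def by (meson Sigma_mono continuous_on_subset order_refl subsetD)

lemma square_mean_limit_sum:
  fixes k f g :: "real \<Rightarrow> real \<Rightarrow> real"
  assumes f: "((\<lambda>h. integral {a..b} (\<lambda>x. (f h x)\<^sup>2)) \<longlongrightarrow> 0) F"
    and g: "((\<lambda>h. integral {a..b} (\<lambda>x. (g h x)\<^sup>2)) \<longlongrightarrow> 0) F"
    and L: "\<forall>\<^sub>F h in F. L2_loc (k h) \<and> L2_loc (f h) \<and> L2_loc (g h) \<and> (\<forall>x. \<bar>k h x\<bar> \<le> \<bar>f h x\<bar> + \<bar>g h x\<bar>)"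
  shows "((\<lambda>h. integral {a..b} (\<lambda>x. (k h x)\<^sup>2)) \<longlongrightarrow> 0) F"
proof (rule tendsto_sandwich[where f = "\<lambda>_. 0" and h = "\<lambda>h. 2 * integral {a..b} (\<lambda>x. (f h x)\<^sup>2) + 2 * integral {a..b} (\<lambda>x. (g h x)\<^sup>2)"])
  have "((\<lambda>h. 2 * integral {a..b} (\<lambda>x. (f h x)\<^sup>2) + 2 * integral {a..b} (\<lambda>x. (g h x)\<^sup>2)) \<longlongrightarrow> 2 * 0 + 2 * 0) F"
    by (intro tendsto_intros f g)
  then show "((\<lambda>h. 2 * integral {a..b} (\<lambda>x. (f h x)\<^sup>2) + 2 * integral {a..b} (\<lambda>x. (g h x)\<^sup>2)) \<longlongrightarrow> 0) F"
    by simp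
  show "\<forall>\<^sub>F h in F. 0 \<le> integral {a..b} (\<lambda>x. (k h x)\<^sup>2)"
    using L by eventually_elim (auto intro!: Henstock_Kurzweil_Integration.integral_nonneg L2_loc_square_integrable)
  show "\<forall>\<^sub>F h in F. integral {a..b} (\<lambda>x. (k h x)\<^sup>2) \<le> 2 * integral {a..b} (\<lambda>x. (f h x)\<^sup>2) + 2 * integral {a..b} (\<lambda>x. (g h x)\<^sup>2)"
    using L
  proof eventually_elim
    case (elim h)
    have if': "(\<lambda>x. (f h x)\<^sup>2) integrable_on {a..b}" and ig: "(\<lambda>x. (g h x)\<^sup>2) integrable_on {a..b}"
      and ik: "(\<lambda>x. (k h x)\<^sup>2) integrable_on {a..b}"
      using elim L2_loc_square_integrable by blast+
    have "integral {a..b} (\<lambda>x. (k h x)\<^sup>2) \<le> integral {a..b} (\<lambda>x. 2 * (f h x)\<^sup>2 + 2 * (g h x)\<^sup>2)"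
    proof (rule Henstock_Kurzweil_Integration.integral_le[OF ik])
      show "(\<lambda>x. 2 * (f h x)\<^sup>2 + 2 * (g h x)\<^sup>2) integrable_on {a..b}"
        by (intro integrable_add integrable_on_mult_right if' ig)
      fix x
      have "(k h x)\<^sup>2 \<le> (\<bar>f h x\<bar> + \<bar>g h x\<bar>)\<^sup>2"
        using elim by (simp add: abs_le_square_iff[symmetric])
      also have "\<dots> \<le> 2 * (f h x)\<^sup>2 + 2 * (g h x)\<^sup>2"
        using sum_squares_bound[of "\<bar>f h x\<bar>" "\<bar>g h x\<bar>"] by (simp add: power2_sum)
      finally show "(k h x)\<^sup>2 \<le> 2 * (f h x)\<^sup>2 + 2 * (g h x)\<^sup>2" .
    qed
    also have "\<dots> = 2 * integral {a..b} (\<lambda>x. (f h x)\<^sup>2) + 2 * integral {a..b} (\<lambda>x. (g h x)\<^sup>2)"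
      by (intro integral_unique has_integral_add has_integral_mult_right integrable_integral if' ig)
    finally show ?case .
  qed
qed (rule tendsto_const)

lemma evol_quotient_L2_loc:
  assumes "evol I u ux v r" "t \<in> I"
  shows "\<forall>\<^sub>F h in at 0. L2_loc (\<lambda>x. (u (t + h) x - u t x) / h - r t x)"
proof -
  note evD = evolD[OF assms(1)]
  have "\<forall>\<^sub>F h in at 0. h \<noteq> (0::real)" by (simp add: eventually_at_filter)
  with eventually_at_0_shift[OF evD(1) assms(2)] show ?thesis
    by eventually_elim (intro L2_loc_diff evD assms L2_loc_continuous continuous_intros; use evD(9) assms in auto)
qed

lemma evol_diff:
  assumes u: "evol I u ux v r" and u': "evol I u' ux' v' r'"
  shows "evol I (\<lambda>t x. u t x - u' t x) (\<lambda>t x. ux t x - ux' t x) (\<lambda>t x. v t x - v' t x) (\<lambda>t x. r t x - r' t x)"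
proof -
  note D = evolD[OF u] and D' = evolD[OF u']
  have "((\<lambda>h. integral {a..b} (\<lambda>x. (((u (t + h) x - u' (t + h) x) - (u t x - u' t x)) / h - (r t x - r' t x))\<^sup>2)) \<longlongrightarrow> 0) (at 0)"
    if t: "t \<in> I" for t a b
  proof (rule square_mean_limit_sum[OF D(8)[OF t] D'(8)[OF t]])
    have "\<forall>\<^sub>F h in at 0. h \<noteq> (0::real)" by (simp add: eventually_at_filter)
    with evol_quotient_L2_loc[OF u t] evol_quotient_L2_loc[OF u' t]
    show "\<forall>\<^sub>F h in at 0. L2_loc (\<lambda>x. ((u (t + h) x - u' (t + h) x) - (u t x - u' t x)) / h - (r t x - r' t x)) \<and>
       L2_loc (\<lambda>x. (u (t + h) x - u t x) / h - r t x) \<and> L2_loc (\<lambda>x. (u' (t + h) x - u' t x) / h - r' t x) \<and>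
       (\<forall>x. \<bar>((u (t + h) x - u' (t + h) x) - (u t x - u' t x)) / h - (r t x - r' t x)\<bar>
          \<le> \<bar>(u (t + h) x - u t x) / h - r t x\<bar> + \<bar>(u' (t + h) x - u' t x) / h - r' t x\<bar>)"
    proof eventually_elim
      case (elim h)
      have eq: "((u (t + h) x - u' (t + h) x) - (u t x - u' t x)) / h - (r t x - r' t x)
        = ((u (t + h) x - u t x) / h - r t x) - ((u' (t + h) x - u' t x) / h - r' t x)" for x
        using elim(3) by (simp add: diff_divide_distrib)
      show ?case unfolding eq using elim L2_loc_diff[OF elim(1,2)] by (auto intro: abs_triangle_ineq4)
    qed
  qed
  moreover have "continuous_on (I \<times> UNIV) (\<lambda>(t, x). u t x - u' t x)" "continuous_on (I \<times> UNIV) (\<lambda>(t, x). ux t x - ux' t x)"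
    using continuous_on_diff[OF D(2) D'(2)] continuous_on_diff[OF D(3) D'(3)] by (simp_all add: case_prod_beta)
  moreover have "integral {a..b} (\<lambda>x. v t x - v' t x) = (ux t b - ux' t b) - (ux t a - ux' t a)"
    if "t \<in> I" "a \<le> b" for t a b
    using integral_diff[OF L2_loc_integrable[OF D(5)[OF that(1)]] L2_loc_integrable[OF D'(5)[OF that(1)]], of a b]
      D(7)[OF that] D'(7)[OF that] by linarith
  ultimately show ?thesis
    unfolding evol_def by (auto intro!: DERIV_diff L2_loc_diff D D')
qed

lemma evol_zero: "open I \<Longrightarrow> evol I (\<lambda>_ _. 0) (\<lambda>_ _. 0) (\<lambda>_ _. 0) (\<lambda>_ _. 0)"
  by (auto simp: evol_def case_prod_beta intro!: continuous_on_const L2_loc_continuous)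

lemma evol_minus:
  assumes "evol I u ux v r"
  shows "evol I (\<lambda>t x. - u t x) (\<lambda>t x. - ux t x) (\<lambda>t x. - v t x) (\<lambda>t x. - r t x)"
  using evol_diff[OF evol_zero[OF evolD(1)[OF assms]] assms] by simp

lemma half_scaled_less: "e / (2 * (\<bar>b - a\<bar> + 1)) * (b - a) < e" if "e > 0" "a \<le> b" for a b e :: real
proof -
  have "(b - a) / (2 * (\<bar>b - a\<bar> + 1)) < 1" using that(2) by (simp add: divide_less_eq)
  from mult_strict_left_mono[OF this that(1)] show ?thesis by simp
qed

text \<open>Supplies the barriers. The mean value theorem, applied in \<open>s\<close> to
  \<open>\<phi> s x - \<phi>t t x * s\<close>, bounds the error of the difference quotient uniformly
  on \<open>{a..b}\<close>, hence in the square mean.\<close>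

lemma evol_smooth:
  fixes \<phi> \<phi>x \<phi>xx \<phi>t :: "real \<Rightarrow> real \<Rightarrow> real"
  assumes c: "continuous_on UNIV (\<lambda>(t, x). \<phi> t x)" "continuous_on UNIV (\<lambda>(t, x). \<phi>x t x)"
      "continuous_on UNIV (\<lambda>(t, x). \<phi>xx t x)" "continuous_on UNIV (\<lambda>(t, x). \<phi>t t x)"
    and d: "\<And>t x. (\<phi> t has_real_derivative \<phi>x t x) (at x)" "\<And>t x. (\<phi>x t has_real_derivative \<phi>xx t x) (at x)"
      "\<And>t x. ((\<lambda>t. \<phi> t x) has_real_derivative \<phi>t t x) (at t)"
    and I: "open I"
  shows "evol I \<phi> \<phi>x \<phi>xx \<phi>t"
proof -
  have sl: "continuous_on UNIV (f t)" if "continuous_on UNIV (\<lambda>(t, x). f t x)" for f :: "real \<Rightarrow> real \<Rightarrow> real" and t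
    using continuous_on_slice[of UNIV f t UNIV] that by simp
  have lim: "((\<lambda>h. integral {a..b} (\<lambda>x. ((\<phi> (t + h) x - \<phi> t x) / h - \<phi>t t x)\<^sup>2)) \<longlongrightarrow> 0) (at 0)" for t a b
  proof (rule tendstoI)
    fix e :: real assume e: "e > 0"
    define e' where "e' = sqrt (e / (2 * (\<bar>b - a\<bar> + 1)))"
    have e': "e' > 0" using e unfolding e'_def by (intro real_sqrt_gt_zero divide_pos_pos mult_pos_pos add_nonneg_pos) auto
    have c4: "continuous_on (UNIV \<times> UNIV) (\<lambda>(t, x). \<phi>t t x)" using c(4) by simp
    from uniform_shift_limit[OF c4 open_UNIV UNIV_I e', of t a b] obtain d' where d': "d' > 0"
      "\<And>h x. \<bar>h\<bar> < d' \<Longrightarrow> x \<in> {a..b} \<Longrightarrow> \<bar>\<phi>t (t + h) x - \<phi>t t x\<bar> < e'" by fastforce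
    have "dist (integral {a..b} (\<lambda>x. ((\<phi> (t + h) x - \<phi> t x) / h - \<phi>t t x)\<^sup>2)) 0 < e" if h: "h \<noteq> 0" "\<bar>h\<bar> < d'" for h
    proof (cases "a \<le> b")
      case True
      have le: "((\<phi> (t + h) x - \<phi> t x) / h - \<phi>t t x)\<^sup>2 \<le> e'\<^sup>2" if x: "x \<in> {a..b}" for x
      proof -
        have "\<bar>(\<phi> (t + h) x - \<phi>t t x * (t + h)) - (\<phi> t x - \<phi>t t x * t)\<bar> \<le> e' * \<bar>(t + h) - t\<bar>"
        proof (rule field_differentiable_bound[of "cball t \<bar>h\<bar>" "\<lambda>s. \<phi> s x - \<phi>t t x * s" "\<lambda>s. \<phi>t s x - \<phi>t t x", unfolded real_norm_def])
          fix s assume s: "s \<in> cball t \<bar>h\<bar>"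
          show "((\<lambda>s. \<phi> s x - \<phi>t t x * s) has_real_derivative \<phi>t s x - \<phi>t t x) (at s within cball t \<bar>h\<bar>)"
            by (auto intro!: derivative_eq_intros has_field_derivative_at_within[OF d(3)])
          have "\<bar>s - t\<bar> < d'" using s h by (auto simp: dist_real_def)
          then show "\<bar>\<phi>t s x - \<phi>t t x\<bar> \<le> e'" using d'(2)[of "s - t" x] x by simp
        qed (auto simp: dist_real_def)
        then have "\<bar>(\<phi> (t + h) x - \<phi> t x) - h * \<phi>t t x\<bar> \<le> e' * \<bar>h\<bar>" by (simp add: algebra_simps)
        then have "\<bar>(\<phi> (t + h) x - \<phi> t x) - h * \<phi>t t x\<bar> / \<bar>h\<bar> \<le> e'" using h by (simp add: divide_le_eq)
        also have "\<bar>(\<phi> (t + h) x - \<phi> t x) - h * \<phi>t t x\<bar> / \<bar>h\<bar> = \<bar>(\<phi> (t + h) x - \<phi> t x) / h - \<phi>t t x\<bar>"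
          using h(1) by (simp add: abs_divide[symmetric] diff_divide_distrib)
        finally show ?thesis using e' abs_le_square_iff[of _ e'] by simp
      qed
      have int: "(\<lambda>x. ((\<phi> (t + h) x - \<phi> t x) / h - \<phi>t t x)\<^sup>2) integrable_on {a..b}"
        by (intro integrable_continuous_real continuous_intros continuous_on_subset[OF sl[OF c(1)]] continuous_on_subset[OF sl[OF c(4)]])
          (use h in auto)
      have "integral {a..b} (\<lambda>x. ((\<phi> (t + h) x - \<phi> t x) / h - \<phi>t t x)\<^sup>2) \<le> integral {a..b} (\<lambda>x. e'\<^sup>2)"
        using le int by (intro Henstock_Kurzweil_Integration.integral_le) auto
      also have "\<dots> = e / (2 * (\<bar>b - a\<bar> + 1)) * (b - a)" using True e by (simp add: e'_def)
      also have "\<dots> < e" by (rule half_scaled_less[OF e True])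
      finally show ?thesis using Henstock_Kurzweil_Integration.integral_nonneg[OF int] by simp
    qed (use e in simp)
    then show "\<forall>\<^sub>F h in at 0. dist (integral {a..b} (\<lambda>x. ((\<phi> (t + h) x - \<phi> t x) / h - \<phi>t t x)\<^sup>2)) 0 < e"
      using d'(1) by (auto simp: eventually_at dist_real_def intro!: exI[of _ d'])
  qed
  show ?thesis
    unfolding evol_def
  proof (intro conjI ballI allI impI I)
    show "continuous_on (I \<times> UNIV) (\<lambda>(t, x). \<phi> t x)" "continuous_on (I \<times> UNIV) (\<lambda>(t, x). \<phi>x t x)"
      using c continuous_on_subset by blast+
    fix t
    show "L2_loc (\<phi>xx t)" "L2_loc (\<phi>t t)" using sl[OF c(3)] sl[OF c(4)] by (auto intro: L2_loc_continuous)
    show "(\<phi> t has_real_derivative \<phi>x t x) (at x)" for x by (rule d)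
    show "integral {a..b} (\<phi>xx t) = \<phi>x t b - \<phi>x t a" if "a \<le> b" for a b
      by (intro integral_unique fundamental_theorem_of_calculus that)
        (auto simp: has_real_derivative_iff_has_vector_derivative[symmetric] intro: has_field_derivative_at_within d)
  qed (rule lim)
qed

lemma evol_affine:
  assumes ev: "evol I u ux v r" and s: "s = 1 \<or> s = -1"
  shows "evol I (\<lambda>t x. u t (s * x + (c + \<kappa> * t))) (\<lambda>t x. s * ux t (s * x + (c + \<kappa> * t)))
    (\<lambda>t x. v t (s * x + (c + \<kappa> * t))) (\<lambda>t x. r t (s * x + (c + \<kappa> * t)) + \<kappa> * ux t (s * x + (c + \<kappa> * t)))"
proof -
  note D = evolD[OF ev]
  have cc: "continuous_on (I \<times> UNIV) (\<lambda>(t, x). f t (s * x + (c + \<kappa> * t)))"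
    if "continuous_on (I \<times> UNIV) (\<lambda>(t, x). f t x)" for f :: "real \<Rightarrow> real \<Rightarrow> real"
  proof -
    have "continuous_on (I \<times> UNIV) (\<lambda>p. (\<lambda>(t, x). f t x) (fst p, s * snd p + (c + \<kappa> * fst p)))"
      by (rule continuous_on_compose2[OF that]) (auto intro!: continuous_intros)
    then show ?thesis by (simp add: case_prod_beta)
  qed
  show ?thesis
    unfolding evol_def
  proof (intro conjI ballI allI impI D(1))
    show "continuous_on (I \<times> UNIV) (\<lambda>(t, x). u t (s * x + (c + \<kappa> * t)))" by (rule cc[OF D(2)])
    show "continuous_on (I \<times> UNIV) (\<lambda>(t, x). s * ux t (s * x + (c + \<kappa> * t)))"
      using continuous_on_mult_left[OF cc[OF D(3)], of s] by (simp add: case_prod_beta)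
    fix t assume t: "t \<in> I"
    let ?c = "c + \<kappa> * t"
    show "((\<lambda>x. u t (s * x + ?c)) has_real_derivative s * ux t (s * x + ?c)) (at x)" for x
    proof -
      have "((\<lambda>x. s * x + ?c) has_real_derivative s) (at x)" by (auto intro!: derivative_eq_intros)
      from DERIV_chain2[where f = "u t" and g = "\<lambda>x. s * x + ?c", OF D(4)[OF t] this]
      show ?thesis by (simp add: mult.commute)
    qed
    show "L2_loc (\<lambda>x. v t (s * x + ?c))" by (rule L2_loc_affine[OF D(5)[OF t] s])
    have Lux: "L2_loc (\<lambda>x. ux t (s * x + ?c))" by (rule L2_loc_affine[OF L2_loc_continuous[OF D(10)[OF t]] s])
    have Lr: "L2_loc (\<lambda>x. r t (s * x + ?c))" by (rule L2_loc_affine[OF D(6)[OF t] s])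
    show "L2_loc (\<lambda>x. r t (s * x + ?c) + \<kappa> * ux t (s * x + ?c))"
      by (intro L2_loc_add L2_loc_cmult Lux Lr)
    show "integral {a..b} (\<lambda>x. v t (s * x + ?c)) = s * ux t (s * b + ?c) - s * ux t (s * a + ?c)" if ab: "a \<le> b" for a b
    proof -
      have "integral {a..b} (\<lambda>x. v t (s * x + ?c)) =
        integral {min (s * a + ?c) (s * b + ?c)..max (s * a + ?c) (s * b + ?c)} (v t)"
        by (rule integral_reflect_translate[OF s ab L2_loc_integrable[OF D(5)[OF t]]])
      also have "\<dots> = s * ux t (s * b + ?c) - s * ux t (s * a + ?c)"
        using s D(7)[OF t] ab by (auto simp: min_def max_def)
      finally show ?thesis .
    qed
    fix a b
    show "((\<lambda>h. integral {a..b} (\<lambda>x. ((u (t + h) (s * x + (c + \<kappa> * (t + h))) - u t (s * x + ?c)) / h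
        - (r t (s * x + ?c) + \<kappa> * ux t (s * x + ?c)))\<^sup>2)) \<longlongrightarrow> 0) (at 0)"
    proof (cases "a \<le> b")
      case ab: True
      let ?f = "\<lambda>h x. (u (t + h) (s * x + ?c) - u t (s * x + ?c)) / h - r t (s * x + ?c)"
      let ?g = "\<lambda>h x. (u (t + h) (s * x + ?c + \<kappa> * h) - u (t + h) (s * x + ?c)) / h - \<kappa> * ux t (s * x + ?c)"
      let ?A = "min (s * a + ?c) (s * b + ?c)" and ?B = "max (s * a + ?c) (s * b + ?c)"
      have hn: "\<forall>\<^sub>F h in at 0. h \<noteq> (0::real)" by (simp add: eventually_at_filter)
      have f0: "((\<lambda>h. integral {a..b} (\<lambda>x. (?f h x)\<^sup>2)) \<longlongrightarrow> 0) (at 0)"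
      proof (rule Lim_transform_eventually[OF D(8)[OF t, of ?A ?B]])
        show "\<forall>\<^sub>F h in at 0. integral {?A..?B} (\<lambda>x. ((u (t + h) x - u t x) / h - r t x)\<^sup>2) = integral {a..b} (\<lambda>x. (?f h x)\<^sup>2)"
          using evol_quotient_L2_loc[OF ev t]
        proof eventually_elim
          case (elim h)
          show ?case
            by (rule integral_reflect_translate[OF s ab L2_loc_square_integrable[OF elim], symmetric])
        qed
      qed
      have g0: "((\<lambda>h. integral {a..b} (\<lambda>x. (?g h x)\<^sup>2)) \<longlongrightarrow> 0) (at 0)"
      proof (rule tendstoI)
        fix e :: real assume e: "e > 0"
        define e' where "e' = sqrt (e / (2 * (b - a + 1)))"
        have e': "e' > 0" using e ab by (simp add: e'_def)
        have "e' / (\<bar>\<kappa>\<bar> + 1) > 0" using e' by simp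
        from uniform_shift_limit[OF D(3,1) t this, of ?A ?B] obtain d where d: "d > 0"
          "\<And>h. \<bar>h\<bar> < d \<Longrightarrow> t + h \<in> I"
          "\<And>h x y. \<bar>h\<bar> < d \<Longrightarrow> x \<in> {?A..?B} \<Longrightarrow> \<bar>y - x\<bar> < d \<Longrightarrow> \<bar>ux (t + h) y - ux t x\<bar> < e' / (\<bar>\<kappa>\<bar> + 1)" by metis
        \<comment> \<open>The denominator keeps both \<open>h\<close> and the displacement
          \<open>\<kappa> * h\<close> below \<open>d\<close>.\<close>
        define d' where "d' = d / (\<bar>\<kappa>\<bar> + 1)"
        have d': "d' > 0" "d' \<le> d" using d(1) by (auto simp: d'_def divide_le_eq)
        have "dist (integral {a..b} (\<lambda>x. (?g h x)\<^sup>2)) 0 < e" if h: "h \<noteq> 0" "\<bar>h\<bar> < d'" for h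
        proof -
          have hd: "\<bar>h\<bar> < d" using h d' by simp
          have khd: "\<bar>\<kappa> * h\<bar> < d"
          proof -
            have "\<bar>\<kappa> * h\<bar> \<le> (\<bar>\<kappa>\<bar> + 1) * \<bar>h\<bar>" by (simp add: abs_mult distrib_right)
            also have "\<dots> < (\<bar>\<kappa>\<bar> + 1) * d'" using h by (intro mult_strict_left_mono) auto
            finally show ?thesis by (simp add: d'_def)
          qed
          have thI: "t + h \<in> I" using d(2) hd .
          have le: "(?g h x)\<^sup>2 \<le> e'\<^sup>2" if x: "x \<in> {a..b}" for x
          proof -
            define X where "X = s * x + ?c"
            have X: "X \<in> {?A..?B}" using x s by (auto simp: X_def)
            have "\<bar>(u (t + h) (X + \<kappa> * h) - ux t X * (X + \<kappa> * h)) - (u (t + h) X - ux t X * X)\<bar> \<le> e' / (\<bar>\<kappa>\<bar> + 1) * \<bar>(X + \<kappa> * h) - X\<bar>"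
            proof (rule field_differentiable_bound[of "cball X \<bar>\<kappa> * h\<bar>" "\<lambda>y. u (t + h) y - ux t X * y" "\<lambda>y. ux (t + h) y - ux t X", unfolded real_norm_def])
              fix y assume y: "y \<in> cball X \<bar>\<kappa> * h\<bar>"
              show "((\<lambda>y. u (t + h) y - ux t X * y) has_real_derivative ux (t + h) y - ux t X) (at y within cball X \<bar>\<kappa> * h\<bar>)"
                by (auto intro!: derivative_eq_intros D(4) thI)
              show "\<bar>ux (t + h) y - ux t X\<bar> \<le> e' / (\<bar>\<kappa>\<bar> + 1)"
                using d(3)[OF hd X, of y] y khd by (simp add: dist_real_def abs_minus_commute)
            qed (auto simp: dist_real_def)
            then have "\<bar>u (t + h) (X + \<kappa> * h) - u (t + h) X - h * (\<kappa> * ux t X)\<bar> \<le> e' / (\<bar>\<kappa>\<bar> + 1) * (\<bar>\<kappa>\<bar> * \<bar>h\<bar>)"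
              by (simp add: algebra_simps abs_mult)
            also have "\<dots> \<le> e' / (\<bar>\<kappa>\<bar> + 1) * ((\<bar>\<kappa>\<bar> + 1) * \<bar>h\<bar>)" using e' by (intro mult_left_mono mult_right_mono) auto
            also have "\<dots> = e' * \<bar>h\<bar>" by simp
            finally have "\<bar>u (t + h) (X + \<kappa> * h) - u (t + h) X - h * (\<kappa> * ux t X)\<bar> / \<bar>h\<bar> \<le> e'" using h by (simp add: divide_le_eq)
            also have "\<bar>u (t + h) (X + \<kappa> * h) - u (t + h) X - h * (\<kappa> * ux t X)\<bar> / \<bar>h\<bar>
               = \<bar>(u (t + h) (X + \<kappa> * h) - u (t + h) X) / h - \<kappa> * ux t X\<bar>"
              using h(1) by (simp add: abs_divide[symmetric] diff_divide_distrib)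
            finally show ?thesis using e' abs_le_square_iff[of _ e'] by (simp add: X_def)
          qed
          have cu: "continuous_on A (u (t + h))" "continuous_on A (ux t)" for A using D(9)[OF thI] D(10)[OF t] by auto
          have int: "(\<lambda>x. (?g h x)\<^sup>2) integrable_on {a..b}"
            by (intro integrable_continuous_real continuous_intros continuous_on_compose2[OF cu(1)[of UNIV]]
                continuous_on_compose2[OF cu(2)[of UNIV]]) (use h in auto)
          have "integral {a..b} (\<lambda>x. (?g h x)\<^sup>2) \<le> integral {a..b} (\<lambda>x. e'\<^sup>2)"
            using le int by (intro Henstock_Kurzweil_Integration.integral_le) auto
          also have "\<dots> = e / (2 * (\<bar>b - a\<bar> + 1)) * (b - a)" using ab e by (simp add: e'_def)
          also have "\<dots> < e" by (rule half_scaled_less[OF e ab])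
          finally show ?thesis using Henstock_Kurzweil_Integration.integral_nonneg[OF int] by simp
        qed
        then show "\<forall>\<^sub>F h in at 0. dist (integral {a..b} (\<lambda>x. (?g h x)\<^sup>2)) 0 < e"
          using d'(1) by (auto simp: eventually_at dist_real_def intro!: exI[of _ d'])
      qed
      show ?thesis
      proof (rule square_mean_limit_sum[OF f0 g0])
        show "\<forall>\<^sub>F h in at 0. L2_loc (\<lambda>x. (u (t + h) (s * x + (c + \<kappa> * (t + h))) - u t (s * x + ?c)) / h
            - (r t (s * x + ?c) + \<kappa> * ux t (s * x + ?c))) \<and> L2_loc (?f h) \<and> L2_loc (?g h) \<and>
          (\<forall>x. \<bar>(u (t + h) (s * x + (c + \<kappa> * (t + h))) - u t (s * x + ?c)) / h - (r t (s * x + ?c) + \<kappa> * ux t (s * x + ?c))\<bar>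
             \<le> \<bar>?f h x\<bar> + \<bar>?g h x\<bar>)"
          using evol_quotient_L2_loc[OF ev t] hn eventually_at_0_shift[OF D(1) t]
        proof eventually_elim
          case (elim h)
          have L1: "L2_loc (?f h)" using L2_loc_affine[OF elim(1) s] .
          have cu: "continuous_on UNIV (u (t + h))" using D(9)[OF elim(3)] .
          have L2: "L2_loc (?g h)"
            by (intro L2_loc_diff L2_loc_cmult Lux L2_loc_continuous continuous_intros continuous_on_compose2[OF cu])
              (use elim(2) in auto)
          have eq: "(u (t + h) (s * x + (c + \<kappa> * (t + h))) - u t (s * x + ?c)) / h - (r t (s * x + ?c) + \<kappa> * ux t (s * x + ?c))
            = ?f h x + ?g h x" for x
            using elim(2) by (simp add: diff_divide_distrib algebra_simps)
          show ?case unfolding eq using L1 L2 L2_loc_add[OF L1 L2] by (auto intro: abs_triangle_ineq)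
        qed
      qed
    qed simp
  qed
qed

section \<open>Comparison, strong positivity and the Hopf lemma\<close>

lemma lsolD:
  assumes "lsol K e I w wx v r"
  shows "evol I w wx v r" and "t \<in> I \<Longrightarrow> \<bar>r t x - v t x\<bar> \<le> K * (\<bar>w t x\<bar> + \<bar>wx t x\<bar>) + e"
  using assms by (auto simp: lsol_def)

lemma lsol_minus:
  assumes "lsol K e I w wx v r"
  shows "lsol K e I (\<lambda>t x. - w t x) (\<lambda>t x. - wx t x) (\<lambda>t x. - v t x) (\<lambda>t x. - r t x)"
  using assms evol_minus[OF lsolD(1)[OF assms]] unfolding lsol_def by (auto simp: abs_minus_commute)

text \<open>The transport term is a multiple of the space derivative and is absorbed into the
  constant.\<close>

lemma lsol_affine:
  assumes ls: "lsol K e I w wx v r" and s: "s = 1 \<or> s = -1"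
  shows "lsol (K + \<bar>\<kappa>\<bar>) e I (\<lambda>t x. w t (s * x + (c + \<kappa> * t))) (\<lambda>t x. s * wx t (s * x + (c + \<kappa> * t)))
    (\<lambda>t x. v t (s * x + (c + \<kappa> * t))) (\<lambda>t x. r t (s * x + (c + \<kappa> * t)) + \<kappa> * wx t (s * x + (c + \<kappa> * t)))"
  unfolding lsol_def
proof (intro conjI ballI allI evol_affine[OF lsolD(1)[OF ls] s])
  fix t x assume t: "t \<in> I"
  let ?X = "s * x + (c + \<kappa> * t)"
  have a: "\<bar>s * wx t ?X\<bar> = \<bar>wx t ?X\<bar>" using s by auto
  have "\<bar>r t ?X + \<kappa> * wx t ?X - v t ?X\<bar> \<le> \<bar>r t ?X - v t ?X\<bar> + \<bar>\<kappa>\<bar> * \<bar>wx t ?X\<bar>"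
    unfolding abs_mult[symmetric] by linarith
  also have "\<dots> \<le> K * (\<bar>w t ?X\<bar> + \<bar>wx t ?X\<bar>) + e + \<bar>\<kappa>\<bar> * (\<bar>w t ?X\<bar> + \<bar>wx t ?X\<bar>)"
    using lsolD(2)[OF ls t, of ?X] by (intro add_mono mult_left_mono) auto
  finally show "\<bar>r t ?X + \<kappa> * wx t ?X - v t ?X\<bar> \<le> (K + \<bar>\<kappa>\<bar>) * (\<bar>w t ?X\<bar> + \<bar>s * wx t ?X\<bar>) + e"
    unfolding a by (simp add: algebra_simps)
qed

lemma energy_derivative:
  fixes \<beta> \<beta>' \<beta>'' :: "real \<Rightarrow> real"
  assumes ev: "evol I u ux v r" and t: "t \<in> I" and ab: "a \<le> b"
    and \<beta>: "\<And>s. (\<beta> has_real_derivative \<beta>' s) (at s)" "\<And>s. (\<beta>' has_real_derivative \<beta>'' s) (at s)"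
      "continuous_on UNIV \<beta>''"
  shows "((\<lambda>t. integral {a..b} (\<lambda>x. \<beta> (u t x))) has_real_derivative integral {a..b} (\<lambda>x. \<beta>' (u t x) * r t x)) (at t)"
    and "(\<lambda>x. \<beta>' (u t x) * r t x) absolutely_integrable_on {a..b}"
proof -
  note D = evolD[OF ev]
  have \<beta>c: "continuous_on UNIV \<beta>" "continuous_on UNIV \<beta>'"
    using \<beta>(1,2) by (meson DERIV_continuous_on DERIV_subset has_field_derivative_at_within)+
  have bc: "continuous_on UNIV (\<lambda>x. \<beta> (u t' x))" if "t' \<in> I" for t'
    by (rule continuous_on_compose2[OF \<beta>c(1) D(9)[OF that]]) auto
  show ai: "(\<lambda>x. \<beta>' (u t x) * r t x) absolutely_integrable_on {a..b}"
    by (intro L2_loc_mult_abs_integrable D(6)[OF t] L2_loc_continuous continuous_on_compose2[OF \<beta>c(2) D(9)[OF t]]) auto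
  have "utd (\<lambda>t y. integral {a..y} (\<lambda>x. \<beta> (u t x) * 1)) (\<lambda>y. integral {a..y} (\<lambda>x. \<beta>' (u t x) * r t x * 1 + \<beta> (u t x) * 0)) t {a..b}"
    by (rule utd_integral(1)[OF D(1) t ab bc ai mean_derivative_compose[OF ev t ab \<beta>]])
      (auto simp: utd_def intro!: continuous_on_const uniform_limit_const)
  from utd_imp_derivative[OF this, of b] ab
  show "((\<lambda>t. integral {a..b} (\<lambda>x. \<beta> (u t x))) has_real_derivative integral {a..b} (\<lambda>x. \<beta>' (u t x) * r t x)) (at t)"
    by simp
qed

lemma continuous_on_12_max0: "continuous_on UNIV (\<lambda>s::real. 12 * (max 0 s)\<^sup>2)"
  by (intro continuous_intros)

text \<open>The energy of the positive part of \<open>z\<close> starts at 0 and grows at most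
  exponentially, by \<open>weighted_energy\<close> with weight 1 and \<open>b = 0\<close>. Only
  points with \<open>z > 0\<close> enter, so a barrier has to be a subsolution only where it exceeds
  the solution.\<close>

lemma comparison:
  assumes ev: "evol I z zx V R" and st: "s \<le> t" "{s..t} \<subseteq> I" and pq: "p < q" and K: "K \<ge> 0"
    and ini: "\<And>x. x \<in> {p..q} \<Longrightarrow> z s x \<le> 0"
    and bd: "\<And>\<tau>. \<tau> \<in> {s..t} \<Longrightarrow> z \<tau> p \<le> 0 \<and> z \<tau> q \<le> 0"
    and le: "\<And>\<tau> x. \<tau> \<in> {s..t} \<Longrightarrow> x \<in> {p..q} \<Longrightarrow> z \<tau> x > 0 \<Longrightarrow> R \<tau> x \<le> V \<tau> x + K * (\<bar>z \<tau> x\<bar> + \<bar>zx \<tau> x\<bar>)"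
    and x: "x \<in> {p..q}"
  shows "z t x \<le> 0"
proof -
  note D = evolD[OF ev]
  define E where "E \<tau> = integral {p..q} (\<lambda>x. (max 0 (z \<tau> x)) ^ 4)" for \<tau>
  define E' where "E' \<tau> = integral {p..q} (\<lambda>x. 4 * (max 0 (z \<tau> x)) ^ 3 * R \<tau> x)" for \<tau>
  note ed = energy_derivative[OF ev _ less_imp_le[OF pq] max0_power4_has_derivative continuous_on_12_max0]
  have dE: "(E has_real_derivative E' \<tau>) (at \<tau>)" if "\<tau> \<in> I" for \<tau>
    using ed(1)[OF that] by (simp add: E_def[abs_def] E'_def)
  define k where "k = K\<^sup>2 / 2 + 4 * K + 1"
  have k: "k > 0" using K by (simp add: k_def add_nonneg_pos)
  have cE: "continuous_on {p..q} (\<lambda>x. (max 0 (z \<tau> x)) ^ 4)" if "\<tau> \<in> I" for \<tau>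
    by (intro continuous_intros D(9)[OF that])
  have E0: "E \<tau> \<ge> 0" if "\<tau> \<in> I" for \<tau>
    unfolding E_def by (intro Henstock_Kurzweil_Integration.integral_nonneg integrable_continuous_real cE that) simp
  have le': "E' \<tau> \<le> k * E \<tau> + 0" if \<tau>: "s < \<tau>" "\<tau> < t" for \<tau>
  proof -
    have \<tau>I: "\<tau> \<in> I" and \<tau>st: "\<tau> \<in> {s..t}" using \<tau> st by auto
    have ai: "R \<tau> absolutely_integrable_on {p..q}" "V \<tau> absolutely_integrable_on {p..q}"
      using D(5,6)[OF \<tau>I] L2_loc_abs_integrable by auto
    have "integral {p..q} (\<lambda>x. 4 * max 0 (z \<tau> x) ^ 3 * R \<tau> x * 1)
      \<le> integral {p..q} (\<lambda>x. max 0 (z \<tau> x) ^ 4 * ((K\<^sup>2 / 2 + 4 * K - 0) * 1 + 0\<^sup>2 * (q - p) * (x - p)) + 4 * 0 * max 0 (z \<tau> x) ^ 3 * 1)"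
    proof (rule weighted_energy(2)[where s = "z \<tau>" and sx = "zx \<tau>" and V = "V \<tau>" and F' = "\<lambda>_. 0"])
      show "R \<tau> x \<le> V \<tau> x + K * (\<bar>z \<tau> x\<bar> + \<bar>zx \<tau> x\<bar>) + 0" if "x \<in> {p..q}" "z \<tau> x > 0" for x
        using le[OF \<tau>st that] by simp
      show "max 0 (z \<tau> q) ^ 3 * 1 * zx \<tau> q \<le> max 0 (z \<tau> p) ^ 3 * 1 * zx \<tau> p"
        using bd[OF \<tau>st] by simp
    qed (use pq ai in \<open>auto intro!: D \<tau>I derivative_eq_intros\<close>)
    also have "\<dots> = (K\<^sup>2 / 2 + 4 * K) * E \<tau>" unfolding E_def by (simp add: mult.commute)
    also have "\<dots> \<le> k * E \<tau>" using E0[OF \<tau>I] by (intro mult_right_mono) (auto simp: k_def)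
    finally show ?thesis by (simp add: E'_def)
  qed
  have "continuous_on {s..t} E"
    using dE st(2) by (meson DERIV_isCont continuous_at_imp_continuous_on subsetD)
  from Gronwall_within[OF st(1) this dE le'] st(2) k
  have "E t \<le> exp (k * (t - s)) * E s" by (auto simp: subset_iff)
  moreover have "E s = 0"
  proof -
    have "E s = integral {p..q} (\<lambda>x. 0)" unfolding E_def by (rule integral_cong) (use ini in auto)
    then show ?thesis by simp
  qed
  moreover have tI: "t \<in> I" using st by auto
  ultimately have "E t = 0" using E0[OF tI] by simp
  then have "integral (cbox p q) (\<lambda>x. (max 0 (z t x)) ^ 4) = 0" by (simp add: E_def)
  moreover have "integral (cbox p q) (\<lambda>x. (max 0 (z t x)) ^ 4) = 0 \<longleftrightarrow> (\<forall>x\<in>cbox p q. (max 0 (z t x)) ^ 4 = 0)"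
    by (rule integral_cbox_eq_0_iff) (use cE[OF tI] pq in auto)
  ultimately have "(max 0 (z t x)) ^ 4 = 0" using x by (simp only: cbox_interval simp_thms)
  then have "max 0 (z t x) = 0" by simp
  then show ?thesis by linarith
qed

text \<open>The barrier is \<open>\<epsilon> (exp (k (x - p + \<kappa> (t - t\<^sub>0))) - 1)\<close>; its zero moves from \<open>q\<close> to \<open>p\<close>
  during the time interval.\<close>

lemma barrier:
  assumes ls: "lsol K 0 I w wx v r" and K: "K \<ge> 0" and d: "d > 0" and I: "{t0 - d..t0} \<subseteq> I" and pq: "p < q"
    and nn: "\<And>t x. t \<in> {t0 - d..t0} \<Longrightarrow> x \<in> {p..q} \<Longrightarrow> w t x \<ge> 0"
    and \<eta>: "\<eta> > 0" "\<And>t. t \<in> {t0 - d..t0} \<Longrightarrow> w t q \<ge> \<eta>"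
  shows "\<exists>k>0. \<exists>\<epsilon>>0. \<forall>x\<in>{p..q}. w t0 x \<ge> \<epsilon> * (exp (k * (x - p)) - 1)"
proof -
  define \<kappa> where "\<kappa> = (q - p) / d"
  have \<kappa>: "\<kappa> > 0" using pq d by (simp add: \<kappa>_def)
  \<comment> \<open>Large enough that \<open>k * k\<close> dominates \<open>k * \<kappa>\<close>,
    which comes from the motion of the barrier, together with \<open>K + K * k\<close> from the
    lower-order terms.\<close>
  define k where "k = \<kappa> + 2 * K + 1"
  have k: "k > 0" using \<kappa> K by (simp add: k_def)
  \<comment> \<open>Keeps the barrier below \<open>\<eta>\<close> at the right end until the time
    \<open>t0\<close>.\<close>
  define \<epsilon> where "\<epsilon> = \<eta> / exp (k * (q - p))"
  have \<epsilon>: "\<epsilon> > 0" using \<eta>(1) by (simp add: \<epsilon>_def)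
  define X where "X t x = exp (k * (x - p + \<kappa> * (t - t0)))" for t x
  have Xc: "continuous_on UNIV (\<lambda>(t, x). X t x)"
    unfolding X_def case_prod_beta by (intro continuous_intros)
  have dX: "((\<lambda>x. X t x) has_real_derivative k * X t x) (at x)" "((\<lambda>t. X t x) has_real_derivative k * \<kappa> * X t x) (at t)" for t x
    unfolding X_def by (auto intro!: derivative_eq_intros)
  have open_I: "open I" using evolD(1)[OF lsolD(1)[OF ls]] .
  have ev\<phi>: "evol I (\<lambda>t x. \<epsilon> * (X t x - 1)) (\<lambda>t x. \<epsilon> * (k * X t x)) (\<lambda>t x. \<epsilon> * (k * (k * X t x))) (\<lambda>t x. \<epsilon> * (k * \<kappa> * X t x))"
  proof (rule evol_smooth)
    show "continuous_on UNIV (\<lambda>(t, x). \<epsilon> * (X t x - 1))" "continuous_on UNIV (\<lambda>(t, x). \<epsilon> * (k * X t x))"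
      "continuous_on UNIV (\<lambda>(t, x). \<epsilon> * (k * (k * X t x)))" "continuous_on UNIV (\<lambda>(t, x). \<epsilon> * (k * \<kappa> * X t x))"
      using Xc unfolding case_prod_beta by (auto intro!: continuous_intros)
  qed (auto intro!: derivative_eq_intros dX open_I)
  note ev = evol_diff[OF ev\<phi> lsolD(1)[OF ls]]
  have "w t0 x \<ge> \<epsilon> * (X t0 x - 1)" if x: "x \<in> {p..q}" for x
  proof -
    have "\<epsilon> * (X t0 x - 1) - w t0 x \<le> 0"
    proof (rule comparison[OF ev _ I pq K])
      show "\<epsilon> * (X (t0 - d) y - 1) - w (t0 - d) y \<le> 0" if y: "y \<in> {p..q}" for y
      proof -
        have "y - p + \<kappa> * (t0 - d - t0) \<le> 0" using y d by (simp add: \<kappa>_def)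
        then have "X (t0 - d) y \<le> 1" using k by (simp add: X_def mult_nonneg_nonpos)
        then have "\<epsilon> * (X (t0 - d) y - 1) \<le> 0" using \<epsilon> by (simp add: mult_nonneg_nonpos)
        then show ?thesis using nn[of "t0 - d" y] y d by simp
      qed
      fix t assume t: "t \<in> {t0 - d..t0}"
      have "\<kappa> * (t - t0) \<le> 0" using t \<kappa> by (simp add: mult_nonneg_nonpos)
      then have "X t p \<le> 1" "X t q \<le> exp (k * (q - p))" using k by (auto simp: X_def mult_nonneg_nonpos)
      then have "\<epsilon> * (X t p - 1) \<le> 0" "\<epsilon> * (X t q - 1) \<le> \<epsilon> * exp (k * (q - p))"
        using \<epsilon> by (auto intro: mult_nonneg_nonpos)
      moreover have "\<epsilon> * exp (k * (q - p)) = \<eta>" by (simp add: \<epsilon>_def)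
      ultimately show "\<epsilon> * (X t p - 1) - w t p \<le> 0 \<and> \<epsilon> * (X t q - 1) - w t q \<le> 0"
        using nn[OF t, of p] \<eta>(2)[OF t] pq by auto
      fix y assume y: "y \<in> {p..q}" and pos: "\<epsilon> * (X t y - 1) - w t y > 0"
      have w0: "w t y \<ge> 0" using nn[OF t y] .
      then have X1: "X t y \<ge> 1" using pos \<epsilon> by (smt (verit) mult_nonneg_nonpos)
      have tI: "t \<in> I" using t I by auto
      have "- (r t y - v t y) \<le> K * (\<bar>w t y\<bar> + \<bar>wx t y\<bar>)" using lsolD(2)[OF ls tI, of y] by simp
      also have "\<dots> \<le> K * (\<epsilon> * X t y + (\<epsilon> * (k * X t y) + \<bar>\<epsilon> * (k * X t y) - wx t y\<bar>))"
      proof (intro mult_left_mono add_mono K)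
        show "\<bar>w t y\<bar> \<le> \<epsilon> * X t y" using w0 pos \<epsilon> by (simp add: algebra_simps)
        have "0 \<le> \<epsilon> * (k * X t y)" using \<epsilon> k by (simp add: X_def)
        then show "\<bar>wx t y\<bar> \<le> \<epsilon> * (k * X t y) + \<bar>\<epsilon> * (k * X t y) - wx t y\<bar>" by linarith
      qed
      also have "\<dots> = \<epsilon> * X t y * (K + K * k) + K * \<bar>\<epsilon> * (k * X t y) - wx t y\<bar>" by (simp add: algebra_simps)
      finally have 1: "- (r t y - v t y) \<le> \<epsilon> * X t y * (K + K * k) + K * \<bar>\<epsilon> * (k * X t y) - wx t y\<bar>" .
      have "K \<le> K * k" using K \<kappa> by (simp add: k_def mult_le_cancel_left1)
      then have "K + K * k + k * \<kappa> \<le> k * (\<kappa> + 2 * K)" by (simp add: algebra_simps)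
      also have "\<dots> \<le> k * k" using k by (intro mult_left_mono) (auto simp: k_def)
      finally have "\<epsilon> * X t y * (K + K * k + k * \<kappa>) \<le> \<epsilon> * X t y * (k * k)"
        using \<epsilon> by (intro mult_left_mono) (auto simp: X_def)
      moreover have "0 \<le> K * \<bar>\<epsilon> * (X t y - 1) - w t y\<bar>" using K by simp
      ultimately show "\<epsilon> * (k * \<kappa> * X t y) - r t y \<le> \<epsilon> * (k * (k * X t y)) - v t y
          + K * (\<bar>\<epsilon> * (X t y - 1) - w t y\<bar> + \<bar>\<epsilon> * (k * X t y) - wx t y\<bar>)"
        using 1 by (simp add: algebra_simps)
    qed (use d x in auto)
    then show ?thesis by simp
  qed
  then have "\<forall>x\<in>{p..q}. w t0 x \<ge> \<epsilon> * (exp (k * (x - p)) - 1)" by (simp add: X_def)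
  then show ?thesis using k \<epsilon> by blast
qed

text \<open>The barrier is positive to the right of \<open>p\<close> and has slope
  \<open>\<epsilon> * k\<close> at \<open>p\<close>; the first fact gives the strong maximum
  principle, the second the Hopf lemma. The minimum of \<open>w\<close> at \<open>q\<close> over the
  compact time interval serves as \<open>\<eta>\<close>.\<close>

lemma strong_positivity_right:
  assumes ls: "lsol K 0 I w wx v r" and K: "K \<ge> 0" and d: "d > 0" and I: "{t0 - d..t0} \<subseteq> I"
    and nn: "\<And>t x. t \<in> {t0 - d..t0} \<Longrightarrow> x \<in> {p..q} \<Longrightarrow> w t x \<ge> 0"
    and \<eta>: "\<And>t. t \<in> {t0 - d..t0} \<Longrightarrow> w t q > 0" and pq: "p < q"
  shows "x \<in> {p<..q} \<Longrightarrow> w t0 x > 0" and "w t0 p = 0 \<Longrightarrow> wx t0 p > 0"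
proof -
  note D = evolD[OF lsolD(1)[OF ls]]
  have "continuous_on {t0 - d..t0} (\<lambda>t. (\<lambda>(t, x). w t x) (t, q))"
    by (rule continuous_on_compose2[OF D(2)]) (use I in \<open>auto intro!: continuous_intros\<close>)
  then have "continuous_on {t0 - d..t0} (\<lambda>t. w t q)" by simp
  from continuous_attains_inf[OF _ _ this] d obtain t1 where t1: "t1 \<in> {t0 - d..t0}" "\<And>t. t \<in> {t0 - d..t0} \<Longrightarrow> w t1 q \<le> w t q"
    by auto
  from barrier[OF ls K d I pq nn \<eta>[OF t1(1)] t1(2)] obtain k \<epsilon> where k: "k > 0" "\<epsilon> > 0"
    "\<And>x. x \<in> {p..q} \<Longrightarrow> w t0 x \<ge> \<epsilon> * (exp (k * (x - p)) - 1)" by blast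
  show "w t0 x > 0" if x: "x \<in> {p<..q}"
  proof -
    have "0 < \<epsilon> * (exp (k * (x - p)) - 1)" using k x by simp
    also have "\<dots> \<le> w t0 x" using k(3)[of x] x by simp
    finally show ?thesis .
  qed
  show "wx t0 p > 0" if w0: "w t0 p = 0"
  proof (rule ccontr)
    assume n: "\<not> ?thesis"
    have t0: "t0 \<in> I" using I d by auto
    have "((\<lambda>x. w t0 x - \<epsilon> * (exp (k * (x - p)) - 1)) has_real_derivative wx t0 p - \<epsilon> * k) (at p)"
      by (auto intro!: derivative_eq_intros D(4)[OF t0])
    moreover have "wx t0 p - \<epsilon> * k < 0" using n k mult_pos_pos[OF k(2,1)] by linarith
    ultimately obtain \<delta> where \<delta>: "\<delta> > 0" "\<And>h. h > 0 \<Longrightarrow> h < \<delta> \<Longrightarrow>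
        w t0 (p + h) - \<epsilon> * (exp (k * (p + h - p)) - 1) < w t0 p - \<epsilon> * (exp (k * (p - p)) - 1)"
      using DERIV_neg_dec_right by blast
    define h where "h = min (\<delta> / 2) (q - p)"
    have h: "h > 0" "h < \<delta>" "h \<le> q - p" using \<delta>(1) pq by (auto simp: h_def)
    show False using \<delta>(2)[OF h(1,2)] k(3)[of "p + h"] h w0 by simp
  qed
qed

lemma strong_positivity_left:
  assumes ls: "lsol K 0 I w wx v r" and K: "K \<ge> 0" and d: "d > 0" and I: "{t0 - d..t0} \<subseteq> I"
    and nn: "\<And>t x. t \<in> {t0 - d..t0} \<Longrightarrow> x \<in> {p..q} \<Longrightarrow> w t x \<ge> 0"
    and \<eta>: "\<And>t. t \<in> {t0 - d..t0} \<Longrightarrow> w t p > 0" and pq: "p < q"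
  shows "x \<in> {p..<q} \<Longrightarrow> w t0 x > 0" and "w t0 q = 0 \<Longrightarrow> wx t0 q < 0"
proof -
  have ls': "lsol K 0 I (\<lambda>t x. w t (- x)) (\<lambda>t x. - wx t (- x)) (\<lambda>t x. v t (- x)) (\<lambda>t x. r t (- x))"
    using lsol_affine[OF ls, of "-1" 0 0] by simp
  have nn': "w t (- x) \<ge> 0" if "t \<in> {t0 - d..t0}" "x \<in> {- q..- p}" for t x using nn[OF that(1), of "- x"] that(2) by auto
  have \<eta>': "w t (- (- p)) > 0" if "t \<in> {t0 - d..t0}" for t using \<eta>[OF that] by simp
  have pq': "- q < - p" using pq by simp
  note sp = strong_positivity_right[OF ls' K d I nn' \<eta>' pq']
  show "w t0 x > 0" if "x \<in> {p..<q}" using sp(1)[of "- x"] that by auto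
  show "wx t0 q < 0" if "w t0 q = 0" using sp(2) that by auto
qed

section \<open>The zero number\<close>

text \<open>With \<open>b = 0\<close> the nested integral grows at most exponentially, so if it is
  positive at time \<open>t\<close> it was positive at time \<open>s\<close>. The sign conditions
  say that \<open>w\<close> at the ends never has the first sign (left) or the last sign (right) of
  the chain, which removes the boundary terms.\<close>

lemma achain_decreasing:
  assumes ls: "lsol K 0 I w wx v r" and K: "K \<ge> 0" and st: "s \<le> t" "{s..t} \<subseteq> I" and pq: "p < q"
    and \<sigma>: "\<sigma> = 1 \<or> \<sigma> = -1" and m: "m \<ge> 1"
    and left: "\<And>\<tau>. \<tau> \<in> {s..t} \<Longrightarrow> \<sigma> * w \<tau> p \<le> 0"
    and right: "\<And>\<tau>. \<tau> \<in> {s..t} \<Longrightarrow> \<sigma> * (-1) ^ (m - 1) * w \<tau> q \<le> 0"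
    and ch: "achain (w t) \<sigma> p m q"
  shows "achain (w s) \<sigma> p m q"
proof -
  note D = evolD[OF lsolD(1)[OF ls]]
  define E where "E \<tau> = nest (w \<tau>) \<sigma> p m q" for \<tau>
  define k where "k = (K\<^sup>2 / 2 + 4 * K) * real m + 1"
  have k: "k > 0" using K by (simp add: k_def add_nonneg_pos)
  have E0: "E \<tau> \<ge> 0" if "\<tau> \<in> I" for \<tau> unfolding E_def by (rule nest_nonneg[OF D(9)[OF that]])
  have "\<exists>E'. (E has_real_derivative E') (at \<tau>) \<and> E' \<le> k * E \<tau> + 0" if \<tau>: "\<tau> \<in> {s..t}" for \<tau>
  proof -
    have \<tau>I: "\<tau> \<in> I" using \<tau> st by auto
    obtain G where G: "utd (\<lambda>t. nest (w t) \<sigma> p m) G \<tau> {p..q}"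
      "\<forall>y\<in>{p..q}. (m = 0 \<or> \<sigma> * (-1) ^ (m - 1) * w \<tau> y \<le> 0) \<longrightarrow> (\<forall>b\<ge>0.
       G y \<le> (K\<^sup>2 / 2 + 4 * K - b) * real m * nest (w \<tau>) \<sigma> p m y + b\<^sup>2 * (q - p) * nmom (w \<tau>) \<sigma> p m y)"
      using nest_time_derivative[OF ls \<tau>I pq K \<sigma> left[OF \<tau>], of m] by blast
    have "(E has_real_derivative G q) (at \<tau>)"
      unfolding E_def[abs_def] by (rule utd_imp_derivative[OF G(1)]) (use pq in simp)
    moreover have "G q \<le> (K\<^sup>2 / 2 + 4 * K) * real m * E \<tau>"
      using G(2)[rule_format, of q 0] right[OF \<tau>] pq by (simp add: E_def)
    ultimately show ?thesis using E0[OF \<tau>I] by (intro exI[of _ "G q"]) (auto simp: k_def algebra_simps)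
  qed
  then obtain E' where E': "\<And>\<tau>. \<tau> \<in> {s..t} \<Longrightarrow> (E has_real_derivative E' \<tau>) (at \<tau>)" "\<And>\<tau>. \<tau> \<in> {s..t} \<Longrightarrow> E' \<tau> \<le> k * E \<tau> + 0"
    by metis
  have "continuous_on {s..t} E"
    using E'(1) by (meson DERIV_isCont continuous_at_imp_continuous_on)
  from Gronwall_within[OF st(1) this E'] k have le: "E t \<le> exp (k * (t - s)) * E s" by auto
  have sI: "s \<in> I" "t \<in> I" using st by auto
  have "E t > 0" using nest_pos_iff[OF D(9)[OF sI(2)] less_imp_le[OF pq]] ch by (simp add: E_def)
  then have "E s > 0" using le E0[OF sI(1)] by (cases "E s = 0") auto
  then show ?thesis using nest_pos_iff[OF D(9)[OF sI(1)] less_imp_le[OF pq]] by (simp add: E_def)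
qed

lemma nest_le_power:
  assumes w: "continuous_on UNIV w" and R: "\<And>x. \<bar>w x\<bar> \<le> R" and \<sigma>: "\<sigma> = 1 \<or> \<sigma> = -1"
  shows "y \<in> {p..q} \<Longrightarrow> nest w \<sigma> p m y \<le> (R ^ 4 * (q - p)) ^ m"
proof (induction m arbitrary: y)
  case (Suc m)
  have R0: "R \<ge> 0" using R[of 0] by linarith
  have \<sigma>m: "\<bar>\<sigma> * (-1) ^ m\<bar> = 1" using \<sigma> by (auto simp: abs_mult power_abs)
  have "nest w \<sigma> p (Suc m) y \<le> integral {p..y} (\<lambda>x. R ^ 4 * (R ^ 4 * (q - p)) ^ m)"
    unfolding nest.simps
  proof (rule Henstock_Kurzweil_Integration.integral_le)
    show "(\<lambda>x. (max 0 (\<sigma> * (-1) ^ m * w x)) ^ 4 * nest w \<sigma> p m x) integrable_on {p..y}"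
      by (intro integrable_continuous_real continuous_intros nest_continuous w continuous_on_subset[OF w]) auto
    fix x assume x: "x \<in> {p..y}"
    have "max 0 (\<sigma> * (-1) ^ m * w x) \<le> \<bar>\<sigma> * (-1) ^ m * w x\<bar>" by linarith
    also have "\<dots> = \<bar>w x\<bar>" using \<sigma>m by (simp add: abs_mult)
    also have "\<dots> \<le> R" by (rule R)
    finally show "(max 0 (\<sigma> * (-1) ^ m * w x)) ^ 4 * nest w \<sigma> p m x \<le> R ^ 4 * (R ^ 4 * (q - p)) ^ m"
      using Suc.IH[of x] x Suc.prems R0 nest_nonneg[OF w] by (intro mult_mono power_mono) auto
  qed auto
  also have "\<dots> = (R ^ 4 * (R ^ 4 * (q - p)) ^ m) * (y - p)" using Suc.prems by simp
  also have "\<dots> \<le> (R ^ 4 * (R ^ 4 * (q - p)) ^ m) * (q - p)"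
    using Suc.prems R0 by (intro mult_left_mono mult_nonneg_nonneg zero_le_power) auto
  finally show ?case by (simp add: algebra_simps)
qed simp

text \<open>Since the moment is at most \<open>l * E\<close>, the energy \<open>E\<close> of chains
  of length \<open>m\<close> grows with a rate of at most
  \<open>(k - b) * real m + b\<^sup>2 * l\<^sup>2\<close>. For large \<open>m\<close> the best
  \<open>b\<close> brings this to -1 or below; then \<open>E\<close> decays exponentially on the
  whole time axis, and a bounded \<open>E\<close> that has decayed for ever is 0. The bound
  \<open>R\<close> enters only at this last point, so \<open>m\<close> does not depend on
  it.\<close>

lemma achain_bounded_length:
  assumes pq: "p < q" and K: "K \<ge> 0"
  shows "\<exists>m\<ge>1. \<forall>w wx v r R \<sigma> t. lsol K 0 UNIV w wx v r \<longrightarrow> (\<forall>t x. \<bar>w t x\<bar> \<le> R) \<longrightarrow> (\<sigma> = 1 \<or> \<sigma> = -1) \<longrightarrow>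
    (\<forall>t. w t p = 0 \<and> w t q = 0) \<longrightarrow> \<not> achain (w t) \<sigma> p m q"
proof -
  define l where "l = q - p"
  have l: "l > 0" using pq by (simp add: l_def)
  define k where "k = K\<^sup>2 / 2 + 4 * K"
  have k: "k \<ge> 0" using K by (simp add: k_def)
  obtain m :: nat where m: "real m \<ge> 4 * l\<^sup>2 * (k + 1) + 1" using real_arch_simple by blast
  have "0 \<le> 4 * l\<^sup>2 * (k + 1)" using k by simp
  then have "real m > 0" using m by linarith
  then have m1: "m \<ge> 1" by simp
  \<comment> \<open>The minimiser of \<open>b\<^sup>2 * l\<^sup>2 - b * real m\<close>; it turns the
    rate into \<open>real m * (k - real m / (4 * l\<^sup>2))\<close>.\<close>
  define b where "b = real m / (2 * l\<^sup>2)"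
  have b: "b \<ge> 0" by (simp add: b_def)
  have key: "(k - b) * real m + b\<^sup>2 * l\<^sup>2 \<le> -1"
  proof -
    have "(k - b) * real m + b\<^sup>2 * l\<^sup>2 = real m * (k - real m / (4 * l\<^sup>2))"
      using l by (simp add: b_def field_simps power2_eq_square)
    moreover have "k - real m / (4 * l\<^sup>2) \<le> -1"
      using m l by (simp add: field_simps)
    moreover have "1 * 1 \<le> real m * (- (k - real m / (4 * l\<^sup>2)))"
      using calculation(2) m1 by (intro mult_mono) auto
    then have "real m * (k - real m / (4 * l\<^sup>2)) \<le> -1" unfolding mult_minus_right by linarith
    ultimately show ?thesis by (simp only:)
  qed
  have "\<not> achain (w t) \<sigma> p m q" if ls: "lsol K 0 UNIV w wx v r" and R: "\<And>t x. \<bar>w t x\<bar> \<le> R"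
    and \<sigma>: "\<sigma> = 1 \<or> \<sigma> = -1" and bd: "\<And>t. w t p = 0 \<and> w t q = 0" for w wx v r R \<sigma> t
  proof
    assume ch: "achain (w t) \<sigma> p m q"
    note D = evolD[OF lsolD(1)[OF ls]]
    define E where "E \<tau> = nest (w \<tau>) \<sigma> p m q" for \<tau>
    have E0: "E \<tau> \<ge> 0" for \<tau> unfolding E_def by (rule nest_nonneg[OF D(9)]) simp
    have "\<exists>E'. (E has_real_derivative E') (at \<tau>) \<and> E' \<le> - E \<tau>" for \<tau>
    proof -
      obtain G where G: "utd (\<lambda>t. nest (w t) \<sigma> p m) G \<tau> {p..q}"
        "\<forall>y\<in>{p..q}. (m = 0 \<or> \<sigma> * (-1) ^ (m - 1) * w \<tau> y \<le> 0) \<longrightarrow> (\<forall>b\<ge>0.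
         G y \<le> (K\<^sup>2 / 2 + 4 * K - b) * real m * nest (w \<tau>) \<sigma> p m y + b\<^sup>2 * (q - p) * nmom (w \<tau>) \<sigma> p m y)"
        using nest_time_derivative[OF ls UNIV_I pq K \<sigma>, of \<tau> m] bd[of \<tau>] by auto
      have "(E has_real_derivative G q) (at \<tau>)"
        unfolding E_def[abs_def] by (rule utd_imp_derivative[OF G(1)]) (use pq in simp)
      moreover have "G q \<le> (k - b) * real m * E \<tau> + b\<^sup>2 * l * nmom (w \<tau>) \<sigma> p m q"
        using G(2)[rule_format, of q b] bd[of \<tau>] b pq by (simp add: E_def k_def l_def)
      moreover have "b\<^sup>2 * l * nmom (w \<tau>) \<sigma> p m q \<le> b\<^sup>2 * l * (l * E \<tau>)"
        using nmom_le[where y = q and p = p and q = q and \<sigma> = \<sigma> and m = m and w = "w \<tau>", OF D(9)[OF UNIV_I]] pq l by (intro mult_left_mono) (auto simp: E_def l_def)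
      moreover have "((k - b) * real m + b\<^sup>2 * l\<^sup>2) * E \<tau> \<le> (-1) * E \<tau>"
        using key E0 by (intro mult_right_mono)
      ultimately show ?thesis by (intro exI[of _ "G q"]) (auto simp: algebra_simps power2_eq_square)
    qed
    then obtain E' where E': "\<And>\<tau>. (E has_real_derivative E' \<tau>) (at \<tau>)" "\<And>\<tau>. E' \<tau> \<le> - E \<tau>" by metis
    have Ec: "continuous_on A E" for A
      using E'(1) by (meson DERIV_isCont continuous_at_imp_continuous_on)
    define C where "C = (R ^ 4 * (q - p)) ^ m"
    have EC: "E \<tau> \<le> C" for \<tau> unfolding E_def C_def using pq by (intro nest_le_power D(9) R \<sigma>) auto
    have Et: "E t > 0" using nest_pos_iff[OF D(9)[OF UNIV_I] less_imp_le[OF pq]] ch by (simp add: E_def)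
    have le: "E t \<le> exp (- n) * C" if "n \<ge> 0" for n
    proof -
      have "E t + 0 / (-1) \<le> exp ((-1) * (t - (t - n))) * (E (t - n) + 0 / (-1))"
        by (rule Gronwall_within[OF _ Ec E'(1)]) (use that E'(2) in auto)
      also have "\<dots> \<le> exp (- n) * C" using EC by simp
      finally show ?thesis by simp
    qed
    have C0: "C > 0" using Et EC[of t] by linarith
    \<comment> \<open>Going back by the time \<open>ln (2 * C / E t)\<close> bounds
      \<open>E t\<close> by its own half.\<close>
    have "E t \<le> exp (- ln (2 * C / E t)) * C" if "2 * C / E t \<ge> 1" using le[of "ln (2 * C / E t)"] that by simp
    moreover have "2 * C / E t \<ge> 1" using EC[of t] Et C0 by (simp add: le_divide_eq)
    moreover have "exp (- ln (2 * C / E t)) * C = E t / 2" using Et C0 by (simp add: exp_minus field_simps)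
    ultimately show False using Et by simp
  qed
  then show ?thesis using m1 by (intro exI[of _ m]) blast
qed

section \<open>The energy of periodic solutions\<close>

lemma periodic_derivative:
  assumes "\<And>x. u (x + P) = u x" "\<And>x. (u has_real_derivative ux x) (at x)"
  shows "ux (x + P) = (ux x :: real)"
proof -
  have "((\<lambda>y. u (y + P)) has_real_derivative ux (x + P)) (at x)"
    using assms(2)[of "x + P"] by (simp add: DERIV_shift)
  moreover have "((\<lambda>y. u (y + P)) has_real_derivative ux x) (at x)" using assms by simp
  ultimately show ?thesis by (rule DERIV_unique)
qed

lemma young_3_1: "4 * m ^ 3 * e \<le> 3 * m ^ 4 + e ^ 4" if "m \<ge> 0" "e \<ge> 0" for m e :: real
proof -
  have "0 \<le> (m - e)\<^sup>2 * (3 * m\<^sup>2 + 2 * m * e + e\<^sup>2)" using that by simp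
  also have "\<dots> = 3 * m ^ 4 - 4 * m ^ 3 * e + e ^ 4"
    by (simp add: power2_eq_square power3_eq_cube power4_eq_xxxx algebra_simps)
  finally show ?thesis by simp
qed

text \<open>Positive and negative parts are treated separately with the weight 1; periodicity
  cancels the boundary terms. The 3 in \<open>k\<close> is left over from Young's inequality for the
  error term, and the factor 2 before \<open>P * e ^ 4\<close> counts the two parts. The equation is
  used only inside \<open>{s<..<t}\<close>, so \<open>s\<close> may be the initial time of a
  solution.\<close>

lemma periodic_energy:
  assumes ls: "lsol K e I w wx v r" and K: "K \<ge> 0" and e: "e \<ge> 0" and P: "P > 0"
    and per: "\<And>t x. t \<in> I \<Longrightarrow> w t (x + P) = w t x"
    and st: "s \<le> t" "{s<..<t} \<subseteq> I" and Ec: "continuous_on {s..t} (\<lambda>\<tau>. integral {0..P} (\<lambda>x. w \<tau> x ^ 4))"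
  defines "k \<equiv> K\<^sup>2 / 2 + 4 * K + 3"
  shows "integral {0..P} (\<lambda>x. w t x ^ 4) \<le> exp (k * (t - s)) * (integral {0..P} (\<lambda>x. w s x ^ 4) + 2 * P * e ^ 4 / k)"
proof -
  have ev: "evol I w wx v r" by (rule lsolD[OF ls])
  note D = evolD[OF ev]
  define E where "E \<tau> = integral {0..P} (\<lambda>x. w \<tau> x ^ 4)" for \<tau>
  define E' where "E' \<tau> = integral {0..P} (\<lambda>x. 4 * w \<tau> x ^ 3 * r \<tau> x)" for \<tau>
  have k: "k > 0" using K by (simp add: k_def add_nonneg_pos)
  have half: "integral {0..P} (\<lambda>x. 4 * max 0 (c * w \<tau> x) ^ 3 * (c * r \<tau> x))
       \<le> k * integral {0..P} (\<lambda>x. max 0 (c * w \<tau> x) ^ 4) + P * e ^ 4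
     \<and> (\<lambda>x. 4 * max 0 (c * w \<tau> x) ^ 3 * (c * r \<tau> x)) integrable_on {0..P}"
    if \<tau>: "\<tau> \<in> I" and c: "c = 1 \<or> c = -1" for \<tau> c
  proof -
    have "w \<tau> P = w \<tau> 0" using per[OF \<tau>, of 0] by simp
    moreover have "wx \<tau> P = wx \<tau> 0"
      using periodic_derivative[of "w \<tau>" P "wx \<tau>" 0] per[OF \<tau>] D(4)[OF \<tau>] by simp
    ultimately have bd: "max 0 (c * w \<tau> P) ^ 3 * 1 * (c * wx \<tau> P) \<le> max 0 (c * w \<tau> 0) ^ 3 * 1 * (c * wx \<tau> 0)" by simp
    have rv: "c * r \<tau> x \<le> c * v \<tau> x + K * (\<bar>c * w \<tau> x\<bar> + \<bar>c * wx \<tau> x\<bar>) + e" for x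
      using lsolD(2)[OF ls \<tau>, of x] c by auto
    have ai: "(\<lambda>x. c * r \<tau> x) absolutely_integrable_on {0..P}" "(\<lambda>x. c * v \<tau> x) absolutely_integrable_on {0..P}"
      by (intro L2_loc_abs_integrable L2_loc_cmult D \<tau>)+
    have dw: "((\<lambda>x. c * w \<tau> x) has_real_derivative c * wx \<tau> x) (at x within {0..P})" for x
      by (intro DERIV_cmult D \<tau>)
    have cw: "continuous_on {0..P} (\<lambda>x. c * wx \<tau> x)" by (intro continuous_intros D \<tau>)
    have iv: "integral {a..b} (\<lambda>x. c * v \<tau> x) = c * wx \<tau> b - c * wx \<tau> a" if "a \<le> b" for a b
      using D(7)[OF \<tau> that] by (simp add: right_diff_distrib)
    have cm: "continuous_on {0..P} (\<lambda>x. max 0 (c * w \<tau> x))" by (intro continuous_intros D \<tau>)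
    note we = weighted_energy[of 0 P "\<lambda>x. c * w \<tau> x" "\<lambda>x. c * wx \<tau> x" "\<lambda>x. c * v \<tau> x" "\<lambda>x. c * r \<tau> x" K e "\<lambda>_. 1" "\<lambda>_. 0" "\<lambda>x. x" P 0,
        OF less_imp_le[OF P] dw cw ai(2) iv ai(1) rv _ _ _ _ _ _ _ bd _ P]
    have we1: "(\<lambda>x. 4 * max 0 (c * w \<tau> x) ^ 3 * (c * r \<tau> x) * 1) absolutely_integrable_on {0..P}"
      by (rule we(1)) auto
    have we2: "integral {0..P} (\<lambda>x. 4 * max 0 (c * w \<tau> x) ^ 3 * (c * r \<tau> x) * 1)
      \<le> integral {0..P} (\<lambda>x. max 0 (c * w \<tau> x) ^ 4 * ((K\<^sup>2 / 2 + 4 * K - 0) * 1 + 0\<^sup>2 * P * x) + 4 * e * max 0 (c * w \<tau> x) ^ 3 * 1)"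
      by (rule we(2)) auto
    also have "\<dots> \<le> integral {0..P} (\<lambda>x. k * max 0 (c * w \<tau> x) ^ 4 + e ^ 4)"
    proof (intro Henstock_Kurzweil_Integration.integral_le integrable_continuous_real continuous_intros cm)
      fix x
      show "max 0 (c * w \<tau> x) ^ 4 * ((K\<^sup>2 / 2 + 4 * K - 0) * 1 + 0\<^sup>2 * P * x) + 4 * e * max 0 (c * w \<tau> x) ^ 3 * 1
        \<le> k * max 0 (c * w \<tau> x) ^ 4 + e ^ 4"
        using young_3_1[OF _ e, of "max 0 (c * w \<tau> x)"] by (simp add: k_def algebra_simps)
    qed (auto intro: D(9)[OF \<tau>])
    also have "\<dots> = k * integral {0..P} (\<lambda>x. max 0 (c * w \<tau> x) ^ 4) + P * e ^ 4"
    proof (rule integral_unique)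
      have c: "((\<lambda>x. e ^ 4) has_integral (P * e ^ 4)) {0..P}" using has_integral_const_real[of "e ^ 4" 0 P] P by simp
      show "((\<lambda>x. k * max 0 (c * w \<tau> x) ^ 4 + e ^ 4) has_integral (k * integral {0..P} (\<lambda>x. max 0 (c * w \<tau> x) ^ 4) + P * e ^ 4)) {0..P}"
        by (intro has_integral_add has_integral_mult_right c integrable_integral integrable_continuous_real continuous_intros cm)
    qed
    finally show ?thesis using set_lebesgue_integral_eq_integral(1)[OF we1] by simp
  qed
  have le: "E' \<tau> \<le> k * E \<tau> + 2 * P * e ^ 4" if "s < \<tau>" "\<tau> < t" for \<tau>
  proof -
    have \<tau>: "\<tau> \<in> I" using that st by auto
    have "(1 :: real) = 1 \<or> (1 :: real) = -1" "(-1 :: real) = 1 \<or> (-1 :: real) = -1" by auto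
    note h1 = half[OF \<tau> this(1)] and h2 = half[OF \<tau> this(2)]
    have cm: "continuous_on {0..P} (\<lambda>x. max 0 (w \<tau> x))" "continuous_on {0..P} (\<lambda>x. max 0 (- w \<tau> x))" by (intro continuous_intros D \<tau>)+
    have p3: "4 * y ^ 3 * z = 4 * max 0 (1 * y) ^ 3 * (1 * z) + 4 * max 0 (- 1 * y) ^ 3 * (- 1 * z)" for y z :: real
      by (auto simp: max_def)
    have p4: "y ^ 4 = max 0 y ^ 4 + max 0 (- y) ^ 4" for y :: real by (auto simp: max_def)
    have "E' \<tau> = integral {0..P} (\<lambda>x. 4 * max 0 (1 * w \<tau> x) ^ 3 * (1 * r \<tau> x) + 4 * max 0 (- 1 * w \<tau> x) ^ 3 * (- 1 * r \<tau> x))"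
      unfolding E'_def by (rule integral_cong) (rule p3)
    also have "\<dots> = integral {0..P} (\<lambda>x. 4 * max 0 (1 * w \<tau> x) ^ 3 * (1 * r \<tau> x)) + integral {0..P} (\<lambda>x. 4 * max 0 (- 1 * w \<tau> x) ^ 3 * (- 1 * r \<tau> x))"
      using h1 h2 by (intro integral_add) blast+
    also have "\<dots> \<le> (k * integral {0..P} (\<lambda>x. max 0 (1 * w \<tau> x) ^ 4) + P * e ^ 4) + (k * integral {0..P} (\<lambda>x. max 0 (- 1 * w \<tau> x) ^ 4) + P * e ^ 4)"
      using h1 h2 by (intro add_mono) blast+
    also have "\<dots> = (k * integral {0..P} (\<lambda>x. max 0 (w \<tau> x) ^ 4) + P * e ^ 4) + (k * integral {0..P} (\<lambda>x. max 0 (- w \<tau> x) ^ 4) + P * e ^ 4)"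
      by simp
    also have "\<dots> = k * (integral {0..P} (\<lambda>x. max 0 (w \<tau> x) ^ 4) + integral {0..P} (\<lambda>x. max 0 (- w \<tau> x) ^ 4)) + 2 * P * e ^ 4"
      by (simp add: algebra_simps)
    also have "integral {0..P} (\<lambda>x. max 0 (w \<tau> x) ^ 4) + integral {0..P} (\<lambda>x. max 0 (- w \<tau> x) ^ 4) = E \<tau>"
    proof -
      have "E \<tau> = integral {0..P} (\<lambda>x. max 0 (w \<tau> x) ^ 4 + max 0 (- w \<tau> x) ^ 4)"
        unfolding E_def by (rule integral_cong) (rule p4)
      also have "\<dots> = integral {0..P} (\<lambda>x. max 0 (w \<tau> x) ^ 4) + integral {0..P} (\<lambda>x. max 0 (- w \<tau> x) ^ 4)"
        by (intro integral_add integrable_continuous_real continuous_intros cm)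
      finally show ?thesis by simp
    qed
    finally show ?thesis .
  qed
  have dE: "(E has_real_derivative E' \<tau>) (at \<tau>)" if "s < \<tau>" "\<tau> < t" for \<tau>
  proof -
    have \<tau>: "\<tau> \<in> I" using that st by auto
    have b1: "((\<lambda>s::real. s ^ 4) has_real_derivative 4 * s ^ 3) (at s)" for s by (auto intro!: derivative_eq_intros)
    have b2: "((\<lambda>s::real. 4 * s ^ 3) has_real_derivative 12 * s ^ 2) (at s)" for s by (auto intro!: derivative_eq_intros)
    have b3: "continuous_on UNIV (\<lambda>s::real. 12 * s ^ 2)" by (intro continuous_intros)
    show ?thesis unfolding E_def[abs_def] E'_def by (rule energy_derivative(1)[OF ev \<tau> less_imp_le[OF P] b1 b2 b3])
  qed
  from Gronwall_within[OF st(1) Ec[folded E_def] dE le] k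
  have "E t + 2 * P * e ^ 4 / k \<le> exp (k * (t - s)) * (E s + 2 * P * e ^ 4 / k)" by simp
  moreover have "2 * P * e ^ 4 / k \<ge> 0" using k P e by simp
  ultimately show ?thesis unfolding E_def by linarith
qed

section \<open>Backward uniqueness\<close>

text \<open>Made for a quantity whose difference quotients can be estimated from the left only. The
  comparison function starts from a strictly larger value and grows with the strictly larger rate
  \<open>k + \<eta>\<close>, so a first contact would contradict the quotient estimate there;
  afterwards \<open>\<eta>\<close> tends to 0.\<close>

lemma left_Dini_Gronwall:
  fixes f :: "real \<Rightarrow> real"
  assumes sb: "s \<le> b" and c: "continuous_on {s..b} f" and f0: "f s \<ge> 0"
    and D: "\<And>\<tau> \<epsilon>. s < \<tau> \<Longrightarrow> \<tau> \<le> b \<Longrightarrow> \<epsilon> > 0 \<Longrightarrow> \<exists>\<delta>>0. \<forall>h. 0 < h \<and> h < \<delta> \<longrightarrow> f \<tau> - f (\<tau> - h) \<le> h * (k * f \<tau> + \<epsilon>)"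
  shows "f b \<le> f s * exp (k * (b - s))"
proof -
  have le: "f b \<le> (f s + \<eta>) * exp ((k + \<eta>) * (b - s))" if \<eta>: "\<eta> > 0" for \<eta>
  proof (rule ccontr)
    assume n: "\<not> ?thesis"
    define F where "F \<tau> = (f s + \<eta>) * exp ((k + \<eta>) * (\<tau> - s))" for \<tau>
    have Fc: "continuous_on A F" for A unfolding F_def by (intro continuous_intros)
    define S where "S = {\<tau> \<in> {s..b}. F \<tau> \<le> f \<tau>}"
    have "closed ({s..b} \<inter> (\<lambda>\<tau>. f \<tau> - F \<tau>) -` {0..})"
      by (intro continuous_closed_preimage continuous_intros c Fc)
    also have "{s..b} \<inter> (\<lambda>\<tau>. f \<tau> - F \<tau>) -` {0..} = S" by (auto simp: S_def)
    finally have "closed S" .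
    moreover have bS: "b \<in> S" using n sb by (simp add: S_def F_def)
    moreover have bb: "bdd_below S" by (auto simp: S_def intro: bdd_belowI[of _ s])
    ultimately have cS: "Inf S \<in> S" by (intro closed_contains_Inf) auto
    define c0 where "c0 = Inf S"
    have c0: "c0 \<in> {s..b}" "F c0 \<le> f c0" using cS by (auto simp: S_def c0_def)
    have "F s > f s" using \<eta> by (simp add: F_def)
    then have sc0: "s < c0" using c0 by (cases "c0 = s") auto
    have before: "f \<tau> < F \<tau>" if "\<tau> \<in> {s..<c0}" for \<tau>
    proof (rule ccontr)
      assume "\<not> ?thesis"
      then have "\<tau> \<in> S" using that c0 by (auto simp: S_def)
      then show False using cInf_lower[OF _ bb, of \<tau>] that by (simp add: c0_def)
    qed
    have Fpos: "F c0 > 0" using f0 \<eta> by (simp add: F_def add_nonneg_pos)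
    have feq: "f c0 = F c0"
    proof (rule ccontr)
      assume "f c0 \<noteq> F c0"
      then have lt: "F c0 < f c0" using c0(2) by simp
      have "continuous_on {s..c0} (\<lambda>\<tau>. f \<tau> - F \<tau>)"
        using c c0(1) by (intro continuous_intros Fc continuous_on_subset[OF c]) auto
      moreover have "f s - F s \<le> 0" "0 \<le> f c0 - F c0" using \<open>F s > f s\<close> lt by auto
      ultimately obtain x where "s \<le> x" "x \<le> c0" "f x - F x = 0"
        using IVT'[of "\<lambda>\<tau>. f \<tau> - F \<tau>" s 0 c0] sc0 by auto
      then show False using before[of x] lt by (cases "x = c0") auto
    qed
    \<comment> \<open>The errors of the two quotients cost \<open>2 * \<epsilon>\<close>, less than
      the gain \<open>\<eta> * F c0\<close> in slope.\<close>
    define \<epsilon> where "\<epsilon> = \<eta> * F c0 / 3"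
    have \<epsilon>: "\<epsilon> > 0" using \<eta> Fpos by (simp add: \<epsilon>_def)
    obtain \<delta>1 where \<delta>1: "\<delta>1 > 0" "\<And>h. 0 < h \<Longrightarrow> h < \<delta>1 \<Longrightarrow> f c0 - f (c0 - h) \<le> h * (k * f c0 + \<epsilon>)"
      using D[OF sc0 _ \<epsilon>] c0(1) by auto
    have "(F has_real_derivative (k + \<eta>) * F c0) (at c0)"
      unfolding F_def by (auto intro!: derivative_eq_intros)
    then have "((\<lambda>h. (F (c0 + h) - F c0) / h) \<longlongrightarrow> (k + \<eta>) * F c0) (at 0)" by (simp add: DERIV_def)
    from tendstoD[OF this \<epsilon>] obtain \<delta>2 where \<delta>2: "\<delta>2 > 0"
      "\<And>h. h \<noteq> 0 \<Longrightarrow> \<bar>h\<bar> < \<delta>2 \<Longrightarrow> \<bar>(F (c0 + h) - F c0) / h - (k + \<eta>) * F c0\<bar> < \<epsilon>"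
      by (auto simp: eventually_at dist_real_def)
    define h where "h = min (min \<delta>1 \<delta>2) (c0 - s) / 2"
    have h: "h > 0" "h < \<delta>1" "h < \<delta>2" "h < c0 - s" using \<delta>1(1) \<delta>2(1) sc0 by (auto simp: h_def min_def)
    have "\<bar>(F (c0 + - h) - F c0) / (- h) - (k + \<eta>) * F c0\<bar> < \<epsilon>" using \<delta>2(2)[of "- h"] h by simp
    then have "(F c0 - F (c0 - h)) / h > (k + \<eta>) * F c0 - \<epsilon>"
      by (simp add: abs_less_iff minus_divide_left[symmetric] diff_divide_distrib)
    then have "F c0 - F (c0 - h) > h * ((k + \<eta>) * F c0 - \<epsilon>)" using h(1) by (simp add: less_divide_eq mult.commute)
    moreover have "f c0 - f (c0 - h) \<ge> F c0 - F (c0 - h)" using before[of "c0 - h"] h feq by auto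
    ultimately have "h * ((k + \<eta>) * F c0 - \<epsilon>) < h * (k * F c0 + \<epsilon>)" using \<delta>1(2)[OF h(1,2)] unfolding feq by linarith
    then have "(k + \<eta>) * F c0 - \<epsilon> < k * F c0 + \<epsilon>" using h(1) by simp
    then have "\<eta> * F c0 < 2 * \<epsilon>" by (simp add: algebra_simps)
    then show False using \<epsilon> by (simp add: \<epsilon>_def)
  qed
  have "((\<lambda>\<eta>. (f s + \<eta>) * exp ((k + \<eta>) * (b - s))) \<longlongrightarrow> (f s + 0) * exp ((k + 0) * (b - s))) (at_right 0)"
    by (intro tendsto_intros)
  then have "f b \<le> (f s + 0) * exp ((k + 0) * (b - s))"
    by (rule tendsto_lowerbound) (auto simp: eventually_at_filter le)
  then show ?thesis by simp
qed

lemma continuous_on_param_integral: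
  fixes f :: "real \<Rightarrow> real \<Rightarrow> real"
  assumes "continuous_on (I \<times> UNIV) (\<lambda>(t, x). f t x)"
  shows "continuous_on I (\<lambda>t. integral {a..b} (f t))"
proof -
  have "continuous_on I (\<lambda>t. integral (cbox a b) (f t))"
    by (rule integral_continuous_on_param) (rule continuous_on_subset[OF assms], auto)
  then show ?thesis by simp
qed

text \<open>The method of the Dirichlet quotient \<open>N = X / Y\<close>: while
  \<open>Y > 0\<close>, the quotient stays bounded on bounded time intervals, hence \<open>Y\<close>
  decays at most exponentially and cannot reach 0 in finite time. The difficulty is that
  \<open>X\<close> is not known to be differentiable, since nothing is assumed about a time
  derivative of \<open>wx\<close>.\<close>

lemma backward_uniqueness:
  assumes ls: "lsol K 0 I w wx v r" and K: "K \<ge> 0" and P: "P > 0"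
    and per: "\<And>t x. t \<in> I \<Longrightarrow> w t (x + P) = w t x"
    and st: "s \<le> t0" "{s..t0} \<subseteq> I" and z: "\<And>x. w t0 x = 0"
  shows "w s y = 0"
proof (rule ccontr)
  assume ny: "w s y \<noteq> 0"
  have ev: "evol I w wx v r" by (rule lsolD[OF ls])
  note D = evolD[OF ev]
  define X where "X t = integral {0..P} (\<lambda>x. (wx t x)\<^sup>2)" for t
  define Y where "Y t = integral {0..P} (\<lambda>x. (w t x)\<^sup>2)" for t
  have Xc: "continuous_on I X" unfolding X_def
    by (rule continuous_on_param_integral) (use continuous_on_power[OF D(3), of 2] in \<open>simp add: case_prod_beta\<close>)
  have Yc: "continuous_on I Y" unfolding Y_def
    by (rule continuous_on_param_integral) (use continuous_on_power[OF D(2), of 2] in \<open>simp add: case_prod_beta\<close>)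
  have X0: "X t \<ge> 0" if "t \<in> I" for t unfolding X_def
    by (intro Henstock_Kurzweil_Integration.integral_nonneg integrable_continuous_real continuous_intros D that) auto
  have Y0: "Y t \<ge> 0" if "t \<in> I" for t unfolding Y_def
    by (intro Henstock_Kurzweil_Integration.integral_nonneg integrable_continuous_real continuous_intros D that) auto
  have wxper: "wx t (x + P) = wx t x" if "t \<in> I" for t x
    using periodic_derivative[of "w t" P "wx t" x] per[OF that] D(4)[OF that] by simp
  have sI: "s \<in> I" using st by auto
  have Yz: "Y t = 0 \<longleftrightarrow> (\<forall>x\<in>{0..P}. w t x = 0)" if "t \<in> I" for t
  proof -
    have "integral (cbox 0 P) (\<lambda>x. (w t x)\<^sup>2) = 0 \<longleftrightarrow> (\<forall>x\<in>cbox 0 P. (w t x)\<^sup>2 = 0)"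
      by (rule integral_cbox_eq_0_iff) (use P in \<open>auto intro!: continuous_intros D that\<close>)
    then show ?thesis by (simp add: Y_def)
  qed
  have peri: "w s (x + of_int n * P) = w s x" for x n
  proof -
    have nat: "w s (x + of_nat n * P) = w s x" for x n
    proof (induction n)
      case (Suc n)
      have "w s (x + of_nat (Suc n) * P) = w s ((x + of_nat n * P) + P)" by (simp add: algebra_simps)
      then show ?case using per[OF sI] Suc by simp
    qed simp
    show ?thesis
    proof (cases "n \<ge> 0")
      case True
      then show ?thesis using nat[of x "nat n"] by simp
    next
      case False
      then show ?thesis using nat[of "x + of_int n * P" "nat (- n)"] by simp
    qed
  qed
  have "Y s \<noteq> 0"
  proof
    assume "Y s = 0"
    define n where "n = \<lfloor>y / P\<rfloor>"
    have "y - of_int n * P \<in> {0..P}"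
      using P floor_divide_lower[OF P, of y] floor_divide_upper[OF P, of y] by (auto simp: n_def algebra_simps)
    then have "w s (y - of_int n * P) = 0" using Yz[OF sI] \<open>Y s = 0\<close> by blast
    then show False using peri[of y "- n"] ny by simp
  qed
  define S where "S = {t \<in> {s..t0}. Y t = 0}"
  have "closed S" unfolding S_def
    using continuous_closed_preimage_constant[of "{s..t0}" Y 0] continuous_on_subset[OF Yc st(2)] by simp
  moreover have "t0 \<in> S" using z st(1) by (simp add: S_def Y_def)
  moreover have bb: "bdd_below S" by (auto simp: S_def intro: bdd_belowI[of _ s])
  ultimately have cS: "Inf S \<in> S" by (intro closed_contains_Inf) auto
  define t1 where "t1 = Inf S"
  have t1: "t1 \<in> {s..t0}" "Y t1 = 0" using cS by (auto simp: S_def t1_def)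
  have st1: "s < t1" using t1 \<open>Y s \<noteq> 0\<close> by (cases "t1 = s") auto
  have Ypos: "Y t > 0" if "t \<in> {s..<t1}" for t
  proof -
    have "t \<notin> S" using cInf_lower[OF _ bb, of t] that by (auto simp: t1_def)
    then have "Y t \<noteq> 0" using that t1 by (auto simp: S_def)
    moreover have "t \<in> I" using that t1 st by auto
    ultimately show ?thesis using Y0[of t] by simp
  qed
  have sub: "{s..t1} \<subseteq> I" using t1 st by auto
  have wv: "integral {0..P} (\<lambda>x. f x * v t x) = - integral {0..P} (\<lambda>x. f' x * wx t x)"
    if t: "t \<in> I" and f: "\<And>x. (f has_real_derivative f' x) (at x)" "continuous_on UNIV f'" "f P = f 0" for t f f'
  proof -
    have "integral {0..P} (\<lambda>x. f x * v t x) = f P * wx t P - f 0 * wx t 0 - integral {0..P} (\<lambda>x. f' x * wx t x)"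
      by (rule integration_by_parts_AC(2))
        (use P in \<open>auto intro!: D t L2_loc_abs_integrable has_field_derivative_at_within[OF f(1)] continuous_on_subset[OF f(2)]\<close>)
    then show ?thesis using wxper[OF t, of 0] f(3) by simp
  qed
  have YD: "(Y has_real_derivative 2 * integral {0..P} (\<lambda>x. w t x * r t x)) (at t)" if t: "t \<in> I" for t
  proof -
    have "((\<lambda>t. integral {0..P} (\<lambda>x. (w t x)\<^sup>2)) has_real_derivative integral {0..P} (\<lambda>x. (2 * w t x) * r t x)) (at t)"
      by (rule energy_derivative(1)[OF ev t, where \<beta>'' = "\<lambda>_. 2"])
        (use P in \<open>auto intro!: derivative_eq_intros continuous_intros\<close>)
    moreover have "integral {0..P} (\<lambda>x. (2 * w t x) * r t x) = 2 * integral {0..P} (\<lambda>x. w t x * r t x)"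
      by (simp add: mult.assoc)
    ultimately show ?thesis by (simp add: Y_def[abs_def])
  qed
  define N where "N t = X t / Y t" for t
  have Lw: "L2_loc (w t)" and Lwx: "L2_loc (wx t)" if "t \<in> I" for t
    using D(9,10)[OF that] by (auto intro: L2_loc_continuous)
  have ewx: "integral {0..P} (\<lambda>x. (r t x - v t x)\<^sup>2) \<le> 2 * K\<^sup>2 * (Y t + X t)" if t: "t \<in> I" for t
  proof -
    have i: "(\<lambda>x. (w t x)\<^sup>2) integrable_on {0..P}" "(\<lambda>x. (wx t x)\<^sup>2) integrable_on {0..P}"
      using Lw[OF t] Lwx[OF t] L2_loc_square_integrable by auto
    have "integral {0..P} (\<lambda>x. (r t x - v t x)\<^sup>2) \<le> integral {0..P} (\<lambda>x. 2 * K\<^sup>2 * ((w t x)\<^sup>2 + (wx t x)\<^sup>2))"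
    proof (rule Henstock_Kurzweil_Integration.integral_le)
      show "(\<lambda>x. (r t x - v t x)\<^sup>2) integrable_on {0..P}"
        by (intro L2_loc_square_integrable L2_loc_diff D t)
      show "(\<lambda>x. 2 * K\<^sup>2 * ((w t x)\<^sup>2 + (wx t x)\<^sup>2)) integrable_on {0..P}"
        by (intro integrable_on_mult_right integrable_add i)
      fix x
      have "\<bar>r t x - v t x\<bar> \<le> K * (\<bar>w t x\<bar> + \<bar>wx t x\<bar>)" using lsolD(2)[OF ls t, of x] by simp
      then have "(r t x - v t x)\<^sup>2 \<le> (K * (\<bar>w t x\<bar> + \<bar>wx t x\<bar>))\<^sup>2" by (metis abs_ge_zero abs_le_square_iff abs_of_nonneg order_trans)
      also have "\<dots> = K\<^sup>2 * (\<bar>w t x\<bar> + \<bar>wx t x\<bar>)\<^sup>2" by (rule power_mult_distrib)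
      also have "\<dots> \<le> K\<^sup>2 * (2 * ((w t x)\<^sup>2 + (wx t x)\<^sup>2))"
        using sum_squares_bound[of "\<bar>w t x\<bar>" "\<bar>wx t x\<bar>"] by (intro mult_left_mono) (auto simp: power2_sum)
      finally show "(r t x - v t x)\<^sup>2 \<le> 2 * K\<^sup>2 * ((w t x)\<^sup>2 + (wx t x)\<^sup>2)" by (simp add: algebra_simps)
    qed
    also have "\<dots> = 2 * K\<^sup>2 * (Y t + X t)"
      unfolding X_def Y_def by (intro integral_unique has_integral_mult_right has_integral_add integrable_integral i)
    finally show ?thesis .
  qed
  have wvX: "integral {0..P} (\<lambda>x. w t x * v t x) = - X t" if t: "t \<in> I" for t
    using wv[OF t, of "w t" "wx t"] D(4,10)[OF t] per[OF t, of 0] by (simp add: X_def power2_eq_square)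
  \<comment> \<open>The left side is what the derivative of \<open>N\<close> would be. Removing from
    \<open>v\<close> its component along \<open>w\<close> leaves \<open>a\<close>, orthogonal to
    \<open>w\<close>; completing the square in \<open>a\<close> then leaves only the lower-order
    part \<open>r - v\<close>, which \<open>ewx\<close> bounds.\<close>
  have A0: "(- 2 * integral {0..P} (\<lambda>x. v t x * r t x) * Y t - X t * (2 * integral {0..P} (\<lambda>x. w t x * r t x))) / (Y t * Y t)
      \<le> K\<^sup>2 * (N t + 1)" if t: "t \<in> {s..<t1}" for t
  proof -
    have tI: "t \<in> I" using t sub by auto
    have Yt: "Y t > 0" using Ypos[OF t] .
    define n where "n = N t"
    have XnY: "X t = n * Y t" using Yt by (simp add: n_def N_def)
    define a where "a x = v t x + n * w t x" for x
    have La: "L2_loc a" unfolding a_def by (intro L2_loc_add L2_loc_cmult Lw D tI)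
    have Le: "L2_loc (\<lambda>x. r t x - v t x)" by (intro L2_loc_diff D tI)
    have i: "(\<lambda>x. f x * g x) integrable_on {0..P}" if "L2_loc f" "L2_loc g" for f g
      using that by (rule L2_loc_mult_integrable)
    have Lv: "L2_loc (v t)" and Lr: "L2_loc (r t)" using D(5,6)[OF tI] .
    have aw: "integral {0..P} (\<lambda>x. a x * w t x) = 0"
    proof -
      have "integral {0..P} (\<lambda>x. a x * w t x) = integral {0..P} (\<lambda>x. w t x * v t x + n * (w t x)\<^sup>2)"
        by (rule integral_cong) (simp add: a_def algebra_simps power2_eq_square)
      also have "\<dots> = integral {0..P} (\<lambda>x. w t x * v t x) + n * Y t"
        unfolding Y_def
        by (intro integral_unique has_integral_mult_right has_integral_add integrable_integral i L2_loc_square_integrable Lw tI Lv)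
      finally show ?thesis using wvX[OF tI] XnY by simp
    qed
    have eq: "integral {0..P} (\<lambda>x. v t x * r t x) + n * integral {0..P} (\<lambda>x. w t x * r t x)
      = integral {0..P} (\<lambda>x. (a x)\<^sup>2 + a x * (r t x - v t x))"
    proof -
      have "integral {0..P} (\<lambda>x. v t x * r t x) + n * integral {0..P} (\<lambda>x. w t x * r t x)
         = integral {0..P} (\<lambda>x. v t x * r t x + n * (w t x * r t x))"
        by (intro integral_unique[symmetric] has_integral_mult_right has_integral_add integrable_integral i Lv Lr Lw tI)
      also have "\<dots> = integral {0..P} (\<lambda>x. ((a x)\<^sup>2 + a x * (r t x - v t x)) + (- n) * (a x * w t x))"
        by (rule integral_cong) (simp add: a_def algebra_simps power2_eq_square)
      also have "\<dots> = integral {0..P} (\<lambda>x. (a x)\<^sup>2 + a x * (r t x - v t x)) + (- n) * integral {0..P} (\<lambda>x. a x * w t x)"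
        by (intro integral_unique has_integral_mult_right has_integral_add integrable_integral integrable_add i L2_loc_square_integrable La Le Lw tI)
      finally show ?thesis using aw by simp
    qed
    have "- (K\<^sup>2 * (Y t + X t)) / 2 \<le> integral {0..P} (\<lambda>x. (- 1 / 4) * (r t x - v t x)\<^sup>2)"
      using ewx[OF tI] by simp
    also have "\<dots> \<le> integral {0..P} (\<lambda>x. (a x)\<^sup>2 + a x * (r t x - v t x))"
    proof (intro Henstock_Kurzweil_Integration.integral_le integrable_add integrable_on_mult_right L2_loc_square_integrable i La Le)
      fix x
      have sq: "0 \<le> y\<^sup>2 + y * d + d\<^sup>2 / 4" for y d :: real
      proof -
        have "0 \<le> (y + d / 2)\<^sup>2" by simp
        then show ?thesis by (simp add: power2_sum power_divide)
      qed
      show "(- 1 / 4) * (r t x - v t x)\<^sup>2 \<le> (a x)\<^sup>2 + a x * (r t x - v t x)"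
        using sq[of "a x" "r t x - v t x"] by linarith
    qed
    finally have ge: "- (K\<^sup>2 * (Y t + X t)) / 2 \<le> integral {0..P} (\<lambda>x. v t x * r t x) + n * integral {0..P} (\<lambda>x. w t x * r t x)"
      unfolding eq .
    have "(- 2 * integral {0..P} (\<lambda>x. v t x * r t x) * Y t - X t * (2 * integral {0..P} (\<lambda>x. w t x * r t x))) / (Y t * Y t)
      = - 2 * (integral {0..P} (\<lambda>x. v t x * r t x) + n * integral {0..P} (\<lambda>x. w t x * r t x)) / Y t"
      using Yt unfolding XnY by (simp add: field_simps)
    also have "\<dots> \<le> K\<^sup>2 * (Y t + X t) / Y t"
      using ge Yt by (intro divide_right_mono) auto
    also have "\<dots> = K\<^sup>2 * (N t + 1)" using Yt by (simp add: N_def field_simps)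
    finally show ?thesis .
  qed
  have dini: "\<exists>\<delta>>0. \<forall>h. 0 < h \<and> h < \<delta> \<longrightarrow> (N t + 1) - (N (t - h) + 1) \<le> h * (K\<^sup>2 * (N t + 1) + \<epsilon>)"
    if t: "s < t" "t < t1" and \<epsilon>: "\<epsilon> > 0" for t \<epsilon>
  proof -
    have tI: "t \<in> I" using t sub by auto
    have Yt: "Y t > 0" using Ypos t by auto
    \<comment> \<open>A difference quotient tested against \<open>v t\<close>;
      \<open>- 2 * J\<close> plays the role of the derivative of \<open>X\<close>.\<close>
    define J where "J h = integral {0..P} (\<lambda>x. v t x * ((w (t + h) x - w t x) / h))" for h
    have Jlim: "(J \<longlongrightarrow> integral {0..P} (\<lambda>x. v t x * r t x)) (at 0)"
    proof (rule LIM_zero_cancel, rule Lim_null_comparison)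
      define q where "q h = integral {0..P} (\<lambda>x. ((w (t + h) x - w t x) / h - r t x)\<^sup>2)" for h
      define V where "V = integral {0..P} (\<lambda>x. (v t x)\<^sup>2)"
      have q0: "(q \<longlongrightarrow> 0) (at 0)" unfolding q_def by (rule D(8)[OF tI])
      define g where "g h = (sqrt (q h) + \<bar>h\<bar>) / 2 * V + sqrt (q h) / 2" for h
      have "(g \<longlongrightarrow> (sqrt 0 + \<bar>0\<bar>) / 2 * V + sqrt 0 / 2) (at 0)" unfolding g_def by (intro tendsto_intros q0) simp_all
      then show "(g \<longlongrightarrow> 0) (at 0)" by simp
      have hn: "\<forall>\<^sub>F h in at 0. h \<noteq> (0::real)" by (simp add: eventually_at_filter)
      show "\<forall>\<^sub>F h in at 0. norm (J h - integral {0..P} (\<lambda>x. v t x * r t x)) \<le> g h"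
        using evol_quotient_L2_loc[OF ev tI] eventually_at_0_shift[OF D(1) tI] hn
      proof eventually_elim
        case (elim h)
        have Lq: "L2_loc (\<lambda>x. (w (t + h) x - w t x) / h - r t x)" by (rule elim)
        have Lv: "L2_loc (v t)" and Lr: "L2_loc (r t)" using D(5,6)[OF tI] .
        have Lw': "L2_loc (\<lambda>x. (w (t + h) x - w t x) / h)"
          using L2_loc_add[OF Lq Lr] by simp
        have qh: "q h \<ge> 0" unfolding q_def by (intro Henstock_Kurzweil_Integration.integral_nonneg L2_loc_square_integrable Lq) simp
        define \<sigma> where "\<sigma> = sqrt (q h) + \<bar>h\<bar>"
        have \<sigma>: "\<sigma> > 0" using elim(3) qh by (simp add: \<sigma>_def add_nonneg_pos)
        have "J h - integral {0..P} (\<lambda>x. v t x * r t x) = integral {0..P} (\<lambda>x. v t x * ((w (t + h) x - w t x) / h) - v t x * r t x)"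
          unfolding J_def by (intro integral_diff[symmetric] L2_loc_mult_integrable Lv Lw' Lr)
        also have "\<dots> = integral {0..P} (\<lambda>x. v t x * ((w (t + h) x - w t x) / h - r t x))"
          by (rule integral_cong) (simp add: right_diff_distrib)
        finally have eq: "J h - integral {0..P} (\<lambda>x. v t x * r t x) = \<dots>" .
        have "norm (integral {0..P} (\<lambda>x. v t x * ((w (t + h) x - w t x) / h - r t x)))
          \<le> integral {0..P} (\<lambda>x. \<sigma> / 2 * (v t x)\<^sup>2 + 1 / (2 * \<sigma>) * ((w (t + h) x - w t x) / h - r t x)\<^sup>2)"
        proof (rule integral_norm_bound_integral)
          show "(\<lambda>x. v t x * ((w (t + h) x - w t x) / h - r t x)) integrable_on {0..P}"
            by (intro L2_loc_mult_integrable Lv Lq)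
          show "(\<lambda>x. \<sigma> / 2 * (v t x)\<^sup>2 + 1 / (2 * \<sigma>) * ((w (t + h) x - w t x) / h - r t x)\<^sup>2) integrable_on {0..P}"
            by (intro integrable_add integrable_on_mult_right L2_loc_square_integrable Lv Lq)
          fix x
          define d where "d = (w (t + h) x - w t x) / h - r t x"
          have "0 \<le> (\<sigma> * \<bar>v t x\<bar> - \<bar>d\<bar>)\<^sup>2" by simp
          then have "2 * \<sigma> * (\<bar>v t x\<bar> * \<bar>d\<bar>) \<le> \<sigma>\<^sup>2 * (v t x)\<^sup>2 + d\<^sup>2" by (simp add: power2_diff power_mult_distrib algebra_simps)
          then show "norm (v t x * d) \<le> \<sigma> / 2 * (v t x)\<^sup>2 + 1 / (2 * \<sigma>) * d\<^sup>2"
            using \<sigma> by (simp add: abs_mult field_simps power2_eq_square)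
        qed
        also have "\<dots> = \<sigma> / 2 * V + 1 / (2 * \<sigma>) * q h"
          unfolding V_def q_def by (intro integral_unique has_integral_mult_right has_integral_add integrable_integral L2_loc_square_integrable Lv Lq)
        also have "\<dots> \<le> g h"
        proof -
          have "q h = sqrt (q h) * sqrt (q h)" using qh by simp
          also have "\<dots> \<le> sqrt (q h) * \<sigma>" using qh by (intro mult_left_mono) (auto simp: \<sigma>_def)
          finally have "1 / (2 * \<sigma>) * q h \<le> sqrt (q h) / 2" using \<sigma> by (simp add: field_simps)
          then show ?thesis by (simp add: g_def \<sigma>_def)
        qed
        finally show ?case unfolding eq .
      qed
    qed
    define y where "y h = (Y (t + h) - Y t) / h" for h
    have ylim: "(y \<longlongrightarrow> 2 * integral {0..P} (\<lambda>x. w t x * r t x)) (at 0)"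
      using YD[OF tI] unfolding y_def DERIV_def .
    have Yl: "((\<lambda>h. Y (t + h)) \<longlongrightarrow> Y t) (at 0)"
      using YD[OF tI, THEN DERIV_isCont] by (simp add: isCont_def LIM_offset_zero_iff)
    define A where "A h = (- 2 * J h * Y t - X t * y h) / (Y t * Y (t + h))" for h
    have Alim: "(A \<longlongrightarrow> (- 2 * integral {0..P} (\<lambda>x. v t x * r t x) * Y t - X t * (2 * integral {0..P} (\<lambda>x. w t x * r t x))) / (Y t * Y t)) (at 0)"
      unfolding A_def by (intro tendsto_intros Jlim ylim Yl) (use Yt in auto)
    have "\<forall>\<^sub>F h in at 0. A h < K\<^sup>2 * (N t + 1) + \<epsilon>"
      by (rule order_tendstoD(2)[OF Alim]) (use A0[of t] t \<epsilon> in auto)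
    then obtain \<delta>0 where \<delta>0: "\<delta>0 > 0" "\<And>h. h \<noteq> 0 \<Longrightarrow> \<bar>h\<bar> < \<delta>0 \<Longrightarrow> A h < K\<^sup>2 * (N t + 1) + \<epsilon>"
      by (auto simp: eventually_at dist_real_def)
    define \<delta> where "\<delta> = min \<delta>0 (t - s)"
    have "(N t + 1) - (N (t - h) + 1) \<le> h * (K\<^sup>2 * (N t + 1) + \<epsilon>)" if h: "0 < h" "h < \<delta>" for h
    proof -
      have thI: "t - h \<in> I" and thY: "Y (t - h) > 0" using h t sub Ypos[of "t - h"] by (auto simp: \<delta>_def)
      \<comment> \<open>Convexity of the square bounds the increment of \<open>X\<close> over the
        past interval from above, and integration by parts moves the space derivative onto
        \<open>v t\<close>. For a future interval the same argument yields a lower bound instead,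
        hence the left-sided Gronwall lemma.\<close>
      have conv: "X t - X (t - h) \<le> h * (- 2 * J (- h))"
      proof -
        have c1: "continuous_on {0..P} (wx t)" "continuous_on {0..P} (wx (t - h))" using D(10) tI thI by auto
        have "2 * integral {0..P} (\<lambda>x. wx t x * (wx (t - h) x - wx t x)) = integral {0..P} (\<lambda>x. 2 * (wx t x * (wx (t - h) x - wx t x)))"
          by simp
        also have "\<dots> \<le> integral {0..P} (\<lambda>x. (wx (t - h) x)\<^sup>2 - (wx t x)\<^sup>2)"
        proof (intro Henstock_Kurzweil_Integration.integral_le integrable_continuous_real continuous_intros c1)
          fix x
          have "0 \<le> (wx (t - h) x - wx t x)\<^sup>2" by simp
          then show "2 * (wx t x * (wx (t - h) x - wx t x)) \<le> (wx (t - h) x)\<^sup>2 - (wx t x)\<^sup>2"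
            by (simp add: power2_eq_square algebra_simps)
        qed
        also have "\<dots> = X (t - h) - X t"
          unfolding X_def by (intro integral_diff integrable_continuous_real continuous_intros c1)
        finally have 1: "2 * integral {0..P} (\<lambda>x. wx t x * (wx (t - h) x - wx t x)) \<le> X (t - h) - X t" .
        have "integral {0..P} (\<lambda>x. (w (t - h) x - w t x) * v t x) = - integral {0..P} (\<lambda>x. (wx (t - h) x - wx t x) * wx t x)"
        proof (rule wv[OF tI])
          show "((\<lambda>x. w (t - h) x - w t x) has_real_derivative wx (t - h) x - wx t x) (at x)" for x
            by (intro DERIV_diff D thI tI)
          show "continuous_on UNIV (\<lambda>x. wx (t - h) x - wx t x)" by (intro continuous_intros D thI tI)
          show "w (t - h) P - w t P = w (t - h) 0 - w t 0" using per[OF thI, of 0] per[OF tI, of 0] by simp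
        qed
        moreover have "integral {0..P} (\<lambda>x. (w (t - h) x - w t x) * v t x) = - h * J (- h)"
        proof -
          have "integral {0..P} (\<lambda>x. (w (t - h) x - w t x) * v t x) = integral {0..P} (\<lambda>x. (- h) * (v t x * ((w (t + - h) x - w t x) / (- h))))"
            by (rule integral_cong) (use h in simp)
          then show ?thesis by (simp add: J_def)
        qed
        ultimately show ?thesis using 1 by (simp add: mult.commute)
      qed
      have "N t - N (t - h) = ((X t - X (t - h)) * Y t - X t * (Y t - Y (t - h))) / (Y t * Y (t - h))"
        using Yt thY by (simp add: N_def field_simps)
      also have "\<dots> \<le> (h * (- 2 * J (- h)) * Y t - X t * (h * y (- h))) / (Y t * Y (t - h))"
      proof (rule divide_right_mono)
        have "Y t - Y (t - h) = h * y (- h)" using h by (simp add: y_def)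
        then show "(X t - X (t - h)) * Y t - X t * (Y t - Y (t - h)) \<le> h * (- 2 * J (- h)) * Y t - X t * (h * y (- h))"
          using mult_right_mono[OF conv, of "Y t"] Yt by simp
      qed (use Yt thY in simp)
      also have "\<dots> = h * A (- h)" by (simp add: A_def algebra_simps add_divide_distrib diff_divide_distrib)
      also have "\<dots> \<le> h * (K\<^sup>2 * (N t + 1) + \<epsilon>)"
        using \<delta>0(2)[of "- h"] h by (intro mult_left_mono) (auto simp: \<delta>_def)
      finally show ?thesis by simp
    qed
    then show ?thesis using \<delta>0(1) t by (intro exI[of _ \<delta>]) (auto simp: \<delta>_def)
  qed
  define B where "B = (N s + 1) * exp (K\<^sup>2 * (t1 - s))"
  have Ns: "N s \<ge> 0" using X0[OF sI] Ypos[of s] st1 by (simp add: N_def)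
  have NB: "N t + 1 \<le> B" if t: "t \<in> {s..<t1}" for t
  proof -
    have "N t + 1 \<le> (N s + 1) * exp (K\<^sup>2 * (t - s))"
    proof (rule left_Dini_Gronwall)
      have "{s..t} \<subseteq> I" using t sub by auto
      moreover have "\<forall>x\<in>{s..t}. Y x \<noteq> 0"
      proof
        fix x assume "x \<in> {s..t}"
        then show "Y x \<noteq> 0" using Ypos[of x] t by auto
      qed
      ultimately show "continuous_on {s..t} (\<lambda>t. N t + 1)" unfolding N_def
        by (intro continuous_intros continuous_on_subset[OF Xc] continuous_on_subset[OF Yc])
    qed (use t Ns dini in auto)
    also have "\<dots> \<le> B" unfolding B_def using t Ns by (intro mult_left_mono) (auto intro!: mult_left_mono)
    finally show ?thesis .
  qed
  define c where "c = (2 + 3 * K) * B"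
  have B1: "B > 0" using Ns by (simp add: B_def add_nonneg_pos)
  have c: "c > 0" using K B1 by (simp add: c_def)
  have Y'ge: "2 * integral {0..P} (\<lambda>x. w t x * r t x) \<ge> - c * Y t" if t: "s < t" "t < t1" for t
  proof -
    have tI: "t \<in> I" using t sub by auto
    have Yt: "Y t > 0" using Ypos t by auto
    have Lv: "L2_loc (v t)" and Lr: "L2_loc (r t)" using D(5,6)[OF tI] .
    have "integral {0..P} (\<lambda>x. w t x * v t x + (- (3 * K / 2) * (w t x)\<^sup>2 + (- (K / 2)) * (wx t x)\<^sup>2)) \<le> integral {0..P} (\<lambda>x. w t x * r t x)"
    proof (intro Henstock_Kurzweil_Integration.integral_le integrable_add integrable_on_mult_right L2_loc_mult_integrable L2_loc_square_integrable Lw Lwx tI Lv Lr)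
      fix x
      have "\<bar>w t x * (r t x - v t x)\<bar> \<le> \<bar>w t x\<bar> * (K * (\<bar>w t x\<bar> + \<bar>wx t x\<bar>))"
        unfolding abs_mult using lsolD(2)[OF ls tI, of x] by (intro mult_left_mono) auto
      also have "\<dots> = K * (w t x)\<^sup>2 + K * (\<bar>w t x\<bar> * \<bar>wx t x\<bar>)" by (simp add: algebra_simps power2_eq_square)
      also have "\<dots> \<le> K * (w t x)\<^sup>2 + K * (((w t x)\<^sup>2 + (wx t x)\<^sup>2) / 2)"
        using sum_squares_bound[of "\<bar>w t x\<bar>" "\<bar>wx t x\<bar>"] K by (intro add_left_mono mult_left_mono) auto
      also have "\<dots> = 3 * K / 2 * (w t x)\<^sup>2 + K / 2 * (wx t x)\<^sup>2" by (simp add: field_simps)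
      finally have "\<bar>w t x * (r t x - v t x)\<bar> \<le> 3 * K / 2 * (w t x)\<^sup>2 + K / 2 * (wx t x)\<^sup>2" .
      then have "- (3 * K / 2 * (w t x)\<^sup>2 + K / 2 * (wx t x)\<^sup>2) \<le> w t x * r t x - w t x * v t x"
        unfolding right_diff_distrib by linarith
      then show "w t x * v t x + (- (3 * K / 2) * (w t x)\<^sup>2 + (- (K / 2)) * (wx t x)\<^sup>2) \<le> w t x * r t x" by simp
    qed
    also have "integral {0..P} (\<lambda>x. w t x * v t x + (- (3 * K / 2) * (w t x)\<^sup>2 + (- (K / 2)) * (wx t x)\<^sup>2))
        = integral {0..P} (\<lambda>x. w t x * v t x) + (- (3 * K / 2) * Y t + (- (K / 2)) * X t)"
      unfolding X_def Y_def
      by (intro integral_unique has_integral_mult_right has_integral_add integrable_integral L2_loc_mult_integrable L2_loc_square_integrable Lw Lwx tI Lv)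
    finally have 1: "- X t - 3 * K / 2 * Y t - K / 2 * X t \<le> integral {0..P} (\<lambda>x. w t x * r t x)"
      using wvX[OF tI] by simp
    have "(2 + 3 * K) * (X t + Y t) \<ge> 2 * X t + 3 * K * Y t + K * X t"
      using K X0[OF tI] Yt by (simp add: algebra_simps)
    moreover have "X t + Y t = (N t + 1) * Y t" using Yt by (simp add: N_def field_simps)
    moreover have "(2 + 3 * K) * ((N t + 1) * Y t) \<le> (2 + 3 * K) * (B * Y t)"
      using NB[of t] t K Yt by (intro mult_left_mono mult_right_mono) auto
    ultimately show ?thesis using 1 by (simp add: c_def algebra_simps)
  qed
  \<comment> \<open>Gronwall for \<open>- Y\<close> with the negative rate \<open>- c\<close> bounds
    \<open>Y t1\<close> from below by a positive multiple of \<open>Y s\<close>.\<close>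
  have "- Y t1 + 0 / (- c) \<le> exp ((- c) * (t1 - s)) * (- Y s + 0 / (- c))"
  proof (rule Gronwall_within[where E' = "\<lambda>t. - (2 * integral {0..P} (\<lambda>x. w t x * r t x))"])
    show "continuous_on {s..t1} (\<lambda>t. - Y t)" by (intro continuous_intros continuous_on_subset[OF Yc sub])
    fix \<tau> assume \<tau>: "s < \<tau>" "\<tau> < t1"
    then have "\<tau> \<in> I" using sub by auto
    then show "((\<lambda>t. - Y t) has_real_derivative - (2 * integral {0..P} (\<lambda>x. w \<tau> x * r \<tau> x))) (at \<tau>)"
      by (intro DERIV_minus YD)
    show "- (2 * integral {0..P} (\<lambda>x. w \<tau> x * r \<tau> x)) \<le> - c * - Y \<tau> + 0" using Y'ge[OF \<tau>] by simp
  qed (use st1 c in auto)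
  then have "exp ((- c) * (t1 - s)) * Y s \<le> 0" using t1(2) by simp
  then show False using Ypos[of s] st1 by (simp add: mult_le_0_iff)
qed

section \<open>Cyclic sign changes\<close>

lemma periodic_int:
  fixes w :: "real \<Rightarrow> real"
  assumes "\<And>x. w (x + P) = w x"
  shows "w (x + of_int n * P) = w x"
proof -
  have nat: "w (x + of_nat n * P) = w x" for x n
  proof (induction n)
    case (Suc n)
    have "w (x + of_nat (Suc n) * P) = w ((x + of_nat n * P) + P)" by (simp add: algebra_simps)
    then show ?case using assms Suc by simp
  qed simp
  show ?thesis
  proof (cases "n \<ge> 0")
    case True
    then show ?thesis using nat[of x "nat n"] by simp
  next
    case False
    then show ?thesis using nat[of "x + of_int n * P" "nat (- n)"] by simp
  qed
qed

lemma periodic_representative: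
  fixes P x p :: real
  assumes "P > 0"
  shows "\<exists>n::int. p \<le> x + of_int n * P \<and> x + of_int n * P < p + P"
proof -
  define n where "n = \<lfloor>(x - p) / P\<rfloor>"
  have "of_int n * P \<le> x - p" "x - p < (of_int n + 1) * P"
    using floor_divide_lower[OF assms, of "x - p"] floor_divide_upper[OF assms, of "x - p"] by (auto simp: n_def)
  then show ?thesis by (intro exI[of _ "- n"]) (auto simp: algebra_simps)
qed

text \<open>At least four sign changes in one period. On a circle sign changes come in pairs, so for
  periodic functions the negation means at most two. Starting with the positive sign is then no
  restriction, as \<open>alt4_minus\<close> and \<open>alt4I'\<close> show.\<close>

definition alt4 :: "real \<Rightarrow> (real \<Rightarrow> real) \<Rightarrow> bool" where
  "alt4 P w \<longleftrightarrow> (\<exists>a b c d. a < b \<and> b < c \<and> c < d \<and> d < a + P \<and> w a > 0 \<and> w b < 0 \<and> w c > 0 \<and> w d < 0)"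

lemma alt4I: "a < b \<Longrightarrow> b < c \<Longrightarrow> c < d \<Longrightarrow> d < a + P \<Longrightarrow> w a > 0 \<Longrightarrow> w b < 0 \<Longrightarrow> w c > 0 \<Longrightarrow> w d < 0 \<Longrightarrow> alt4 P w"
  unfolding alt4_def by blast

lemma alt4_minus:
  assumes per: "\<And>x. w (x + P) = w x"
  shows "alt4 P (\<lambda>x. - w x) \<longleftrightarrow> alt4 P w"
proof -
  have imp: "alt4 P (\<lambda>x. - w x)" if per: "\<And>x. w (x + P) = w x" and alt: "alt4 P w" for w
  proof -
    obtain a b c d where *: "a < b" "b < c" "c < d" "d < a + P" "w a > 0" "w b < 0" "w c > 0" "w d < 0"
      using alt unfolding alt4_def by blast
    show ?thesis by (rule alt4I[of b c d "a + P"]) (use * per[of a] in auto)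
  qed
  show ?thesis using imp[of w] imp[of "\<lambda>x. - w x"] per by auto
qed

lemma alt4I':
  assumes per: "\<And>x. w (x + P) = w x"
    and "a < b" "b < c" "c < d" "d < a + P" "w a < 0" "w b > 0" "w c < 0" "w d > 0"
  shows "alt4 P w"
  by (rule alt4I[of b c d "a + P"]) (use assms in auto)

text \<open>Cutting the circle at a point where \<open>w\<close> is positive turns the cyclic
  condition into a chain with signs -, +, - on an interval whose ends satisfy the sign conditions of
  \<open>achain_decreasing\<close>. The quadruple is translated so that its first point lies in the
  period before \<open>p\<close>; the cases tell how far it must be rotated.\<close>

lemma alt4_iff_achain:
  assumes per: "\<And>x. w (x + P) = w x" and P: "P > 0" and p: "w p > 0"
  shows "alt4 P w \<longleftrightarrow> achain w (-1) p 3 (p + P)"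
proof
  assume "achain w (-1) p 3 (p + P)"
  then obtain x1 x2 x3 where "p < x1" "x1 < x2" "x2 < x3" "x3 < p + P" "w x1 < 0" "w x2 > 0" "w x3 < 0"
    by (auto simp: numeral_3_eq_3)
  then show "alt4 P w" using p by (intro alt4I[of p x1 x2 x3])
next
  assume "alt4 P w"
  then obtain a0 b0 c0 d0 where *: "a0 < b0" "b0 < c0" "c0 < d0" "d0 < a0 + P" "w a0 > 0" "w b0 < 0" "w c0 > 0" "w d0 < 0"
    unfolding alt4_def by blast
  obtain n :: int where n: "p - P \<le> a0 + of_int n * P" "a0 + of_int n * P < p"
    using periodic_representative[OF P, of "p - P" a0] by auto
  define k where "k = of_int n * P"
  define a b c d where "a = a0 + k" and "b = b0 + k" and "c = c0 + k" and "d = d0 + k"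
  have w: "w a > 0" "w b < 0" "w c > 0" "w d < 0" "w (a + P) > 0" "w (b + P) < 0" "w (c + P) > 0" "w (d + P) < 0"
    using * per periodic_int[of w P, OF per] by (auto simp: a_def b_def c_def d_def k_def)
  have o: "a < b" "b < c" "c < d" "d < a + P" "p - P \<le> a" "a < p" using * n by (auto simp: a_def b_def c_def d_def k_def)
  have chain: "achain w (-1) p 3 (p + P)"
    if "p < x1" "x1 < x2" "x2 < x3" "x3 < p + P" "w x1 < 0" "w x2 > 0" "w x3 < 0" for x1 x2 x3
    unfolding numeral_3_eq_3 achain.simps
    using that by (intro exI[of _ x3] exI[of _ x2] exI[of _ x1] conjI) auto
  have "p \<noteq> b" "p \<noteq> d" using w p by auto
  then consider "p < b" | "b < p" "p < d" | "d < p" by linarith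
  then show "achain w (-1) p 3 (p + P)"
  proof cases
    case 1
    show ?thesis by (rule chain[of b c d]) (use 1 o w in auto)
  next
    case 2
    show ?thesis by (rule chain[of d "a + P" "b + P"]) (use 2 o w in auto)
  next
    case 3
    show ?thesis by (rule chain[of "b + P" "c + P" "d + P"]) (use 3 o w in auto)
  qed
qed

lemma continuous_time_sign:
  fixes w :: "real \<Rightarrow> real \<Rightarrow> real"
  assumes "continuous_on (I \<times> UNIV) (\<lambda>(t, x). w t x)" "open I" "t \<in> I" "w t x > 0"
  shows "\<exists>d>0. \<forall>t'. \<bar>t' - t\<bar> < d \<longrightarrow> t' \<in> I \<and> w t' x > 0"
proof -
  obtain d where "d > 0" and d: "\<And>h. \<bar>h\<bar> < d \<Longrightarrow> t + h \<in> I \<and> (\<forall>y\<in>{x..x}. \<forall>z. \<bar>z - y\<bar> < d \<longrightarrow> \<bar>w (t + h) z - w t y\<bar> < w t x)"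
    using uniform_shift_limit[OF assms(1-4), of x x] by auto
  show ?thesis
  proof (intro exI[of _ d] conjI allI impI \<open>d > 0\<close>)
    fix t' assume "\<bar>t' - t\<bar> < d"
    from d[OF this] \<open>d > 0\<close> have "t' \<in> I" "\<bar>w t' x - w t x\<bar> < w t x" by auto
    then show "t' \<in> I" "w t' x > 0" by auto
  qed
qed

text \<open>A circle has no ends, so it is cut at a point where \<open>w\<close> does not vanish.
  The sign at the cut persists only for a short time; Bolzano bisection joins the local statements,
  each with its own cut, and \<open>nz\<close> provides a cut at every time.\<close>

lemma alt4_decreasing:
  assumes ls: "lsol K 0 I w wx v r" and K: "K \<ge> 0" and P: "P > 0"
    and per: "\<And>t x. t \<in> I \<Longrightarrow> w t (x + P) = w t x"
    and st: "s \<le> t" "{s..t} \<subseteq> I" and nz: "\<And>\<tau>. \<tau> \<in> {s..t} \<Longrightarrow> \<exists>x. w \<tau> x \<noteq> 0"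
    and alt: "alt4 P (w t)"
  shows "alt4 P (w s)"
proof -
  have I: "open I" using evolD(1)[OF lsolD(1)[OF ls]] .
  have local: "\<exists>d>0. \<forall>a b. a \<le> \<tau> \<and> \<tau> \<le> b \<and> b - a < d \<longrightarrow> alt4 P (w b) \<longrightarrow> alt4 P (w a)"
    if ls: "lsol K 0 I w wx v r" and per: "\<And>t x. t \<in> I \<Longrightarrow> w t (x + P) = w t x" and \<tau>: "\<tau> \<in> I" and x: "w \<tau> x > 0"
    for w wx v r \<tau> x
  proof -
    note D = evolD[OF lsolD(1)[OF ls]]
    obtain d where d: "d > 0" "\<And>t'. \<bar>t' - \<tau>\<bar> < d \<Longrightarrow> t' \<in> I \<and> w t' x > 0"
      using continuous_time_sign[OF D(2,1) \<tau> x] by auto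
    show ?thesis
    proof (intro exI[of _ d] conjI allI impI d(1))
      fix a b assume ab: "a \<le> \<tau> \<and> \<tau> \<le> b \<and> b - a < d" and alt: "alt4 P (w b)"
      have in_d: "t' \<in> I \<and> w t' x > 0" if "t' \<in> {a..b}" for t' using d(2)[of t'] that ab by auto
      have "achain (w b) (-1) x 3 (x + P)"
        using alt4_iff_achain[of "w b" P x] per P in_d[of b] ab alt by auto
      then have "achain (w a) (-1) x 3 (x + P)"
      proof (rule achain_decreasing[OF ls K, rotated -1])
        fix t' assume t': "t' \<in> {a..b}"
        have pos: "w t' x > 0" and "w t' (x + P) = w t' x" using in_d[OF t'] per by auto
        then show "- 1 * w t' x \<le> 0" "- 1 * (- 1) ^ (3 - 1) * w t' (x + P) \<le> 0" by auto
      qed (use ab P in_d in auto)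
      then show "alt4 P (w a)"
        using alt4_iff_achain[of "w a" P x] per P in_d[of a] ab by auto
    qed
  qed
  have "s \<le> s \<and> t \<le> t \<longrightarrow> alt4 P (w t) \<longrightarrow> alt4 P (w s)"
  proof (rule Bolzano[OF st(1), of "\<lambda>a b. s \<le> a \<and> b \<le> t \<longrightarrow> alt4 P (w b) \<longrightarrow> alt4 P (w a)"])
    fix \<tau> assume \<tau>: "s \<le> \<tau>" "\<tau> \<le> t"
    then have \<tau>I: "\<tau> \<in> I" using st by auto
    obtain x where "w \<tau> x \<noteq> 0" using nz[of \<tau>] \<tau> by auto
    then consider "w \<tau> x > 0" | "- w \<tau> x > 0" by linarith
    then show "\<exists>d>0. \<forall>a b. a \<le> \<tau> \<and> \<tau> \<le> b \<and> b - a < d \<longrightarrow> (s \<le> a \<and> b \<le> t \<longrightarrow> alt4 P (w b) \<longrightarrow> alt4 P (w a))"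
    proof cases
      case 1
      then show ?thesis using local[OF ls per \<tau>I] by blast
    next
      case 2
      from local[OF lsol_minus[OF ls] _ \<tau>I 2] per obtain d where d: "d > 0"
        "\<And>a b. a \<le> \<tau> \<Longrightarrow> \<tau> \<le> b \<Longrightarrow> b - a < d \<Longrightarrow> alt4 P (\<lambda>x. - w b x) \<Longrightarrow> alt4 P (\<lambda>x. - w a x)" by auto
      have "alt4 P (\<lambda>x. - w t' x) \<longleftrightarrow> alt4 P (w t')" if "s \<le> t'" "t' \<le> t" for t'
        using alt4_minus[of "w t'" P] per that st by auto
      then have "\<forall>a b. a \<le> \<tau> \<and> \<tau> \<le> b \<and> b - a < d \<longrightarrow> (s \<le> a \<and> b \<le> t \<longrightarrow> alt4 P (w b) \<longrightarrow> alt4 P (w a))"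
        using d(2) \<tau> by (meson order_trans)
      then show ?thesis using d(1) by blast
    qed
  qed auto
  then show ?thesis using alt by simp
qed

section \<open>Generic simplicity of zeros\<close>

text \<open>Minimising \<open>x - \<kappa> t\<close> over the zero set of \<open>w\<close> gives a time at which, in a frame moving with speed
  \<open>\<kappa>\<close>, the region left of the first zero is free of zeros; the Hopf lemma then applies at that zero.\<close>

lemma simple_zeros_on_arc:
  assumes ls: "lsol K 0 I w wx v r" and K: "K \<ge> 0" and t12: "t1 < t2" "{t1..t2} \<subseteq> I" and pq: "p < q"
    and p: "\<And>t. t \<in> {t1..t2} \<Longrightarrow> w t p < 0" and q: "\<And>t. t \<in> {t1..t2} \<Longrightarrow> w t q > 0"
    and nodown: "\<And>t x y. t \<in> {t1..t2} \<Longrightarrow> p \<le> x \<Longrightarrow> x < y \<Longrightarrow> y \<le> q \<Longrightarrow> w t x > 0 \<Longrightarrow> w t y \<ge> 0"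
  shows "\<exists>t\<in>{t1..t2}. \<forall>x\<in>{p..q}. w t x = 0 \<longrightarrow> wx t x \<noteq> 0"
proof -
  note D = evolD[OF lsolD(1)[OF ls]]
  \<comment> \<open>Fast enough that any zero at time \<open>t2\<close> has a smaller value of
    \<open>x - \<kappa> * t\<close> than every zero at time \<open>t1\<close>. So the minimum is
    attained after \<open>t1\<close>, and a time interval before it is available for the Hopf
    lemma.\<close>
  define \<kappa> where "\<kappa> = (q - p) / (t2 - t1) + 1"
  have "\<kappa> * (t2 - t1) = (q - p) + (t2 - t1)" using t12 by (simp add: \<kappa>_def distrib_right)
  moreover have "(q - p) / (t2 - t1) > 0" using t12 pq by (intro divide_pos_pos) auto
  ultimately have \<kappa>: "\<kappa> > 0" "\<kappa> * (t2 - t1) > q - p" using t12 unfolding \<kappa>_def by linarith+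
  define Z where "Z = ({t1..t2} \<times> {p..q}) \<inter> (\<lambda>(t, x). w t x) -` {0}"
  have zero: "\<exists>x\<in>{p..y}. w t x = 0" if t: "t \<in> {t1..t2}" and y: "p \<le> y" "y \<le> q" "w t y \<ge> 0" for t y
    using IVT'[of "w t" p 0 y] p[OF t] D(9)[of t] t t12 y by fastforce
  have "compact Z"
  proof -
    have "continuous_on ({t1..t2} \<times> {p..q}) (\<lambda>(t, x). w t x)"
      by (rule continuous_on_subset[OF D(2)]) (use t12 in auto)
    then have "closed Z" unfolding Z_def
      by (intro continuous_closed_preimage) (auto intro!: closed_Times)
    moreover have "bounded Z" unfolding Z_def
      by (rule bounded_subset[of "{t1..t2} \<times> {p..q}"]) (auto intro!: bounded_Times)
    ultimately show ?thesis using compact_eq_bounded_closed by blast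
  qed
  moreover have "Z \<noteq> {}" using zero[of t1 q] q[of t1] t12 pq by (fastforce simp: Z_def)
  moreover have "continuous_on Z (\<lambda>z. snd z - \<kappa> * fst z)" by (intro continuous_intros)
  ultimately obtain z where z: "z \<in> Z" "\<And>z'. z' \<in> Z \<Longrightarrow> snd z - \<kappa> * fst z \<le> snd z' - \<kappa> * fst z'"
    using continuous_attains_inf[of Z "\<lambda>z. snd z - \<kappa> * fst z"] by blast
  obtain ts xs where ztx: "z = (ts, xs)" by (cases z)
  have ts: "ts \<in> {t1..t2}" and xs: "xs \<in> {p..q}" and w0: "w ts xs = 0" using z(1) by (auto simp: Z_def ztx)
  have min: "xs - \<kappa> * ts \<le> x - \<kappa> * t" if "t \<in> {t1..t2}" "x \<in> {p..q}" "w t x = 0" for t x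
    using z(2)[of "(t, x)"] that by (auto simp: Z_def ztx)
  have pxs: "p < xs" using p[OF ts] w0 xs by (cases "xs = p") auto
  have tst1: "t1 < ts"
  proof (rule ccontr)
    assume "\<not> ?thesis"
    then have "ts = t1" using ts by simp
    obtain x where "x \<in> {p..q}" "w t2 x = 0" using zero[of t2 q] q[of t2] t12 pq by force
    then have "xs - \<kappa> * t1 \<le> q - \<kappa> * t2" using min[of t2 x] t12 \<open>ts = t1\<close> by auto
    then show False using \<kappa>(2) xs by (simp add: algebra_simps)
  qed
  have neg: "w t x < 0" if t: "t \<in> {t1..t2}" and x: "p \<le> x" "x < xs + \<kappa> * (t - ts)" "x \<le> q" for t x
  proof (rule ccontr)
    assume "\<not> ?thesis"
    then obtain y where y: "y \<in> {p..x}" "w t y = 0" using zero[OF t, of x] x by force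
    then have "xs - \<kappa> * ts \<le> y - \<kappa> * t" using min[OF t, of y] x by auto
    then show False using x y by (simp add: algebra_simps)
  qed
  \<comment> \<open>Half of the distance from \<open>p\<close> to \<open>xs\<close> is reserved for
    the space variable, half for the motion of the frame, so that the region considered does not
    leave the arc.\<close>
  define \<rho> where "\<rho> = (xs - p) / 2"
  have \<rho>: "\<rho> > 0" using pxs by (simp add: \<rho>_def)
  define d where "d = min (ts - t1) (\<rho> / \<kappa>)"
  have d: "d > 0" "d \<le> ts - t1" "\<kappa> * d \<le> \<rho>" using tst1 \<rho> \<kappa> by (auto simp: d_def min_def field_simps)
  \<comment> \<open>\<open>y\<close> measures the distance to the left of the moving line through
    \<open>(ts, xs)\<close>, and the sign is reversed. So \<open>?W\<close> is positive for small
    \<open>y > 0\<close>, and the Hopf lemma applies at \<open>y = 0\<close>.\<close>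
  let ?W = "\<lambda>t y. - w t (- 1 * y + ((xs - \<kappa> * ts) + \<kappa> * t))"
  have lsW: "lsol (K + \<bar>\<kappa>\<bar>) 0 I ?W (\<lambda>t y. - (- 1 * wx t (- 1 * y + ((xs - \<kappa> * ts) + \<kappa> * t))))
     (\<lambda>t y. - v t (- 1 * y + ((xs - \<kappa> * ts) + \<kappa> * t)))
     (\<lambda>t y. - (r t (- 1 * y + ((xs - \<kappa> * ts) + \<kappa> * t)) + \<kappa> * wx t (- 1 * y + ((xs - \<kappa> * ts) + \<kappa> * t))))"
    by (rule lsol_minus[OF lsol_affine[OF ls]]) simp
  note DW = evolD[OF lsolD(1)[OF lsW]]
  have subI: "{ts - d..ts} \<subseteq> I" using d ts t12 by auto
  have Wpos: "?W t y > 0" if t: "t \<in> {ts - d..ts}" and y: "0 < y" "y \<le> \<rho>" for t y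
  proof -
    have t': "t \<in> {t1..t2}" using t d ts by auto
    have "\<kappa> * (ts - t) \<le> \<kappa> * d" using t \<kappa> by (intro mult_left_mono) auto
    then have 1: "\<kappa> * (ts - t) \<le> \<rho>" using d by linarith
    have 2: "\<kappa> * (t - ts) \<le> 0" using t \<kappa> by (simp add: mult_nonneg_nonpos)
    have "w t (xs + \<kappa> * (t - ts) - y) < 0"
      by (rule neg[OF t']) (use 1 2 y xs in \<open>auto simp: \<rho>_def algebra_simps\<close>)
    then show ?thesis by (simp add: algebra_simps)
  qed
  have Wnn: "?W t y \<ge> 0" if t: "t \<in> {ts - d..ts}" and y: "y \<in> {0..\<rho>}" for t y
  proof (cases "y = 0")
    case True
    show ?thesis
    proof (rule ccontr)
      assume n: "\<not> ?thesis"
      have tI: "t \<in> I" using t subI by auto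
      have "continuous_on {0..\<rho>} (?W t)" by (rule DW(9)[OF tI])
      from IVT'[of "?W t" 0 0 \<rho>, OF _ _ _ this] n Wpos[OF t, of \<rho>] \<rho> True
      obtain y' where y': "0 \<le> y'" "y' \<le> \<rho>" "?W t y' = 0" by auto
      then have "y' \<noteq> 0" using n True by auto
      then show False using Wpos[OF t, of y'] y' by auto
    qed
  qed (use Wpos[OF t, of y] y in auto)
  have wx1: "wx ts xs > 0"
  proof -
    have "0 < - (- 1 * wx ts (- 1 * 0 + ((xs - \<kappa> * ts) + \<kappa> * ts)))"
      by (rule strong_positivity_right(2)[OF lsW _ d(1) subI Wnn]) (use K \<rho> Wpos w0 in auto)
    then show ?thesis by simp
  qed
  \<comment> \<open>There is no other zero at time \<open>ts\<close>: just right of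
    \<open>xs\<close> the function is positive, also shortly before; since it cannot become negative
    again up to \<open>q\<close>, the strong maximum principle makes it positive.\<close>
  have "wx ts x \<noteq> 0" if x: "x \<in> {p..q}" "w ts x = 0" for x
  proof (cases "x = xs")
    case False
    have tsI: "ts \<in> I" using ts t12 by auto
    have "xs \<le> x" using min[OF ts x] by simp
    then have xsx: "xs < x" using False by simp
    obtain \<delta> where \<delta>: "\<delta> > 0" "\<And>h. h > 0 \<Longrightarrow> h < \<delta> \<Longrightarrow> w ts xs < w ts (xs + h)"
      using DERIV_pos_inc_right[OF D(4)[OF tsI] wx1] by blast
    define h where "h = min (\<delta> / 2) ((x - xs) / 2)"
    have h: "0 < h" "h < \<delta>" "h \<le> (x - xs) / 2" using \<delta>(1) xsx unfolding h_def min_def by (auto split: if_splits)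
    define y where "y = xs + h"
    have y: "xs < y" "y < x" "w ts y > 0"
      using \<delta>(2)[OF h(1,2)] h xsx w0 by (auto simp: y_def field_simps)
    obtain d' where d': "d' > 0" "\<And>t'. \<bar>t' - ts\<bar> < d' \<Longrightarrow> t' \<in> I \<and> w t' y > 0"
      using continuous_time_sign[OF D(2,1) tsI y(3)] by auto
    define e where "e = min (d' / 2) (ts - t1)"
    have e: "e > 0" "e < d'" "e \<le> ts - t1" using d' tst1 by (auto simp: e_def)
    have in12: "t \<in> {t1..t2}" if "t \<in> {ts - e..ts}" for t using that e ts by auto
    have "w ts x > 0"
    proof (rule strong_positivity_right(1)[OF ls K e(1), of ts y q])
      show "{ts - e..ts} \<subseteq> I" using in12 t12 by blast
      show "w t x' \<ge> 0" if t: "t \<in> {ts - e..ts}" and x': "x' \<in> {y..q}" for t x'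
      proof -
        have "w t y > 0" using d'(2)[of t] t e by auto
        then show ?thesis using nodown[OF in12[OF t], of y x'] x' y pxs by (cases "x' = y") auto
      qed
      show "w t q > 0" if "t \<in> {ts - e..ts}" for t using q[OF in12[OF that]] .
    qed (use y x in auto)
    then show ?thesis using x by simp
  qed (use wx1 in simp)
  then show ?thesis using ts by blast
qed

text \<open>A negative point \<open>p\<close> and a positive point \<open>q\<close> that keep their
  signs for a while cut the circle into two arcs. Without four sign changes \<open>w\<close> crosses
  zero in one direction only on each arc, so \<open>simple_zeros_on_arc\<close> applies to both.
  What remains is to find one time that is good for both arcs.\<close>

lemma generic_simple_zeros:
  assumes ls: "lsol K 0 I w wx v r" and K: "K \<ge> 0" and P: "P > 0"
    and per: "\<And>t x. t \<in> I \<Longrightarrow> w t (x + P) = w t x"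
    and ab: "a < b" "{a..b} \<subseteq> I"
    and noalt: "\<And>t. t \<in> {a..b} \<Longrightarrow> \<not> alt4 P (w t)"
    and pos: "\<And>t. t \<in> {a..b} \<Longrightarrow> \<exists>x. w t x > 0" and neg: "\<And>t. t \<in> {a..b} \<Longrightarrow> \<exists>x. w t x < 0"
  shows "\<exists>t\<in>{a..b}. \<forall>x. w t x = 0 \<longrightarrow> wx t x \<noteq> 0"
proof (rule ccontr)
  assume no: "\<not> ?thesis"
  note D = evolD[OF lsolD(1)[OF ls]]
  define m where "m = (a + b) / 2"
  have m: "m \<in> {a<..<b}" "m \<in> I" using ab by (auto simp: m_def)
  obtain p where p: "w m p < 0" using neg[of m] m by auto
  obtain q0 where q0: "w m q0 > 0" using pos[of m] m by auto
  obtain n :: int where n: "p \<le> q0 + of_int n * P" "q0 + of_int n * P < p + P"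
    using periodic_representative[OF P, of p q0] by auto
  define q where "q = q0 + of_int n * P"
  have q: "w m q > 0" using q0 periodic_int[of "w m" P q0 n] per m by (simp add: q_def)
  have pq: "p < q" "q < p + P" using n p q by (auto simp: q_def[symmetric] less_le)
  obtain d1 where d1: "d1 > 0" "\<And>t'. \<bar>t' - m\<bar> < d1 \<Longrightarrow> t' \<in> I \<and> w t' q > 0"
    using continuous_time_sign[OF D(2,1) m(2) q] by auto
  note Dm = evolD[OF lsolD(1)[OF lsol_minus[OF ls]]]
  have "- w m p > 0" using p by simp
  from continuous_time_sign[OF Dm(2,1) m(2) this] obtain d2 where d2: "d2 > 0" "\<And>t'. \<bar>t' - m\<bar> < d2 \<Longrightarrow> w t' p < 0"
    by auto
  define d where "d = min (min d1 d2) (b - m) / 2"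
  have d: "d > 0" "d < d1" "d < d2" "d < b - m" using d1 d2 m by (auto simp: d_def min_def)
  have sub: "t \<in> {a..b}" if "t \<in> {m..m + d}" for t using that d m by auto
  have wp: "w t p < 0" and wq: "w t q > 0" and tI: "t \<in> I" if "t \<in> {m..m + d}" for t
    using d1(2)[of t] d2(2)[of t] that d by auto
  have perp: "w t (p + P) < 0" if "t \<in> {m..m + d}" for t using wp[OF that] per[OF tI[OF that]] by simp
  have nd1: "w t y \<ge> 0" if t: "t \<in> {m..m + d}" and xy: "p \<le> x" "x < y" "y \<le> q" "w t x > 0" for t x y
  proof (rule ccontr)
    assume n: "\<not> ?thesis"
    have "alt4 P (w t)"
    proof (rule alt4I'[of "w t" P p x y q])
      show "p < x" using xy wp[OF t] by (cases "p = x") auto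
      show "y < q" using xy n wq[OF t] by (cases "y = q") auto
    qed (use n xy pq wp[OF t] wq[OF t] per[OF tI[OF t]] in auto)
    then show False using noalt[OF sub[OF t]] by simp
  qed
  have nd2: "- w t y \<ge> 0" if t: "t \<in> {m..m + d}" and xy: "q \<le> x" "x < y" "y \<le> p + P" "- w t x > 0" for t x y
  proof (rule ccontr)
    assume n: "\<not> ?thesis"
    have "alt4 P (w t)"
    proof (rule alt4I[of q x y "p + P"])
      show "q < x" using xy wq[OF t] by (cases "q = x") auto
      show "y < p + P" using xy n perp[OF t] by (cases "y = p + P") auto
    qed (use n xy pq perp[OF t] wq[OF t] in auto)
    then show False using noalt[OF sub[OF t]] by simp
  qed
  have arc: "(\<exists>x\<in>{p..q}. w t x = 0 \<and> wx t x = 0) \<or> (\<exists>x\<in>{q..p + P}. w t x = 0 \<and> wx t x = 0)"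
    if t: "t \<in> {m..m + d}" for t
  proof -
    obtain x where x: "w t x = 0" "wx t x = 0" using no sub[OF t] by blast
    obtain n :: int where n: "p \<le> x + of_int n * P" "x + of_int n * P < p + P"
      using periodic_representative[OF P, of p x] by auto
    have wxper: "wx t (y + P) = wx t y" for y
      using periodic_derivative[of "w t" P "wx t" y] per[OF tI[OF t]] D(4)[OF tI[OF t]] by simp
    have "w t (x + of_int n * P) = 0" "wx t (x + of_int n * P) = 0"
      using x periodic_int[of "w t" P, OF per[OF tI[OF t]]] periodic_int[of "wx t" P, OF wxper] by auto
    then show ?thesis using n by (cases "x + of_int n * P \<le> q") (auto intro!: bexI[of _ "x + of_int n * P"])
  qed
  \<comment> \<open>Times with a degenerate zero on the first arc: a projection of a compact set,
    hence closed. One good time therefore comes with an interval of good times, on which the second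
    arc can be treated.\<close>
  define D1 where "D1 = {t \<in> {m..m + d}. \<exists>x\<in>{p..q}. w t x = 0 \<and> wx t x = 0}"
  have closedD1: "closed D1"
  proof -
    let ?C = "({m..m + d} \<times> {p..q}) \<inter> ((\<lambda>(t, x). w t x) -` {0} \<inter> (\<lambda>(t, x). wx t x) -` {0})"
    have sb: "{m..m + d} \<times> {p..q} \<subseteq> I \<times> UNIV" using tI by auto
    have "closed (({m..m + d} \<times> {p..q}) \<inter> (\<lambda>(t, x). w t x) -` {0})" "closed (({m..m + d} \<times> {p..q}) \<inter> (\<lambda>(t, x). wx t x) -` {0})"
      by (intro continuous_closed_preimage continuous_on_subset[OF D(2) sb] continuous_on_subset[OF D(3) sb] closed_Times closed_atLeastAtMost closed_singleton)+
    from closed_Int[OF this] have "closed ?C" by (rule back_subst) auto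
    moreover have "bounded ?C"
      by (rule bounded_subset[of "{m..m + d} \<times> {p..q}"]) (auto intro!: bounded_Times)
    ultimately have "compact ?C" using compact_eq_bounded_closed by blast
    then have "compact (fst ` ?C)" by (intro compact_continuous_image continuous_intros)
    moreover have "fst ` ?C = D1" by (force simp: D1_def image_iff)
    ultimately show ?thesis using compact_imp_closed by metis
  qed
  show False
  proof (cases "D1 = {m..m + d}")
    case True
    have "\<exists>t\<in>{m..m + d}. \<forall>x\<in>{p..q}. w t x = 0 \<longrightarrow> wx t x \<noteq> 0"
      by (rule simple_zeros_on_arc[OF ls K]) (use d pq wp wq nd1 tI in auto)
    then show False using True unfolding D1_def by blast
  next
    case False
    then obtain t0 where t0: "t0 \<in> {m..m + d}" "t0 \<notin> D1" unfolding D1_def by blast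
    then obtain e where e: "e > 0" "ball t0 e \<inter> D1 = {}"
      using closedD1 by (metis Compl_iff disjoint_eq_subset_Compl inf_commute open_Compl openE subset_Compl_self_eq compl_le_swap1)
    define u1 u2 where "u1 = max m (t0 - e / 2)" and "u2 = min (m + d) (t0 + e / 2)"
    have u: "u1 < u2" "m \<le> u1" "u2 \<le> m + d" using t0 e d by (auto simp: u1_def u2_def)
    have sub': "t \<in> {m..m + d}" "t \<notin> D1" if "t \<in> {u1..u2}" for t
    proof -
      show "t \<in> {m..m + d}" using that u by auto
      have "t0 - e / 2 \<le> t" "t \<le> t0 + e / 2" using that by (auto simp: u1_def u2_def)
      then have "\<bar>t - t0\<bar> \<le> e / 2" by linarith
      then have "\<bar>t0 - t\<bar> < e" using e(1) by linarith
      then have "t \<in> ball t0 e" by (simp add: dist_real_def)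
      then show "t \<notin> D1" using e by blast
    qed
    have "\<exists>t\<in>{u1..u2}. \<forall>x\<in>{q..p + P}. - w t x = 0 \<longrightarrow> - wx t x \<noteq> 0"
    proof (rule simple_zeros_on_arc[OF lsol_minus[OF ls] K u(1)])
      show "{u1..u2} \<subseteq> I" using sub' tI by blast
      show "- w t q < 0" "- w t (p + P) > 0" if "t \<in> {u1..u2}" for t using wq perp sub'[OF that] by auto
      show "0 \<le> - w t y" if "t \<in> {u1..u2}" "q \<le> x" "x < y" "y \<le> p + P" "0 < - w t x" for t x y
        using nd2[OF sub'(1)[OF that(1)]] that by auto
    qed (use pq in auto)
    then obtain t where t: "t \<in> {u1..u2}" "\<forall>x\<in>{q..p + P}. w t x = 0 \<longrightarrow> wx t x \<noteq> 0" by auto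
    then show False using arc[OF sub'(1)[OF t(1)]] sub'[OF t(1)] unfolding D1_def by blast
  qed
qed

text \<open>\<open>max \<bar>w x\<bar> (wx x)\<close> has a positive minimum
  \<open>\<epsilon>\<close> on the interval. A function that is \<open>\<epsilon>\<close>-close
  together with its derivative therefore has positive slope at each of its own zeros and cannot
  leave the positive values.\<close>

lemma no_down_crossing_stable:
  fixes w wx :: "real \<Rightarrow> real"
  assumes pq: "p < q" and w: "continuous_on {p..q} w" "continuous_on {p..q} wx"
    and z: "\<And>x. x \<in> {p..q} \<Longrightarrow> w x = 0 \<Longrightarrow> wx x > 0"
  shows "\<exists>\<epsilon>>0. \<forall>u ux. (\<forall>x. (u has_real_derivative ux x) (at x)) \<and> (\<forall>x\<in>{p..q}. \<bar>u x - w x\<bar> < \<epsilon> \<and> \<bar>ux x - wx x\<bar> < \<epsilon>) \<longrightarrow>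
     (\<forall>x y. p \<le> x \<and> x < y \<and> y \<le> q \<and> u x > 0 \<longrightarrow> u y > 0)"
proof -
  have "continuous_on {p..q} (\<lambda>x. max \<bar>w x\<bar> (wx x))" by (intro continuous_intros w)
  from continuous_attains_inf[OF _ _ this] pq obtain x0 where x0: "x0 \<in> {p..q}"
    "\<And>x. x \<in> {p..q} \<Longrightarrow> max \<bar>w x0\<bar> (wx x0) \<le> max \<bar>w x\<bar> (wx x)" by auto
  define \<epsilon> where "\<epsilon> = max \<bar>w x0\<bar> (wx x0)"
  have \<epsilon>: "\<epsilon> > 0" using z[OF x0(1)] by (cases "w x0 = 0") (auto simp: \<epsilon>_def)
  have "u y > 0" if du: "\<And>x. (u has_real_derivative ux x) (at x)"
    and cl: "\<And>x. x \<in> {p..q} \<Longrightarrow> \<bar>u x - w x\<bar> < \<epsilon> \<and> \<bar>ux x - wx x\<bar> < \<epsilon>"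
    and xy: "p \<le> x" "x < y" "y \<le> q" "u x > 0" for u ux x y
  proof (rule ccontr)
    assume n: "\<not> u y > 0"
    have uc: "continuous_on A u" for A using du by (meson DERIV_isCont continuous_at_imp_continuous_on)
    define S where "S = {x..y} \<inter> u -` {..0}"
    have "closed S" unfolding S_def by (intro continuous_closed_preimage uc) auto
    moreover have "y \<in> S" using n xy by (auto simp: S_def)
    moreover have bb: "bdd_below S" by (auto simp: S_def intro: bdd_belowI[of _ x])
    ultimately have cS: "Inf S \<in> S" by (intro closed_contains_Inf) auto
    define c where "c = Inf S"
    have c: "x \<le> c" "c \<le> y" "u c \<le> 0" using cS by (auto simp: S_def c_def)
    have xc: "x < c" using c xy by (cases "x = c") auto
    have before: "u s > 0" if "x \<le> s" "s < c" for s
    proof (rule ccontr)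
      assume "\<not> ?thesis"
      then have "s \<in> S" using that c by (auto simp: S_def)
      then show False using cInf_lower[OF _ bb, of s] that by (simp add: c_def)
    qed
    have uc0: "u c = 0"
    proof (rule ccontr)
      assume "u c \<noteq> 0"
      then obtain s where "x \<le> s" "s \<le> c" "u s = 0" using IVT2'[of u c 0 x] c xy uc by fastforce
      then show False using before[of s] \<open>u c \<noteq> 0\<close> by (cases "s = c") auto
    qed
    have cpq: "c \<in> {p..q}" using c xy by auto
    have "\<bar>w c\<bar> < \<epsilon>" using cl[OF cpq] uc0 by simp
    then have "wx c \<ge> \<epsilon>" using x0(2)[OF cpq] by (auto simp: \<epsilon>_def max_def split: if_splits)
    then have "ux c > 0" using cl[OF cpq] by auto
    from DERIV_pos_inc_left[OF du this] obtain \<delta> where \<delta>: "\<delta> > 0" "\<And>h. h > 0 \<Longrightarrow> h < \<delta> \<Longrightarrow> u (c - h) < u c" by blast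
    define h where "h = min (\<delta> / 2) (c - x)"
    have "h > 0" "h < \<delta>" "h \<le> c - x" using \<delta>(1) xc by (auto simp: h_def)
    then show False using \<delta>(2)[of h] before[of "c - h"] uc0 by auto
  qed
  then show ?thesis using \<epsilon> by (intro exI[of _ \<epsilon>]) blast
qed

text \<open>The circle is cut at a positive and a negative point of \<open>w\<close>. On each arc
  all zeros have slopes of the same sign, since one of the wrong sign would bring two further sign
  changes. So \<open>no_down_crossing_stable\<close>, applied to \<open>w\<close> on one arc and to
  \<open>- w\<close> on the other, rules out new sign changes.\<close>

lemma alt4_stable:
  fixes w wx :: "real \<Rightarrow> real"
  assumes P: "P > 0" and per: "\<And>x. w (x + P) = w x"
    and dw: "\<And>x. (w has_real_derivative wx x) (at x)" and wxc: "continuous_on UNIV wx"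
    and noalt: "\<not> alt4 P w" and simple: "\<And>x. w x = 0 \<Longrightarrow> wx x \<noteq> 0"
    and pos: "\<exists>x. w x > 0" and neg: "\<exists>x. w x < 0"
  shows "\<exists>\<epsilon>>0. \<forall>u ux. (\<forall>x. (u has_real_derivative ux x) (at x)) \<and> (\<forall>x. u (x + P) = u x) \<and>
     (\<forall>x. \<bar>u x - w x\<bar> < \<epsilon> \<and> \<bar>ux x - wx x\<bar> < \<epsilon>) \<longrightarrow> \<not> alt4 P u"
proof -
  have wc: "continuous_on A w" for A using dw by (meson DERIV_isCont continuous_at_imp_continuous_on)
  obtain p where p: "w p > 0" using pos by auto
  obtain q0 where q0: "w q0 < 0" using neg by auto
  obtain n :: int where n: "p \<le> q0 + of_int n * P" "q0 + of_int n * P < p + P"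
    using periodic_representative[OF P, of p q0] by auto
  define q where "q = q0 + of_int n * P"
  have q: "w q < 0" using q0 periodic_int[of w P q0 n] per by (simp add: q_def)
  have pq: "p < q" "q < p + P" using n p q by (auto simp: q_def[symmetric] less_le)
  have wxq: "wx x > 0" if x: "x \<in> {q..p + P}" "w x = 0" for x
  proof (rule ccontr)
    assume "\<not> ?thesis"
    then have neg: "wx x < 0" using simple[OF x(2)] by simp
    have x': "q < x" "x < p + P" using x q p per[of p] by (auto simp: less_le)
    obtain \<delta>1 where \<delta>1: "\<delta>1 > 0" "\<And>h. h > 0 \<Longrightarrow> h < \<delta>1 \<Longrightarrow> w (x + h) < w x"
      using DERIV_neg_dec_right[OF dw neg] by blast
    obtain \<delta>2 where \<delta>2: "\<delta>2 > 0" "\<And>h. h > 0 \<Longrightarrow> h < \<delta>2 \<Longrightarrow> w x < w (x - h)"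
      using DERIV_neg_dec_left[OF dw neg] by blast
    define h1 h2 where "h1 = min (\<delta>1 / 2) ((p + P - x) / 2)" and "h2 = min (\<delta>2 / 2) ((x - q) / 2)"
    have h: "h1 > 0" "h1 < \<delta>1" "x + h1 < p + P" "h2 > 0" "h2 < \<delta>2" "q < x - h2"
      using \<delta>1(1) \<delta>2(1) x' by (auto simp: h1_def h2_def min_def field_simps)
    have "alt4 P w"
      by (rule alt4I[of p q "x - h2" "x + h1"]) (use h pq p q \<delta>1(2)[OF h(1,2)] \<delta>2(2)[OF h(4,5)] x in auto)
    then show False using noalt by simp
  qed
  have wxp: "- wx x > 0" if x: "x \<in> {p..q}" "- w x = 0" for x
  proof (rule ccontr)
    assume "\<not> ?thesis"
    then have pos: "wx x > 0" using simple[of x] x by auto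
    have x': "p < x" "x < q" using x q p by (auto simp: less_le)
    obtain \<delta>1 where \<delta>1: "\<delta>1 > 0" "\<And>h. h > 0 \<Longrightarrow> h < \<delta>1 \<Longrightarrow> w x < w (x + h)"
      using DERIV_pos_inc_right[OF dw pos] by blast
    obtain \<delta>2 where \<delta>2: "\<delta>2 > 0" "\<And>h. h > 0 \<Longrightarrow> h < \<delta>2 \<Longrightarrow> w (x - h) < w x"
      using DERIV_pos_inc_left[OF dw pos] by blast
    define h1 h2 where "h1 = min (\<delta>1 / 2) ((q - x) / 2)" and "h2 = min (\<delta>2 / 2) ((x - p) / 2)"
    have h: "h1 > 0" "h1 < \<delta>1" "x + h1 < q" "h2 > 0" "h2 < \<delta>2" "p < x - h2"
      using \<delta>1(1) \<delta>2(1) x' by (auto simp: h1_def h2_def min_def field_simps)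
    have "alt4 P w"
      by (rule alt4I[of p "x - h2" "x + h1" q]) (use h pq p q \<delta>1(2)[OF h(1,2)] \<delta>2(2)[OF h(4,5)] x in auto)
    then show False using noalt by simp
  qed
  obtain \<epsilon>1 where \<epsilon>1: "\<epsilon>1 > 0" "\<And>u ux. (\<forall>x. (u has_real_derivative ux x) (at x)) \<Longrightarrow>
     (\<forall>x\<in>{q..p + P}. \<bar>u x - w x\<bar> < \<epsilon>1 \<and> \<bar>ux x - wx x\<bar> < \<epsilon>1) \<Longrightarrow>
     (\<forall>x y. q \<le> x \<and> x < y \<and> y \<le> p + P \<and> u x > 0 \<longrightarrow> u y > 0)"
    using no_down_crossing_stable[of q "p + P" w wx] pq wc continuous_on_subset[OF wxc] wxq by (metis subset_UNIV)
  obtain \<epsilon>2 where \<epsilon>2: "\<epsilon>2 > 0" "\<And>u ux. (\<forall>x. (u has_real_derivative ux x) (at x)) \<Longrightarrow>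
     (\<forall>x\<in>{p..q}. \<bar>u x - - w x\<bar> < \<epsilon>2 \<and> \<bar>ux x - - wx x\<bar> < \<epsilon>2) \<Longrightarrow>
     (\<forall>x y. p \<le> x \<and> x < y \<and> y \<le> q \<and> u x > 0 \<longrightarrow> u y > 0)"
  proof -
    have "continuous_on {p..q} (\<lambda>x. - w x)" "continuous_on {p..q} (\<lambda>x. - wx x)"
      using wc continuous_on_subset[OF wxc] by (auto intro!: continuous_intros)
    from no_down_crossing_stable[OF pq(1) this wxp] that show ?thesis by metis
  qed
  define \<epsilon> where "\<epsilon> = min (min \<epsilon>1 \<epsilon>2) (w p)"
  have \<epsilon>: "\<epsilon> > 0" "\<epsilon> \<le> \<epsilon>1" "\<epsilon> \<le> \<epsilon>2" "\<epsilon> \<le> w p" using \<epsilon>1 \<epsilon>2 p by (auto simp: \<epsilon>_def)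
  have "\<not> alt4 P u" if du: "\<forall>x. (u has_real_derivative ux x) (at x)" and pu: "\<And>x. u (x + P) = u x"
    and cl: "\<And>x. \<bar>u x - w x\<bar> < \<epsilon> \<and> \<bar>ux x - wx x\<bar> < \<epsilon>" for u ux
  proof
    assume "alt4 P u"
    have up: "u p > 0" using cl[of p] \<epsilon> by auto
    obtain x1 x2 x3 where x: "p < x1" "x1 < x2" "x2 < x3" "x3 < p + P" "u x1 < 0" "u x2 > 0" "u x3 < 0"
      using alt4_iff_achain[OF pu P up] \<open>alt4 P u\<close> by (auto simp: numeral_3_eq_3)
    have c1: "\<forall>x\<in>{q..p + P}. \<bar>u x - w x\<bar> < \<epsilon>1 \<and> \<bar>ux x - wx x\<bar> < \<epsilon>1"
      using cl \<epsilon> by (meson less_le_trans)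
    have du': "\<forall>x. ((\<lambda>x. - u x) has_real_derivative - ux x) (at x)" using du by (auto intro: DERIV_minus)
    have c2: "\<forall>x\<in>{p..q}. \<bar>- u x - - w x\<bar> < \<epsilon>2 \<and> \<bar>- ux x - - wx x\<bar> < \<epsilon>2"
    proof
      fix x
      show "\<bar>- u x - - w x\<bar> < \<epsilon>2 \<and> \<bar>- ux x - - wx x\<bar> < \<epsilon>2" using cl[of x] \<epsilon> by (auto simp: abs_less_iff)
    qed
    have "x2 > q" using \<epsilon>2(2)[OF du' c2] x by (smt (verit))
    then show False using \<epsilon>1(2)[OF du c1] x by (smt (verit))
  qed
  then show ?thesis using \<epsilon>(1) by (intro exI[of _ \<epsilon>]) blast
qed

section \<open>Topology of the phase space\<close>

section \<open>Sequences in metrizable spaces\<close>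

lemma metrizable_compact_subsequence:
  assumes "metrizable_space X" "compact_space X" "range \<sigma> \<subseteq> topspace X"
  shows "\<exists>l r. l \<in> topspace X \<and> strict_mono (r :: nat \<Rightarrow> nat) \<and> limitin X (\<sigma> \<circ> r) l sequentially"
proof -
  obtain M d where M: "Metric_space M d" and X: "X = Metric_space.mtopology M d"
    using assms(1) unfolding metrizable_space_def by blast
  interpret Metric_space M d by (rule M)
  have "compactin mtopology M" using assms(2) by (simp add: X compact_space_def)
  then show ?thesis using compactin_sequentially[of M] assms(3) by (simp add: X)
qed

lemma metrizable_sequentially_closed:
  assumes "metrizable_space X" "S \<subseteq> topspace X"
    and "\<And>\<sigma> l. range \<sigma> \<subseteq> S \<Longrightarrow> limitin X \<sigma> l sequentially \<Longrightarrow> l \<in> S"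
  shows "closedin X S"
proof -
  obtain M d where M: "Metric_space M d" and X: "X = Metric_space.mtopology M d"
    using assms(1) unfolding metrizable_space_def by blast
  interpret Metric_space M d by (rule M)
  show ?thesis unfolding X metric_closedin_iff_sequentially_closed using assms(2,3) by (auto simp: X)
qed

lemma metrizable_sequentially_continuous:
  assumes X: "metrizable_space X" and f: "f \<in> topspace X \<rightarrow> topspace Y"
    and lim: "\<And>\<sigma> l. range \<sigma> \<subseteq> topspace X \<Longrightarrow> limitin X \<sigma> l sequentially \<Longrightarrow> limitin Y (\<lambda>n. f (\<sigma> n)) (f l) sequentially"
  shows "continuous_map X Y f"
  unfolding continuous_map_closedin
proof (intro conjI ballI allI impI)
  fix C assume C: "closedin Y C"
  show "closedin X {x \<in> topspace X. f x \<in> C}"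
  proof (rule metrizable_sequentially_closed[OF X])
    fix \<sigma> l assume \<sigma>: "range \<sigma> \<subseteq> {x \<in> topspace X. f x \<in> C}" and l: "limitin X \<sigma> l sequentially"
    have "limitin Y (\<lambda>n. f (\<sigma> n)) (f l) sequentially" by (rule lim[OF _ l]) (use \<sigma> in auto)
    then have "f l \<in> C" by (rule limitin_closedin[OF _ C]) (use \<sigma> in \<open>auto intro!: always_eventually\<close>)
    then show "l \<in> {x \<in> topspace X. f x \<in> C}" using limitin_topspace[OF l] by simp
  qed auto
qed (use f in auto)

lemma limitin_subsubsequence:
  assumes l: "l \<in> topspace X"
    and sub: "\<And>r :: nat \<Rightarrow> nat. strict_mono r \<Longrightarrow> \<exists>s :: nat \<Rightarrow> nat. strict_mono s \<and> limitin X (\<lambda>n. \<sigma> (r (s n))) l sequentially"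
  shows "limitin X \<sigma> l sequentially"
  unfolding limitin_def
proof (intro conjI allI impI l)
  fix U assume U: "openin X U \<and> l \<in> U"
  show "\<forall>\<^sub>F n in sequentially. \<sigma> n \<in> U"
  proof (rule ccontr)
    assume "\<not> ?thesis"
    then have "\<exists>\<^sub>F n in sequentially. \<sigma> n \<notin> U" by (simp add: frequently_def)
    then have inf: "infinite {n. \<sigma> n \<notin> U}" by (simp add: frequently_cofinite cofinite_eq_sequentially[symmetric])
    let ?r = "enumerate {n. \<sigma> n \<notin> U}"
    obtain s :: "nat \<Rightarrow> nat" where "limitin X (\<lambda>n. \<sigma> (?r (s n))) l sequentially"
      using sub[of ?r] strict_mono_enumerate[OF inf] by blast
    then have "\<forall>\<^sub>F n in sequentially. \<sigma> (?r (s n)) \<in> U" using U by (auto simp: limitin_def)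
    then obtain n where "\<sigma> (?r (s n)) \<in> U" by (auto simp: eventually_sequentially)
    then show False using enumerate_in_set[OF inf, of "s n"] by simp
  qed
qed

section \<open>The fractional power space\<close>

lemma C1_perD:
  assumes "u \<in> C1_per L"
  shows "u (x + L) = u x" and "(u has_real_derivative deriv u x) (at x)"
    and "continuous_on A (deriv u)" and "continuous_on A u"
proof -
  obtain D where D: "\<And>x. (u has_real_derivative D x) (at x)" "continuous_on UNIV D"
    using assms unfolding C1_per_def C1_differentiable_on_def by (auto simp: has_real_derivative_iff_has_vector_derivative)
  then have eq: "deriv u = D" using DERIV_imp_deriv by blast
  show "u (x + L) = u x" using assms by (auto simp: C1_per_def)
  show "(u has_real_derivative deriv u x) (at x)" using D(1) eq by simp
  show "continuous_on A (deriv u)" using D(2) eq continuous_on_subset by auto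
  show "continuous_on A u" using D(1) by (meson DERIV_isCont continuous_at_imp_continuous_on)
qed

lemma C1_perI:
  assumes "\<And>x. u (x + L) = u x" "\<And>x. (u has_real_derivative D x) (at x)" "continuous_on UNIV D"
  shows "u \<in> C1_per L" and "deriv u = D"
proof -
  show "u \<in> C1_per L" using assms unfolding C1_per_def C1_differentiable_on_def
    by (auto simp: has_real_derivative_iff_has_vector_derivative)
  show "deriv u = D" using assms(2) DERIV_imp_deriv by blast
qed

lemma C1_per_diff:
  assumes "u \<in> C1_per L" "v \<in> C1_per L"
  shows "(\<lambda>x. u x - v x) \<in> C1_per L" and "deriv (\<lambda>x. u x - v x) = (\<lambda>x. deriv u x - deriv v x)"
proof -
  have *: "((\<lambda>x. u x - v x) has_real_derivative deriv u x - deriv v x) (at x)" for x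
    by (intro derivative_intros C1_perD(2)[OF assms(1)] C1_perD(2)[OF assms(2)])
  have c: "continuous_on UNIV (\<lambda>x. deriv u x - deriv v x)" using assms by (intro continuous_intros C1_perD(3))
  have p: "u (x + L) - v (x + L) = u x - v x" for x using assms by (simp add: C1_perD(1))
  show "(\<lambda>x. u x - v x) \<in> C1_per L" "deriv (\<lambda>x. u x - v x) = (\<lambda>x. deriv u x - deriv v x)"
    using C1_perI[of "\<lambda>x. u x - v x", OF p * c] .
qed

lemma C1_per_cmult:
  assumes "u \<in> C1_per L"
  shows "(\<lambda>x. c * u x) \<in> C1_per L" and "deriv (\<lambda>x. c * u x) = (\<lambda>x. c * deriv u x)"
proof -
  have *: "((\<lambda>x. c * u x) has_real_derivative c * deriv u x) (at x)" for x
    using DERIV_cmult[OF C1_perD(2)[OF assms]] .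
  have c: "continuous_on UNIV (\<lambda>x. c * deriv u x)" using assms by (intro continuous_intros C1_perD(3))
  have p: "c * u (x + L) = c * u x" for x using assms by (simp add: C1_perD(1))
  show "(\<lambda>x. c * u x) \<in> C1_per L" "deriv (\<lambda>x. c * u x) = (\<lambda>x. c * deriv u x)"
    using C1_perI[of "\<lambda>x. c * u x", OF p * c] .
qed

lemma periodic_bounded:
  fixes u :: "real \<Rightarrow> real"
  assumes "L > 0" "\<And>x. u (x + L) = u x" "continuous_on UNIV u"
  shows "\<exists>B. \<forall>x. \<bar>u x\<bar> \<le> B"
proof -
  have "compact (u ` {0..L})" by (intro compact_continuous_image continuous_on_subset[OF assms(3)]) auto
  then obtain B where B: "\<And>x. x \<in> {0..L} \<Longrightarrow> \<bar>u x\<bar> \<le> B"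
    by (metis bounded_iff compact_imp_bounded image_eqI real_norm_def)
  have "\<bar>u x\<bar> \<le> B" for x
  proof -
    obtain n :: int where "0 \<le> x + of_int n * L" "x + of_int n * L < 0 + L" using periodic_representative[OF assms(1), of 0 x] by auto
    then show ?thesis using B[of "x + of_int n * L"] periodic_int[of u L, OF assms(2)] by simp
  qed
  then show ?thesis by blast
qed

definition frac_term :: "real \<Rightarrow> real \<Rightarrow> (real \<Rightarrow> real) \<Rightarrow> int \<Rightarrow> real" where
  "frac_term L \<alpha> u k = (1 + circle_eigenvalue L k) powr \<alpha> * cmod (fourier_coeff L u k)"

lemma frac_term_nonneg: "0 \<le> frac_term L \<alpha> u k" by (simp add: frac_term_def)

lemma fourier_coeff_diff:
  assumes "continuous_on {0..L} u" "continuous_on {0..L} v"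
  shows "fourier_coeff L (\<lambda>x. u x - v x) k = fourier_coeff L u k - fourier_coeff L v k"
proof -
  have c: "continuous_on {0..L} (\<lambda>x. cnj (circle_char L k x))"
    using circle_char_deriv[of L k]
    by (intro continuous_intros continuous_at_imp_continuous_on ballI has_vector_derivative_continuous) auto
  have "(\<lambda>x. of_real (u x) * cnj (circle_char L k x)) absolutely_integrable_on {0..L}"
    "(\<lambda>x. of_real (v x) * cnj (circle_char L k x)) absolutely_integrable_on {0..L}"
    using assms by (intro absolutely_integrable_continuous_real continuous_intros c; simp)+
  from set_integral_diff(2)[OF this] show ?thesis
    unfolding fourier_coeff_def by (simp add: algebra_simps)
qed

lemma frac_term_diff:
  assumes "continuous_on {0..L} u" "continuous_on {0..L} v"
  shows "frac_term L \<alpha> (\<lambda>x. u x - v x) k \<le> frac_term L \<alpha> u k + frac_term L \<alpha> v k"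
  unfolding frac_term_def fourier_coeff_diff[OF assms] distrib_left[symmetric]
  by (intro mult_left_mono norm_triangle_ineq4) auto

lemma frac_term_cmult: "frac_term L \<alpha> (\<lambda>x. c * u x) k = \<bar>c\<bar> * frac_term L \<alpha> u k"
proof -
  have "fourier_coeff L (\<lambda>x. c * u x) k = of_real c * fourier_coeff L u k"
    unfolding fourier_coeff_def set_integral_mult_right[symmetric] by (simp add: mult.assoc)
  then show ?thesis by (simp add: frac_term_def norm_mult mult_ac)
qed

lemma frac_space_alt:
  assumes "L > 0"
  shows "u \<in> frac_space L \<alpha> \<longleftrightarrow> u \<in> C1_per L \<and> (\<lambda>k. (frac_term L \<alpha> u k)\<^sup>2) summable_on UNIV"
proof -
  have "u \<in> L2_per L" if u: "u \<in> C1_per L"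
  proof -
    have "u \<in> borel_measurable lebesgue"
      using borel_measurable_continuous_onI[OF C1_perD(4)[OF u]] by (simp add: measurable_completion)
    moreover have "(\<lambda>x. (u x)\<^sup>2) absolutely_integrable_on {0..L}"
      by (intro absolutely_integrable_continuous_real continuous_intros C1_perD(4)[OF u])
    ultimately show ?thesis using C1_perD(1)[OF u] by (auto simp: L2_per_def)
  qed
  then show ?thesis by (auto simp: frac_space_def frac_domain_def frac_term_def)
qed

lemma frac_norm_alt: "frac_norm L \<alpha> u = sqrt (\<Sum>\<^sub>\<infinity>k. (frac_term L \<alpha> u k)\<^sup>2)"
  by (simp add: frac_norm_def frac_term_def)

lemma frac_norm_nonneg: "0 \<le> frac_norm L \<alpha> u"
  unfolding frac_norm_alt by (intro real_sqrt_ge_zero infsum_nonneg) simp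

lemma Minkowski_infsum:
  fixes a b c :: "'i \<Rightarrow> real"
  assumes "\<And>k. 0 \<le> a k" "\<And>k. a k \<le> b k + c k" "\<And>k. 0 \<le> b k" "\<And>k. 0 \<le> c k"
    and "(\<lambda>k. (b k)\<^sup>2) summable_on UNIV" "(\<lambda>k. (c k)\<^sup>2) summable_on UNIV"
  shows "(\<lambda>k. (a k)\<^sup>2) summable_on UNIV"
    and "sqrt (\<Sum>\<^sub>\<infinity>k. (a k)\<^sup>2) \<le> sqrt (\<Sum>\<^sub>\<infinity>k. (b k)\<^sup>2) + sqrt (\<Sum>\<^sub>\<infinity>k. (c k)\<^sup>2)"
proof -
  let ?S = "sqrt (\<Sum>\<^sub>\<infinity>k. (b k)\<^sup>2) + sqrt (\<Sum>\<^sub>\<infinity>k. (c k)\<^sup>2)"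
  have S: "0 \<le> ?S" by (intro add_nonneg_nonneg real_sqrt_ge_zero infsum_nonneg) auto
  have fin: "(\<Sum>k\<in>F. (a k)\<^sup>2) \<le> ?S\<^sup>2" if "finite F" for F
  proof -
    have "sqrt (\<Sum>k\<in>F. (a k)\<^sup>2) \<le> L2_set (\<lambda>k. b k + c k) F"
      unfolding L2_set_def by (intro real_sqrt_le_mono sum_mono power_mono assms)
    also have "\<dots> \<le> L2_set b F + L2_set c F" by (rule L2_set_triangle_ineq)
    also have "\<dots> \<le> ?S" unfolding L2_set_def
      by (intro add_mono real_sqrt_le_mono finite_sum_le_infsum assms that) auto
    finally show ?thesis by (simp add: sqrt_le_D)
  qed
  show sm: "(\<lambda>k. (a k)\<^sup>2) summable_on UNIV"
    by (rule nonneg_bounded_partial_sums_imp_summable_on[of _ _ "?S\<^sup>2"])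
      (auto intro!: eventually_finite_subsets_at_top_weakI fin)
  have "(\<Sum>\<^sub>\<infinity>k. (a k)\<^sup>2) \<le> ?S\<^sup>2" by (rule infsum_le_finite_sums[OF sm]) (use fin in auto)
  then show "sqrt (\<Sum>\<^sub>\<infinity>k. (a k)\<^sup>2) \<le> ?S" using S by (simp add: real_le_lsqrt)
qed

lemma frac_space_diff:
  assumes "L > 0" "u \<in> frac_space L \<alpha>" "v \<in> frac_space L \<alpha>"
  shows "(\<lambda>x. u x - v x) \<in> frac_space L \<alpha>"
  using assms(2,3) unfolding frac_space_alt[OF assms(1)]
  by (auto intro!: C1_per_diff Minkowski_infsum(1)[OF frac_term_nonneg frac_term_diff] C1_perD(4) frac_term_nonneg)

lemma frac_space_cmult:
  assumes "L > 0" "u \<in> frac_space L \<alpha>"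
  shows "(\<lambda>x. c * u x) \<in> frac_space L \<alpha>" and "frac_norm L \<alpha> (\<lambda>x. c * u x) = \<bar>c\<bar> * frac_norm L \<alpha> u"
  using assms(2) unfolding frac_space_alt[OF assms(1)] frac_norm_alt
  by (auto simp: frac_term_cmult power_mult_distrib infsum_cmult_right real_sqrt_mult intro!: C1_per_cmult summable_on_cmult_right)

locale frac_embedding =
  fixes L \<alpha> :: real
  assumes L: "L > 0" and embedding: "compactly_embedded_C1 L \<alpha>"
begin

lemma frac_C1: "u \<in> frac_space L \<alpha> \<Longrightarrow> u \<in> C1_per L" by (simp add: frac_space_def)

lemma bounded_sequence_subsequence:
  assumes "\<And>n. w n \<in> frac_space L \<alpha>" "\<And>n. frac_norm L \<alpha> (w n) \<le> B"
  shows "\<exists>r v. strict_mono (r :: nat \<Rightarrow> nat) \<and> v \<in> C1_per L \<and>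
    (\<forall>e>0. \<forall>\<^sub>F n in sequentially. \<forall>x. \<bar>w (r n) x - v x\<bar> < e \<and> \<bar>deriv (w (r n)) x - deriv v x\<bar> < e)"
proof -
  obtain r :: "nat \<Rightarrow> nat" and v where r: "strict_mono r" "v \<in> C1_per L"
    "uniform_limit UNIV (\<lambda>n. w (r n)) v sequentially"
    "uniform_limit UNIV (\<lambda>n. deriv (w (r n))) (deriv v) sequentially"
    using embedding assms unfolding compactly_embedded_C1_def by blast
  have "\<forall>\<^sub>F n in sequentially. \<forall>x. \<bar>w (r n) x - v x\<bar> < e \<and> \<bar>deriv (w (r n)) x - deriv v x\<bar> < e" if "e > 0" for e
    using uniform_limitD[OF r(3) that] uniform_limitD[OF r(4) that] by eventually_elim (auto simp: dist_real_def)
  then show ?thesis using r by blast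
qed

text \<open>The multiples \<open>n u\<close> form a bounded sequence, so a subsequence of them converges.\<close>

lemma norm_zero:
  assumes u: "u \<in> frac_space L \<alpha>" and z: "frac_norm L \<alpha> u = 0"
  shows "u x = 0"
proof -
  define w where "w = (\<lambda>n::nat. \<lambda>x. real n * u x)"
  have "w n \<in> frac_space L \<alpha>" "frac_norm L \<alpha> (w n) \<le> 0" for n
    using frac_space_cmult[OF L u, of "real n"] z by (simp_all add: w_def)
  from bounded_sequence_subsequence[of w, OF this] obtain r v where r: "strict_mono (r :: nat \<Rightarrow> nat)"
    and ev: "\<And>e. e > 0 \<Longrightarrow> \<forall>\<^sub>F n in sequentially. \<forall>x. \<bar>w (r n) x - v x\<bar> < e \<and> \<bar>deriv (w (r n)) x - deriv v x\<bar> < e"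
    by blast
  obtain N where N: "\<And>n. n \<ge> N \<Longrightarrow> \<bar>w (r n) x - v x\<bar> < 1"
    using ev[of 1] unfolding eventually_sequentially by fastforce
  show ?thesis
  proof (rule ccontr)
    assume nz: "u x \<noteq> 0"
    obtain n0 where n0: "real n0 * \<bar>u x\<bar> > 1 + \<bar>v x\<bar>" using reals_Archimedean3[of "\<bar>u x\<bar>"] nz by auto
    define n where "n = max N n0"
    have "n0 \<le> r n" using strict_mono_imp_increasing[OF r(1), of n] by (simp add: n_def)
    then have "real n0 * \<bar>u x\<bar> \<le> real (r n) * \<bar>u x\<bar>" by (intro mult_right_mono) auto
    then have "\<bar>w (r n) x\<bar> > 1 + \<bar>v x\<bar>" using n0 by (simp add: w_def abs_mult)
    then show False using N[of n] by (auto simp: n_def)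
  qed
qed

text \<open>Boundedness of the embedding follows from its compactness: normalised elements that
  violate every bound would have a subsequence converging uniformly with derivatives, whose values
  are bounded.\<close>

lemma C1_bound:
  shows "\<exists>C\<ge>0. \<forall>u\<in>frac_space L \<alpha>. \<forall>x. \<bar>u x\<bar> \<le> C * frac_norm L \<alpha> u \<and> \<bar>deriv u x\<bar> \<le> C * frac_norm L \<alpha> u"
proof (rule ccontr)
  assume n: "\<not> ?thesis"
  have "\<exists>u\<in>frac_space L \<alpha>. \<exists>x. \<bar>u x\<bar> > real n * frac_norm L \<alpha> u \<or> \<bar>deriv u x\<bar> > real n * frac_norm L \<alpha> u" for n :: nat
  proof (rule ccontr)
    assume "\<not> ?thesis"
    then have "\<forall>u\<in>frac_space L \<alpha>. \<forall>x. \<bar>u x\<bar> \<le> real n * frac_norm L \<alpha> u \<and> \<bar>deriv u x\<bar> \<le> real n * frac_norm L \<alpha> u"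
      by (meson not_le)
    then show False using n of_nat_0_le_iff[of n] by blast
  qed
  then obtain u x where u: "\<And>n. u n \<in> frac_space L \<alpha>"
    and big: "\<And>n. \<bar>u n (x n)\<bar> > real n * frac_norm L \<alpha> (u n) \<or> \<bar>deriv (u n) (x n)\<bar> > real n * frac_norm L \<alpha> (u n)"
    by metis
  have N: "frac_norm L \<alpha> (u n) > 0" for n
  proof (rule ccontr)
    assume "\<not> ?thesis"
    then have 0: "frac_norm L \<alpha> (u n) = 0" using frac_norm_nonneg[of L \<alpha> "u n"] by simp
    then have "u n = (\<lambda>x. 0)" using norm_zero[OF u] by blast
    then show False using big[of n] 0 by simp
  qed
  define w where "w = (\<lambda>n x. (1 / frac_norm L \<alpha> (u n)) * u n x)"
  have dw: "deriv (w n) = (\<lambda>x. (1 / frac_norm L \<alpha> (u n)) * deriv (u n) x)" for n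
    unfolding w_def by (rule C1_per_cmult(2)[OF frac_C1[OF u]])
  have "w n \<in> frac_space L \<alpha>" "frac_norm L \<alpha> (w n) \<le> 1" for n
    using frac_space_cmult[OF L u[of n], of "1 / frac_norm L \<alpha> (u n)"] N[of n] by (simp_all add: w_def)
  from bounded_sequence_subsequence[of w, OF this] obtain r v where r: "strict_mono (r :: nat \<Rightarrow> nat)" "v \<in> C1_per L"
    and ev: "\<And>e. e > 0 \<Longrightarrow> \<forall>\<^sub>F n in sequentially. \<forall>x. \<bar>w (r n) x - v x\<bar> < e \<and> \<bar>deriv (w (r n)) x - deriv v x\<bar> < e"
    by blast
  obtain M where M: "\<And>n x. n \<ge> M \<Longrightarrow> \<bar>w (r n) x - v x\<bar> < 1 \<and> \<bar>deriv (w (r n)) x - deriv v x\<bar> < 1"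
    using ev[of 1] unfolding eventually_sequentially by fastforce
  obtain B1 where B1: "\<And>x. \<bar>v x\<bar> \<le> B1" using periodic_bounded[OF L C1_perD(1,4)[OF r(2)]] by auto
  have per': "deriv v (x + L) = deriv v x" for x
    by (rule periodic_derivative[of v L "deriv v"]) (use C1_perD[OF r(2)] in auto)
  obtain B2 where B2: "\<And>x. \<bar>deriv v x\<bar> \<le> B2" using periodic_bounded[OF L per' C1_perD(3)[OF r(2)]] by auto
  obtain n0 :: nat where n0: "real n0 > 1 + \<bar>B1\<bar> + \<bar>B2\<bar>" using reals_Archimedean2 by blast
  define n where "n = max M n0"
  have rn: "real (r n) > 1 + \<bar>B1\<bar> + \<bar>B2\<bar>" using strict_mono_imp_increasing[OF r(1), of n] n0 by (simp add: n_def)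
  have "\<bar>w (r n) (x (r n))\<bar> > real (r n) \<or> \<bar>deriv (w (r n)) (x (r n))\<bar> > real (r n)"
    using big[of "r n"] N[of "r n"] unfolding dw by (auto simp: w_def abs_mult field_simps)
  moreover have "\<bar>w (r n) (x (r n)) - v (x (r n))\<bar> < 1" "\<bar>deriv (w (r n)) (x (r n)) - deriv v (x (r n))\<bar> < 1"
    using M[of n "x (r n)"] by (auto simp: n_def)
  ultimately show False using rn B1[of "x (r n)"] B2[of "x (r n)"] by linarith
qed

text \<open>\<open>frac_topology\<close> is defined through \<open>Metric_space.mtopology\<close>,
  whose theory is available once the norm distance is a metric. Definiteness rests on
  \<open>norm_zero\<close>, the triangle inequality on Minkowski's inequality for the Fourier
  coefficients.\<close>

sublocale frac: Metric_space "frac_space L \<alpha>" "\<lambda>u v. frac_norm L \<alpha> (\<lambda>x. u x - v x)"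
proof
  fix u v w
  show "0 \<le> frac_norm L \<alpha> (\<lambda>x. u x - v x)" by (rule frac_norm_nonneg)
  show "frac_norm L \<alpha> (\<lambda>x. u x - v x) = frac_norm L \<alpha> (\<lambda>x. v x - u x)"
  proof -
    have "(\<lambda>x. v x - u x) = (\<lambda>x. (-1) * (u x - v x))" by auto
    then show ?thesis unfolding frac_norm_alt by (simp only: frac_term_cmult) simp
  qed
  assume u: "u \<in> frac_space L \<alpha>" and v: "v \<in> frac_space L \<alpha>"
  show "(frac_norm L \<alpha> (\<lambda>x. u x - v x) = 0) = (u = v)"
  proof
    assume "frac_norm L \<alpha> (\<lambda>x. u x - v x) = 0"
    then show "u = v" using norm_zero[OF frac_space_diff[OF L u v]] by auto
  next
    assume "u = v"
    then show "frac_norm L \<alpha> (\<lambda>x. u x - v x) = 0"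
      using frac_space_cmult(2)[OF L u, of 0] by simp
  qed
  assume w: "w \<in> frac_space L \<alpha>"
  have le: "frac_term L \<alpha> (\<lambda>x. u x - w x) k \<le> frac_term L \<alpha> (\<lambda>x. u x - v x) k + frac_term L \<alpha> (\<lambda>x. v x - w x) k" for k
  proof -
    have c: "continuous_on {0..L} (\<lambda>x. u x - v x)" "continuous_on {0..L} (\<lambda>x. (-1) * (v x - w x))"
      using C1_perD(4)[OF frac_C1[OF u]] C1_perD(4)[OF frac_C1[OF v]] C1_perD(4)[OF frac_C1[OF w]]
      by (intro continuous_intros; simp)+
    show ?thesis using frac_term_diff[OF c, of \<alpha> k] unfolding frac_term_cmult by simp
  qed
  show "frac_norm L \<alpha> (\<lambda>x. u x - w x) \<le> frac_norm L \<alpha> (\<lambda>x. u x - v x) + frac_norm L \<alpha> (\<lambda>x. v x - w x)"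
    unfolding frac_norm_alt
    by (rule Minkowski_infsum(2)[OF frac_term_nonneg le frac_term_nonneg frac_term_nonneg])
      (use frac_space_diff[OF L u v] frac_space_diff[OF L v w] frac_space_alt[OF L] in auto)
qed

lemma frac_topology_eq: "frac_topology L \<alpha> = frac.mtopology"
  by (simp add: frac_topology_def)

lemma limitin_frac_uniform:
  assumes lim: "limitin (frac_topology L \<alpha>) w u F" and e: "e > 0"
  shows "\<forall>\<^sub>F n in F. w n \<in> frac_space L \<alpha> \<and> (\<forall>x. \<bar>w n x - u x\<bar> < e \<and> \<bar>deriv (w n) x - deriv u x\<bar> < e)"
proof -
  obtain C where C: "C \<ge> 0" "\<And>u x. u \<in> frac_space L \<alpha> \<Longrightarrow> \<bar>u x\<bar> \<le> C * frac_norm L \<alpha> u"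
    "\<And>u x. u \<in> frac_space L \<alpha> \<Longrightarrow> \<bar>deriv u x\<bar> \<le> C * frac_norm L \<alpha> u" using C1_bound by auto
  have u: "u \<in> frac_space L \<alpha>" using limitin_topspace[OF lim] by (simp add: frac_topology_eq)
  have "e / (C + 1) > 0" using e C by simp
  then have "\<forall>\<^sub>F n in F. w n \<in> frac_space L \<alpha> \<and> frac_norm L \<alpha> (\<lambda>x. w n x - u x) < e / (C + 1)"
    using lim unfolding frac_topology_eq frac.limitin_metric by blast
  then show ?thesis
  proof eventually_elim
    case (elim n)
    have d: "(\<lambda>x. w n x - u x) \<in> frac_space L \<alpha>" using elim u frac_space_diff[OF L] by blast
    have "C * frac_norm L \<alpha> (\<lambda>x. w n x - u x) \<le> C * (e / (C + 1))" using elim C by (intro mult_left_mono) auto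
    also have "\<dots> < e" using C e by (simp add: field_simps)
    finally have less: "C * frac_norm L \<alpha> (\<lambda>x. w n x - u x) < e" .
    have "\<bar>w n x - u x\<bar> < e \<and> \<bar>deriv (w n) x - deriv u x\<bar> < e" for x
    proof -
      have "deriv (\<lambda>x. w n x - u x) x = deriv (w n) x - deriv u x"
        using C1_per_diff(2)[OF frac_C1 frac_C1, of "w n" u] elim u by metis
      then show ?thesis using C(2,3)[OF d, of x] less by simp
    qed
    then show ?case using elim by blast
  qed
qed

end

section \<open>The compact-open topology and the hull\<close>

lemma topspace_compact_open: "topspace compact_open_topology = {g. continuous_on UNIV g}"
proof -
  have "{g. continuous_on UNIV g \<and> g ` {} \<subseteq> UNIV} \<in>
      {{g. continuous_on UNIV g \<and> g ` K \<subseteq> U} | K U. compact (K :: 'a set) \<and> open (U :: 'b set)}"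
    by blast
  then show ?thesis
    unfolding compact_open_topology_def topology_generated_by_topspace by (auto intro!: exI[of _ "{}"])
qed

lemma openin_compact_open:
  assumes "compact K" "open U"
  shows "openin compact_open_topology {g. continuous_on UNIV g \<and> g ` K \<subseteq> U}"
  unfolding compact_open_topology_def by (rule topology_generated_by_Basis) (use assms in blast)

text \<open>Finitely many balls on which \<open>g\<close> stays within \<open>e / 2\<close> of its
  value at the centre cover \<open>K\<close>. Each of them gives one subbasic open set; the closed
  balls are used there because their traces on \<open>K\<close> are compact.\<close>

lemma compact_open_neighbourhood:
  fixes g :: "'a::metric_space \<Rightarrow> 'b::metric_space"
  assumes g: "continuous_on UNIV g" and K: "compact K" and e: "e > 0"
  shows "\<exists>U. openin compact_open_topology U \<and> g \<in> U \<and> (\<forall>h\<in>U. \<forall>z\<in>K. dist (h z) (g z) < e)"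
proof -
  have "\<exists>d>0. \<forall>y. dist y z \<le> d \<longrightarrow> dist (g y) (g z) < e / 2" for z
  proof -
    have "e / 2 > 0" using e by simp
    then obtain d where "d > 0" "\<And>y. dist y z < d \<Longrightarrow> dist (g y) (g z) < e / 2"
      using g unfolding continuous_on_iff by (metis UNIV_I)
    then show ?thesis by (intro exI[of _ "d / 2"]) auto
  qed
  then obtain d where d: "\<And>z. d z > 0" "\<And>z y. dist y z \<le> d z \<Longrightarrow> dist (g y) (g z) < e / 2" by metis
  have "K \<subseteq> (\<Union>z\<in>K. ball z (d z))" using d(1) by force
  from compactE_image[OF K _ this] obtain F where F: "F \<subseteq> K" "finite F" "K \<subseteq> (\<Union>z\<in>F. ball z (d z))"
    using open_ball by blast
  define W where "W = (\<lambda>z. {h. continuous_on UNIV h \<and> h ` (K \<inter> cball z (d z)) \<subseteq> ball (g z) (e / 2)})"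
  define U where "U = (\<Inter>z\<in>F. W z) \<inter> topspace compact_open_topology"
  have "openin compact_open_topology (W z)" for z
    unfolding W_def by (rule openin_compact_open) (use K in \<open>auto intro: compact_Int_closed\<close>)
  then have "openin compact_open_topology U" unfolding U_def using F(2) by (intro openin_INT) auto
  moreover have "g \<in> U"
  proof -
    have "g y \<in> ball (g z) (e / 2)" if "y \<in> cball z (d z)" for y z
      using d(2)[of y z] that by (simp add: dist_commute)
    then show ?thesis using g by (auto simp: U_def W_def topspace_compact_open)
  qed
  moreover have "dist (h z) (g z) < e" if h: "h \<in> U" and z: "z \<in> K" for h z
  proof -
    obtain y where y: "y \<in> F" "z \<in> ball y (d y)" using F z by auto
    have "h \<in> W y" using h y(1) by (auto simp: U_def)
    moreover have "z \<in> K \<inter> cball y (d y)" using y z by auto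
    ultimately have "h z \<in> ball (g y) (e / 2)" unfolding W_def by blast
    moreover have "dist (g z) (g y) < e / 2" using d(2)[of z y] y by (auto simp: dist_commute)
    ultimately show ?thesis using dist_triangle_half_r[of "g y" "h z" e "g z"] by (simp add: dist_commute)
  qed
  ultimately show ?thesis by blast
qed

lemma limitin_compact_open_uniform:
  fixes g :: "'a::metric_space \<Rightarrow> 'b::metric_space"
  assumes lim: "limitin compact_open_topology \<sigma> g F" and K: "compact K" and e: "e > 0"
  shows "\<forall>\<^sub>F n in F. \<forall>z\<in>K. dist (\<sigma> n z) (g z) < e"
proof -
  have "continuous_on UNIV g" using limitin_topspace[OF lim] by (simp add: topspace_compact_open)
  from compact_open_neighbourhood[OF this K e] obtain U where U: "openin compact_open_topology U" "g \<in> U"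
    "\<And>h z. h \<in> U \<Longrightarrow> z \<in> K \<Longrightarrow> dist (h z) (g z) < e" by blast
  have "\<forall>\<^sub>F n in F. \<sigma> n \<in> U" by (rule limitinD[OF lim U(1,2)])
  then show ?thesis by eventually_elim (use U(3) in blast)
qed

lemma limitin_compact_open_eval:
  fixes g :: "'a::heine_borel \<Rightarrow> 'b::metric_space"
  assumes lim: "limitin compact_open_topology \<sigma> g F" and z: "(\<zeta> \<longlongrightarrow> z) F"
  shows "((\<lambda>n. \<sigma> n (\<zeta> n)) \<longlongrightarrow> g z) F"
proof (rule tendstoI)
  fix e :: real assume e: "e > 0"
  have g: "continuous_on UNIV g" using limitin_topspace[OF lim] by (simp add: topspace_compact_open)
  have "((\<lambda>n. g (\<zeta> n)) \<longlongrightarrow> g z) F"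
    using g z by (metis UNIV_I continuous_on_def isCont_tendsto_compose continuous_on_eq_continuous_at open_UNIV)
  then have 1: "\<forall>\<^sub>F n in F. dist (g (\<zeta> n)) (g z) < e / 2" using e by (intro tendstoD) auto
  have 2: "\<forall>\<^sub>F n in F. dist (\<zeta> n) z < 1" using z by (intro tendstoD) auto
  have 3: "\<forall>\<^sub>F n in F. \<forall>y\<in>cball z 1. dist (\<sigma> n y) (g y) < e / 2"
    by (rule limitin_compact_open_uniform[OF lim]) (use e in auto)
  show "\<forall>\<^sub>F n in F. dist (\<sigma> n (\<zeta> n)) (g z) < e"
    using 1 2 3
  proof eventually_elim
    case (elim n)
    then have "dist (\<sigma> n (\<zeta> n)) (g (\<zeta> n)) < e / 2" by (auto simp: dist_commute)
    then show ?case using elim dist_triangle_half_l[of "\<sigma> n (\<zeta> n)" "g (\<zeta> n)" e "g z"] by (simp add: dist_commute)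
  qed
qed

lemma continuous_map_compact_open_eval:
  "continuous_map compact_open_topology euclidean (\<lambda>g. g z)"
  unfolding continuous_map_def
proof (intro conjI allI impI)
  fix U :: "'b set" assume "openin euclidean U"
  then have "openin compact_open_topology {g :: 'a \<Rightarrow> 'b. continuous_on UNIV g \<and> g ` {z} \<subseteq> U}"
    by (intro openin_compact_open) auto
  then show "openin compact_open_topology {g \<in> topspace compact_open_topology. g z \<in> U}"
    by (simp add: topspace_compact_open)
qed auto

lemma Hausdorff_compact_open: "Hausdorff_space (compact_open_topology :: ('a::topological_space \<Rightarrow> 'b::metric_space) topology)"
  unfolding Hausdorff_space_def
proof (intro allI impI)
  fix g h :: "'a \<Rightarrow> 'b"
  assume gh: "g \<in> topspace compact_open_topology \<and> h \<in> topspace compact_open_topology \<and> g \<noteq> h"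
  then obtain z where z: "g z \<noteq> h z" by auto
  obtain U V where UV: "open U" "open V" "g z \<in> U" "h z \<in> V" "U \<inter> V = {}" using hausdorff[OF z] by blast
  show "\<exists>U V. openin compact_open_topology U \<and> openin compact_open_topology V \<and> g \<in> U \<and> h \<in> V \<and> disjnt U V"
  proof (intro exI conjI)
    show "openin compact_open_topology {g. continuous_on UNIV g \<and> g ` {z} \<subseteq> U}"
      "openin compact_open_topology {g. continuous_on UNIV g \<and> g ` {z} \<subseteq> V}"
      by (rule openin_compact_open; simp add: UV)+
  qed (use gh UV in \<open>auto simp: topspace_compact_open disjnt_def\<close>)
qed

text \<open>The way in which properties of \<open>f\<close> reach the members of its hull: evenness
  and Lipschitz bounds pass to limits of translates, and no derivative of a member of the hull is
  needed.\<close>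

lemma time_hull_approx:
  assumes "g \<in> time_hull f"
  shows "continuous_on UNIV g"
    and "compact K \<Longrightarrow> e > 0 \<Longrightarrow> \<exists>\<tau>. \<forall>z\<in>K. \<bar>f (fst z + \<tau>, snd z) - g z\<bar> < e"
proof -
  show c: "continuous_on UNIV g" using assms unfolding time_hull_def in_closure_of topspace_compact_open by simp
  assume K: "compact K" and e: "e > 0"
  from compact_open_neighbourhood[OF c K e] obtain U where U: "openin compact_open_topology U" "g \<in> U"
    "\<And>h z. h \<in> U \<Longrightarrow> z \<in> K \<Longrightarrow> dist (h z) (g z) < e" by blast
  then obtain \<tau> where "shift \<tau> f \<in> U" using assms unfolding time_hull_def in_closure_of by blast
  then show "\<exists>\<tau>. \<forall>z\<in>K. \<bar>f (fst z + \<tau>, snd z) - g z\<bar> < e"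
    using U(3)[of "shift \<tau> f"] by (intro exI[of _ \<tau>]) (auto simp: shift_def dist_real_def split_beta)
qed

lemma time_hull_even:
  assumes ev: "\<And>t u p. f (t, u, p) = f (t, u, - p)" and g: "g \<in> time_hull f"
  shows "g (t, u, - p) = (g (t, u, p) :: real)"
proof -
  have "\<bar>g (t, u, - p) - g (t, u, p)\<bar> \<le> 0 + 2 * e" if "e > 0" for e
  proof -
    have "compact {(t, u, p), (t, u, - p)}" by simp
    from time_hull_approx(2)[OF g this that]
    obtain \<tau> where "\<forall>z\<in>{(t, u, p), (t, u, - p)}. \<bar>f (fst z + \<tau>, snd z) - g z\<bar> < e" by blast
    then show ?thesis using ev[of "t + \<tau>" u p] by auto
  qed
  then have "\<bar>g (t, u, - p) - g (t, u, p)\<bar> \<le> 0 + e" if "e > 0" for e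
    using that by (metis half_gt_zero mult.commute nonzero_mult_div_cancel_left times_divide_eq_right zero_neq_numeral)
  then have "\<bar>g (t, u, - p) - g (t, u, p)\<bar> \<le> 0" by (rule field_le_epsilon)
  then show ?thesis by simp
qed

text \<open>Admissibility of the partial derivatives bounds them on compact sets uniformly in time;
  the two arguments are then changed one after the other.\<close>

lemma standing_assumption_Lipschitz:
  assumes st: "standing_assumption f" and R: "R \<ge> 0"
  shows "\<exists>K\<ge>0. \<forall>t a a' b b'. \<bar>a\<bar> \<le> R \<longrightarrow> \<bar>a'\<bar> \<le> R \<longrightarrow> \<bar>b\<bar> \<le> R \<longrightarrow> \<bar>b'\<bar> \<le> R \<longrightarrow>
    \<bar>f (t, a, b) - f (t, a', b')\<bar> \<le> K * (\<bar>a - a'\<bar> + \<bar>b - b'\<bar>)"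
proof -
  have "compact ({- R..R} \<times> {- R..R})" by (intro compact_Times) auto
  then have bd: "\<exists>B. \<forall>t a b. \<bar>a\<bar> \<le> R \<longrightarrow> \<bar>b\<bar> \<le> R \<longrightarrow> \<bar>frechet_derivative f (at (t, a, b)) w\<bar> \<le> B" if "w \<in> Basis" for w
  proof -
    have "bounded ((\<lambda>z. frechet_derivative f (at z) w) ` (UNIV \<times> ({- R..R} \<times> {- R..R})))"
      using st that \<open>compact _\<close> unfolding standing_assumption_def uniformly_almost_periodic_def admissible_def by blast
    then obtain B where "\<And>z. z \<in> UNIV \<times> ({- R..R} \<times> {- R..R}) \<Longrightarrow> \<bar>frechet_derivative f (at z) w\<bar> \<le> B"
      unfolding bounded_iff by auto
    then show ?thesis by (intro exI[of _ B]) (auto simp: abs_le_iff)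
  qed
  obtain B1 where B1: "\<And>t a b. \<bar>a\<bar> \<le> R \<Longrightarrow> \<bar>b\<bar> \<le> R \<Longrightarrow> \<bar>frechet_derivative f (at (t, a, b)) (0, 1, 0)\<bar> \<le> B1"
    using bd[of "(0, 1, 0)"] by (auto simp: Basis_prod_def)
  obtain B2 where B2: "\<And>t a b. \<bar>a\<bar> \<le> R \<Longrightarrow> \<bar>b\<bar> \<le> R \<Longrightarrow> \<bar>frechet_derivative f (at (t, a, b)) (0, 0, 1)\<bar> \<le> B2"
    using bd[of "(0, 0, 1)"] by (auto simp: Basis_prod_def)
  have df: "(f has_derivative frechet_derivative f (at z)) (at z)" for z
    using st frechet_derivative_works unfolding standing_assumption_def C1_fun_def by blast
  have d1: "((\<lambda>a. f (t, a, b)) has_field_derivative frechet_derivative f (at (t, a, b)) (0, 1, 0)) (at a within S)" for t a b S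
  proof -
    have "((\<lambda>a. (t, a, b)) has_derivative (\<lambda>h. (0, h, 0))) (at a within S)" by (auto intro!: derivative_eq_intros)
    from has_derivative_compose[OF this df]
    have "((\<lambda>a. f (t, a, b)) has_derivative (\<lambda>h. frechet_derivative f (at (t, a, b)) (0, h, 0))) (at a within S)" .
    moreover have "(\<lambda>h. frechet_derivative f (at (t, a, b)) (0, h, 0)) = (*) (frechet_derivative f (at (t, a, b)) (0, 1, 0))"
    proof
      fix h show "frechet_derivative f (at (t, a, b)) (0, h, 0) = frechet_derivative f (at (t, a, b)) (0, 1, 0) * h"
        using linear_scale[OF has_derivative_linear[OF df[of "(t, a, b)"]], of h "(0, 1, 0)"] by simp
    qed
    ultimately show ?thesis unfolding has_field_derivative_def by (simp only:)
  qed
  have d2: "((\<lambda>b. f (t, a, b)) has_field_derivative frechet_derivative f (at (t, a, b)) (0, 0, 1)) (at b within S)" for t a b S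
  proof -
    have "((\<lambda>b. (t, a, b)) has_derivative (\<lambda>h. (0, 0, h))) (at b within S)" by (auto intro!: derivative_eq_intros)
    from has_derivative_compose[OF this df]
    have "((\<lambda>b. f (t, a, b)) has_derivative (\<lambda>h. frechet_derivative f (at (t, a, b)) (0, 0, h))) (at b within S)" .
    moreover have "(\<lambda>h. frechet_derivative f (at (t, a, b)) (0, 0, h)) = (*) (frechet_derivative f (at (t, a, b)) (0, 0, 1))"
    proof
      fix h show "frechet_derivative f (at (t, a, b)) (0, 0, h) = frechet_derivative f (at (t, a, b)) (0, 0, 1) * h"
        using linear_scale[OF has_derivative_linear[OF df[of "(t, a, b)"]], of h "(0, 0, 1)"] by simp
    qed
    ultimately show ?thesis unfolding has_field_derivative_def by (simp only:)
  qed
  define K where "K = \<bar>B1\<bar> + \<bar>B2\<bar>"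
  have "\<bar>f (t, a, b) - f (t, a', b')\<bar> \<le> K * (\<bar>a - a'\<bar> + \<bar>b - b'\<bar>)"
    if ab: "\<bar>a\<bar> \<le> R" "\<bar>a'\<bar> \<le> R" "\<bar>b\<bar> \<le> R" "\<bar>b'\<bar> \<le> R" for t a a' b b'
  proof -
    have "norm (f (t, a, b) - f (t, a', b)) \<le> B1 * norm (a - a')"
      by (rule field_differentiable_bound[of "{- R..R}" "\<lambda>a. f (t, a, b)", OF _ d1]) (use B1 ab in auto)
    moreover have "B1 * norm (a - a') \<le> K * \<bar>a - a'\<bar>" by (auto simp: K_def intro!: mult_right_mono)
    moreover have "norm (f (t, a', b) - f (t, a', b')) \<le> B2 * norm (b - b')"
      by (rule field_differentiable_bound[of "{- R..R}" "\<lambda>b. f (t, a', b)", OF _ d2]) (use B2 ab in auto)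
    moreover have "B2 * norm (b - b') \<le> K * \<bar>b - b'\<bar>" by (auto simp: K_def intro!: mult_right_mono)
    ultimately show ?thesis unfolding distrib_left real_norm_def by linarith
  qed
  then show ?thesis by (intro exI[of _ K]) (auto simp: K_def)
qed

text \<open>Solutions are compared at all times and over all members of the hull, so the constant
  must depend on neither. It is inherited from \<open>f\<close> by approximation at two
  points.\<close>

lemma time_hull_Lipschitz:
  assumes st: "standing_assumption f" and R: "R \<ge> 0"
  shows "\<exists>K\<ge>0. \<forall>g\<in>time_hull f. \<forall>t a a' b b'. \<bar>a\<bar> \<le> R \<longrightarrow> \<bar>a'\<bar> \<le> R \<longrightarrow> \<bar>b\<bar> \<le> R \<longrightarrow> \<bar>b'\<bar> \<le> R \<longrightarrow>
    \<bar>g (t, a, b) - g (t, a', b')\<bar> \<le> K * (\<bar>a - a'\<bar> + \<bar>b - b'\<bar>)"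
proof -
  obtain K where K: "K \<ge> 0" and f: "\<And>t a a' b b'. \<bar>a\<bar> \<le> R \<Longrightarrow> \<bar>a'\<bar> \<le> R \<Longrightarrow> \<bar>b\<bar> \<le> R \<Longrightarrow> \<bar>b'\<bar> \<le> R \<Longrightarrow>
    \<bar>f (t, a, b) - f (t, a', b')\<bar> \<le> K * (\<bar>a - a'\<bar> + \<bar>b - b'\<bar>)"
    using standing_assumption_Lipschitz[OF assms] by blast
  have "\<bar>g (t, a, b) - g (t, a', b')\<bar> \<le> K * (\<bar>a - a'\<bar> + \<bar>b - b'\<bar>)"
    if g: "g \<in> time_hull f" and ab: "\<bar>a\<bar> \<le> R" "\<bar>a'\<bar> \<le> R" "\<bar>b\<bar> \<le> R" "\<bar>b'\<bar> \<le> R" for g t a a' b b'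
  proof (rule field_le_epsilon)
    fix e :: real assume "e > 0"
    then have "compact {(t, a, b), (t, a', b')}" "e / 2 > 0" by simp_all
    from time_hull_approx(2)[OF g this]
    obtain \<tau> where "\<forall>z\<in>{(t, a, b), (t, a', b')}. \<bar>f (fst z + \<tau>, snd z) - g z\<bar> < e / 2" by blast
    then have "\<bar>f (t + \<tau>, a, b) - g (t, a, b)\<bar> < e / 2" "\<bar>f (t + \<tau>, a', b') - g (t, a', b')\<bar> < e / 2" by auto
    then show "\<bar>g (t, a, b) - g (t, a', b')\<bar> \<le> K * (\<bar>a - a'\<bar> + \<bar>b - b'\<bar>) + e" using f[OF ab, of "t + \<tau>"] by linarith
  qed
  then show ?thesis using K by blast
qed

section \<open>The phase space of a minimal set\<close>

locale minimal_setting = frac_embedding +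
  fixes f :: "real \<times> real \<times> real \<Rightarrow> real" and M :: "state set"
  assumes standing: "standing_assumption f" and even: "\<And>t u p. f (t, u, p) = f (t, u, - p)"
    and minimal: "minimal_set L \<alpha> f M"
begin

definition T :: "state topology" where "T = subtopology (phase_topology L \<alpha> f) M"

lemma topspace_phase: "topspace (phase_topology L \<alpha> f) = frac_space L \<alpha> \<times> time_hull f"
  using closure_of_subset_topspace[of compact_open_topology "range (\<lambda>\<tau>. shift \<tau> f)"]
  by (auto simp: phase_topology_def hull_topology_def time_hull_def frac_topology_eq)

lemma M_subset: "z \<in> M \<Longrightarrow> fst z \<in> frac_space L \<alpha>" "z \<in> M \<Longrightarrow> snd z \<in> time_hull f"
  using minimal compactin_subset_topspace[of "phase_topology L \<alpha> f" M] topspace_phase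
  unfolding minimal_set_def by auto

lemma topspace_T: "topspace T = M"
  unfolding T_def topspace_subtopology topspace_phase using M_subset by (auto simp: mem_Times_iff)

lemma compact_T: "compact_space T"
  using minimal unfolding minimal_set_def T_def by (auto simp: compactin_subspace)

lemma limitin_T:
  "limitin T \<sigma> z F \<longleftrightarrow> z \<in> M \<and> (\<forall>\<^sub>F n in F. \<sigma> n \<in> M) \<and> limitin (frac_topology L \<alpha>) (\<lambda>n. fst (\<sigma> n)) (fst z) F \<and>
     limitin (hull_topology f) (\<lambda>n. snd (\<sigma> n)) (snd z) F"
  unfolding T_def limitin_subtopology phase_topology_def limitin_pairwise by (simp add: o_def)

lemma limitin_T_hull: "limitin T \<sigma> z F \<Longrightarrow> limitin compact_open_topology (\<lambda>n. snd (\<sigma> n)) (snd z) F"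
  unfolding limitin_T hull_topology_def limitin_subtopology by blast

lemma limitin_T_frac: "limitin T \<sigma> z F \<Longrightarrow> limitin (frac_topology L \<alpha>) (\<lambda>n. fst (\<sigma> n)) (fst z) F"
  unfolding limitin_T by blast

lemma continuous_map_frac_eval: "continuous_map (frac_topology L \<alpha>) euclideanreal (\<lambda>u. u x)"
proof (rule metrizable_sequentially_continuous)
  show "metrizable_space (frac_topology L \<alpha>)" unfolding frac_topology_eq by (rule frac.metrizable_space_mtopology)
  fix \<sigma> u assume l: "limitin (frac_topology L \<alpha>) \<sigma> u sequentially"
  have "(\<lambda>n. \<sigma> n x) \<longlonglongrightarrow> u x"
  proof (rule tendstoI)
    fix e :: real assume "e > 0"
    from limitin_frac_uniform[OF l this] show "\<forall>\<^sub>F n in sequentially. dist (\<sigma> n x) (u x) < e"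
      by eventually_elim (simp add: dist_real_def)
  qed
  then show "limitin euclideanreal (\<lambda>n. \<sigma> n x) (u x) sequentially" by simp
qed auto

text \<open>Evaluations at rational points are countably many continuous functions that separate the
  points of the compact set \<open>M\<close>, so they embed it into a countable product of lines.
  This allows closedness and continuity to be checked with sequences.\<close>

lemma metrizable_T: "metrizable_space T"
proof -
  define e :: "state \<Rightarrow> (rat + rat \<times> rat \<times> rat) \<Rightarrow> real" where
    "e = (\<lambda>z i. case i of Inl q \<Rightarrow> fst z (of_rat q) | Inr (q, a, b) \<Rightarrow> snd z (of_rat q, of_rat a, of_rat b))"
  have 1: "continuous_map T euclideanreal (\<lambda>z. fst z x)" for x
  proof -
    have "continuous_map (phase_topology L \<alpha> f) (frac_topology L \<alpha>) fst" unfolding phase_topology_def by (rule continuous_map_fst)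
    from continuous_map_compose[OF this continuous_map_frac_eval, of x]
    show ?thesis unfolding T_def by (simp add: continuous_map_from_subtopology o_def)
  qed
  have 2: "continuous_map T euclideanreal (\<lambda>z. snd z x)" for x
  proof -
    have "continuous_map (phase_topology L \<alpha> f) (hull_topology f) snd" unfolding phase_topology_def by (rule continuous_map_snd)
    moreover have "continuous_map (hull_topology f) euclideanreal (\<lambda>g. g x)"
      unfolding hull_topology_def by (intro continuous_map_from_subtopology continuous_map_compact_open_eval)
    ultimately have "continuous_map (phase_topology L \<alpha> f) euclideanreal ((\<lambda>g. g x) \<circ> snd)" by (rule continuous_map_compose)
    then show ?thesis unfolding T_def by (simp add: continuous_map_from_subtopology o_def)
  qed
  have "continuous_map T (product_topology (\<lambda>_. euclideanreal) UNIV) e"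
    unfolding continuous_map_componentwise_UNIV
  proof
    fix i show "continuous_map T euclideanreal (\<lambda>z. e z i)"
      using 1 2 by (cases i) (auto simp: e_def split: prod.split)
  qed
  then have e: "continuous_map T euclidean e" by (simp add: euclidean_product_topology)
  have inj: "inj_on e M"
  proof (rule inj_onI)
    fix z z' assume z: "z \<in> M" "z' \<in> M" and eq: "e z = e z'"
    have u: "fst z \<in> C1_per L" "fst z' \<in> C1_per L" using z by (auto intro: frac_C1 M_subset)
    have g: "continuous_on UNIV (snd z)" "continuous_on UNIV (snd z')" using z by (auto intro: time_hull_approx(1) M_subset)
    have "fst z x - fst z' x = 0" for x
    proof (rule continuous_constant_on_closure[of "\<rat>" "\<lambda>x. fst z x - fst z' x" 0])
      show "continuous_on (closure \<rat>) (\<lambda>x. fst z x - fst z' x)" by (intro continuous_intros C1_perD(4)[OF u(1)] C1_perD(4)[OF u(2)])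
      fix x :: real assume "x \<in> \<rat>"
      then obtain q where "x = of_rat q" by (rule Rats_cases)
      then show "fst z x - fst z' x = 0" using fun_cong[OF eq, of "Inl q"] by (simp add: e_def)
    qed (simp add: Rats_closure_real)
    moreover have "snd z y - snd z' y = 0" for y
    proof (rule continuous_constant_on_closure[of "\<rat> \<times> \<rat> \<times> \<rat>" "\<lambda>y. snd z y - snd z' y" 0])
      show "continuous_on (closure (\<rat> \<times> \<rat> \<times> \<rat>)) (\<lambda>y. snd z y - snd z' y)"
        by (intro continuous_intros continuous_on_subset[OF g(1)] continuous_on_subset[OF g(2)]) auto
      fix y :: "real \<times> real \<times> real" assume "y \<in> \<rat> \<times> \<rat> \<times> \<rat>"
      then obtain q a b where "y = (of_rat q, of_rat a, of_rat b)" by (auto elim!: Rats_cases)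
      then show "snd z y - snd z' y = 0" using fun_cong[OF eq, of "Inr (q, a, b)"] by (simp add: e_def)
    qed (simp add: Rats_closure_real closure_Times)
    ultimately show "z = z'" by (auto simp: prod_eq_iff fun_eq_iff)
  qed
  have "embedding_map T euclidean e"
    by (rule continuous_imp_embedding_map[OF e compact_T]) (use inj topspace_T in auto)
  then have "T homeomorphic_space (subtopology euclidean (e ` topspace T))"
    unfolding embedding_map_def using homeomorphic_map_imp_homeomorphic_space by blast
  then show ?thesis
    using homeomorphic_metrizable_space metrizable_space_subtopology metrizable_space_euclidean by metis
qed

end

section \<open>Solutions, and the flow they define on the minimal set\<close>

section \<open>Solutions\<close>

lemma periodic_integral_shift:
  fixes h :: "real \<Rightarrow> real"
  assumes "\<And>x. h (x + L) = h x" "a \<le> b"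
  shows "integral {a + of_int n * L..b + of_int n * L} h = integral {a..b} h"
    and "h integrable_on {a + of_int n * L..b + of_int n * L} \<longleftrightarrow> h integrable_on {a..b}"
proof -
  have sh: "h (1 * x + of_int n * L) = h x" for x and n :: int using periodic_int[of h L x n] assms(1) by simp
  have hi: "(h has_integral i) {a..b}" if "(h has_integral i) {a + of_int n * L..b + of_int n * L}" "a \<le> b" for i a b and n :: int
    using has_integral_reflect_translate[of 1 h i a "of_int n * L" b] that unfolding sh by (simp add: min_def max_def)
  have "(h has_integral i) {a..b} \<longleftrightarrow> (h has_integral i) {a + of_int n * L..b + of_int n * L}" for i
  proof
    assume "(h has_integral i) {a..b}"
    then show "(h has_integral i) {a + of_int n * L..b + of_int n * L}"
      using hi[where n = "- n" and a = "a + of_int n * L" and b = "b + of_int n * L"] assms(2) by simp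
  qed (use hi assms(2) in blast)
  then show "integral {a + of_int n * L..b + of_int n * L} h = integral {a..b} h"
    "h integrable_on {a + of_int n * L..b + of_int n * L} \<longleftrightarrow> h integrable_on {a..b}"
    by (auto simp: integral_def integrable_on_def)
qed

text \<open>The multiple \<open>n\<close> is chosen before \<open>h\<close>, so it is the same for
  all the difference quotients to which the bound is applied.\<close>

lemma periodic_integral_bound:
  fixes L a b :: real
  assumes L: "L > 0"
  shows "\<exists>n. \<forall>h. (\<forall>x. h (x + L) = h x) \<longrightarrow> (\<forall>x. h x \<ge> 0) \<longrightarrow> h integrable_on {0..L} \<longrightarrow>
    h integrable_on {a..b} \<and> integral {a..b} h \<le> real n * integral {0..L} h"
proof (cases "a \<le> b")
  case False
  then show ?thesis by (intro exI[of _ 0]) auto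
next
  case True
  obtain m :: int where m: "0 \<le> a + of_int m * L" using periodic_representative[OF L, of 0 a] by auto
  obtain n :: nat where "b + of_int m * L < real n * L" using reals_Archimedean3[OF L] by blast
  then have n: "b + of_int m * L \<le> real n * L" by simp
  have "h integrable_on {a..b} \<and> integral {a..b} h \<le> real n * integral {0..L} h"
    if per: "\<And>x. h (x + L) = h x" and nn: "\<And>x. h x \<ge> 0" and int: "h integrable_on {0..L}" for h
  proof -
    have full: "h integrable_on {0..real n * L} \<and> integral {0..real n * L} h = real n * integral {0..L} h" for n :: nat
    proof (induction n)
      case (Suc n)
      have e: "{0 + of_int (int n) * L..L + of_int (int n) * L} = {real n * L..real (Suc n) * L}" by (simp add: algebra_simps)
      have 1: "h integrable_on {real n * L..real (Suc n) * L}" "integral {real n * L..real (Suc n) * L} h = integral {0..L} h"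
        using periodic_integral_shift[of h L 0 L "int n", OF per] int L unfolding e by auto
      have o: "0 \<le> real n * L" "real n * L \<le> real (Suc n) * L" using L by (auto simp: algebra_simps)
      have 2: "h integrable_on {0..real (Suc n) * L}" using Henstock_Kurzweil_Integration.integrable_combine[OF o] Suc 1 by blast
      have "integral {0..real (Suc n) * L} h = real n * integral {0..L} h + integral {0..L} h"
        using Henstock_Kurzweil_Integration.integral_combine[OF o 2] Suc 1 by simp
      then show ?case using 2 by (simp add: algebra_simps)
    qed (use integrable_on_refl[of h 0] in auto)
    have sub: "{a + of_int m * L..b + of_int m * L} \<subseteq> {0..real n * L}" using m n by auto
    have 1: "h integrable_on {a + of_int m * L..b + of_int m * L}"
      by (rule integrable_on_subinterval[OF _ sub]) (use full in blast)
    have "integral {a + of_int m * L..b + of_int m * L} h \<le> integral {0..real n * L} h"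
      by (rule integral_subset_le[OF sub 1]) (use full nn in auto)
    then show ?thesis using full 1 periodic_integral_shift[of h L a b m, OF per True] by simp
  qed
  then show ?thesis by (intro exI[of _ n]) blast
qed

lemma L2_per_L2_loc:
  assumes L: "L > 0" and v: "v \<in> L2_per L"
  shows "L2_loc v" and "L2_norm_per L v = sqrt (integral {0..L} (\<lambda>x. (v x)\<^sup>2))"
proof -
  have per: "\<And>x. v (x + L) = v x" and m: "v \<in> borel_measurable lebesgue" and i: "(\<lambda>x. (v x)\<^sup>2) absolutely_integrable_on {0..L}"
    using v by (auto simp: L2_per_def)
  have "(\<lambda>x. (v x)\<^sup>2) integrable_on {a..b}" for a b
    using periodic_integral_bound[OF L, of a b] per set_lebesgue_integral_eq_integral(1)[OF i] by fastforce
  then show "L2_loc v" using m by (auto simp: L2_loc_def)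
  show "L2_norm_per L v = sqrt (integral {0..L} (\<lambda>x. (v x)\<^sup>2))"
    unfolding L2_norm_per_def set_lebesgue_integral_eq_integral(2)[OF i] ..
qed

lemma L2_loc_L2_per:
  assumes "L2_loc v" "\<And>x. v (x + L) = v x"
  shows "v \<in> L2_per L"
proof -
  have "(\<lambda>x. (v x)\<^sup>2) absolutely_integrable_on {0..L}"
    using L2_loc_mult_abs_integrable[OF assms(1,1)] by (simp add: power2_eq_square)
  then show ?thesis using assms by (auto simp: L2_per_def L2_loc_def)
qed

text \<open>The definition relates \<open>deriv u\<close> and \<open>v\<close> only on intervals
  that start at 0 and stay in one period; periodicity extends the identity to
  \<open>{0..real n * L}\<close> and, by a shift, to all intervals.\<close>

lemma H2_second_deriv_integral:
  assumes L: "L > 0" and H: "H2_second_deriv L u v" and ab: "a \<le> b"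
  shows "integral {a..b} v = deriv u b - deriv u a"
proof -
  have u: "u \<in> C1_per L" and v: "v \<in> L2_per L"
    and base: "\<And>x. x \<in> {0..L} \<Longrightarrow> deriv u x = deriv u 0 + (LINT y:{0..x}|lebesgue. v y)"
    using H unfolding H2_second_deriv_def by blast+
  note v2 = L2_per_L2_loc(1)[OF L v]
  note int = L2_loc_integrable[OF v2]
  have vper: "\<And>x. v (x + L) = v x" using v by (auto simp: L2_per_def)
  have uper: "deriv u (x + L) = deriv u x" for x
    by (rule periodic_derivative[of u L "deriv u"]) (use C1_perD[OF u] in auto)
  have unit: "integral {0..x} v = deriv u x - deriv u 0" if "x \<in> {0..L}" for x
    unfolding base[OF that] set_lebesgue_integral_eq_integral(2)[OF L2_loc_abs_integrable[OF v2]] by simp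
  have comb: "integral {a..c} v = integral {a..b} v + integral {b..c} v" if "a \<le> b" "b \<le> c" for a b c
    using Henstock_Kurzweil_Integration.integral_combine[OF that int] by simp
  have pos: "x \<in> {0..real n * L} \<Longrightarrow> integral {0..x} v = deriv u x - deriv u 0" for x n
  proof (induction n arbitrary: x)
    case 0
    then show ?case by simp
  next
    case (Suc n)
    show ?case
    proof (cases "x \<le> real n * L")
      case True
      then show ?thesis using Suc by simp
    next
      case False
      define y where "y = x - real n * L"
      have x: "x = y + of_int (int n) * L" by (simp add: y_def)
      have y: "y \<in> {0..L}" using Suc(2) False by (auto simp: y_def algebra_simps)
      have "integral {0 + of_int (int n) * L..y + of_int (int n) * L} v = deriv u y - deriv u 0"
        using periodic_integral_shift(1)[of v L 0 y "int n", OF vper] unit[OF y] y by simp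
      moreover have "deriv u y = deriv u x" "deriv u 0 = deriv u (real n * L)"
        using periodic_int[of "deriv u" L y "int n"] periodic_int[of "deriv u" L 0 "int n"] uper x by auto
      moreover have "integral {0..real n * L} v = deriv u (real n * L) - deriv u 0" using Suc(1)[of "real n * L"] L by simp
      ultimately show ?thesis using comb[of 0 "real n * L" x] False L x by simp
    qed
  qed
  obtain m :: int where m: "0 \<le> a + of_int m * L" using periodic_representative[OF L, of 0 a] by auto
  obtain n :: nat where n: "b + of_int m * L < real n * L" using reals_Archimedean3[OF L] by blast
  have "integral {a + of_int m * L..b + of_int m * L} v = deriv u (b + of_int m * L) - deriv u (a + of_int m * L)"
    using comb[of 0 "a + of_int m * L" "b + of_int m * L"] pos[of "a + of_int m * L" n] pos[of "b + of_int m * L" n] m n ab by auto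
  then show ?thesis
    using periodic_integral_shift(1)[of v L a b m, OF vper ab] periodic_int[of "deriv u" L _ m, OF uper] by simp
qed

definition C1_cont :: "real set \<Rightarrow> (real \<Rightarrow> real \<Rightarrow> real) \<Rightarrow> bool" where
  "C1_cont I w \<longleftrightarrow> (\<forall>t\<in>I. \<forall>e>0. \<exists>d>0. \<forall>s\<in>I. \<bar>s - t\<bar> < d \<longrightarrow>
     (\<forall>x. \<bar>w s x - w t x\<bar> < e \<and> \<bar>deriv (w s) x - deriv (w t) x\<bar> < e))"

lemma uniform_joint_continuous:
  fixes w :: "real \<Rightarrow> real \<Rightarrow> real"
  assumes "\<And>t e. t \<in> I \<Longrightarrow> e > 0 \<Longrightarrow> \<exists>d>0. \<forall>s\<in>I. \<bar>s - t\<bar> < d \<longrightarrow> (\<forall>x. \<bar>w s x - w t x\<bar> < e)"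
    and "\<And>t. t \<in> I \<Longrightarrow> continuous_on UNIV (w t)"
  shows "continuous_on (I \<times> UNIV) (\<lambda>(t, x). w t x)"
  unfolding continuous_on_iff
proof (clarify)
  fix t x and e :: real assume t: "t \<in> I" and e: "0 < e"
  obtain d1 where d1: "d1 > 0" "\<And>s x. s \<in> I \<Longrightarrow> \<bar>s - t\<bar> < d1 \<Longrightarrow> \<bar>w s x - w t x\<bar> < e / 2"
    using assms(1)[OF t, of "e / 2"] e by auto
  have "e / 2 > 0" using e by simp
  then obtain d2 where d2: "d2 > 0" "\<And>y. dist y x < d2 \<Longrightarrow> dist (w t y) (w t x) < e / 2"
    using assms(2)[OF t] unfolding continuous_on_iff by blast
  show "\<exists>d>0. \<forall>x'\<in>I \<times> UNIV. dist x' (t, x) < d \<longrightarrow> dist (case x' of (t, x) \<Rightarrow> w t x) (w t x) < e"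
  proof (intro exI[of _ "min d1 d2"] conjI ballI impI)
    fix p assume p: "p \<in> I \<times> (UNIV :: real set)" and d: "dist p (t, x) < min d1 d2"
    obtain s y where sy: "p = (s, y)" by (cases p)
    have "dist s t < d1" "dist y x < d2"
      using d dist_fst_le[of p "(t, x)"] dist_snd_le[of p "(t, x)"] by (auto simp: sy)
    then have "\<bar>w s y - w t y\<bar> < e / 2" "\<bar>w t y - w t x\<bar> < e / 2"
      using d1(2)[of s y] d2(2)[of y] p by (auto simp: sy dist_real_def)
    then have "\<bar>w s y - w t x\<bar> < e" by linarith
    then show "dist (case p of (t, x) \<Rightarrow> w t x) (w t x) < e" by (simp add: sy dist_real_def)
  qed (use d1 d2 in auto)
qed

lemma C1_cont_joint:
  assumes "C1_cont I w" "\<And>t. t \<in> I \<Longrightarrow> w t \<in> C1_per L"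
  shows "continuous_on (I \<times> UNIV) (\<lambda>(t, x). w t x)" and "continuous_on (I \<times> UNIV) (\<lambda>(t, x). deriv (w t) x)"
proof -
  have C: "\<exists>d>0. \<forall>s\<in>I. \<bar>s - t\<bar> < d \<longrightarrow> (\<forall>x. \<bar>w s x - w t x\<bar> < e \<and> \<bar>deriv (w s) x - deriv (w t) x\<bar> < e)"
    if "t \<in> I" "e > 0" for t e
    using assms(1) that unfolding C1_cont_def by blast
  show "continuous_on (I \<times> UNIV) (\<lambda>(t, x). w t x)"
  proof (rule uniform_joint_continuous)
    show "\<exists>d>0. \<forall>s\<in>I. \<bar>s - t\<bar> < d \<longrightarrow> (\<forall>x. \<bar>w s x - w t x\<bar> < e)" if "t \<in> I" "e > 0" for t e
      using C[OF that] by blast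
  qed (rule C1_perD(4)[OF assms(2)])
  show "continuous_on (I \<times> UNIV) (\<lambda>(t, x). deriv (w t) x)"
  proof (rule uniform_joint_continuous)
    show "\<exists>d>0. \<forall>s\<in>I. \<bar>s - t\<bar> < d \<longrightarrow> (\<forall>x. \<bar>deriv (w s) x - deriv (w t) x\<bar> < e)" if "t \<in> I" "e > 0" for t e
      using C[OF that] by blast
  qed (rule C1_perD(3)[OF assms(2)])
qed

text \<open>Convergence in the norm over one period becomes convergence on every bounded interval by
  \<open>periodic_integral_bound\<close>; continuity into \<open>C1\<close> gives the joint
  continuity.\<close>

lemma evol_of_solution:
  assumes L: "L > 0" and I: "open I" and C: "C1_cont I w" and w: "\<And>t. t \<in> I \<Longrightarrow> w t \<in> C1_per L"
    and g: "continuous_on UNIV g"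
    and eq: "\<And>t. t \<in> I \<Longrightarrow> \<exists>v. H2_second_deriv L (w t) v \<and>
        ((\<lambda>h. L2_norm_per L (\<lambda>x. (w (t + h) x - w t x) / h - (v x + g (t, w t x, deriv (w t) x)))) \<longlongrightarrow> 0) (at 0)"
  shows "\<exists>v. evol I w (\<lambda>t. deriv (w t)) v (\<lambda>t x. v t x + g (t, w t x, deriv (w t) x))"
proof -
  obtain v where H: "\<And>t. t \<in> I \<Longrightarrow> H2_second_deriv L (w t) (v t)"
    and lim: "\<And>t. t \<in> I \<Longrightarrow>
        ((\<lambda>h. L2_norm_per L (\<lambda>x. (w (t + h) x - w t x) / h - (v t x + g (t, w t x, deriv (w t) x)))) \<longlongrightarrow> 0) (at 0)"
  proof -
    have "\<forall>t\<in>I. \<exists>v. H2_second_deriv L (w t) v \<and>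
        ((\<lambda>h. L2_norm_per L (\<lambda>x. (w (t + h) x - w t x) / h - (v x + g (t, w t x, deriv (w t) x)))) \<longlongrightarrow> 0) (at 0)"
      using eq by blast
    from bchoice[OF this] that show ?thesis by blast
  qed
  define r where "r = (\<lambda>t x. v t x + g (t, w t x, deriv (w t) x))"
  have vper: "v t \<in> L2_per L" and v2: "L2_loc (v t)" if "t \<in> I" for t
    using H[OF that] L2_per_L2_loc[OF L, of "v t"] unfolding H2_second_deriv_def by blast+
  have gc: "continuous_on UNIV (\<lambda>x. g (t, w t x, deriv (w t) x))" if "t \<in> I" for t
    by (rule continuous_on_compose2[OF g]) (intro continuous_intros C1_perD(3)[OF w[OF that]] C1_perD(4)[OF w[OF that]] subset_UNIV)+
  have r2: "L2_loc (r t)" if "t \<in> I" for t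
    unfolding r_def by (intro L2_loc_add v2[OF that] L2_loc_continuous gc[OF that])
  have dper: "deriv (w t) (x + L) = deriv (w t) x" if "t \<in> I" for t x
    by (rule periodic_derivative[of "w t" L "deriv (w t)"]) (use C1_perD[OF w[OF that]] in auto)
  have rper: "r t (x + L) = r t x" if "t \<in> I" for t x
    using vper[OF that] dper[OF that] C1_perD(1)[OF w[OF that]] by (auto simp: r_def L2_per_def)
  have "((\<lambda>h. integral {a..b} (\<lambda>x. ((w (t + h) x - w t x) / h - r t x)\<^sup>2)) \<longlongrightarrow> 0) (at 0)" if t: "t \<in> I" for t a b
  proof -
    define Q where "Q = (\<lambda>h x. (w (t + h) x - w t x) / h - r t x)"
    obtain n where n: "\<And>h. (\<And>x. h (x + L) = h x) \<Longrightarrow> (\<And>x. h x \<ge> 0) \<Longrightarrow> h integrable_on {0..L} \<Longrightarrow>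
      h integrable_on {a..b} \<and> integral {a..b} h \<le> real n * integral {0..L} h" using periodic_integral_bound[OF L, of a b] by metis
    have Q: "L2_loc (Q h)" "Q h (x + L) = Q h x" if h: "t + h \<in> I" for h x
    proof -
      have "continuous_on UNIV (\<lambda>x. (w (t + h) x - w t x) / h)"
        using C1_perD(4)[OF w[OF h]] C1_perD(4)[OF w[OF t]] unfolding divide_inverse by (intro continuous_intros) auto
      then show "L2_loc (Q h)" unfolding Q_def by (intro L2_loc_diff L2_loc_continuous r2[OF t])
      show "Q h (x + L) = Q h x" using C1_perD(1)[OF w[OF h]] C1_perD(1)[OF w[OF t]] rper[OF t] by (simp add: Q_def)
    qed
    have "((\<lambda>h. (L2_norm_per L (Q h))\<^sup>2) \<longlongrightarrow> 0\<^sup>2) (at 0)"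
      using lim[OF t] unfolding Q_def r_def by (intro tendsto_power)
    then have lim2: "((\<lambda>h. real n * (L2_norm_per L (Q h))\<^sup>2) \<longlongrightarrow> 0) (at 0)"
      using tendsto_mult_right_zero[of "\<lambda>h. (L2_norm_per L (Q h))\<^sup>2" "at 0" "real n"] by simp
    have ev: "\<forall>\<^sub>F h in at 0. t + h \<in> I" by (rule eventually_at_0_shift[OF I t])
    have "((\<lambda>h. integral {a..b} (\<lambda>x. (Q h x)\<^sup>2)) \<longlongrightarrow> 0) (at 0)"
    proof (rule tendsto_sandwich[OF _ _ tendsto_const lim2])
      show "\<forall>\<^sub>F h in at 0. 0 \<le> integral {a..b} (\<lambda>x. (Q h x)\<^sup>2)"
        using ev by eventually_elim (use Q in \<open>auto intro!: Henstock_Kurzweil_Integration.integral_nonneg L2_loc_square_integrable\<close>)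
      show "\<forall>\<^sub>F h in at 0. integral {a..b} (\<lambda>x. (Q h x)\<^sup>2) \<le> real n * (L2_norm_per L (Q h))\<^sup>2"
        using ev
      proof eventually_elim
        case (elim h)
        have "L2_norm_per L (Q h) = sqrt (integral {0..L} (\<lambda>x. (Q h x)\<^sup>2))"
          by (rule L2_per_L2_loc(2)[OF L L2_loc_L2_per[OF Q[OF elim]]])
        moreover have "0 \<le> integral {0..L} (\<lambda>x. (Q h x)\<^sup>2)"
          using Q[OF elim] by (auto intro!: Henstock_Kurzweil_Integration.integral_nonneg L2_loc_square_integrable)
        ultimately have "(L2_norm_per L (Q h))\<^sup>2 = integral {0..L} (\<lambda>x. (Q h x)\<^sup>2)" by simp
        then show ?case using n[of "\<lambda>x. (Q h x)\<^sup>2"] Q[OF elim] L2_loc_square_integrable by simp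
      qed
    qed
    then show ?thesis by (simp add: Q_def)
  qed
  then have "evol I w (\<lambda>t. deriv (w t)) v r"
    unfolding evol_def using I C1_cont_joint[OF C w] C1_perD(2)[OF w] v2 r2 H2_second_deriv_integral[OF L H] by blast
  then show ?thesis unfolding r_def by blast
qed

context frac_embedding
begin

lemma solves_C1:
  assumes "solves L \<alpha> g u0 T w"
  shows "t \<in> {0..<T} \<Longrightarrow> w t \<in> frac_space L \<alpha>" and "C1_cont {0..<T} w"
proof -
  have c: "continuous_map (top_of_set {0..<T}) (frac_topology L \<alpha>) w" using assms by (simp add: solves_def)
  show fr: "w t \<in> frac_space L \<alpha>" if "t \<in> {0..<T}" for t
    using continuous_map_image_subset_topspace[OF c] that by (auto simp: frac_topology_eq)
  show "C1_cont {0..<T} w" unfolding C1_cont_def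
  proof (intro ballI allI impI)
    fix t and e :: real assume t: "t \<in> {0..<T}" and e: "e > 0"
    have "limitin (frac_topology L \<alpha>) w (w t) (at t within {0..<T})"
      unfolding limitin_def
    proof (intro conjI allI impI)
      show "w t \<in> topspace (frac_topology L \<alpha>)" using fr[OF t] by (simp add: frac_topology_eq)
      fix U assume U: "openin (frac_topology L \<alpha>) U \<and> w t \<in> U"
      have "openin (top_of_set {0..<T}) {s \<in> topspace (top_of_set {0..<T}). w s \<in> U}"
        using c U unfolding continuous_map_def by blast
      then obtain V where "open V" "{s \<in> {0..<T}. w s \<in> U} = {0..<T} \<inter> V" by (auto simp: openin_open)
      then show "\<forall>\<^sub>F s in at t within {0..<T}. w s \<in> U" unfolding eventually_at_topological using t U by blast
    qed
    from limitin_frac_uniform[OF this e] obtain d where d: "d > 0" "\<And>s. s \<in> {0..<T} \<Longrightarrow> s \<noteq> t \<Longrightarrow> dist s t < d \<Longrightarrow>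
        \<forall>x. \<bar>w s x - w t x\<bar> < e \<and> \<bar>deriv (w s) x - deriv (w t) x\<bar> < e" unfolding eventually_at by blast
    show "\<exists>d>0. \<forall>s\<in>{0..<T}. \<bar>s - t\<bar> < d \<longrightarrow> (\<forall>x. \<bar>w s x - w t x\<bar> < e \<and> \<bar>deriv (w s) x - deriv (w t) x\<bar> < e)"
    proof (intro exI[of _ d] conjI ballI impI d(1))
      fix s assume s: "s \<in> {0..<T}" "\<bar>s - t\<bar> < d"
      show "\<forall>x. \<bar>w s x - w t x\<bar> < e \<and> \<bar>deriv (w s) x - deriv (w t) x\<bar> < e"
        using d(2)[OF s(1)] s e by (cases "s = t") (auto simp: dist_real_def)
    qed
  qed
qed

lemma solves_evol:
  assumes "solves L \<alpha> g u0 T w" "continuous_on UNIV g"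
  shows "\<exists>v. evol {0<..<T} w (\<lambda>t. deriv (w t)) v (\<lambda>t x. v t x + g (t, w t x, deriv (w t) x))"
proof (rule evol_of_solution[OF L open_greaterThanLessThan _ _ assms(2)])
  show "C1_cont {0<..<T} w" using solves_C1(2)[OF assms(1)] unfolding C1_cont_def
    by (meson atLeastLessThan_iff greaterThanLessThan_iff less_imp_le)
qed (use assms(1) solves_C1(1)[OF assms(1)] in \<open>auto simp: solves_def frac_C1\<close>)

text \<open>One estimate for two purposes: equal nonlinearities with \<open>e = 0\<close> give
  uniqueness, \<open>e > 0\<close> gives continuous dependence on the state and the nonlinearity.
  The difference is controlled only in the mean of order four, not in the norm of the phase
  space.\<close>

lemma solution_difference:
  assumes s1: "solves L \<alpha> g u0 T w" and s2: "solves L \<alpha> g' u0' T' w'" and t: "0 \<le> t" "t < T" "t < T'"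
    and gc: "continuous_on UNIV g" "continuous_on UNIV g'" and K: "K \<ge> 0" and e: "e \<ge> 0"
    and b1: "\<And>s x. s \<in> {0..t} \<Longrightarrow> \<bar>w s x\<bar> \<le> R \<and> \<bar>deriv (w s) x\<bar> \<le> R"
    and b2: "\<And>s x. s \<in> {0..t} \<Longrightarrow> \<bar>w' s x\<bar> \<le> R \<and> \<bar>deriv (w' s) x\<bar> \<le> R"
    and Lip: "\<And>s a a' b b'. \<bar>a\<bar> \<le> R \<Longrightarrow> \<bar>a'\<bar> \<le> R \<Longrightarrow> \<bar>b\<bar> \<le> R \<Longrightarrow> \<bar>b'\<bar> \<le> R \<Longrightarrow>
      \<bar>g (s, a, b) - g (s, a', b')\<bar> \<le> K * (\<bar>a - a'\<bar> + \<bar>b - b'\<bar>)"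
    and ge: "\<And>s a b. s \<in> {0..t} \<Longrightarrow> \<bar>a\<bar> \<le> R \<Longrightarrow> \<bar>b\<bar> \<le> R \<Longrightarrow> \<bar>g (s, a, b) - g' (s, a, b)\<bar> \<le> e"
  defines "k \<equiv> K\<^sup>2 / 2 + 4 * K + 3"
  shows "integral {0..L} (\<lambda>x. (w t x - w' t x) ^ 4) \<le> exp (k * t) * (integral {0..L} (\<lambda>x. (u0 x - u0' x) ^ 4) + 2 * L * e ^ 4 / k)"
proof -
  obtain v where v: "evol {0<..<T} w (\<lambda>t. deriv (w t)) v (\<lambda>t x. v t x + g (t, w t x, deriv (w t) x))"
    using solves_evol[OF s1 gc(1)] by blast
  obtain v' where v': "evol {0<..<T'} w' (\<lambda>t. deriv (w' t)) v' (\<lambda>t x. v' t x + g' (t, w' t x, deriv (w' t) x))"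
    using solves_evol[OF s2 gc(2)] by blast
  let ?I = "{0<..<t}"
  have "evol ?I w (\<lambda>t. deriv (w t)) v (\<lambda>t x. v t x + g (t, w t x, deriv (w t) x))"
    "evol ?I w' (\<lambda>t. deriv (w' t)) v' (\<lambda>t x. v' t x + g' (t, w' t x, deriv (w' t) x))"
    by (rule evol_subset[OF v]; use t in auto) (rule evol_subset[OF v']; use t in auto)
  note ev = evol_diff[OF this]
  have ls: "lsol K e ?I (\<lambda>t x. w t x - w' t x) (\<lambda>t x. deriv (w t) x - deriv (w' t) x) (\<lambda>t x. v t x - v' t x)
     (\<lambda>t x. (v t x + g (t, w t x, deriv (w t) x)) - (v' t x + g' (t, w' t x, deriv (w' t) x)))"
    unfolding lsol_def
  proof (intro conjI ballI allI ev)
    fix s x assume s: "s \<in> ?I"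
    then have s': "s \<in> {0..t}" by auto
    have "\<bar>g (s, w s x, deriv (w s) x) - g (s, w' s x, deriv (w' s) x)\<bar> \<le> K * (\<bar>w s x - w' s x\<bar> + \<bar>deriv (w s) x - deriv (w' s) x\<bar>)"
      using b1[OF s'] b2[OF s'] by (intro Lip) auto
    moreover have "\<bar>g (s, w' s x, deriv (w' s) x) - g' (s, w' s x, deriv (w' s) x)\<bar> \<le> e"
      using b2[OF s'] by (intro ge[OF s']) auto
    ultimately show "\<bar>(v s x + g (s, w s x, deriv (w s) x)) - (v' s x + g' (s, w' s x, deriv (w' s) x)) - (v s x - v' s x)\<bar>
      \<le> K * (\<bar>w s x - w' s x\<bar> + \<bar>deriv (w s) x - deriv (w' s) x\<bar>) + e" by linarith
  qed
  have jc: "continuous_on ({0..t} \<times> UNIV) (\<lambda>(t, x). w t x)" "continuous_on ({0..t} \<times> UNIV) (\<lambda>(t, x). w' t x)"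
    by (rule continuous_on_subset[OF C1_cont_joint(1)[OF solves_C1(2)[OF s1] frac_C1[OF solves_C1(1)[OF s1]]]]; use t in auto)
      (rule continuous_on_subset[OF C1_cont_joint(1)[OF solves_C1(2)[OF s2] frac_C1[OF solves_C1(1)[OF s2]]]]; use t in auto)
  have "continuous_on ({0..t} \<times> UNIV) (\<lambda>(t, x). (w t x - w' t x) ^ 4)"
    using jc unfolding split_beta by (intro continuous_intros)
  then have Ec: "continuous_on {0..t} (\<lambda>\<tau>. integral {0..L} (\<lambda>x. (w \<tau> x - w' \<tau> x) ^ 4))"
    by (rule continuous_on_param_integral)
  have per: "w s (x + L) - w' s (x + L) = w s x - w' s x" if "s \<in> ?I" for s x
    using that t C1_perD(1)[OF frac_C1[OF solves_C1(1)[OF s1]]] C1_perD(1)[OF frac_C1[OF solves_C1(1)[OF s2]]] by simp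
  have "w 0 = u0" "w' 0 = u0'" using s1 s2 by (auto simp: solves_def)
  then show ?thesis unfolding k_def
    using periodic_energy[OF ls K e L per t(1) _ Ec] by simp
qed

lemma solves_bounded:
  assumes s: "solves L \<alpha> g u0 T w" and t: "0 \<le> t" "t < T"
  shows "\<exists>R\<ge>0. \<forall>s\<in>{0..t}. \<forall>x. \<bar>w s x\<bar> \<le> R \<and> \<bar>deriv (w s) x\<bar> \<le> R"
proof -
  note fr = frac_C1[OF solves_C1(1)[OF s]]
  note jc = C1_cont_joint[OF solves_C1(2)[OF s] fr]
  have cpt: "compact ({0..t} \<times> {0..L})" by (intro compact_Times) auto
  have bd: "\<exists>B. \<forall>s\<in>{0..t}. \<forall>x. \<bar>h s x\<bar> \<le> B"
    if h: "continuous_on ({0..<T} \<times> UNIV) (\<lambda>(t, x). h t x)" "\<And>s x. s \<in> {0..t} \<Longrightarrow> h s (x + L) = h s x" for h :: "real \<Rightarrow> real \<Rightarrow> real"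
  proof -
    have "compact ((\<lambda>(t, x). h t x) ` ({0..t} \<times> {0..L}))"
      by (rule compact_continuous_image[OF continuous_on_subset[OF h(1)] cpt]) (use t in auto)
    then have "bounded ((\<lambda>(t, x). h t x) ` ({0..t} \<times> {0..L}))" by (rule compact_imp_bounded)
    then obtain B where "\<forall>y\<in>(\<lambda>(t, x). h t x) ` ({0..t} \<times> {0..L}). norm y \<le> B" unfolding bounded_iff by blast
    then have B: "\<bar>h s x\<bar> \<le> B" if "s \<in> {0..t}" "x \<in> {0..L}" for s x using that by force
    have "\<bar>h s x\<bar> \<le> B" if s: "s \<in> {0..t}" for s x
    proof -
      obtain n :: int where "0 \<le> x + of_int n * L" "x + of_int n * L < 0 + L" using periodic_representative[OF L, of 0 x] by auto
      then show ?thesis using B[OF s, of "x + of_int n * L"] periodic_int[of "h s" L x n] h(2)[OF s] by simp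
    qed
    then show ?thesis by blast
  qed
  have sT: "s \<in> {0..<T}" if "s \<in> {0..t}" for s using that t by auto
  obtain B1 where B1: "\<And>s x. s \<in> {0..t} \<Longrightarrow> \<bar>w s x\<bar> \<le> B1"
    using bd[OF jc(1)] C1_perD(1)[OF fr[OF sT]] by blast
  have "deriv (w s) (x + L) = deriv (w s) x" if "s \<in> {0..t}" for s x
    by (rule periodic_derivative[of "w s" L "deriv (w s)"]) (use C1_perD[OF fr[OF sT[OF that]]] in auto)
  then obtain B2 where B2: "\<And>s x. s \<in> {0..t} \<Longrightarrow> \<bar>deriv (w s) x\<bar> \<le> B2"
    using bd[OF jc(2)] by blast
  show ?thesis
    by (intro exI[of _ "max 0 (max B1 B2)"]) (use B1 B2 in \<open>auto simp: le_max_iff_disj\<close>)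
qed

lemma solves_shift:
  assumes s: "solves L \<alpha> g u0 T w" and "0 \<le> s" "s < T"
  shows "solves L \<alpha> (shift s g) (w s) (T - s) (\<lambda>t. w (s + t))"
  unfolding solves_def
proof (intro conjI ballI)
  have c: "continuous_map (top_of_set {0..<T}) (frac_topology L \<alpha>) w" using s by (simp add: solves_def)
  have "continuous_map (top_of_set {0..<T - s}) (top_of_set {0..<T}) (\<lambda>t. s + t)"
    using assms by (auto simp: continuous_map_in_subtopology intro!: continuous_intros)
  from continuous_map_compose[OF this c]
  show "continuous_map (top_of_set {0..<T - s}) (frac_topology L \<alpha>) (\<lambda>t. w (s + t))" by (simp add: o_def)
  fix t assume t: "t \<in> {0<..<T - s}"
  then have "s + t \<in> {0<..<T}" using assms by auto
  then obtain v where "H2_second_deriv L (w (s + t)) v \<and>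
        ((\<lambda>h. L2_norm_per L (\<lambda>x. (w (s + t + h) x - w (s + t) x) / h
                - (v x + g (s + t, w (s + t) x, deriv (w (s + t)) x)))) \<longlongrightarrow> 0) (at 0)"
    using s unfolding solves_def by blast
  then show "\<exists>v. H2_second_deriv L (w (s + t)) v \<and>
        ((\<lambda>h. L2_norm_per L (\<lambda>x. (w (s + (t + h)) x - w (s + t) x) / h
                - (v x + shift s g (t, w (s + t) x, deriv (w (s + t)) x)))) \<longlongrightarrow> 0) (at 0)"
    by (auto simp: shift_def add_ac)
qed (use assms in auto)

lemma solves_cong:
  assumes s: "solves L \<alpha> g u0 T' w" and T: "0 < T" "T \<le> T'" and eq: "\<And>t. t \<in> {0..<T} \<Longrightarrow> w' t = w t"
  shows "solves L \<alpha> g u0 T w'"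
  unfolding solves_def
proof (intro conjI ballI)
  show "w' 0 = u0" using s eq[of 0] T by (simp add: solves_def)
  have "continuous_map (top_of_set {0..<T}) (frac_topology L \<alpha>) w"
    using s T continuous_map_from_subtopology_mono[of euclidean "{0..<T'}" _ w "{0..<T}"] by (auto simp: solves_def)
  then show "continuous_map (top_of_set {0..<T}) (frac_topology L \<alpha>) w'" by (rule continuous_map_eq) (use eq in auto)
  fix t assume t: "t \<in> {0<..<T}"
  then obtain v where v: "H2_second_deriv L (w t) v"
    "((\<lambda>h. L2_norm_per L (\<lambda>x. (w (t + h) x - w t x) / h - (v x + g (t, w t x, deriv (w t) x)))) \<longlongrightarrow> 0) (at 0)"
    using s T unfolding solves_def by force
  have wt: "w' t = w t" using eq[of t] t by auto
  have "\<forall>\<^sub>F h in at 0. t + h \<in> {0<..<T}" by (rule eventually_at_0_shift) (use t in auto)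
  then have "\<forall>\<^sub>F h in at 0. L2_norm_per L (\<lambda>x. (w (t + h) x - w t x) / h - (v x + g (t, w t x, deriv (w t) x))) =
    L2_norm_per L (\<lambda>x. (w' (t + h) x - w' t x) / h - (v x + g (t, w' t x, deriv (w' t) x)))"
    by eventually_elim (use eq wt in auto)
  from Lim_transform_eventually[OF v(2) this] v(1)
  show "\<exists>v. H2_second_deriv L (w' t) v \<and>
    ((\<lambda>h. L2_norm_per L (\<lambda>x. (w' (t + h) x - w' t x) / h - (v x + g (t, w' t x, deriv (w' t) x)))) \<longlongrightarrow> 0) (at 0)"
    using wt by auto
qed (use T in auto)

lemma integral_power4_zero:
  assumes "continuous_on UNIV p" "\<And>x. p (x + L) = p x" "integral {0..L} (\<lambda>x. p x ^ 4) \<le> 0"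
  shows "p x = (0 :: real)"
proof -
  have c: "continuous_on {0..L} (\<lambda>x. p x ^ 4)" by (intro continuous_intros continuous_on_subset[OF assms(1)]) auto
  have "integral {0..L} (\<lambda>x. p x ^ 4) \<ge> 0" by (intro Henstock_Kurzweil_Integration.integral_nonneg integrable_continuous_real c) auto
  then have "integral {0..L} (\<lambda>x. p x ^ 4) = 0" using assms(3) by simp
  then have "((\<lambda>x. p x ^ 4) has_integral 0) (cbox 0 L)" using integrable_integral[OF integrable_continuous_real[OF c]] by simp
  then have z: "p y ^ 4 = 0" if "y \<in> {0..L}" for y
    using has_integral_0_cbox_imp_0[of 0 L "\<lambda>x. p x ^ 4" y] c that L by auto
  obtain n :: int where "0 \<le> x + of_int n * L" "x + of_int n * L < 0 + L" using periodic_representative[OF L, of 0 x] by auto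
  then show ?thesis using z[of "x + of_int n * L"] periodic_int[of p L x n] assms(2) by simp
qed

lemma solves_unique:
  assumes s1: "solves L \<alpha> g u T w" and s2: "solves L \<alpha> g u T' w'" and t: "0 \<le> t" "t < T" "t < T'"
    and st: "standing_assumption f" and g: "g \<in> time_hull f"
  shows "w t = w' t"
proof -
  obtain R1 where R1: "\<And>s x. s \<in> {0..t} \<Longrightarrow> \<bar>w s x\<bar> \<le> R1 \<and> \<bar>deriv (w s) x\<bar> \<le> R1" "R1 \<ge> 0"
    using solves_bounded[OF s1 t(1,2)] by blast
  obtain R2 where R2: "\<And>s x. s \<in> {0..t} \<Longrightarrow> \<bar>w' s x\<bar> \<le> R2 \<and> \<bar>deriv (w' s) x\<bar> \<le> R2"
    using solves_bounded[OF s2 t(1,3)] by blast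
  define R where "R = max R1 R2"
  have R: "R \<ge> 0" "R1 \<le> R" "R2 \<le> R" using R1 by (auto simp: R_def)
  have bd: "\<And>s x. s \<in> {0..t} \<Longrightarrow> \<bar>w s x\<bar> \<le> R \<and> \<bar>deriv (w s) x\<bar> \<le> R"
    "\<And>s x. s \<in> {0..t} \<Longrightarrow> \<bar>w' s x\<bar> \<le> R \<and> \<bar>deriv (w' s) x\<bar> \<le> R"
    using R1(1) R2 R(2,3) order_trans by metis+
  obtain K where K: "K \<ge> 0" "\<And>s a a' b b'. \<bar>a\<bar> \<le> R \<Longrightarrow> \<bar>a'\<bar> \<le> R \<Longrightarrow> \<bar>b\<bar> \<le> R \<Longrightarrow> \<bar>b'\<bar> \<le> R \<Longrightarrow>
      \<bar>g (s, a, b) - g (s, a', b')\<bar> \<le> K * (\<bar>a - a'\<bar> + \<bar>b - b'\<bar>)"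
    using time_hull_Lipschitz[OF st R(1)] g by blast
  note gc = time_hull_approx(1)[OF g]
  have le: "integral {0..L} (\<lambda>x. (w t x - w' t x) ^ 4) \<le> 0"
    using solution_difference[OF s1 s2 t gc gc K(1) order_refl bd K(2)] by simp
  have fr: "w t \<in> C1_per L" "w' t \<in> C1_per L"
    using frac_C1[OF solves_C1(1)[OF s1]] frac_C1[OF solves_C1(1)[OF s2]] t by auto
  have "w t x - w' t x = 0" for x
    using C1_per_diff(1)[OF fr] by (intro integral_power4_zero[OF _ _ le]) (auto dest: C1_perD(1,4))
  then show ?thesis by auto
qed

lemma phi_solves:
  assumes s: "solves L \<alpha> g u T w" and t: "0 \<le> t" "t < T"
    and st: "standing_assumption f" and g: "g \<in> time_hull f"
  shows "phi L \<alpha> t u g = w t"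
  unfolding phi_def
proof (rule the_equality)
  fix v assume "\<exists>T w. t < T \<and> solves L \<alpha> g u T w \<and> v = w t"
  then obtain T' w' where "t < T'" "solves L \<alpha> g u T' w'" "v = w' t" by blast
  then show "v = w t" using solves_unique[OF _ s t(1) _ t(2) st g] by blast
qed (use s t in blast)

end

section \<open>The flow on the minimal set\<close>

lemma power4_sum_le: "(x + y) ^ 4 \<le> 8 * (x ^ 4 + y ^ 4)" for x y :: real
proof -
  have sq: "(a + b)\<^sup>2 \<le> 2 * (a\<^sup>2 + b\<^sup>2)" for a b :: real
    using zero_le_power2[of "a - b"] by (simp add: power2_eq_square algebra_simps)
  have p4: "a ^ 4 = (a\<^sup>2)\<^sup>2" for a :: real by simp
  have "((x + y)\<^sup>2)\<^sup>2 \<le> (2 * (x\<^sup>2 + y\<^sup>2))\<^sup>2" by (intro power_mono sq) auto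
  also have "\<dots> = 4 * (x\<^sup>2 + y\<^sup>2)\<^sup>2" by (simp only: power_mult_distrib) simp
  also have "\<dots> \<le> 4 * (2 * ((x\<^sup>2)\<^sup>2 + (y\<^sup>2)\<^sup>2))" by (intro mult_left_mono sq) auto
  finally show ?thesis unfolding p4[of "x + y"] p4[of x] p4[of y] by simp
qed

context minimal_setting
begin

abbreviation Pi_map :: "real \<Rightarrow> state \<Rightarrow> state" where "Pi_map \<equiv> skew_product L \<alpha>"

lemma Pi_map_eq: "Pi_map t z = (phi L \<alpha> t (fst z) (snd z), shift t (snd z))"
  by (simp add: skew_product_def split_beta)

lemma Pi_map_M: "z \<in> M \<Longrightarrow> 0 \<le> t \<Longrightarrow> Pi_map t z \<in> M"
  and sol_exists_M: "z \<in> M \<Longrightarrow> 0 \<le> t \<Longrightarrow> sol_exists L \<alpha> (snd z) (fst z) t"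
  using minimal unfolding minimal_set_def positively_invariant_def by fastforce+

lemma orbit_solves:
  assumes z: "z \<in> M" and S: "S > 0"
  shows "solves L \<alpha> (snd z) (fst z) S (\<lambda>t. phi L \<alpha> t (fst z) (snd z))"
proof -
  obtain S' w where w: "S < S'" "solves L \<alpha> (snd z) (fst z) S' w"
    using sol_exists_M[OF z, of S] S unfolding sol_exists_def by auto
  show ?thesis
  proof (rule solves_cong[OF w(2) S])
    fix t assume "t \<in> {0..<S}"
    then show "phi L \<alpha> t (fst z) (snd z) = w t" using phi_solves[OF w(2) _ _ standing M_subset(2)[OF z]] w by auto
  qed (use w in simp)
qed

lemma shift_add: "shift (s + t) g = shift s (shift t g)"
  by (auto simp: shift_def add_ac)

lemma shift_0: "shift 0 g = g" by (auto simp: shift_def)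

lemma Pi_map_0: "z \<in> M \<Longrightarrow> Pi_map 0 z = z"
  using orbit_solves[of z 1] by (simp add: Pi_map_eq shift_0 solves_def)

lemma Pi_map_add:
  assumes z: "z \<in> M" and s: "0 \<le> s" and t: "0 \<le> t"
  shows "Pi_map (s + t) z = Pi_map s (Pi_map t z)"
proof -
  have T: "s + t + 1 > 0" using s t by simp
  have "solves L \<alpha> (shift t (snd z)) (phi L \<alpha> t (fst z) (snd z)) (s + t + 1 - t) (\<lambda>s. phi L \<alpha> (t + s) (fst z) (snd z))"
    by (rule solves_shift[OF orbit_solves[OF z T] t]) (use s in simp)
  from phi_solves[OF this s _ standing] M_subset(2)[OF Pi_map_M[OF z t]] s
  have "phi L \<alpha> s (phi L \<alpha> t (fst z) (snd z)) (shift t (snd z)) = phi L \<alpha> (t + s) (fst z) (snd z)"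
    by (simp add: Pi_map_eq)
  then show ?thesis by (simp add: Pi_map_eq shift_add add.commute)
qed

lemma M_bounded: "\<exists>R\<ge>0. \<forall>z\<in>M. \<forall>x. \<bar>fst z x\<bar> \<le> R \<and> \<bar>deriv (fst z) x\<bar> \<le> R"
proof (rule ccontr)
  assume neg: "\<not> ?thesis"
  have "\<exists>z\<in>M. \<exists>x. \<bar>fst z x\<bar> > real n \<or> \<bar>deriv (fst z) x\<bar> > real n" for n :: nat
  proof (rule ccontr)
    assume "\<not> ?thesis"
    then have "\<forall>z\<in>M. \<forall>x. \<bar>fst z x\<bar> \<le> real n \<and> \<bar>deriv (fst z) x\<bar> \<le> real n" by (meson not_le)
    then show False using neg of_nat_0_le_iff[of n] by blast
  qed
  then obtain z x where z: "\<And>n. z n \<in> M" and big: "\<And>n. \<bar>fst (z n) (x n)\<bar> > real n \<or> \<bar>deriv (fst (z n)) (x n)\<bar> > real n"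
    by metis
  obtain l r where r: "strict_mono (r :: nat \<Rightarrow> nat)" "limitin T (z \<circ> r) l sequentially"
    using metrizable_compact_subsequence[OF metrizable_T compact_T, of z] z topspace_T by auto
  have l: "l \<in> M" using limitin_topspace[OF r(2)] topspace_T by simp
  note fl = frac_C1[OF M_subset(1)[OF l]]
  obtain B1 where B1: "\<And>x. \<bar>fst l x\<bar> \<le> B1" using periodic_bounded[OF L C1_perD(1,4)[OF fl]] by auto
  have "deriv (fst l) (x + L) = deriv (fst l) x" for x
    by (rule periodic_derivative[of "fst l" L "deriv (fst l)"]) (use C1_perD[OF fl] in auto)
  from periodic_bounded[OF L this C1_perD(3)[OF fl]] obtain B2 where B2: "\<And>x. \<bar>deriv (fst l) x\<bar> \<le> B2" by auto
  have ev: "\<forall>\<^sub>F n in sequentially. (z \<circ> r) n \<in> M \<and> (\<forall>x. \<bar>fst ((z \<circ> r) n) x - fst l x\<bar> < 1 \<and> \<bar>deriv (fst ((z \<circ> r) n)) x - deriv (fst l) x\<bar> < 1)"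
    using limitin_frac_uniform[OF limitin_T_frac[OF r(2)], of 1] z by (auto elim!: eventually_mono)
  obtain n0 :: nat where n0: "real n0 > 1 + \<bar>B1\<bar> + \<bar>B2\<bar>" using reals_Archimedean2 by blast
  have "\<forall>\<^sub>F n in sequentially. n0 \<le> n" by (rule eventually_ge_at_top)
  with ev have "\<forall>\<^sub>F n in sequentially. False"
  proof eventually_elim
    case (elim n)
    have "real n0 \<le> real (r n)" using elim strict_mono_imp_increasing[OF r(1), of n] by simp
    moreover have "\<bar>fst (z (r n)) (x (r n)) - fst l (x (r n))\<bar> < 1" "\<bar>deriv (fst (z (r n))) (x (r n)) - deriv (fst l) (x (r n))\<bar> < 1"
      using elim by auto
    ultimately show False using big[of "r n"] n0 B1[of "x (r n)"] B2[of "x (r n)"] by linarith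
  qed
  then show False by simp
qed

text \<open>A closed-graph statement. The energy estimate identifies the limit of the images in the
  mean of order four, but does not produce convergence in the phase space; compactness of
  \<open>M\<close> supplies that in \<open>Pi_map_continuous\<close>.\<close>

lemma Pi_map_limit:
  assumes tn: "\<And>n. 0 \<le> tn n" "tn \<longlonglongrightarrow> t" and zn: "range zn \<subseteq> M" "limitin T zn z sequentially"
    and y: "limitin T (\<lambda>n. Pi_map (tn n) (zn n)) y sequentially"
  shows "y = Pi_map t z"
proof -
  have z: "z \<in> M" and yM: "y \<in> M" using limitin_topspace[OF zn(2)] limitin_topspace[OF y] topspace_T by auto
  have znM: "zn n \<in> M" for n using zn(1) by auto
  have t: "0 \<le> t" using LIMSEQ_le_const[OF tn(2), of 0] tn(1) by auto
  have snd_y: "snd y = shift t (snd z)"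
  proof
    fix p :: "real \<times> real \<times> real"
    have "(\<lambda>n. snd (Pi_map (tn n) (zn n)) p) \<longlonglongrightarrow> snd y p"
      using limitin_compact_open_eval[OF limitin_T_hull[OF y] tendsto_const, of p] .
    moreover have "(\<lambda>n. snd (zn n) (fst p + tn n, snd p)) \<longlonglongrightarrow> snd z (fst p + t, snd p)"
      by (rule limitin_compact_open_eval[OF limitin_T_hull[OF zn(2)]]) (intro tendsto_intros tn)
    ultimately show "snd y p = shift t (snd z) p"
      using LIMSEQ_unique by (fastforce simp: Pi_map_eq shift_def split_beta)
  qed
  obtain R where R: "R \<ge> 0" "\<And>z x. z \<in> M \<Longrightarrow> \<bar>fst z x\<bar> \<le> R \<and> \<bar>deriv (fst z) x\<bar> \<le> R" using M_bounded by blast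
  obtain K where K: "K \<ge> 0" "\<And>g s a a' b b'. g \<in> time_hull f \<Longrightarrow> \<bar>a\<bar> \<le> R \<Longrightarrow> \<bar>a'\<bar> \<le> R \<Longrightarrow> \<bar>b\<bar> \<le> R \<Longrightarrow> \<bar>b'\<bar> \<le> R \<Longrightarrow>
      \<bar>g (s, a, b) - g (s, a', b')\<bar> \<le> K * (\<bar>a - a'\<bar> + \<bar>b - b'\<bar>)"
    using time_hull_Lipschitz[OF standing R(1)] by blast
  define k where "k = K\<^sup>2 / 2 + 4 * K + 3"
  have k: "k > 0" using K by (simp add: k_def add_nonneg_pos)
  define a b p q where "a = (\<lambda>n. fst (Pi_map (tn n) (zn n)))" and "b = (\<lambda>n. phi L \<alpha> (tn n) (fst z) (snd z))"
    and "p = fst y" and "q = phi L \<alpha> t (fst z) (snd z)"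
  have C: "p \<in> C1_per L" "q \<in> C1_per L" "a n \<in> C1_per L" "b n \<in> C1_per L" for n
    using frac_C1[OF M_subset(1)[OF yM]] frac_C1[OF M_subset(1)[OF Pi_map_M[OF z t]]]
      frac_C1[OF M_subset(1)[OF Pi_map_M[OF znM tn(1)]]] frac_C1[OF M_subset(1)[OF Pi_map_M[OF z tn(1)]]]
    by (simp_all add: p_def q_def a_def b_def Pi_map_eq)
  \<comment> \<open>From \<open>p - q = (p - a n) + (a n - b n) + (b n - q)\<close> with
    \<open>power4_sum_le\<close> used twice: 72 = 8 + 64 belongs to the two outer differences, 64 to
    the middle one, which the energy estimate bounds.\<close>
  define c where "c = 72 * L + 64 * (exp (k * (t + 1)) * (L + 2 * L / k))"
  have est: "integral {0..L} (\<lambda>x. (p x - q x) ^ 4) \<le> c * e ^ 4" if e: "e > 0" for e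
  proof -
    have 1: "\<forall>\<^sub>F n in sequentially. \<forall>x. \<bar>a n x - p x\<bar> < e"
      using limitin_frac_uniform[OF limitin_T_frac[OF y] e] by eventually_elim (simp add: a_def p_def)
    have T: "t + 1 > 0" using t by simp
    obtain d where d: "d > 0" "\<And>s. s \<in> {0..<t + 1} \<Longrightarrow> \<bar>s - t\<bar> < d \<Longrightarrow>
        \<forall>x. \<bar>phi L \<alpha> s (fst z) (snd z) x - phi L \<alpha> t (fst z) (snd z) x\<bar> < e"
      using solves_C1(2)[OF orbit_solves[OF z T]] t e unfolding C1_cont_def
      by (metis (no_types, lifting) atLeastLessThan_iff less_add_one)
    have 2: "\<forall>\<^sub>F n in sequentially. \<bar>tn n - t\<bar> < min d 1"
      using tendstoD[OF tn(2), of "min d 1"] d by (simp add: dist_real_def)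
    have 3: "\<forall>\<^sub>F n in sequentially. \<forall>x. \<bar>fst (zn n) x - fst z x\<bar> < e"
      using limitin_frac_uniform[OF limitin_T_frac[OF zn(2)] e] by eventually_elim simp
    have "compact ({0..t + 1} \<times> {- R..R} \<times> {- R..R})" by (intro compact_Times) auto
    from limitin_compact_open_uniform[OF limitin_T_hull[OF zn(2)] this e]
    have 4: "\<forall>\<^sub>F n in sequentially. \<forall>w\<in>{0..t + 1} \<times> {- R..R} \<times> {- R..R}. dist (snd (zn n) w) (snd z w) < e" .
    from eventually_happens'[OF sequentially_bot eventually_conj[OF 1 eventually_conj[OF 2 eventually_conj[OF 3 4]]]]
    obtain n where n1: "\<And>x. \<bar>a n x - p x\<bar> < e" and n2: "\<bar>tn n - t\<bar> < min d 1" and n3: "\<And>x. \<bar>fst (zn n) x - fst z x\<bar> < e"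
      and n4: "\<And>w. w \<in> {0..t + 1} \<times> {- R..R} \<times> {- R..R} \<Longrightarrow> dist (snd (zn n) w) (snd z w) < e" by blast
    have tn': "0 \<le> tn n" "tn n < t + 1" "tn n \<in> {0..<t + 1}" using n2 tn(1)[of n] by auto
    have n5: "\<bar>b n x - q x\<bar> < e" for x using d(2)[OF tn'(3)] n2 by (auto simp: b_def q_def)
    have "integral {0..L} (\<lambda>x. (phi L \<alpha> (tn n) (fst (zn n)) (snd (zn n)) x - phi L \<alpha> (tn n) (fst z) (snd z) x) ^ 4)
      \<le> exp ((K\<^sup>2 / 2 + 4 * K + 3) * tn n) * (integral {0..L} (\<lambda>x. (fst (zn n) x - fst z x) ^ 4) + 2 * L * e ^ 4 / (K\<^sup>2 / 2 + 4 * K + 3))"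
    proof (rule solution_difference[OF orbit_solves[OF znM T] orbit_solves[OF z T] tn'(1,2,2), where R = R])
      show "continuous_on UNIV (snd (zn n))" "continuous_on UNIV (snd z)"
        using time_hull_approx(1)[OF M_subset(2)[OF znM]] time_hull_approx(1)[OF M_subset(2)[OF z]] by blast+
      show "\<bar>phi L \<alpha> s (fst (zn n)) (snd (zn n)) x\<bar> \<le> R \<and> \<bar>deriv (phi L \<alpha> s (fst (zn n)) (snd (zn n))) x\<bar> \<le> R" if "s \<in> {0..tn n}" for s x
        using R(2)[OF Pi_map_M[OF znM, of s]] that by (simp add: Pi_map_eq)
      show "\<bar>phi L \<alpha> s (fst z) (snd z) x\<bar> \<le> R \<and> \<bar>deriv (phi L \<alpha> s (fst z) (snd z)) x\<bar> \<le> R" if "s \<in> {0..tn n}" for s x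
        using R(2)[OF Pi_map_M[OF z, of s]] that by (simp add: Pi_map_eq)
      show "\<bar>snd (zn n) (s, a, b) - snd z (s, a, b)\<bar> \<le> e" if "s \<in> {0..tn n}" "\<bar>a\<bar> \<le> R" "\<bar>b\<bar> \<le> R" for s a b
        using n4[of "(s, a, b)"] that tn' by (auto simp: dist_real_def abs_le_iff)
    qed (use K e M_subset(2)[OF znM] in auto)
    then have "integral {0..L} (\<lambda>x. (a n x - b n x) ^ 4) \<le> exp (k * tn n) * (integral {0..L} (\<lambda>x. (fst (zn n) x - fst z x) ^ 4) + 2 * L * e ^ 4 / k)"
      by (simp add: a_def b_def Pi_map_eq k_def)
    also have "\<dots> \<le> exp (k * (t + 1)) * (L * e ^ 4 + 2 * L * e ^ 4 / k)"
    proof (intro mult_mono add_mono order_refl)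
      have Cz: "fst (zn n) \<in> C1_per L" "fst z \<in> C1_per L" using M_subset(1) znM z frac_C1 by auto
      have i: "(\<lambda>x. (fst (zn n) x - fst z x) ^ 4) integrable_on {0..L}"
        by (intro integrable_continuous_real continuous_intros C1_perD(4)[OF Cz(1)] C1_perD(4)[OF Cz(2)])
      have "integral {0..L} (\<lambda>x. (fst (zn n) x - fst z x) ^ 4) \<le> integral {0..L} (\<lambda>x. e ^ 4)"
      proof (rule Henstock_Kurzweil_Integration.integral_le[OF i])
        show "(fst (zn n) x - fst z x) ^ 4 \<le> e ^ 4" for x using n3[of x] power_mono[of "\<bar>fst (zn n) x - fst z x\<bar>" e 4] by simp
      qed auto
      then show "integral {0..L} (\<lambda>x. (fst (zn n) x - fst z x) ^ 4) \<le> L * e ^ 4" using L by simp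
      show "0 \<le> integral {0..L} (\<lambda>x. (fst (zn n) x - fst z x) ^ 4) + 2 * L * e ^ 4 / k"
        using i L k by (intro add_nonneg_nonneg Henstock_Kurzweil_Integration.integral_nonneg) auto
    qed (use tn' k in auto)
    finally have ab: "integral {0..L} (\<lambda>x. (a n x - b n x) ^ 4) \<le> exp (k * (t + 1)) * (L * e ^ 4 + 2 * L * e ^ 4 / k)" .
    have i1: "(\<lambda>x. (a n x - b n x) ^ 4) integrable_on {0..L}" "(\<lambda>x. (p x - q x) ^ 4) integrable_on {0..L}"
      by (intro integrable_continuous_real continuous_intros C1_perD(4)[OF C(1)] C1_perD(4)[OF C(2)] C1_perD(4)[OF C(3)] C1_perD(4)[OF C(4)])+
    have pw: "(p x - q x) ^ 4 \<le> 72 * e ^ 4 + 64 * (a n x - b n x) ^ 4" for x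
    proof -
      have e1: "(p x - a n x) ^ 4 \<le> e ^ 4" using n1[of x] power_mono[of "\<bar>p x - a n x\<bar>" e 4] by (simp add: abs_minus_commute)
      have e2: "(b n x - q x) ^ 4 \<le> e ^ 4" using n5[of x] power_mono[of "\<bar>b n x - q x\<bar>" e 4] by simp
      have s1: "((p x - a n x) + (a n x - q x)) ^ 4 \<le> 8 * ((p x - a n x) ^ 4 + (a n x - q x) ^ 4)" by (rule power4_sum_le)
      have s2: "((a n x - b n x) + (b n x - q x)) ^ 4 \<le> 8 * ((a n x - b n x) ^ 4 + (b n x - q x) ^ 4)" by (rule power4_sum_le)
      have "(p x - a n x) + (a n x - q x) = p x - q x" "(a n x - b n x) + (b n x - q x) = a n x - q x" by auto
      then show ?thesis using s1 s2 e1 e2 by simp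
    qed
    have "integral {0..L} (\<lambda>x. (p x - q x) ^ 4) \<le> integral {0..L} (\<lambda>x. 72 * e ^ 4 + 64 * (a n x - b n x) ^ 4)"
      by (rule Henstock_Kurzweil_Integration.integral_le) (use pw i1 in \<open>auto intro!: integrable_add integrable_on_mult_right\<close>)
    also have "\<dots> = 72 * e ^ 4 * L + 64 * integral {0..L} (\<lambda>x. (a n x - b n x) ^ 4)"
      using i1 L by (subst Henstock_Kurzweil_Integration.integral_add) (auto intro!: integrable_on_mult_right)
    also have "\<dots> \<le> 72 * e ^ 4 * L + 64 * (exp (k * (t + 1)) * (L * e ^ 4 + 2 * L * e ^ 4 / k))"
      using ab by simp
    also have "\<dots> = c * e ^ 4" by (simp add: c_def algebra_simps)
    finally show ?thesis .
  qed
  have c: "c \<ge> 0" using L k by (simp add: c_def)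
  have "integral {0..L} (\<lambda>x. (p x - q x) ^ 4) \<le> 0 + \<delta>" if \<delta>: "\<delta> > 0" for \<delta>
  proof -
    define e where "e = min 1 (\<delta> / (c + 1))"
    have e: "e > 0" "e \<le> 1" "e \<le> \<delta> / (c + 1)" using \<delta> c by (auto simp: e_def)
    have "e ^ 4 \<le> e ^ 1" by (rule power_decreasing) (use e in auto)
    then have "c * e ^ 4 \<le> c * (\<delta> / (c + 1))" using e c by (intro mult_left_mono) auto
    also have "\<dots> \<le> \<delta>" using c \<delta> by (simp add: field_simps)
    finally show ?thesis using est[OF e(1)] by simp
  qed
  then have "integral {0..L} (\<lambda>x. (p x - q x) ^ 4) \<le> 0" by (rule field_le_epsilon)
  then have "p x - q x = 0" for x
    using C1_per_diff(1)[OF C(1,2)] by (intro integral_power4_zero) (auto dest: C1_perD(1,4))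
  then have "p = q" by auto
  then show ?thesis using snd_y by (simp add: Pi_map_eq prod_eq_iff p_def q_def)
qed

lemma M_subsequence:
  assumes "range z \<subseteq> M"
  shows "\<exists>l r. l \<in> M \<and> strict_mono (r :: nat \<Rightarrow> nat) \<and> limitin T (\<lambda>n. z (r n)) l sequentially"
  using metrizable_compact_subsequence[OF metrizable_T compact_T, of z] assms topspace_T by (auto simp: o_def)

lemma Pi_map_continuous:
  assumes tn: "\<And>n. 0 \<le> tn n" "tn \<longlonglongrightarrow> t" and zn: "range zn \<subseteq> M" "limitin T zn z sequentially"
  shows "limitin T (\<lambda>n. Pi_map (tn n) (zn n)) (Pi_map t z) sequentially"
proof (rule limitin_subsubsequence)
  have z: "z \<in> M" using limitin_topspace[OF zn(2)] topspace_T by simp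
  have t: "0 \<le> t" using LIMSEQ_le_const[OF tn(2), of 0] tn(1) by auto
  show "Pi_map t z \<in> topspace T" using Pi_map_M[OF z t] topspace_T by simp
  fix r :: "nat \<Rightarrow> nat" assume r: "strict_mono r"
  have "range (\<lambda>n. Pi_map (tn (r n)) (zn (r n))) \<subseteq> M" using Pi_map_M[OF _ tn(1)] zn(1) by blast
  from M_subsequence[OF this] obtain y s where s: "strict_mono (s :: nat \<Rightarrow> nat)"
    "limitin T (\<lambda>n. Pi_map (tn (r (s n))) (zn (r (s n)))) y sequentially" by blast
  have rs: "strict_mono (r \<circ> s)" using r s(1) by (simp add: strict_mono_o)
  have "y = Pi_map t z"
  proof (rule Pi_map_limit[where tn = "\<lambda>n. tn (r (s n))" and zn = "\<lambda>n. zn (r (s n))"])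
    show "(\<lambda>n. tn (r (s n))) \<longlonglongrightarrow> t" using LIMSEQ_subseq_LIMSEQ[OF tn(2) rs] by (simp add: o_def)
    show "limitin T (\<lambda>n. zn (r (s n))) z sequentially" using limitin_subsequence[OF rs zn(2)] by (simp add: o_def)
  qed (use tn zn s in auto)
  then show "\<exists>s. strict_mono s \<and> limitin T (\<lambda>n. Pi_map (tn (r (s n))) (zn (r (s n)))) (Pi_map t z) sequentially"
    using s by blast
qed

text \<open>Closedness under sequential limits suffices because \<open>T\<close> is compact and
  metrizable; the invariant sets used later are all defined by conditions that pass to limits of
  sequences.\<close>

lemma minimality:
  assumes "N \<subseteq> M" "N \<noteq> {}" "\<And>t. 0 \<le> t \<Longrightarrow> Pi_map t ` N \<subseteq> N"
    and cl: "\<And>\<sigma> l. range \<sigma> \<subseteq> N \<Longrightarrow> limitin T \<sigma> l sequentially \<Longrightarrow> l \<in> N"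
  shows "N = M"
proof -
  have "closedin T N" by (rule metrizable_sequentially_closed[OF metrizable_T _ cl]) (use assms topspace_T in auto)
  then have "compactin T N" by (rule closedin_compact_space[OF compact_T])
  then have "compactin (phase_topology L \<alpha> f) N" unfolding T_def compactin_subtopology by blast
  moreover have "positively_invariant L \<alpha> N"
    unfolding positively_invariant_def using assms(1,3) sol_exists_M by (auto simp: image_subset_iff)
  ultimately show ?thesis using minimal assms(1,2) unfolding minimal_set_def by blast
qed

text \<open>The image is positively invariant because the maps commute, and closed under limits by
  compactness together with \<open>Pi_map_limit\<close>; so minimality applies to it.\<close>

lemma Pi_map_surj:
  assumes t: "0 \<le> t"
  shows "Pi_map t ` M = M"
proof (rule minimality)
  show "Pi_map t ` M \<subseteq> M" using Pi_map_M t by auto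
  show "Pi_map t ` M \<noteq> {}" using minimal by (auto simp: minimal_set_def)
  fix s :: real assume "0 \<le> s"
  then have "Pi_map s (Pi_map t z) = Pi_map t (Pi_map s z)" if "z \<in> M" for z
    using Pi_map_add[OF that, of s t] Pi_map_add[OF that, of t s] t by (simp add: add.commute)
  then show "Pi_map s ` Pi_map t ` M \<subseteq> Pi_map t ` M" using Pi_map_M[OF _ \<open>0 \<le> s\<close>] by (auto simp: image_iff)
next
  fix \<sigma> l assume \<sigma>: "range \<sigma> \<subseteq> Pi_map t ` M" "limitin T \<sigma> l sequentially"
  have "\<forall>n. \<exists>z\<in>M. \<sigma> n = Pi_map t z" using \<sigma>(1) by blast
  then obtain z where z: "\<And>n. z n \<in> M" "\<And>n. \<sigma> n = Pi_map t (z n)" by metis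
  then have "range z \<subseteq> M" by auto
  from M_subsequence[OF this] obtain y s where s: "y \<in> M" "strict_mono (s :: nat \<Rightarrow> nat)"
    "limitin T (\<lambda>n. z (s n)) y sequentially" by blast
  have "limitin T (\<lambda>n. Pi_map t (z (s n))) l sequentially"
    using limitin_subsequence[OF s(2) \<sigma>(2)] z(2) by (simp add: o_def)
  then have "l = Pi_map t y" by (intro Pi_map_limit[OF _ tendsto_const _ s(3)]) (use t z in auto)
  then show "l \<in> Pi_map t ` M" using s(1) by simp
qed

text \<open>The nonlinearities agree because shifts are invertible, and the states agree by
  \<open>backward_uniqueness\<close> applied to the difference of the two orbits.\<close>

lemma Pi_map_inj:
  assumes t: "0 \<le> t"
  shows "inj_on (Pi_map t) M"
proof (rule inj_onI)
  fix z z' assume z: "z \<in> M" "z' \<in> M" and eq: "Pi_map t z = Pi_map t z'"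
  \<comment> \<open>The equation is known only at positive times. Stepping back by one unit, which
    surjectivity permits, makes \<open>z\<close> and \<open>z'\<close> values of solutions at the
    interior time 1.\<close>
  obtain y y' where y: "y \<in> M" "z = Pi_map 1 y" "y' \<in> M" "z' = Pi_map 1 y'"
  proof -
    have "Pi_map 1 ` M = M" by (rule Pi_map_surj) simp
    then have "z \<in> Pi_map 1 ` M" "z' \<in> Pi_map 1 ` M" using z by blast+
    then show ?thesis using that by blast
  qed
  have shift_inj: "g = g'" if "shift s g = shift s g'" for s and g g' :: "real \<times> real \<times> real \<Rightarrow> real"
    using arg_cong[OF that, of "shift (- s)"] shift_add[of "- s" s g] shift_add[of "- s" s g'] by (simp add: shift_0)
  have eq': "Pi_map (t + 1) y = Pi_map (t + 1) y'" using eq y Pi_map_add[OF y(1) t, of 1] Pi_map_add[OF y(3) t, of 1] by simp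
  then have g: "snd y' = snd y" using shift_inj[of "t + 1" "snd y'" "snd y"] by (simp add: Pi_map_eq)
  have T: "t + 2 > 0" using t by simp
  note gc = time_hull_approx(1)[OF M_subset(2)[OF y(1)]]
  note s1 = orbit_solves[OF y(1) T] and s2 = orbit_solves[OF y(3) T, unfolded g]
  define w w' where "w = (\<lambda>t. phi L \<alpha> t (fst y) (snd y))" and "w' = (\<lambda>t. phi L \<alpha> t (fst y') (snd y))"
  obtain v where v: "evol {0<..<t + 2} w (\<lambda>t. deriv (w t)) v (\<lambda>t x. v t x + snd y (t, w t x, deriv (w t) x))"
    using solves_evol[OF s1 gc] unfolding w_def by blast
  obtain v' where v': "evol {0<..<t + 2} w' (\<lambda>t. deriv (w' t)) v' (\<lambda>t x. v' t x + snd y (t, w' t x, deriv (w' t) x))"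
    using solves_evol[OF s2 gc] unfolding w'_def by blast
  obtain R where R: "R \<ge> 0" "\<And>z x. z \<in> M \<Longrightarrow> \<bar>fst z x\<bar> \<le> R \<and> \<bar>deriv (fst z) x\<bar> \<le> R" using M_bounded by blast
  obtain K where K: "K \<ge> 0" "\<And>s a a' b b'. \<bar>a\<bar> \<le> R \<Longrightarrow> \<bar>a'\<bar> \<le> R \<Longrightarrow> \<bar>b\<bar> \<le> R \<Longrightarrow> \<bar>b'\<bar> \<le> R \<Longrightarrow>
      \<bar>snd y (s, a, b) - snd y (s, a', b')\<bar> \<le> K * (\<bar>a - a'\<bar> + \<bar>b - b'\<bar>)"
    using time_hull_Lipschitz[OF standing R(1)] M_subset(2)[OF y(1)] by blast
  have ls: "lsol K 0 {0<..<t + 2} (\<lambda>t x. w t x - w' t x) (\<lambda>t x. deriv (w t) x - deriv (w' t) x) (\<lambda>t x. v t x - v' t x)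
     (\<lambda>t x. (v t x + snd y (t, w t x, deriv (w t) x)) - (v' t x + snd y (t, w' t x, deriv (w' t) x)))"
    unfolding lsol_def
  proof (intro conjI ballI allI evol_diff[OF v v'])
    fix s x assume s: "s \<in> {0<..<t + 2}"
    have "\<bar>w s x\<bar> \<le> R \<and> \<bar>deriv (w s) x\<bar> \<le> R" "\<bar>w' s x\<bar> \<le> R \<and> \<bar>deriv (w' s) x\<bar> \<le> R"
      using R(2)[OF Pi_map_M[OF y(1), of s], of x] R(2)[OF Pi_map_M[OF y(3), of s], of x] s g
      by (simp_all add: Pi_map_eq w_def w'_def)
    then have "\<bar>snd y (s, w s x, deriv (w s) x) - snd y (s, w' s x, deriv (w' s) x)\<bar> \<le> K * (\<bar>w s x - w' s x\<bar> + \<bar>deriv (w s) x - deriv (w' s) x\<bar>)"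
      by (intro K) auto
    then show "\<bar>(v s x + snd y (s, w s x, deriv (w s) x)) - (v' s x + snd y (s, w' s x, deriv (w' s) x)) - (v s x - v' s x)\<bar>
      \<le> K * (\<bar>w s x - w' s x\<bar> + \<bar>deriv (w s) x - deriv (w' s) x\<bar>) + 0" by linarith
  qed
  have "w 1 x - w' 1 x = 0" for x
  proof (rule backward_uniqueness[OF ls K(1) L, of 1 "t + 1"])
    show "w s (x + L) - w' s (x + L) = w s x - w' s x" if s: "s \<in> {0<..<t + 2}" for s x
      using s C1_perD(1)[OF frac_C1[OF solves_C1(1)[OF s1]]] C1_perD(1)[OF frac_C1[OF solves_C1(1)[OF s2]]]
      by (simp add: w_def w'_def)
    show "w (t + 1) x - w' (t + 1) x = 0" for x using eq' g by (simp add: w_def w'_def Pi_map_eq)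
  qed (use t in auto)
  then have "phi L \<alpha> 1 (fst y) (snd y) = phi L \<alpha> 1 (fst y') (snd y)" unfolding w_def w'_def by auto
  then show "z = z'" using y g by (simp add: Pi_map_eq)
qed

definition \<Phi> :: "real \<Rightarrow> state \<Rightarrow> state" where "\<Phi> = skew_product_on L \<alpha> M"

text \<open>The second statement determines \<open>\<Phi> t z\<close>, because forward maps are
  injective. Claims about negative times are reduced to forward times by pushing with a large enough
  \<open>s\<close>.\<close>

lemma \<Phi>_char:
  assumes z: "z \<in> M"
  shows "\<Phi> t z \<in> M" and "0 \<le> s \<Longrightarrow> 0 \<le> s + t \<Longrightarrow> Pi_map s (\<Phi> t z) = Pi_map (s + t) z"
proof -
  have neg: "\<Phi> t z \<in> M \<and> Pi_map (- t) (\<Phi> t z) = z" if t: "t < 0"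
  proof -
    have "\<exists>!y. y \<in> M \<and> Pi_map (- t) y = z"
    proof (rule ex_ex1I)
      have "Pi_map (- t) ` M = M" by (rule Pi_map_surj) (use t in simp)
      with z have "z \<in> Pi_map (- t) ` M" by (simp only:)
      then show "\<exists>y. y \<in> M \<and> Pi_map (- t) y = z" by auto
      fix y y' assume "y \<in> M \<and> Pi_map (- t) y = z" "y' \<in> M \<and> Pi_map (- t) y' = z"
      then show "y = y'" using inj_onD[OF Pi_map_inj[of "- t"], of y y'] t by simp
    qed
    from theI'[OF this] show ?thesis using t by (simp add: \<Phi>_def skew_product_on_def)
  qed
  show "\<Phi> t z \<in> M"
    using neg Pi_map_M[OF z] by (cases "t \<ge> 0") (auto simp: \<Phi>_def skew_product_on_def)
  show "Pi_map s (\<Phi> t z) = Pi_map (s + t) z" if "0 \<le> s" "0 \<le> s + t"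
  proof (cases "t \<ge> 0")
    case True
    then show ?thesis using Pi_map_add[OF z that(1), of t] by (simp add: \<Phi>_def skew_product_on_def)
  next
    case False
    then have "Pi_map ((s + t) + - t) (\<Phi> t z) = Pi_map (s + t) (Pi_map (- t) (\<Phi> t z))"
      using neg that by (intro Pi_map_add) auto
    then show ?thesis using neg False by simp
  qed
qed

lemma \<Phi>_nonneg: "0 \<le> t \<Longrightarrow> \<Phi> t z = Pi_map t z"
  by (simp add: \<Phi>_def skew_product_on_def)

lemma \<Phi>_0: "z \<in> M \<Longrightarrow> \<Phi> 0 z = z" using Pi_map_0 by (simp add: \<Phi>_nonneg)

lemma \<Phi>_add:
  assumes z: "z \<in> M"
  shows "\<Phi> (s + t) z = \<Phi> s (\<Phi> t z)"
proof -
  define S where "S = \<bar>s\<bar> + \<bar>t\<bar>"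
  have "Pi_map S (\<Phi> (s + t) z) = Pi_map (S + (s + t)) z" by (rule \<Phi>_char(2)[OF z]) (auto simp: S_def)
  moreover have "Pi_map S (\<Phi> s (\<Phi> t z)) = Pi_map (S + s) (\<Phi> t z)" by (rule \<Phi>_char(2)[OF \<Phi>_char(1)[OF z]]) (auto simp: S_def)
  moreover have "\<dots> = Pi_map (S + s + t) z" by (rule \<Phi>_char(2)[OF z]) (auto simp: S_def)
  ultimately have "Pi_map S (\<Phi> (s + t) z) = Pi_map S (\<Phi> s (\<Phi> t z))" by (simp add: add.assoc)
  then show ?thesis using Pi_map_inj[of S] \<Phi>_char(1) z by (auto simp: S_def inj_on_def)
qed

lemma snd_\<Phi>:
  assumes z: "z \<in> M"
  shows "snd (\<Phi> t z) = shift t (snd z)"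
proof -
  have "Pi_map \<bar>t\<bar> (\<Phi> t z) = Pi_map (\<bar>t\<bar> + t) z" by (rule \<Phi>_char(2)[OF z]) auto
  then have "shift \<bar>t\<bar> (snd (\<Phi> t z)) = shift (\<bar>t\<bar> + t) (snd z)" by (simp add: Pi_map_eq)
  from arg_cong[OF this, of "shift (- \<bar>t\<bar>)"] show ?thesis by (simp add: shift_add[symmetric] shift_0)
qed

text \<open>A common push by \<open>S\<close>, a bound for the convergent times, makes all times
  nonnegative. There the limit of a subsequence is identified by \<open>Pi_map_limit\<close>, and
  injectivity brings the result back.\<close>

lemma \<Phi>_continuous:
  assumes tn: "tn \<longlonglongrightarrow> t" and zn: "range zn \<subseteq> M" "limitin T zn z sequentially"
  shows "limitin T (\<lambda>n. \<Phi> (tn n) (zn n)) (\<Phi> t z) sequentially"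
proof (rule limitin_subsubsequence)
  have z: "z \<in> M" using limitin_topspace[OF zn(2)] topspace_T by simp
  have znM: "zn n \<in> M" for n using zn by auto
  show "\<Phi> t z \<in> topspace T" using \<Phi>_char(1)[OF z] topspace_T by simp
  obtain S where S: "\<forall>n. norm (tn n) \<le> S" using convergent_imp_Bseq[OF convergentI[OF tn]] unfolding Bseq_def by blast
  have S': "0 \<le> S" "0 \<le> S + tn n" for n
    using order_trans[OF norm_ge_zero S[rule_format]] S[rule_format, of n] by auto
  have St: "0 \<le> S + t"
    by (rule LIMSEQ_le_const[of "\<lambda>n. S + tn n"]) (use S'(2) tn in \<open>auto intro!: tendsto_intros\<close>)
  fix r :: "nat \<Rightarrow> nat" assume r: "strict_mono r"
  have "range (\<lambda>n. \<Phi> (tn (r n)) (zn (r n))) \<subseteq> M" using \<Phi>_char(1)[OF znM] by blast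
  from M_subsequence[OF this] obtain y s where s: "y \<in> M" "strict_mono (s :: nat \<Rightarrow> nat)"
    "limitin T (\<lambda>n. \<Phi> (tn (r (s n))) (zn (r (s n)))) y sequentially" by blast
  have rs: "strict_mono (r \<circ> s)" using r s(2) by (simp add: strict_mono_o)
  have "limitin T (\<lambda>n. Pi_map S (\<Phi> (tn (r (s n))) (zn (r (s n))))) (Pi_map S y) sequentially"
    by (rule Pi_map_continuous[OF S'(1) tendsto_const _ s(3)]) (use \<Phi>_char(1)[OF znM] in blast)
  moreover have "Pi_map S (\<Phi> (tn (r (s n))) (zn (r (s n)))) = Pi_map (S + tn (r (s n))) (zn (r (s n)))" for n
    by (rule \<Phi>_char(2)[OF znM]) (use S' in auto)
  ultimately have l: "limitin T (\<lambda>n. Pi_map (S + tn (r (s n))) (zn (r (s n)))) (Pi_map S y) sequentially" by simp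
  have "Pi_map S y = Pi_map (S + t) z"
  proof (rule Pi_map_limit[OF _ _ _ _ l])
    show "(\<lambda>n. S + tn (r (s n))) \<longlonglongrightarrow> S + t"
      using LIMSEQ_subseq_LIMSEQ[OF tn rs] by (auto simp: o_def intro!: tendsto_intros)
    show "limitin T (\<lambda>n. zn (r (s n))) z sequentially" using limitin_subsequence[OF rs zn(2)] by (simp add: o_def)
  qed (use S' zn(1) in auto)
  also have "\<dots> = Pi_map S (\<Phi> t z)" using \<Phi>_char(2)[OF z S'(1) St] by simp
  finally have "y = \<Phi> t z" using Pi_map_inj[OF S'(1)] s(1) \<Phi>_char(1)[OF z] by (auto simp: inj_on_def)
  then show "\<exists>s. strict_mono s \<and> limitin T (\<lambda>n. \<Phi> (tn (r (s n))) (zn (r (s n)))) (\<Phi> t z) sequentially"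
    using s by blast
qed

text \<open>Near each time \<open>t\<close> the orbit is a forward solution started at
  \<open>t - 1\<close>, for which \<open>t\<close> is the interior time 1. The result holds on the
  whole time axis, as \<open>achain_bounded_length\<close> requires.\<close>

lemma \<Phi>_evol:
  assumes z: "z \<in> M"
  shows "\<exists>v. evol UNIV (\<lambda>t. fst (\<Phi> t z)) (\<lambda>t. deriv (fst (\<Phi> t z))) v
    (\<lambda>t x. v t x + snd z (t, fst (\<Phi> t z) x, deriv (fst (\<Phi> t z)) x))"
proof (rule evol_of_solution[OF L open_UNIV])
  show "fst (\<Phi> t z) \<in> C1_per L" for t using frac_C1[OF M_subset(1)[OF \<Phi>_char(1)[OF z]]] .
  show "continuous_on UNIV (snd z)" using time_hull_approx(1)[OF M_subset(2)[OF z]] .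
  have loc: "fst (\<Phi> (t + h) z) = phi L \<alpha> (1 + h) (fst (\<Phi> (t - 1) z)) (snd (\<Phi> (t - 1) z))" if "- 1 \<le> h" for t h
  proof -
    have "\<Phi> ((1 + h) + (t - 1)) z = \<Phi> (1 + h) (\<Phi> (t - 1) z)" by (rule \<Phi>_add[OF z])
    then have "\<Phi> (t + h) z = Pi_map (1 + h) (\<Phi> (t - 1) z)" using that by (simp add: \<Phi>_nonneg add.commute)
    then show ?thesis by (simp add: Pi_map_eq)
  qed
  have sol: "solves L \<alpha> (snd (\<Phi> (t - 1) z)) (fst (\<Phi> (t - 1) z)) 2 (\<lambda>s. phi L \<alpha> s (fst (\<Phi> (t - 1) z)) (snd (\<Phi> (t - 1) z)))" for t
    by (rule orbit_solves[OF \<Phi>_char(1)[OF z]]) simp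
  show "C1_cont UNIV (\<lambda>t. fst (\<Phi> t z))" unfolding C1_cont_def
  proof (intro ballI allI impI)
    fix t e :: real assume e: "e > 0"
    obtain d where d: "d > 0" "\<And>s. s \<in> {0..<2} \<Longrightarrow> \<bar>s - 1\<bar> < d \<Longrightarrow>
      (\<forall>x. \<bar>phi L \<alpha> s (fst (\<Phi> (t - 1) z)) (snd (\<Phi> (t - 1) z)) x - phi L \<alpha> 1 (fst (\<Phi> (t - 1) z)) (snd (\<Phi> (t - 1) z)) x\<bar> < e \<and>
        \<bar>deriv (phi L \<alpha> s (fst (\<Phi> (t - 1) z)) (snd (\<Phi> (t - 1) z))) x - deriv (phi L \<alpha> 1 (fst (\<Phi> (t - 1) z)) (snd (\<Phi> (t - 1) z))) x\<bar> < e)"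
    proof -
      have "(1::real) \<in> {0..<2}" by simp
      then show ?thesis using solves_C1(2)[OF sol[of t], unfolded C1_cont_def, rule_format, of 1 e] e that by blast
    qed
    show "\<exists>d>0. \<forall>s\<in>UNIV. \<bar>s - t\<bar> < d \<longrightarrow> (\<forall>x. \<bar>fst (\<Phi> s z) x - fst (\<Phi> t z) x\<bar> < e \<and> \<bar>deriv (fst (\<Phi> s z)) x - deriv (fst (\<Phi> t z)) x\<bar> < e)"
    proof (intro exI[of _ "min d 1"] conjI ballI impI)
      fix s assume s: "\<bar>s - t\<bar> < min d 1"
      then have "1 + (s - t) \<in> {0..<2}" "\<bar>1 + (s - t) - 1\<bar> < d" by auto
      from d(2)[OF this] show "\<forall>x. \<bar>fst (\<Phi> s z) x - fst (\<Phi> t z) x\<bar> < e \<and> \<bar>deriv (fst (\<Phi> s z)) x - deriv (fst (\<Phi> t z)) x\<bar> < e"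
        using loc[of "s - t" t] loc[of 0 t] s by (simp add: abs_less_iff)
    qed (use d in simp)
  qed
  fix t :: real
  have "(1::real) \<in> {0<..<2}" by simp
  then obtain v where v: "H2_second_deriv L (phi L \<alpha> 1 (fst (\<Phi> (t - 1) z)) (snd (\<Phi> (t - 1) z))) v"
    "((\<lambda>h. L2_norm_per L (\<lambda>x. (phi L \<alpha> (1 + h) (fst (\<Phi> (t - 1) z)) (snd (\<Phi> (t - 1) z)) x - phi L \<alpha> 1 (fst (\<Phi> (t - 1) z)) (snd (\<Phi> (t - 1) z)) x) / h
      - (v x + snd (\<Phi> (t - 1) z) (1, phi L \<alpha> 1 (fst (\<Phi> (t - 1) z)) (snd (\<Phi> (t - 1) z)) x,
          deriv (phi L \<alpha> 1 (fst (\<Phi> (t - 1) z)) (snd (\<Phi> (t - 1) z))) x)))) \<longlongrightarrow> 0) (at 0)"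
    using sol[of t] unfolding solves_def by blast
  have g: "snd (\<Phi> (t - 1) z) (1, a, b) = snd z (t, a, b)" for a b unfolding snd_\<Phi>[OF z] by (simp add: shift_def)
  have p1: "phi L \<alpha> 1 (fst (\<Phi> (t - 1) z)) (snd (\<Phi> (t - 1) z)) = fst (\<Phi> t z)" using loc[of 0 t] by simp
  have "\<forall>\<^sub>F h :: real in at 0. h \<in> {-1<..<1}" by (rule eventually_at_in_open') auto
  then have "\<forall>\<^sub>F h in at 0. L2_norm_per L (\<lambda>x. (phi L \<alpha> (1 + h) (fst (\<Phi> (t - 1) z)) (snd (\<Phi> (t - 1) z)) x - fst (\<Phi> t z) x) / h
      - (v x + snd z (t, fst (\<Phi> t z) x, deriv (fst (\<Phi> t z)) x))) =
    L2_norm_per L (\<lambda>x. (fst (\<Phi> (t + h) z) x - fst (\<Phi> t z) x) / h - (v x + snd z (t, fst (\<Phi> t z) x, deriv (fst (\<Phi> t z)) x)))"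
    by eventually_elim (simp add: loc)
  from Lim_transform_eventually[OF v(2)[unfolded g p1] this] v(1)[unfolded p1]
  show "\<exists>v. H2_second_deriv L (fst (\<Phi> t z)) v \<and>
        ((\<lambda>h. L2_norm_per L (\<lambda>x. (fst (\<Phi> (t + h) z) x - fst (\<Phi> t z) x) / h - (v x + snd z (t, fst (\<Phi> t z) x, deriv (fst (\<Phi> t z)) x)))) \<longlongrightarrow> 0) (at 0)"
    by blast
qed

end

section \<open>Geometry of the minimal set\<close>

section \<open>Reflection symmetry of the minimal set\<close>

text \<open>A chain consists of finitely many strict inequalities, so pointwise convergence
  preserves it.\<close>

lemma achain_limit:
  assumes lim: "\<And>x. (\<lambda>n. w n x) \<longlonglongrightarrow> w' x" and ch: "achain w' \<sigma> p m y"
  shows "\<forall>\<^sub>F n in sequentially. achain (w n) \<sigma> p m y"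
  using ch
proof (induction m arbitrary: y)
  case (Suc m)
  then obtain x where x: "p < x" "x < y" "\<sigma> * (-1) ^ m * w' x > 0" "achain w' \<sigma> p m x" by auto
  have "(\<lambda>n. \<sigma> * (-1) ^ m * w n x) \<longlonglongrightarrow> \<sigma> * (-1) ^ m * w' x" by (intro tendsto_intros lim)
  then have "\<forall>\<^sub>F n in sequentially. \<sigma> * (-1) ^ m * w n x > 0" using order_tendstoD(1) x(3) by blast
  then show ?case using Suc.IH[OF x(4)]
  proof eventually_elim
    case (elim n)
    then show ?case using x(1,2) by auto
  qed
qed simp

context minimal_setting
begin

lemma M_C1: "z \<in> M \<Longrightarrow> fst z \<in> C1_per L"
  using frac_C1 M_subset by blast

lemma limitin_T_eval:
  assumes "limitin T \<sigma> l F"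
  shows "((\<lambda>n. fst (\<sigma> n) x) \<longlongrightarrow> fst l x) F" and "((\<lambda>n. deriv (fst (\<sigma> n)) x) \<longlongrightarrow> deriv (fst l) x) F"
proof -
  have "\<forall>\<^sub>F n in F. dist (fst (\<sigma> n) x) (fst l x) < e" "\<forall>\<^sub>F n in F. dist (deriv (fst (\<sigma> n)) x) (deriv (fst l) x) < e" if "e > 0" for e
    using limitin_frac_uniform[OF limitin_T_frac[OF assms] that] by (eventually_elim, simp add: dist_real_def)+
  then show "((\<lambda>n. fst (\<sigma> n) x) \<longlongrightarrow> fst l x) F" "((\<lambda>n. deriv (fst (\<sigma> n)) x) \<longlongrightarrow> deriv (fst l) x) F"
    by (auto intro: tendstoI)
qed

lemma \<Phi>_eval_continuous:
  assumes z: "z \<in> M"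
  shows "continuous_on A (\<lambda>t. fst (\<Phi> t z) x)" and "continuous_on A (\<lambda>t. deriv (fst (\<Phi> t z)) x)"
proof -
  obtain v r where "evol UNIV (\<lambda>t. fst (\<Phi> t z)) (\<lambda>t. deriv (fst (\<Phi> t z))) v r" using \<Phi>_evol[OF z] by blast
  note c = evolD(2,3)[OF this]
  have "continuous_on A (\<lambda>t. (\<lambda>(t, x). fst (\<Phi> t z) x) (t, x))" "continuous_on A (\<lambda>t. (\<lambda>(t, x). deriv (fst (\<Phi> t z)) x) (t, x))"
    by (rule continuous_on_compose2[OF c(1)] continuous_on_compose2[OF c(2)]; auto intro!: continuous_intros)+
  then show "continuous_on A (\<lambda>t. fst (\<Phi> t z) x)" "continuous_on A (\<lambda>t. deriv (fst (\<Phi> t z)) x)" by simp_all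
qed

text \<open>By evenness the nonlinearity takes the same value at slope \<open>s * b\<close> and at
  slope \<open>b\<close>, so a reflected or translated solution solves the same equation.
  \<open>K\<close> stems from the bounds on \<open>M\<close> and the Lipschitz constant of the hull
  alone, hence serves all pairs, reflections and shifts.\<close>

lemma difference_lsol:
  "\<exists>K\<ge>0. \<forall>z z' s c. z \<in> M \<longrightarrow> z' \<in> M \<longrightarrow> snd z = snd z' \<longrightarrow> s = 1 \<or> s = -1 \<longrightarrow>
    (\<exists>v r. lsol K 0 UNIV (\<lambda>t x. fst (\<Phi> t z) x - fst (\<Phi> t z') (s * x + c))
       (\<lambda>t x. deriv (fst (\<Phi> t z)) x - s * deriv (fst (\<Phi> t z')) (s * x + c)) v r)"
proof -
  obtain R where R: "R \<ge> 0" "\<And>z x. z \<in> M \<Longrightarrow> \<bar>fst z x\<bar> \<le> R \<and> \<bar>deriv (fst z) x\<bar> \<le> R" using M_bounded by blast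
  obtain K where K: "K \<ge> 0" "\<And>g s a a' b b'. g \<in> time_hull f \<Longrightarrow> \<bar>a\<bar> \<le> R \<Longrightarrow> \<bar>a'\<bar> \<le> R \<Longrightarrow> \<bar>b\<bar> \<le> R \<Longrightarrow> \<bar>b'\<bar> \<le> R \<Longrightarrow>
      \<bar>g (s, a, b) - g (s, a', b')\<bar> \<le> K * (\<bar>a - a'\<bar> + \<bar>b - b'\<bar>)"
    using time_hull_Lipschitz[OF standing R(1)] by blast
  have "\<exists>v r. lsol K 0 UNIV (\<lambda>t x. fst (\<Phi> t z) x - fst (\<Phi> t z') (s * x + c))
       (\<lambda>t x. deriv (fst (\<Phi> t z)) x - s * deriv (fst (\<Phi> t z')) (s * x + c)) v r"
    if z: "z \<in> M" "z' \<in> M" "snd z = snd z'" and s: "s = 1 \<or> s = -1" for z z' s c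
  proof -
    obtain v where v: "evol UNIV (\<lambda>t. fst (\<Phi> t z)) (\<lambda>t. deriv (fst (\<Phi> t z))) v
      (\<lambda>t x. v t x + snd z (t, fst (\<Phi> t z) x, deriv (fst (\<Phi> t z)) x))" using \<Phi>_evol[OF z(1)] by blast
    obtain v' where v': "evol UNIV (\<lambda>t. fst (\<Phi> t z')) (\<lambda>t. deriv (fst (\<Phi> t z'))) v'
      (\<lambda>t x. v' t x + snd z (t, fst (\<Phi> t z') x, deriv (fst (\<Phi> t z')) x))" using \<Phi>_evol[OF z(2)] unfolding z(3) by blast
    from evol_affine[OF v' s, of c 0] have
      "evol UNIV (\<lambda>t x. fst (\<Phi> t z') (s * x + c)) (\<lambda>t x. s * deriv (fst (\<Phi> t z')) (s * x + c)) (\<lambda>t x. v' t (s * x + c))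
        (\<lambda>t x. v' t (s * x + c) + snd z (t, fst (\<Phi> t z') (s * x + c), deriv (fst (\<Phi> t z')) (s * x + c)))" by simp
    note ev = evol_diff[OF v this]
    have "lsol K 0 UNIV (\<lambda>t x. fst (\<Phi> t z) x - fst (\<Phi> t z') (s * x + c))
       (\<lambda>t x. deriv (fst (\<Phi> t z)) x - s * deriv (fst (\<Phi> t z')) (s * x + c)) (\<lambda>t x. v t x - v' t (s * x + c))
       (\<lambda>t x. (v t x + snd z (t, fst (\<Phi> t z) x, deriv (fst (\<Phi> t z)) x)) -
         (v' t (s * x + c) + snd z (t, fst (\<Phi> t z') (s * x + c), deriv (fst (\<Phi> t z')) (s * x + c))))"
      unfolding lsol_def
    proof (intro conjI ballI allI ev)
      fix t x
      have even': "snd z (t, a, s * b) = snd z (t, a, b)" for a b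
        using time_hull_even[OF even M_subset(2)[OF z(1)], of t a b] s by auto
      have sb: "\<bar>s * b\<bar> = \<bar>b\<bar>" for b using s by (auto simp: abs_mult)
      have "\<bar>snd z (t, fst (\<Phi> t z) x, deriv (fst (\<Phi> t z)) x) - snd z (t, fst (\<Phi> t z') (s * x + c), s * deriv (fst (\<Phi> t z')) (s * x + c))\<bar>
        \<le> K * (\<bar>fst (\<Phi> t z) x - fst (\<Phi> t z') (s * x + c)\<bar> + \<bar>deriv (fst (\<Phi> t z)) x - s * deriv (fst (\<Phi> t z')) (s * x + c)\<bar>)"
        by (rule K(2)[OF M_subset(2)[OF z(1)]]) (use R(2)[OF \<Phi>_char(1)[OF z(1)]] R(2)[OF \<Phi>_char(1)[OF z(2)]] sb in auto)
      then show "\<bar>v t x + snd z (t, fst (\<Phi> t z) x, deriv (fst (\<Phi> t z)) x) -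
            (v' t (s * x + c) + snd z (t, fst (\<Phi> t z') (s * x + c), deriv (fst (\<Phi> t z')) (s * x + c))) - (v t x - v' t (s * x + c))\<bar>
         \<le> K * (\<bar>fst (\<Phi> t z) x - fst (\<Phi> t z') (s * x + c)\<bar> + \<bar>deriv (fst (\<Phi> t z)) x - s * deriv (fst (\<Phi> t z')) (s * x + c)\<bar>) + 0"
        unfolding even' by (simp add: algebra_simps)
    qed
    then show ?thesis by blast
  qed
  then show ?thesis using K(1) by blast
qed

definition sym_axis :: "real \<Rightarrow> bool" where
  "sym_axis a \<longleftrightarrow> (\<forall>z\<in>M. \<forall>x. fst z (2 * a - x) = fst z x)"

text \<open>\<open>D z\<close> vanishes at \<open>a\<close> and at the opposite point
  \<open>p\<close>, so chain lengths on this arc are bounded. The states without chains of length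
  \<open>m\<close> form a closed positively invariant set, which is therefore all of
  \<open>M\<close> or empty. For the least \<open>m\<close> of the first kind either
  \<open>m = 1\<close> and \<open>D\<close> vanishes, or every state has a chain of length
  \<open>m - 1\<close> and none of length \<open>m\<close>; then the last sign before
  \<open>a\<close> persists up to \<open>a\<close>, and the Hopf lemma gives a nonzero
  slope.\<close>

lemma sym_axis_or_slope:
  "sym_axis a \<or> (\<forall>z\<in>M. deriv (fst z) a \<noteq> 0)"
proof -
  define p where "p = a - L / 2"
  have pa: "p < a" using L by (simp add: p_def)
  define D where "D = (\<lambda>z :: state. \<lambda>x. fst z x - fst z (2 * a - x))"
  define Dx where "Dx = (\<lambda>z :: state. \<lambda>x. deriv (fst z) x + deriv (fst z) (2 * a - x))"
  obtain K where K: "K \<ge> 0" and ls0: "\<And>z z' s c. z \<in> M \<Longrightarrow> z' \<in> M \<Longrightarrow> snd z = snd z' \<Longrightarrow> s = 1 \<or> s = -1 \<Longrightarrow>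
    \<exists>v r. lsol K 0 UNIV (\<lambda>t x. fst (\<Phi> t z) x - fst (\<Phi> t z') (s * x + c))
       (\<lambda>t x. deriv (fst (\<Phi> t z)) x - s * deriv (fst (\<Phi> t z')) (s * x + c)) v r" using difference_lsol by blast
  have ls: "\<exists>v r. lsol K 0 UNIV (\<lambda>t. D (\<Phi> t z)) (\<lambda>t. Dx (\<Phi> t z)) v r" if z: "z \<in> M" for z
  proof -
    have e: "- 1 * x + 2 * a = 2 * a - x" for x by simp
    show ?thesis using ls0[OF z z refl, of "- 1" "2 * a"] unfolding e D_def Dx_def by simp
  qed
  have D0: "D z p = 0" "D z a = 0" if z: "z \<in> M" for z
  proof -
    have "2 * a - p = p + L" by (simp add: p_def)
    then show "D z p = 0" using C1_perD(1)[OF M_C1[OF z], of p] unfolding D_def by (simp only: diff_self)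
    show "D z a = 0" by (simp add: D_def)
  qed
  obtain R where R: "R \<ge> 0" "\<And>z x. z \<in> M \<Longrightarrow> \<bar>fst z x\<bar> \<le> R \<and> \<bar>deriv (fst z) x\<bar> \<le> R" using M_bounded by blast
  have DR: "\<bar>D z x\<bar> \<le> 2 * R" if "z \<in> M" for z x
    using R(2)[OF that, of x] R(2)[OF that, of "2 * a - x"] unfolding D_def by linarith
  obtain m0 where m0: "m0 \<ge> 1" "\<And>w wx v r R \<sigma> t. lsol K 0 UNIV w wx v r \<Longrightarrow> (\<forall>t x. \<bar>w t x\<bar> \<le> R) \<Longrightarrow> (\<sigma> = 1 \<or> \<sigma> = -1) \<Longrightarrow>
    (\<forall>t. w t p = 0 \<and> w t a = 0) \<Longrightarrow> \<not> achain (w t) \<sigma> p m0 a" using achain_bounded_length[OF pa K] by blast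
  define N where "N = (\<lambda>m. {z \<in> M. \<forall>\<sigma>\<in>{1, -1}. \<not> achain (D z) \<sigma> p m a})"
  have Nm0: "N m0 = M"
  proof -
    have "\<not> achain (D z) \<sigma> p m0 a" if z: "z \<in> M" and \<sigma>: "\<sigma> \<in> {1, -1}" for z \<sigma>
    proof -
      obtain v r where "lsol K 0 UNIV (\<lambda>t. D (\<Phi> t z)) (\<lambda>t. Dx (\<Phi> t z)) v r" using ls[OF z] by blast
      from m0(2)[OF this, of "2 * R" \<sigma> 0] DR[OF \<Phi>_char(1)[OF z]] D0[OF \<Phi>_char(1)[OF z]] \<sigma> \<Phi>_0[OF z]
      show ?thesis by auto
    qed
    then show ?thesis unfolding N_def by blast
  qed
  have Nall: "N m = M" if m: "m \<ge> 1" and ne: "N m \<noteq> {}" for m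
  proof (rule minimality[OF _ ne])
    show "N m \<subseteq> M" by (auto simp: N_def)
    show "Pi_map t ` N m \<subseteq> N m" if t: "0 \<le> t" for t
    proof (rule image_subsetI)
      fix z assume z: "z \<in> N m"
      then have zM: "z \<in> M" by (simp add: N_def)
      obtain v r where v: "lsol K 0 UNIV (\<lambda>t. D (\<Phi> t z)) (\<lambda>t. Dx (\<Phi> t z)) v r" using ls[OF zM] by blast
      have "\<not> achain (D (\<Phi> t z)) \<sigma> p m a" if \<sigma>: "\<sigma> \<in> {1, -1}" for \<sigma>
      proof
        assume "achain (D (\<Phi> t z)) \<sigma> p m a"
        then have "achain (D (\<Phi> 0 z)) \<sigma> p m a"
          by (intro achain_decreasing[OF v K t _ pa _ m]) (use D0[OF \<Phi>_char(1)[OF zM]] \<sigma> in auto)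
        then show False using z \<sigma> unfolding N_def \<Phi>_0[OF zM] by blast
      qed
      then show "Pi_map t z \<in> N m" using Pi_map_M[OF zM t] t by (simp add: N_def \<Phi>_nonneg)
    qed
    fix \<sigma> l assume \<sigma>: "range \<sigma> \<subseteq> N m" "limitin T \<sigma> l sequentially"
    have l: "l \<in> M" using limitin_topspace[OF \<sigma>(2)] topspace_T by simp
    have "\<not> achain (D l) s p m a" if s: "s \<in> {1, -1}" for s
    proof
      assume "achain (D l) s p m a"
      moreover have "(\<lambda>n. D (\<sigma> n) x) \<longlonglongrightarrow> D l x" for x
        unfolding D_def by (intro tendsto_intros limitin_T_eval(1)[OF \<sigma>(2)])
      ultimately have "\<forall>\<^sub>F n in sequentially. achain (D (\<sigma> n)) s p m a" by (intro achain_limit[of "\<lambda>n. D (\<sigma> n)" "D l"])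
      then obtain n where "achain (D (\<sigma> n)) s p m a" by (auto simp: eventually_sequentially)
      moreover have "\<sigma> n \<in> N m" using \<sigma>(1) by blast
      ultimately show False using s unfolding N_def by blast
    qed
    then show "l \<in> N m" using l unfolding N_def by blast
  qed
  define m where "m = (LEAST m. m \<ge> 1 \<and> N m = M)"
  have m: "m \<ge> 1" "N m = M" using LeastI[of "\<lambda>m. m \<ge> 1 \<and> N m = M", OF conjI[OF m0(1) Nm0]] by (auto simp: m_def)
  have least: "N k \<noteq> M" if "k \<ge> 1" "k < m" for k using not_less_Least[of k "\<lambda>m. m \<ge> 1 \<and> N m = M"] that by (auto simp: m_def)
  show ?thesis
  proof (cases "m = 1")
    case True
    have Dz: "D z x = 0" if z: "z \<in> M" and x: "p < x" "x < a" for z x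
    proof -
      have "\<not> achain (D z) \<sigma> p 1 a" if "\<sigma> \<in> {1, -1}" for \<sigma> using z m(2) True that unfolding N_def by blast
      from this[of 1] this[of "-1"] have "\<not> D z x > 0" "\<not> - D z x > 0" using x by (auto simp del: not_less)
      then show ?thesis by linarith
    qed
    have "fst z (2 * a - x) = fst z x" if z: "z \<in> M" for z x
    proof -
      note per = C1_perD(1)[OF M_C1[OF z]]
      have loc: "fst z (2 * a - y) = fst z y" if "p \<le> y" "y \<le> a + L / 2" for y
      proof -
        consider "y = p" | "p < y" "y < a" | "y = a" | "a < y" "y < a + L / 2" | "y = a + L / 2" using \<open>p \<le> y\<close> \<open>y \<le> _\<close> by linarith
        then show ?thesis
        proof cases
          case 1 then show ?thesis using D0(1)[OF z] by (simp add: D_def)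
        next
          case 2 then show ?thesis using Dz[OF z] by (simp add: D_def)
        next
          case 4
          then have "D z (2 * a - y) = 0" by (intro Dz[OF z]) (auto simp: p_def)
          then show ?thesis by (simp add: D_def)
        next
          case 5 then show ?thesis using D0(1)[OF z] by (simp add: D_def p_def)
        qed simp
      qed
      obtain n :: int where n: "p \<le> x + of_int n * L" "x + of_int n * L < p + L" using periodic_representative[OF L, of p x] by auto
      have e: "2 * a - (x + of_int n * L) = (2 * a - x) + of_int (- n) * L" by simp
      have "fst z (2 * a - (x + of_int n * L)) = fst z (x + of_int n * L)" by (rule loc) (use n in \<open>auto simp: p_def\<close>)
      then show ?thesis unfolding e periodic_int[of "fst z" L, OF per] .
    qed
    then show ?thesis by (simp add: sym_axis_def)
  next
    case False
    then obtain n where n: "m = Suc (Suc n)" using m(1) by (metis One_nat_def Suc_le_D le_Suc_eq not_less_eq_eq)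
    \<comment> \<open>By the leastness of \<open>m\<close> this set is not all of \<open>M\<close>,
      so by the dichotomy it is empty: every state has a chain of length
      \<open>Suc n\<close>.\<close>
    have empty: "N (Suc n) = {}" using Nall[of "Suc n"] least[of "Suc n"] n by auto
    have "deriv (fst z) a \<noteq> 0" if z: "z \<in> M" for z
    proof -
      obtain \<sigma> where \<sigma>: "\<sigma> \<in> {1, -1}" and ch: "achain (D z) \<sigma> p (Suc n) a" using empty z unfolding N_def by blast
      then obtain x where x: "p < x" "x < a" "\<sigma> * (-1) ^ n * D z x > 0" "achain (D z) \<sigma> p n x" by auto
      obtain v r where v: "lsol K 0 UNIV (\<lambda>t. D (\<Phi> t z)) (\<lambda>t. Dx (\<Phi> t z)) v r" using ls[OF z] by blast
      define \<tau> where "\<tau> = \<sigma> * (-1) ^ n"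
      have \<tau>: "\<tau> = 1 \<or> \<tau> = -1" using \<sigma> by (auto simp: \<tau>_def) (metis minus_minus neg_one_even_power neg_one_odd_power)+
      have v\<tau>: "\<exists>v r. lsol K 0 UNIV (\<lambda>t y. \<tau> * D (\<Phi> t z) y) (\<lambda>t y. \<tau> * Dx (\<Phi> t z) y) v r"
        using \<tau>
      proof
        assume 1: "\<tau> = 1"
        show ?thesis unfolding 1 mult_1 by (intro exI) (rule v)
      next
        assume 1: "\<tau> = - 1"
        show ?thesis unfolding 1 mult_minus1 by (intro exI) (rule lsol_minus[OF v])
      qed
      then obtain v' r' where v': "lsol K 0 UNIV (\<lambda>t y. \<tau> * D (\<Phi> t z) y) (\<lambda>t y. \<tau> * Dx (\<Phi> t z) y) v' r'" by blast
      have ev: "\<forall>\<^sub>F t in at 0. achain (D (\<Phi> t z)) \<sigma> p n x \<and> \<tau> * D (\<Phi> t z) x > 0"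
      proof -
        have lim: "((\<lambda>t. D (\<Phi> t z) y) \<longlongrightarrow> D z y) (at 0)" for y
        proof -
          have "continuous_on UNIV (\<lambda>t. D (\<Phi> t z) y)" unfolding D_def by (intro continuous_intros \<Phi>_eval_continuous(1)[OF z])
          then have "((\<lambda>t. D (\<Phi> t z) y) \<longlongrightarrow> D (\<Phi> 0 z) y) (at 0)" by (auto simp: continuous_on_def)
          then show ?thesis using \<Phi>_0[OF z] by simp
        qed
        have chain: "\<forall>\<^sub>F t in at 0. achain (D (\<Phi> t z)) \<sigma> p k y" if "achain (D z) \<sigma> p k y" for k y
          using that
        proof (induction k arbitrary: y)
          case (Suc k)
          then obtain u where u: "p < u" "u < y" "\<sigma> * (-1) ^ k * D z u > 0" "achain (D z) \<sigma> p k u" by auto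
          have "((\<lambda>t. \<sigma> * (-1) ^ k * D (\<Phi> t z) u) \<longlongrightarrow> \<sigma> * (-1) ^ k * D z u) (at 0)" by (intro tendsto_intros lim)
          then have "\<forall>\<^sub>F t in at 0. \<sigma> * (-1) ^ k * D (\<Phi> t z) u > 0" using order_tendstoD(1) u(3) by blast
          then show ?case using Suc.IH[OF u(4)] by eventually_elim (use u(1,2) in auto)
        qed simp
        have "((\<lambda>t. \<tau> * D (\<Phi> t z) x) \<longlongrightarrow> \<tau> * D z x) (at 0)" by (intro tendsto_intros lim)
        then have "\<forall>\<^sub>F t in at 0. \<tau> * D (\<Phi> t z) x > 0" using order_tendstoD(1) x(3) unfolding \<tau>_def by blast
        then show ?thesis using chain[OF x(4)] by eventually_elim simp
      qed
      then obtain d where d: "d > 0" "\<And>t. t \<noteq> 0 \<Longrightarrow> dist t 0 < d \<Longrightarrow> achain (D (\<Phi> t z)) \<sigma> p n x \<and> \<tau> * D (\<Phi> t z) x > 0"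
        unfolding eventually_at by auto
      have near: "achain (D (\<Phi> t z)) \<sigma> p n x \<and> \<tau> * D (\<Phi> t z) x > 0" if t: "t \<in> {0 - d / 2..0}" for t
      proof (cases "t = 0")
        case True
        then show ?thesis using x(3,4) \<Phi>_0[OF z] by (simp add: \<tau>_def)
      next
        case False
        then show ?thesis using d t by (auto simp: dist_real_def)
      qed
      \<comment> \<open>A value of the opposite sign between \<open>x\<close> and \<open>a\<close>
        would extend the chain to the excluded length \<open>m\<close>.\<close>
      have nn: "\<tau> * D (\<Phi> t z) y \<ge> 0" if t: "t \<in> {0 - d / 2..0}" and y: "y \<in> {x..a}" for t y
      proof (rule ccontr)
        assume neg: "\<not> ?thesis"
        have "y \<noteq> x" using neg near[OF t] by auto
        moreover have "y \<noteq> a" using neg D0(2)[OF \<Phi>_char(1)[OF z]] by auto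
        ultimately have y': "x < y" "y < a" using y by auto
        have "achain (D (\<Phi> t z)) \<sigma> p (Suc n) y"
          unfolding achain.simps using near[OF t] x y' by (intro exI[of _ x]) (auto simp: \<tau>_def)
        moreover have "\<sigma> * (-1) ^ Suc n * D (\<Phi> t z) y > 0" using neg by (simp add: \<tau>_def)
        ultimately have "achain (D (\<Phi> t z)) \<sigma> p (Suc (Suc n)) a"
          unfolding achain.simps(2)[of _ _ _ "Suc n"] using x y' by (intro exI[of _ y] conjI) auto
        then show False using m(2) n \<Phi>_char(1)[OF z, of t] \<sigma> unfolding N_def by blast
      qed
      \<comment> \<open>The Hopf lemma at the end \<open>a\<close>; there \<open>Dx z a\<close> is
        twice the slope of the state.\<close>
      have "\<tau> * Dx (\<Phi> 0 z) a < 0"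
        by (rule strong_positivity_left(2)[OF v' K _ _ nn]) (use d near x D0(2)[OF \<Phi>_char(1)[OF z]] in auto)
      then show ?thesis using \<Phi>_0[OF z] by (auto simp: Dx_def)
    qed
    then show ?thesis by blast
  qed
qed

lemma sym_axis_slope: "sym_axis a \<Longrightarrow> z \<in> M \<Longrightarrow> deriv (fst z) (2 * a - x) = - deriv (fst z) x"
proof -
  assume a: "sym_axis a" and z: "z \<in> M"
  have e: "(\<lambda>x. fst z (2 * a - x)) = fst z" using a z by (auto simp: sym_axis_def)
  have "((\<lambda>x. fst z (2 * a - x)) has_real_derivative deriv (fst z) (2 * a - x) * (0 - 1)) (at x)"
    by (rule DERIV_chain2[OF C1_perD(2)[OF M_C1[OF z]]]) (intro derivative_intros)
  then have "(fst z has_real_derivative - deriv (fst z) (2 * a - x)) (at x)" unfolding e by simp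
  from DERIV_unique[OF this C1_perD(2)[OF M_C1[OF z]]] show ?thesis by simp
qed

text \<open>The slope at \<open>a\<close> vanishes on no state. So the states with positive slope
  form a closed set, which is invariant because the slope is continuous along orbits; minimality
  leaves only two possibilities.\<close>

lemma slope_sign:
  "sym_axis a \<or> (\<forall>z\<in>M. deriv (fst z) a > 0) \<or> (\<forall>z\<in>M. deriv (fst z) a < 0)"
proof (cases "sym_axis a")
  case False
  then have nz: "\<And>z. z \<in> M \<Longrightarrow> deriv (fst z) a \<noteq> 0" using sym_axis_or_slope by blast
  define N where "N = {z \<in> M. deriv (fst z) a > 0}"
  show ?thesis
  proof (cases "N = {}")
    case True
    then show ?thesis using nz unfolding N_def by (metis (mono_tags, lifting) empty_Collect_eq linorder_neqE_linordered_idom)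
  next
    case ne: False
    have "N = M"
    proof (rule minimality[OF _ ne])
      show "N \<subseteq> M" by (auto simp: N_def)
      show "Pi_map t ` N \<subseteq> N" if t: "0 \<le> t" for t
      proof (rule image_subsetI)
        fix z assume z: "z \<in> N"
        then have zM: "z \<in> M" by (simp add: N_def)
        have "deriv (fst (\<Phi> t z)) a > 0"
        proof (rule ccontr)
          assume n: "\<not> ?thesis"
          have "continuous_on {0..t} (\<lambda>t. deriv (fst (\<Phi> t z)) a)" by (rule \<Phi>_eval_continuous(2)[OF zM])
          from IVT2'[of "\<lambda>t. deriv (fst (\<Phi> t z)) a", OF _ _ t this, of 0] n z \<Phi>_0[OF zM]
          obtain s where "deriv (fst (\<Phi> s z)) a = 0" by (auto simp: N_def)
          then show False using nz \<Phi>_char(1)[OF zM] by blast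
        qed
        then show "Pi_map t z \<in> N" using Pi_map_M[OF zM t] t by (simp add: N_def \<Phi>_nonneg)
      qed
      fix \<sigma> l assume \<sigma>: "range \<sigma> \<subseteq> N" "limitin T \<sigma> l sequentially"
      have l: "l \<in> M" using limitin_topspace[OF \<sigma>(2)] topspace_T by simp
      have "deriv (fst (\<sigma> n)) a \<ge> 0" for n using \<sigma>(1) by (auto simp: N_def image_subset_iff intro: less_imp_le)
      then have "deriv (fst l) a \<ge> 0" using LIMSEQ_le_const[OF limitin_T_eval(2)[OF \<sigma>(2)]] by blast
      then show "l \<in> N" using l nz[OF l] by (simp add: N_def)
    qed
    then show ?thesis unfolding N_def by blast
  qed
qed simp

lemma M_nonempty: "M \<noteq> {}" using minimal by (simp add: minimal_set_def)

text \<open>By the dichotomy the critical points of any single state are exactly the axes, hence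
  common to all states. Between the two axes nearest to a point that is not an axis the slope has
  one sign; if it is negative, reflection at the left axis provides the increasing interval.\<close>

lemma profile:
  "(\<forall>z\<in>M. \<forall>x y. fst z x = fst z y) \<or>
   (\<exists>x0 l. l > 0 \<and> sym_axis x0 \<and> sym_axis (x0 + l) \<and> (\<forall>z\<in>M. \<forall>x. x0 < x \<and> x < x0 + l \<longrightarrow> deriv (fst z) x > 0))"
proof (cases "\<forall>a. sym_axis a")
  case True
  have "fst z x = fst z y" if "z \<in> M" for z x y
  proof -
    have "fst z (2 * a - y) = fst z y" for a using True that unfolding sym_axis_def by blast
    from this[of "(x + y) / 2"] show ?thesis by (simp add: field_simps)
  qed
  then show ?thesis by blast
next
  case False
  then obtain b where b: "\<not> sym_axis b" by blast
  obtain z0 where z0: "z0 \<in> M" using M_nonempty by blast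
  have crit: "sym_axis a \<longleftrightarrow> deriv (fst z) a = 0" if z: "z \<in> M" for a z
    using sym_axis_or_slope[of a] sym_axis_slope[of a z a] z by auto
  define S where "S = {a. sym_axis a}"
  have S_eq: "S = deriv (fst z0) -` {0}" using crit[OF z0] by (auto simp: S_def)
  have "closed S" unfolding S_eq
    using continuous_closed_vimage[of "{0}" "deriv (fst z0)"] C1_perD(3)[OF M_C1[OF z0], of UNIV]
    by (auto simp: continuous_on_eq_continuous_at)
  have dper: "deriv (fst z0) (x + L) = deriv (fst z0) x" for x
    by (rule periodic_derivative[of "fst z0" L "deriv (fst z0)"]) (use C1_perD[OF M_C1[OF z0]] in auto)
  \<comment> \<open>Every period contains a critical point, so \<open>b\<close> has axes on both
    sides.\<close>
  have "\<exists>s>b. s < b + L \<and> deriv (fst z0) s = 0"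
  proof -
    obtain s l where "b < s" "s < b + L" "DERIV (fst z0) s :> l" "fst z0 (b + L) - fst z0 b = (b + L - b) * l"
      using MVT[of b "b + L" "fst z0"] L C1_perD(4)[OF M_C1[OF z0]] C1_perD(2)[OF M_C1[OF z0]]
      by (metis less_add_same_cancel1 real_differentiable_def)
    then show ?thesis using C1_perD(1)[OF M_C1[OF z0], of b] L DERIV_imp_deriv by fastforce
  qed
  then obtain s where s: "b < s" "s \<in> S" by (auto simp: S_eq)
  have s': "s - of_int n * L \<in> S" for n :: int
    using s(2) periodic_int[of "deriv (fst z0)" L s "- n", OF dper] by (simp add: S_eq)
  obtain n :: int where n: "b - L \<le> s + of_int n * L" "s + of_int n * L < b" using periodic_representative[OF L, of "b - L" s] by auto
  have s2: "s + of_int n * L \<in> S" using s'[of "- n"] by simp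
  define x0 x1 where "x0 = Sup (S \<inter> {..b})" and "x1 = Inf (S \<inter> {b..})"
  have bs: "closed (S \<inter> {..b})" "S \<inter> {..b} \<noteq> {}" "bdd_above (S \<inter> {..b})" "closed (S \<inter> {b..})" "S \<inter> {b..} \<noteq> {}" "bdd_below (S \<inter> {b..})"
    using \<open>closed S\<close> s s2 n by (auto simp: closed_Int intro!: bdd_aboveI[of _ b] bdd_belowI[of _ b])
  have x0: "x0 \<in> S" "x0 \<le> b" using closed_contains_Sup[OF bs(2,3,1)] by (auto simp: x0_def)
  have x1: "x1 \<in> S" "b \<le> x1" using closed_contains_Inf[OF bs(5,6,4)] by (auto simp: x1_def)
  have "b \<notin> S" using b by (simp add: S_def)
  then have xb: "x0 < b" "b < x1" using x0 x1 by (auto simp: less_le)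
  have notS: "x \<notin> S" if "x0 < x" "x < x1" for x
  proof
    assume "x \<in> S"
    then show False using cSup_upper[OF _ bs(3), of x] cInf_lower[OF _ bs(6), of x] that by (cases "x \<le> b") (auto simp: x0_def x1_def)
  qed
  have sgn: "deriv (fst z) x > 0 \<longleftrightarrow> deriv (fst z) b > 0" if z: "z \<in> M" and x: "x0 < x" "x < x1" for z x
  proof (rule ccontr)
    assume n: "\<not> ?thesis"
    have c: "continuous_on A (deriv (fst z))" for A by (rule C1_perD(3)[OF M_C1[OF z]])
    have "\<exists>y. min x b \<le> y \<and> y \<le> max x b \<and> deriv (fst z) y = 0"
    proof (cases "deriv (fst z) (min x b) \<le> 0")
      case True
      then have "0 \<le> deriv (fst z) (max x b)" using n by (auto simp: min_def max_def split: if_splits)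
      then show ?thesis using IVT'[of "deriv (fst z)" "min x b" 0 "max x b", OF True _ _ c] by auto
    next
      case False
      then have "deriv (fst z) (max x b) \<le> 0" using n by (auto simp: min_def max_def split: if_splits)
      then show ?thesis using IVT2'[of "deriv (fst z)" "max x b" 0 "min x b", OF _ _ _ c] False by auto
    qed
    then obtain y where y: "min x b \<le> y" "y \<le> max x b" "deriv (fst z) y = 0" by blast
    then have "y \<in> S" "x0 < y" "y < x1" using crit[OF z, of y] x xb by (auto simp: S_def min_def max_def split: if_splits)
    then show False using notS by blast
  qed
  have sy: "sym_axis x0" "sym_axis x1" using x0 x1 by (auto simp: S_def)
  consider "\<forall>z\<in>M. deriv (fst z) b > 0" | "\<forall>z\<in>M. deriv (fst z) b < 0" using slope_sign[of b] b by blast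
  then show ?thesis
  proof cases
    case 1
    then have "\<forall>z\<in>M. \<forall>x. x0 < x \<and> x < x0 + (x1 - x0) \<longrightarrow> deriv (fst z) x > 0" using sgn by simp
    then show ?thesis using sy xb by (intro disjI2 exI[of _ x0] exI[of _ "x1 - x0"]) auto
  next
    case 2
    have neg: "deriv (fst z) x < 0" if "z \<in> M" "x0 < x" "x < x1" for z x
      using sgn[OF that] 2 notS[OF that(2,3)] crit[OF that(1), of x] that(1) by (force simp: S_def)
    have "deriv (fst z) x > 0" if z: "z \<in> M" and x: "2 * x0 - x1 < x" "x < x0" for z x
      using neg[OF z, of "2 * x0 - x"] sym_axis_slope[OF sy(1) z, of x] x by simp
    moreover have "sym_axis (2 * x0 - x1)"
      unfolding sym_axis_def
    proof (intro ballI allI)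
      fix z x assume z: "z \<in> M"
      have r0: "fst z (2 * x0 - y) = fst z y" and r1: "fst z (2 * x1 - y) = fst z y" for y using sy z by (auto simp: sym_axis_def)
      have "fst z (2 * (2 * x0 - x1) - x) = fst z (2 * x0 - (2 * x1 - (2 * x0 - x)))" by (simp add: algebra_simps)
      then show "fst z (2 * (2 * x0 - x1) - x) = fst z x" unfolding r0 r1 .
    qed
    ultimately show ?thesis using sy xb
      by (intro disjI2 exI[of _ "2 * x0 - x1"] exI[of _ "x1 - x0"]) (auto simp: algebra_simps)
  qed
qed

end

section \<open>Separation of the fibres at the minimum\<close>

lemma alt4_limit:
  assumes lim: "\<And>x. ((\<lambda>n. w n x) \<longlongrightarrow> w' x) F" and alt: "alt4 P w'"
  shows "\<forall>\<^sub>F n in F. alt4 P (w n)"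
proof -
  obtain a b c d where *: "a < b" "b < c" "c < d" "d < a + P" "w' a > 0" "w' b < 0" "w' c > 0" "w' d < 0"
    using alt unfolding alt4_def by blast
  have "\<forall>\<^sub>F n in F. w n a > 0" "\<forall>\<^sub>F n in F. w n b < 0" "\<forall>\<^sub>F n in F. w n c > 0" "\<forall>\<^sub>F n in F. w n d < 0"
    using order_tendstoD[OF lim] * by blast+
  then show ?thesis by eventually_elim (rule alt4I[OF *(1-4)])
qed

lemma periodic_uniformly_continuous:
  fixes h :: "real \<Rightarrow> real"
  assumes P: "P > 0" and per: "\<And>x. h (x + P) = h x" and c: "continuous_on UNIV h" and e: "e > 0"
  shows "\<exists>d>0. \<forall>x y. \<bar>x - y\<bar> < d \<longrightarrow> \<bar>h x - h y\<bar> < e"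
proof -
  have "uniformly_continuous_on {-1..P + 1} h"
    by (rule compact_uniformly_continuous[OF continuous_on_subset[OF c]]) auto
  then obtain d where d: "d > 0" "\<And>x y. x \<in> {-1..P + 1} \<Longrightarrow> y \<in> {-1..P + 1} \<Longrightarrow> \<bar>x - y\<bar> < d \<Longrightarrow> \<bar>h x - h y\<bar> < e"
    unfolding uniformly_continuous_on_def dist_real_def using e by (metis abs_minus_commute)
  show ?thesis
  proof (intro exI[of _ "min d 1"] conjI allI impI)
    fix x y :: real assume xy: "\<bar>x - y\<bar> < min d 1"
    obtain n :: int where n: "0 \<le> x + of_int n * P" "x + of_int n * P < 0 + P" using periodic_representative[OF P, of 0 x] by auto
    have "\<bar>h (x + of_int n * P) - h (y + of_int n * P)\<bar> < e" by (rule d(2)) (use n xy in auto)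
    then show "\<bar>h x - h y\<bar> < e" using periodic_int[of h P _ n, OF per] by simp
  qed (use d in simp)
qed

text \<open>\<open>comparison\<close> needs signs at the ends of an interval, which a circle lacks.
  If \<open>w\<close> vanishes identically at some time, the energy keeps it zero. Otherwise the
  circle is cut, for a short time, at a point where \<open>w\<close> is negative, and a positive
  value counts as a chain of length 1; where \<open>w\<close> is positive, the premise fails
  nearby.\<close>

lemma (in frac_embedding) order_preserved:
  assumes ls: "lsol K 0 UNIV w wx v r" and K: "K \<ge> 0" and per: "\<And>t x. w t (x + L) = w t x"
    and st: "s \<le> t" and le: "\<And>x. w s x \<le> 0"
  shows "w t x \<le> 0"
proof (cases "\<exists>\<tau>\<in>{s..t}. \<forall>x. w \<tau> x = 0")
  case True
  then obtain \<tau> where \<tau>: "\<tau> \<in> {s..t}" "\<And>x. w \<tau> x = 0" by blast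
  note D = evolD[OF lsolD(1)[OF ls]]
  have "continuous_on (UNIV \<times> UNIV) (\<lambda>(t, x). w t x ^ 4)"
    using D(2) unfolding split_beta by (intro continuous_intros)
  from continuous_on_param_integral[OF this] have Ec: "continuous_on {\<tau>..t} (\<lambda>\<tau>. integral {0..L} (\<lambda>x. w \<tau> x ^ 4))"
    using continuous_on_subset by blast
  have "integral {0..L} (\<lambda>x. w t x ^ 4) \<le> 0"
    using periodic_energy[OF ls K order_refl L per _ _ Ec] \<tau> by simp
  from integral_power4_zero[OF D(9) per this] show ?thesis by simp
next
  case False
  note D = evolD[OF lsolD(1)[OF ls]]
  note Dm = evolD[OF lsolD(1)[OF lsol_minus[OF ls]]]
  have "s \<le> s \<and> t \<le> t \<longrightarrow> (\<forall>x. w s x \<le> 0) \<longrightarrow> (\<forall>x. w t x \<le> 0)"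
  proof (rule Bolzano[OF st, of "\<lambda>a b. s \<le> a \<and> b \<le> t \<longrightarrow> (\<forall>x. w a x \<le> 0) \<longrightarrow> (\<forall>x. w b x \<le> 0)"])
    fix \<tau> assume \<tau>: "s \<le> \<tau>" "\<tau> \<le> t"
    then have "\<tau> \<in> {s..t}" by simp
    then obtain y where "w \<tau> y \<noteq> 0" using False by blast
    then consider "w \<tau> y > 0" | "- w \<tau> y > 0" by linarith
    then show "\<exists>d>0. \<forall>a b. a \<le> \<tau> \<and> \<tau> \<le> b \<and> b - a < d \<longrightarrow> (s \<le> a \<and> b \<le> t \<longrightarrow> (\<forall>x. w a x \<le> 0) \<longrightarrow> (\<forall>x. w b x \<le> 0))"
    proof cases
      case 1
      obtain d where d: "d > 0" "\<And>t'. \<bar>t' - \<tau>\<bar> < d \<Longrightarrow> w t' y > 0"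
        using continuous_time_sign[OF D(2,1) UNIV_I 1] by auto
      show ?thesis
      proof (intro exI[of _ d] conjI allI impI d(1))
        fix a b x assume ab: "a \<le> \<tau> \<and> \<tau> \<le> b \<and> b - a < d" and neg: "\<forall>x. w a x \<le> 0"
        have "w a y > 0" by (rule d(2)) (use ab in auto)
        then show "w b x \<le> 0" using neg by (meson not_le)
      qed
    next
      case 2
      obtain d where d: "d > 0" "\<And>t'. \<bar>t' - \<tau>\<bar> < d \<Longrightarrow> - w t' y > 0"
        using continuous_time_sign[OF Dm(2,1) UNIV_I 2] by auto
      show ?thesis
      proof (intro exI[of _ d] conjI allI impI d(1))
        fix a b x assume ab: "a \<le> \<tau> \<and> \<tau> \<le> b \<and> b - a < d" and neg: "\<forall>x. w a x \<le> 0"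
        have wy: "w t' y < 0" if "t' \<in> {a..b}" for t' using d(2)[of t'] that ab by auto
        show "w b x \<le> 0"
        proof (rule ccontr)
          assume pos: "\<not> w b x \<le> 0"
          obtain n :: int where n: "y \<le> x + of_int n * L" "x + of_int n * L < y + L" using periodic_representative[OF L, of y x] by auto
          have wx': "w b (x + of_int n * L) > 0" using pos periodic_int[of "w b" L x n, OF per] by simp
          have "x + of_int n * L \<noteq> y" using wx' wy[of b] ab by auto
          then have "achain (w b) 1 y 1 (y + L)" using n wx' by (auto intro!: exI[of _ "x + of_int n * L"])
          then have "achain (w a) 1 y 1 (y + L)"
            by (intro achain_decreasing[OF ls K, where s = a and t = b]) (use ab L wy per in \<open>auto intro: less_imp_le\<close>)
          then show False using neg by (auto simp: not_less[symmetric])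
        qed
      qed
    qed
  qed auto
  then show ?thesis using le by blast
qed

locale even_profile = minimal_setting +
  fixes x0 l :: real
  assumes l: "l > 0" and axis0: "sym_axis x0" and axis1: "sym_axis (x0 + l)"
    and slope: "\<And>z x. z \<in> M \<Longrightarrow> x0 < x \<Longrightarrow> x < x0 + l \<Longrightarrow> deriv (fst z) x > 0"
begin

text \<open>The composition of the reflections at \<open>x0\<close> and \<open>x0 + l\<close> is the
  translation by \<open>2 * l\<close>.\<close>

definition P :: real where "P = 2 * l"

lemma P: "P > 0" using l by (simp add: P_def)

lemma refl: "z \<in> M \<Longrightarrow> fst z (2 * x0 - x) = fst z x"
  using axis0 by (simp add: sym_axis_def)

lemma per: "z \<in> M \<Longrightarrow> fst z (x + P) = fst z x"
proof -
  assume z: "z \<in> M"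
  have "fst z (2 * (x0 + l) - (2 * x0 - x)) = fst z (2 * x0 - x)" using axis1 z unfolding sym_axis_def by blast
  moreover have "2 * (x0 + l) - (2 * x0 - x) = x + P" by (simp add: P_def)
  ultimately show ?thesis using refl[OF z] by (simp only:)
qed

lemma increasing:
  assumes z: "z \<in> M" and xy: "x0 \<le> x" "x < y" "y \<le> x0 + l"
  shows "fst z x < fst z y"
proof (rule DERIV_pos_imp_increasing_open[OF xy(2)])
  show "\<exists>d. DERIV (fst z) s :> d \<and> d > 0" if "x < s" "s < y" for s
    using slope[OF z, of s] C1_perD(2)[OF M_C1[OF z], of s] that xy by (intro exI[of _ "deriv (fst z) s"]) auto
qed (rule C1_perD(4)[OF M_C1[OF z]])

definition pair :: "state \<Rightarrow> state \<Rightarrow> bool" where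
  "pair z z' \<longleftrightarrow> z \<in> M \<and> z' \<in> M \<and> snd z = snd z'"

lemma pair_\<Phi>: "pair z z' \<Longrightarrow> pair (\<Phi> t z) (\<Phi> t z')"
  using \<Phi>_char(1) snd_\<Phi> by (simp add: pair_def)

lemma pair_sym: "pair z z' \<Longrightarrow> pair z' z" by (simp add: pair_def)

lemma shift_lsol:
  "\<exists>K\<ge>0. \<forall>z z' c. pair z z' \<longrightarrow>
    (\<exists>v r. lsol K 0 UNIV (\<lambda>t x. fst (\<Phi> t z) x - fst (\<Phi> t z') (x + c))
       (\<lambda>t x. deriv (fst (\<Phi> t z)) x - deriv (fst (\<Phi> t z')) (x + c)) v r)"
proof -
  obtain K where K: "K \<ge> 0" and ls: "\<And>z z' s c. z \<in> M \<Longrightarrow> z' \<in> M \<Longrightarrow> snd z = snd z' \<Longrightarrow> s = 1 \<or> s = -1 \<Longrightarrow>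
    \<exists>v r. lsol K 0 UNIV (\<lambda>t x. fst (\<Phi> t z) x - fst (\<Phi> t z') (s * x + c))
       (\<lambda>t x. deriv (fst (\<Phi> t z)) x - s * deriv (fst (\<Phi> t z')) (s * x + c)) v r" using difference_lsol by blast
  have "\<exists>v r. lsol K 0 UNIV (\<lambda>t x. fst (\<Phi> t z) x - fst (\<Phi> t z') (x + c))
       (\<lambda>t x. deriv (fst (\<Phi> t z)) x - deriv (fst (\<Phi> t z')) (x + c)) v r" if "pair z z'" for z z' c
    using ls[of z z' 1 c] that unfolding pair_def mult_1 by blast
  then show ?thesis using K by blast
qed

lemma pair_subsequence:
  assumes "\<And>n. pair (\<sigma> n) (\<sigma>' n)"
  shows "\<exists>r z z'. strict_mono (r :: nat \<Rightarrow> nat) \<and> limitin T (\<lambda>n. \<sigma> (r n)) z sequentially \<and> limitin T (\<lambda>n. \<sigma>' (r n)) z' sequentially \<and> pair z z'"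
proof -
  have "range \<sigma> \<subseteq> M" using assms by (auto simp: pair_def)
  from M_subsequence[OF this] obtain z r where r: "z \<in> M" "strict_mono (r :: nat \<Rightarrow> nat)" "limitin T (\<lambda>n. \<sigma> (r n)) z sequentially" by blast
  have "range (\<lambda>n. \<sigma>' (r n)) \<subseteq> M" using assms by (auto simp: pair_def)
  from M_subsequence[OF this] obtain z' s where s: "z' \<in> M" "strict_mono (s :: nat \<Rightarrow> nat)" "limitin T (\<lambda>n. \<sigma>' (r (s n))) z' sequentially" by blast
  have r': "limitin T (\<lambda>n. \<sigma> (r (s n))) z sequentially" using limitin_subsequence[OF s(2) r(3)] by (simp add: o_def)
  have "snd z p = snd z' p" for p
  proof -
    have "(\<lambda>n. snd (\<sigma> (r (s n))) p) \<longlonglongrightarrow> snd z p" by (rule limitin_compact_open_eval[OF limitin_T_hull[OF r'] tendsto_const])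
    moreover have "(\<lambda>n. snd (\<sigma>' (r (s n))) p) \<longlonglongrightarrow> snd z' p" by (rule limitin_compact_open_eval[OF limitin_T_hull[OF s(3)] tendsto_const])
    moreover have "snd (\<sigma>' (r (s n))) = snd (\<sigma> (r (s n)))" for n using assms by (simp add: pair_def)
    ultimately show ?thesis using LIMSEQ_unique by simp
  qed
  then have "pair z z'" using r(1) s(1) by (auto simp: pair_def)
  then show ?thesis using r' s(3) strict_mono_o[OF r(2) s(2)] by (intro exI[of _ "r \<circ> s"] exI[of _ z] exI[of _ z']) (simp add: o_def)
qed

text \<open>The fibre is closed in the compact space \<open>T\<close>, and evaluation at
  \<open>x\<close> is continuous.\<close>

lemma fibre_max:
  assumes z: "z \<in> M"
  shows "\<exists>m\<in>M. snd m = snd z \<and> (\<forall>y\<in>M. snd y = snd z \<longrightarrow> fst y x \<le> fst m x)"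
proof -
  define F where "F = {y \<in> M. snd y = snd z}"
  have "closedin T F"
  proof (rule metrizable_sequentially_closed[OF metrizable_T])
    show "F \<subseteq> topspace T" by (auto simp: F_def topspace_T)
    fix \<sigma> y assume \<sigma>: "range \<sigma> \<subseteq> F" and y: "limitin T \<sigma> y sequentially"
    have "snd y p = snd z p" for p
    proof -
      have "(\<lambda>n. snd (\<sigma> n) p) \<longlonglongrightarrow> snd y p" by (rule limitin_compact_open_eval[OF limitin_T_hull[OF y] tendsto_const])
      moreover have "snd (\<sigma> n) = snd z" for n using \<sigma> by (auto simp: F_def)
      ultimately show ?thesis by (simp add: LIMSEQ_const_iff)
    qed
    then show "y \<in> F" using limitin_topspace[OF y] by (auto simp: F_def topspace_T)
  qed
  then have "compactin T F" by (rule closedin_compact_space[OF compact_T])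
  moreover have "continuous_map T euclideanreal (\<lambda>y. fst y x)"
    by (rule metrizable_sequentially_continuous[OF metrizable_T]) (auto intro: limitin_T_eval(1))
  ultimately have "compact ((\<lambda>y. fst y x) ` F)" using image_compactin by fastforce
  moreover have "(\<lambda>y. fst y x) ` F \<noteq> {}" using z unfolding F_def by blast
  ultimately obtain s where "s \<in> (\<lambda>y. fst y x) ` F" "\<forall>t\<in>(\<lambda>y. fst y x) ` F. t \<le> s" using compact_attains_sup by blast
  then show ?thesis by (auto simp: F_def)
qed

text \<open>By minimality the relation would hold, for a suitable partner, for every member of \<open>M\<close>; it fails
  for the one with the largest value at \<open>x\<^sub>0\<close> in its fibre.\<close>

lemma no_shifted_order:
  assumes c: "0 < c" "c \<le> l" and zz: "pair z z'"
  shows "\<exists>x. fst z x > fst z' (x + c)"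
proof (rule ccontr)
  assume "\<not> ?thesis"
  then have le: "\<And>x. fst z x \<le> fst z' (x + c)" by (meson not_le)
  obtain K where K: "K \<ge> 0" and ls: "\<And>z z' c. pair z z' \<Longrightarrow>
    \<exists>v r. lsol K 0 UNIV (\<lambda>t x. fst (\<Phi> t z) x - fst (\<Phi> t z') (x + c))
       (\<lambda>t x. deriv (fst (\<Phi> t z)) x - deriv (fst (\<Phi> t z')) (x + c)) v r" using shift_lsol by blast
  define N where "N = {y. \<exists>y'. pair y y' \<and> (\<forall>x. fst y x \<le> fst y' (x + c))}"
  have "N = M"
  proof (rule minimality)
    show "N \<subseteq> M" by (auto simp: N_def pair_def)
    show "N \<noteq> {}" using zz le unfolding N_def by blast
    fix t :: real assume t: "0 \<le> t"
    show "Pi_map t ` N \<subseteq> N"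
    proof (rule image_subsetI)
      fix y assume "y \<in> N"
      then obtain y' where y': "pair y y'" "\<And>x. fst y x \<le> fst y' (x + c)" by (auto simp: N_def)
      have M: "y \<in> M" "y' \<in> M" using y'(1) by (auto simp: pair_def)
      obtain v r where v: "lsol K 0 UNIV (\<lambda>t x. fst (\<Phi> t y) x - fst (\<Phi> t y') (x + c))
       (\<lambda>t x. deriv (fst (\<Phi> t y)) x - deriv (fst (\<Phi> t y')) (x + c)) v r" using ls[OF y'(1)] by blast
      have "fst (\<Phi> t y) x - fst (\<Phi> t y') (x + c) \<le> 0" for x
      proof (rule order_preserved[OF v K _ t])
        show "fst (\<Phi> t y) (x + L) - fst (\<Phi> t y') (x + L + c) = fst (\<Phi> t y) x - fst (\<Phi> t y') (x + c)" for t x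
          using C1_perD(1)[OF M_C1[OF \<Phi>_char(1)[OF M(1)]], of t x] C1_perD(1)[OF M_C1[OF \<Phi>_char(1)[OF M(2)]], of t "x + c"]
          by (simp add: add_ac)
        show "fst (\<Phi> 0 y) x - fst (\<Phi> 0 y') (x + c) \<le> 0" for x using y'(2) \<Phi>_0 M by simp
      qed
      then have "\<forall>x. fst (\<Phi> t y) x \<le> fst (\<Phi> t y') (x + c)" by simp
      then have "\<Phi> t y \<in> N" using pair_\<Phi>[OF y'(1)] unfolding N_def by blast
      then show "Pi_map t y \<in> N" using t by (simp add: \<Phi>_nonneg)
    qed
  next
    fix \<sigma> y assume \<sigma>: "range \<sigma> \<subseteq> N" "limitin T \<sigma> y sequentially"
    have "\<forall>n. \<exists>y'. pair (\<sigma> n) y' \<and> (\<forall>x. fst (\<sigma> n) x \<le> fst y' (x + c))" using \<sigma>(1) unfolding N_def by blast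
    from choice[OF this] obtain \<sigma>' where \<sigma>': "\<And>n. pair (\<sigma> n) (\<sigma>' n)" "\<And>n x. fst (\<sigma> n) x \<le> fst (\<sigma>' n) (x + c)" by blast
    obtain r u u' where r: "strict_mono (r :: nat \<Rightarrow> nat)" "limitin T (\<lambda>n. \<sigma> (r n)) u sequentially"
      "limitin T (\<lambda>n. \<sigma>' (r n)) u' sequentially" "pair u u'" using pair_subsequence[of \<sigma> \<sigma>', OF \<sigma>'(1)] by blast
    have "limitin T (\<lambda>n. \<sigma> (r n)) y sequentially" using limitin_subsequence[OF r(1) \<sigma>(2)] by (simp add: o_def)
    then have "u = y" using limitin_Hausdorff_unique[OF r(2) _ _ metrizable_imp_Hausdorff_space[OF metrizable_T]] by simp
    moreover have "fst u x \<le> fst u' (x + c)" for x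
      by (rule LIMSEQ_le[OF limitin_T_eval(1)[OF r(2)] limitin_T_eval(1)[OF r(3)]]) (use \<sigma>'(2) in blast)
    ultimately show "y \<in> N" using r(4) unfolding N_def by blast
  qed
  have zM: "z \<in> M" using zz by (simp add: pair_def)
  obtain m where m: "m \<in> M" "snd m = snd z" "\<And>y. y \<in> M \<Longrightarrow> snd y = snd z \<Longrightarrow> fst y x0 \<le> fst m x0" using fibre_max[OF zM] by blast
  then have "m \<in> N" using \<open>N = M\<close> by simp
  then obtain m' where m': "pair m m'" "\<And>x. fst m x \<le> fst m' (x + c)" by (auto simp: N_def)
  \<comment> \<open>The chain of inequalities: \<open>x0 + c\<close> lies on the increasing branch,
    its mirror image is \<open>x0 - c\<close>, and the order relation leads from there to
    \<open>m'\<close> at \<open>x0\<close>, which cannot exceed the maximum of the fibre.\<close>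
  have "fst m x0 < fst m (x0 + c)" by (rule increasing[OF m(1)]) (use c in auto)
  also have "\<dots> = fst m (x0 - c)" using refl[OF m(1), of "x0 + c"] by simp
  also have "\<dots> \<le> fst m' x0" using m'(2)[of "x0 - c"] by simp
  also have "\<dots> \<le> fst m x0" by (rule m(3)) (use m' m in \<open>auto simp: pair_def\<close>)
  finally show False by simp
qed

text \<open>The previous lemma with the two states exchanged, read off at the mirror image of the
  shifted point.\<close>

lemma no_shifted_order':
  assumes c: "0 < c" "c \<le> l" and zz: "pair z z'"
  shows "\<exists>x. fst z x < fst z' (x + c)"
proof -
  obtain x where x: "fst z' x > fst z (x + c)" using no_shifted_order[OF c pair_sym[OF zz]] by blast
  have M: "z \<in> M" "z' \<in> M" using zz by (auto simp: pair_def)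
  have "fst z (2 * x0 - (x + c)) < fst z' (2 * x0 - x)" using x refl[OF M(1)] refl[OF M(2)] by simp
  then show ?thesis by (intro exI[of _ "2 * x0 - (x + c)"]) (simp add: algebra_simps)
qed

text \<open>Distinct states stay distinct by injectivity, so an order would be strict at time 1 by
  the strong maximum principle. Between periodic functions a strict order has a positive gap, which
  survives a small shift; this contradicts \<open>no_shifted_order\<close>.\<close>

lemma no_order:
  assumes zz: "pair z z'" and ne: "z \<noteq> z'"
  shows "\<exists>x. fst z x > fst z' x"
proof (rule ccontr)
  assume "\<not> ?thesis"
  then have le: "\<And>x. fst z x \<le> fst z' x" by (meson not_le)
  have M: "z \<in> M" "z' \<in> M" using zz by (auto simp: pair_def)
  obtain K v r where K: "K \<ge> 0" and ls: "lsol K 0 UNIV (\<lambda>t x. fst (\<Phi> t z) x - fst (\<Phi> t z') (x + 0))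
       (\<lambda>t x. deriv (fst (\<Phi> t z)) x - deriv (fst (\<Phi> t z')) (x + 0)) v r" using shift_lsol zz by blast
  let ?w = "\<lambda>t x. fst (\<Phi> t z) x - fst (\<Phi> t z') (x + 0)"
  have le': "?w t x \<le> 0" if "0 \<le> t" for t x
  proof (rule order_preserved[OF ls K _ that])
    show "?w t (x + L) = ?w t x" for t x
      using C1_perD(1)[OF M_C1[OF \<Phi>_char(1)[OF M(1)]], of t x] C1_perD(1)[OF M_C1[OF \<Phi>_char(1)[OF M(2)]], of t x] by simp
    show "?w 0 x \<le> 0" for x using le \<Phi>_0 M by simp
  qed
  note lm = lsol_minus[OF ls]
  note Dm = evolD[OF lsolD(1)[OF lm]]
  have "\<Phi> 1 z \<noteq> \<Phi> 1 z'" using Pi_map_inj[of 1] M ne by (auto simp: \<Phi>_nonneg inj_on_def)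
  moreover have "snd (\<Phi> 1 z) = snd (\<Phi> 1 z')" using pair_\<Phi>[OF zz] by (simp add: pair_def)
  ultimately have "fst (\<Phi> 1 z) \<noteq> fst (\<Phi> 1 z')" by (simp add: prod_eq_iff)
  then obtain q where "fst (\<Phi> 1 z) q \<noteq> fst (\<Phi> 1 z') q" by auto
  then have q: "- ?w 1 q > 0" using le'[of 1 q] by simp
  obtain d where d: "d > 0" "\<And>t'. \<bar>t' - 1\<bar> < d \<Longrightarrow> - ?w t' q > 0" using continuous_time_sign[OF Dm(2,1) UNIV_I q] by auto
  define e where "e = min (d / 2) 1"
  have e: "e > 0" "e < d" "e \<le> 1" using d by (auto simp: e_def)
  have strict: "fst (\<Phi> 1 z) x < fst (\<Phi> 1 z') x" for x
  proof -
    obtain n :: int where n: "q - P \<le> x + of_int n * P" "x + of_int n * P < q - P + P" using periodic_representative[OF P, of "q - P" x] by auto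
    have "- ?w 1 (x + of_int n * P) > 0"
    proof (rule strong_positivity_right(1)[OF lm K e(1)])
      show "- ?w t y \<ge> 0" if "t \<in> {1 - e..1}" for t y using le'[of t y] that e by auto
      show "- ?w t q > 0" if "t \<in> {1 - e..1}" for t using d(2)[of t] that e by auto
      show "q - 2 * P < q" "x + of_int n * P \<in> {q - 2 * P<..q}" using n P by auto
    qed auto
    then show ?thesis
      using periodic_int[of "fst (\<Phi> 1 z)" P x n, OF per[OF \<Phi>_char(1)[OF M(1)]]]
        periodic_int[of "fst (\<Phi> 1 z')" P x n, OF per[OF \<Phi>_char(1)[OF M(2)]]] by simp
  qed
  define u u' where "u = \<Phi> 1 z" and "u' = \<Phi> 1 z'"
  have uM: "u \<in> M" "u' \<in> M" using \<Phi>_char(1) M by (auto simp: u_def u'_def)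
  have "continuous_on {0..P} (\<lambda>x. fst u' x - fst u x)"
    by (intro continuous_intros C1_perD(4)[OF M_C1[OF uM(1)]] C1_perD(4)[OF M_C1[OF uM(2)]])
  moreover have "{0..P} \<noteq> {}" using P by simp
  ultimately have "\<exists>y\<in>{0..P}. \<forall>x\<in>{0..P}. fst u' y - fst u y \<le> fst u' x - fst u x"
    by (intro continuous_attains_inf compact_Icc)
  then obtain y where y: "\<And>x. x \<in> {0..P} \<Longrightarrow> fst u' y - fst u y \<le> fst u' x - fst u x" by blast
  define m where "m = fst u' y - fst u y"
  have m: "m > 0" using strict by (simp add: m_def u_def u'_def)
  have gap: "m \<le> fst u' x - fst u x" for x
  proof -
    obtain n :: int where n: "0 \<le> x + of_int n * P" "x + of_int n * P < 0 + P" using periodic_representative[OF P, of 0 x] by auto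
    then show ?thesis using y[of "x + of_int n * P"]
      periodic_int[of "fst u" P x n, OF per[OF uM(1)]] periodic_int[of "fst u'" P x n, OF per[OF uM(2)]] by (simp add: m_def)
  qed
  obtain d' where d': "d' > 0" "\<And>x y. \<bar>x - y\<bar> < d' \<Longrightarrow> \<bar>fst u' x - fst u' y\<bar> < m"
    using periodic_uniformly_continuous[OF P per[OF uM(2)] C1_perD(4)[OF M_C1[OF uM(2)]] m] by blast
  define c where "c = min l (d' / 2)"
  have c: "0 < c" "c \<le> l" "c < d'" using l d' by (auto simp: c_def)
  have "pair u u'" unfolding u_def u'_def by (rule pair_\<Phi>[OF zz])
  from no_shifted_order[OF c(1,2) this] obtain x where "fst u x > fst u' (x + c)" by blast
  then show False using gap[of x] d'(2)[of "x + c" x] c by auto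
qed

text \<open>The shift by half a period makes the second function decrease where the first increases.
  The difference is therefore monotone on each half period, which leaves room for two sign changes
  only.\<close>

lemma no_alt4_half_period:
  assumes zz: "pair z z'"
  shows "\<not> alt4 P (\<lambda>x. fst z x - fst z' (x + l))"
proof
  let ?w = "\<lambda>x. fst z x - fst z' (x + l)"
  assume alt: "alt4 P ?w"
  have M: "z \<in> M" "z' \<in> M" using zz by (auto simp: pair_def)
  have pw: "?w (x + P) = ?w x" for x using per[OF M(1), of x] per[OF M(2), of "x + l"] by (simp add: add_ac)
  have even: "?w (2 * (x0 + l) - x) = ?w x" for x
  proof -
    have "2 * (x0 + l) - x = (2 * x0 - x) + P" "2 * (x0 + l) - x + l = (2 * x0 - (x + l)) + P + P" by (simp_all add: P_def)
    then show ?thesis by (simp only: per[OF M(1)] per[OF M(2)] refl[OF M(1)] refl[OF M(2)])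
  qed
  have inc: "?w x < ?w y" if xy: "x0 \<le> x" "x < y" "y \<le> x0 + l" for x y
  proof -
    have "fst z' (s + l) = fst z' (2 * x0 + l - s)" for s
    proof -
      have "2 * x0 - (s + l) + P = 2 * x0 + l - s" by (simp add: P_def)
      then show ?thesis using refl[OF M(2), of "s + l"] per[OF M(2), of "2 * x0 - (s + l)"] by (simp only:)
    qed
    moreover have "fst z' (2 * x0 + l - y) < fst z' (2 * x0 + l - x)" by (rule increasing[OF M(2)]) (use xy in auto)
    ultimately show ?thesis using increasing[OF M(1) xy] by simp
  qed
  have dec: "?w x > ?w y" if xy: "x0 + l \<le> x" "x < y" "y \<le> x0 + P" for x y
  proof -
    have "?w (2 * (x0 + l) - y) < ?w (2 * (x0 + l) - x)" by (rule inc) (use xy in \<open>auto simp: P_def\<close>)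
    then show ?thesis unfolding even .
  qed
  obtain a where a: "?w a > 0" using alt unfolding alt4_def by blast
  have top: "?w (x0 + l) > 0"
  proof -
    obtain n :: int where n: "x0 \<le> a + of_int n * P" "a + of_int n * P < x0 + P" using periodic_representative[OF P, of x0 a] by auto
    have "?w (a + of_int n * P) > 0" using a periodic_int[of ?w P a n, OF pw] by simp
    moreover have "?w (a + of_int n * P) \<le> ?w (x0 + l)"
    proof -
      consider "a + of_int n * P < x0 + l" | "a + of_int n * P = x0 + l" | "a + of_int n * P > x0 + l" by linarith
      then show ?thesis
      proof cases
        case 1 then show ?thesis using inc[of "a + of_int n * P" "x0 + l"] n by simp
      next
        case 2 then show ?thesis by simp
      next
        case 3 then show ?thesis using dec[of "x0 + l" "a + of_int n * P"] n by simp
      qed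
    qed
    ultimately show ?thesis by linarith
  qed
  obtain x1 x2 x3 where x: "x0 + l < x1" "x1 < x2" "x2 < x3" "x3 < x0 + l + P" "?w x1 < 0" "?w x2 > 0" "?w x3 < 0"
    using alt4_iff_achain[of ?w P "x0 + l", OF pw P top] alt by (auto simp: numeral_3_eq_3)
  show False
  proof (cases "x2 \<le> x0 + P")
    case True
    then show ?thesis using dec[of x1 x2] x by simp
  next
    case False
    have "?w (x2 - P) < ?w (x3 - P)" by (rule inc) (use False x P in \<open>auto simp: P_def\<close>)
    then have "?w x2 < ?w x3" using pw[of "x2 - P"] pw[of "x3 - P"] by simp
    then show ?thesis using x by simp
  qed
qed

text \<open>Otherwise take the supremum of the shifts with four sign changes. The limit pair there has
  two sign changes, and simple zeros at some earlier time, while the approximating pairs have four at all earlier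
  times.\<close>

lemma no_alt4_shift:
  assumes c: "0 < c" "c \<le> l" and zz: "pair z z'"
  shows "\<not> alt4 P (\<lambda>x. fst z x - fst z' (x + c))"
proof
  assume alt0: "alt4 P (\<lambda>x. fst z x - fst z' (x + c))"
  \<comment> \<open>The supremum is taken over all pairs at once, since the limit pair obtained at
    the extremal shift need not be related to the given one.\<close>
  define B where "B = {c. 0 < c \<and> c \<le> l \<and> (\<exists>z z'. pair z z' \<and> alt4 P (\<lambda>x. fst z x - fst z' (x + c)))}"
  have cB: "c \<in> B" using c zz alt0 unfolding B_def by blast
  have bdd: "bdd_above B" by (rule bdd_aboveI[of _ l]) (auto simp: B_def)
  define s where "s = Sup B"
  have s: "0 < s" "s \<le> l"
  proof -
    show "0 < s" using cSup_upper[OF cB bdd] c by (simp add: s_def)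
    show "s \<le> l" unfolding s_def
    proof (rule cSup_least)
      show "B \<noteq> {}" using cB by blast
    qed (simp add: B_def)
  qed
  \<comment> \<open>Four sign changes survive a small increase of the shift, so \<open>s\<close> in
    \<open>B\<close> would not be an upper bound unless \<open>s = l\<close>, and that case is
    excluded by \<open>no_alt4_half_period\<close>.\<close>
  have sB: "s \<notin> B"
  proof
    assume "s \<in> B"
    then obtain z z' where zz: "pair z z'" and alt: "alt4 P (\<lambda>x. fst z x - fst z' (x + s))" unfolding B_def by blast
    have "s \<noteq> l" using no_alt4_half_period[OF zz] alt by auto
    then have sl: "s < l" using s by simp
    have M: "z' \<in> M" using zz by (simp add: pair_def)
    have "((\<lambda>c. fst z x - fst z' (x + c)) \<longlongrightarrow> fst z x - fst z' (x + s)) (at_right s)" for x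
    proof -
      have "isCont (fst z') (x + s)" using C1_perD(2)[OF M_C1[OF M]] DERIV_isCont by blast
      then have "((\<lambda>c. fst z' (x + c)) \<longlongrightarrow> fst z' (x + s)) (at_right s)"
        by (rule isCont_tendsto_compose) (intro tendsto_intros)
      then show ?thesis by (intro tendsto_intros)
    qed
    from alt4_limit[OF this alt] have "\<forall>\<^sub>F c in at_right s. alt4 P (\<lambda>x. fst z x - fst z' (x + c))" .
    moreover have "\<forall>\<^sub>F c in at_right s. c \<in> {s<..<l}" by (rule eventually_at_right_real[OF sl])
    ultimately have "\<forall>\<^sub>F c in at_right s. c \<in> B \<and> s < c"
    proof eventually_elim
      case (elim c)
      then have "0 < c" "c \<le> l" "s < c" using s by auto
      then show ?case using zz elim(1) unfolding B_def by blast
    qed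
    then obtain c' where "c' \<in> B" "s < c'" using eventually_happens' trivial_limit_at_right_real by blast
    then show False using cSup_upper[OF _ bdd, of c'] by (simp add: s_def)
  qed
  have "s \<in> closure B" unfolding s_def using closure_contains_Sup[OF _ bdd] cB by blast
  then obtain cn where cn: "\<And>n. cn n \<in> B" "cn \<longlonglongrightarrow> s" unfolding closure_sequential by blast
  have "\<forall>n. \<exists>p. pair (fst p) (snd p) \<and> alt4 P (\<lambda>x. fst (fst p) x - fst (snd p) (x + cn n))"
    using cn(1) unfolding B_def by auto
  from choice[OF this] obtain p where p: "\<And>n. pair (fst (p n)) (snd (p n))"
    "\<And>n. alt4 P (\<lambda>x. fst (fst (p n)) x - fst (snd (p n)) (x + cn n))" by blast
  obtain r z z' where r: "strict_mono (r :: nat \<Rightarrow> nat)" "limitin T (\<lambda>n. fst (p (r n))) z sequentially"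
      "limitin T (\<lambda>n. snd (p (r n))) z' sequentially" "pair z z'" using pair_subsequence[of "\<lambda>n. fst (p n)" "\<lambda>n. snd (p n)", OF p(1)] by blast
  have cr: "(\<lambda>n. cn (r n)) \<longlonglongrightarrow> s" using LIMSEQ_subseq_LIMSEQ[OF cn(2) r(1)] by (simp add: o_def)
  have M: "z \<in> M" "z' \<in> M" using r(4) by (auto simp: pair_def)
  obtain K where K: "K \<ge> 0" and ls: "\<And>z z' c. pair z z' \<Longrightarrow>
    \<exists>v r. lsol K 0 UNIV (\<lambda>t x. fst (\<Phi> t z) x - fst (\<Phi> t z') (x + c))
       (\<lambda>t x. deriv (fst (\<Phi> t z)) x - deriv (fst (\<Phi> t z')) (x + c)) v r" using shift_lsol by blast
  have wper: "fst (\<Phi> t z) (x + P) - fst (\<Phi> t z') (x + P + c) = fst (\<Phi> t z) x - fst (\<Phi> t z') (x + c)"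
    if "pair z z'" for z z' t x c
    using per[OF \<Phi>_char(1), of z t x] per[OF \<Phi>_char(1), of z' t "x + c"] that by (simp add: pair_def add_ac)
  let ?w = "\<lambda>t x. fst (\<Phi> t z) x - fst (\<Phi> t z') (x + s)"
  let ?wx = "\<lambda>t x. deriv (fst (\<Phi> t z)) x - deriv (fst (\<Phi> t z')) (x + s)"
  obtain v v' where v: "lsol K 0 UNIV ?w ?wx v v'" using ls[OF r(4)] by blast
  have noalt: "\<not> alt4 P (?w t)" for t using sB s pair_\<Phi>[OF r(4)] unfolding B_def by blast
  \<comment> \<open>The limit difference takes both signs at all times; this is what allows the
    circle to be cut into two arcs.\<close>
  have pos: "\<exists>x. ?w t x > 0" for t using no_shifted_order[OF s pair_\<Phi>[OF r(4)], of t] by (auto simp: less_diff_eq)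
  have neg: "\<exists>x. ?w t x < 0" for t using no_shifted_order'[OF s pair_\<Phi>[OF r(4)], of t] by (auto simp: diff_less_eq)
  have "\<exists>t\<in>{-1..0}. \<forall>x. ?w t x = 0 \<longrightarrow> ?wx t x \<noteq> 0"
    by (rule generic_simple_zeros[OF v K P wper[OF r(4)] _ _ noalt pos neg]) auto
  then obtain t where t: "t \<le> 0" "\<And>x. ?w t x = 0 \<Longrightarrow> ?wx t x \<noteq> 0" by auto
  note D = evolD[OF lsolD(1)[OF v]]
  have "\<exists>\<epsilon>>0. \<forall>u ux. (\<forall>x. (u has_real_derivative ux x) (at x)) \<and> (\<forall>x. u (x + P) = u x) \<and>
     (\<forall>x. \<bar>u x - ?w t x\<bar> < \<epsilon> \<and> \<bar>ux x - ?wx t x\<bar> < \<epsilon>) \<longrightarrow> \<not> alt4 P u"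
    by (rule alt4_stable[OF P wper[OF r(4)] D(4) D(10) noalt t(2) pos neg]) auto
  then obtain \<epsilon> where \<epsilon>: "\<epsilon> > 0" and stab: "\<And>u ux. (\<And>x. (u has_real_derivative ux x) (at x)) \<Longrightarrow> (\<And>x. u (x + P) = u x) \<Longrightarrow>
     (\<And>x. \<bar>u x - ?w t x\<bar> < \<epsilon> \<and> \<bar>ux x - ?wx t x\<bar> < \<epsilon>) \<Longrightarrow> \<not> alt4 P u" by blast
  have rM: "range (\<lambda>n. fst (p (r n))) \<subseteq> M" "range (\<lambda>n. snd (p (r n))) \<subseteq> M" using p(1) by (auto simp: pair_def)
  have \<epsilon>3: "\<epsilon> / 3 > 0" using \<epsilon> by simp
  have e1: "\<forall>\<^sub>F n in sequentially. \<forall>x. \<bar>fst (\<Phi> t (fst (p (r n)))) x - fst (\<Phi> t z) x\<bar> < \<epsilon> / 3 \<and>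
      \<bar>deriv (fst (\<Phi> t (fst (p (r n))))) x - deriv (fst (\<Phi> t z)) x\<bar> < \<epsilon> / 3"
    using limitin_frac_uniform[OF limitin_T_frac[OF \<Phi>_continuous[OF tendsto_const[of t] rM(1) r(2)]] \<epsilon>3] by eventually_elim blast
  have e2: "\<forall>\<^sub>F n in sequentially. \<forall>x. \<bar>fst (\<Phi> t (snd (p (r n)))) x - fst (\<Phi> t z') x\<bar> < \<epsilon> / 3 \<and>
      \<bar>deriv (fst (\<Phi> t (snd (p (r n))))) x - deriv (fst (\<Phi> t z')) x\<bar> < \<epsilon> / 3"
    using limitin_frac_uniform[OF limitin_T_frac[OF \<Phi>_continuous[OF tendsto_const[of t] rM(2) r(3)]] \<epsilon>3] by eventually_elim blast
  note Cz' = M_C1[OF \<Phi>_char(1)[OF M(2)], of t]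
  have dper: "deriv (fst (\<Phi> t z')) (x + L) = deriv (fst (\<Phi> t z')) x" for x
    by (rule periodic_derivative[of "fst (\<Phi> t z')" L "deriv (fst (\<Phi> t z'))"]) (use C1_perD[OF Cz'] in auto)
  obtain d1 where d1: "d1 > 0" "\<And>x y. \<bar>x - y\<bar> < d1 \<Longrightarrow> \<bar>fst (\<Phi> t z') x - fst (\<Phi> t z') y\<bar> < \<epsilon> / 3"
    using periodic_uniformly_continuous[OF L C1_perD(1,4)[OF Cz'] \<epsilon>3] by blast
  obtain d2 where d2: "d2 > 0" "\<And>x y. \<bar>x - y\<bar> < d2 \<Longrightarrow> \<bar>deriv (fst (\<Phi> t z')) x - deriv (fst (\<Phi> t z')) y\<bar> < \<epsilon> / 3"
    using periodic_uniformly_continuous[OF L dper C1_perD(3)[OF Cz'] \<epsilon>3] by blast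
  have e3: "\<forall>\<^sub>F n in sequentially. \<bar>cn (r n) - s\<bar> < min d1 d2"
    using tendstoD[OF cr, of "min d1 d2"] d1 d2 by (simp add: dist_real_def)
  from eventually_happens'[OF sequentially_bot eventually_conj[OF e1 eventually_conj[OF e2 e3]]]
  obtain n where n1: "\<And>x. \<bar>fst (\<Phi> t (fst (p (r n)))) x - fst (\<Phi> t z) x\<bar> < \<epsilon> / 3"
    "\<And>x. \<bar>deriv (fst (\<Phi> t (fst (p (r n))))) x - deriv (fst (\<Phi> t z)) x\<bar> < \<epsilon> / 3"
    and n2: "\<And>x. \<bar>fst (\<Phi> t (snd (p (r n)))) x - fst (\<Phi> t z') x\<bar> < \<epsilon> / 3"
    "\<And>x. \<bar>deriv (fst (\<Phi> t (snd (p (r n))))) x - deriv (fst (\<Phi> t z')) x\<bar> < \<epsilon> / 3"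
    and n3: "\<bar>cn (r n) - s\<bar> < min d1 d2" by blast
  define y y' \<gamma> where "y = fst (p (r n))" and "y' = snd (p (r n))" and "\<gamma> = cn (r n)"
  have yy: "pair y y'" using p(1) by (simp add: y_def y'_def)
  have \<gamma>: "0 < \<gamma>" "\<gamma> \<le> l" using cn(1)[of "r n"] by (auto simp: \<gamma>_def B_def)
  let ?u = "\<lambda>t x. fst (\<Phi> t y) x - fst (\<Phi> t y') (x + \<gamma>)"
  obtain q q' where q: "lsol K 0 UNIV ?u (\<lambda>t x. deriv (fst (\<Phi> t y)) x - deriv (fst (\<Phi> t y')) (x + \<gamma>)) q q'" using ls[OF yy] by blast
  have "\<not> alt4 P (?u t)"
  proof (rule stab)
    show "(?u t has_real_derivative deriv (fst (\<Phi> t y)) x - deriv (fst (\<Phi> t y')) (x + \<gamma>)) (at x)" for x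
      by (rule evolD(4)[OF lsolD(1)[OF q] UNIV_I])
    show "?u t (x + P) = ?u t x" for x by (rule wper[OF yy])
    fix x
    have "\<bar>(x + \<gamma>) - (x + s)\<bar> < d1" "\<bar>(x + \<gamma>) - (x + s)\<bar> < d2" using n3 by (auto simp: \<gamma>_def)
    from d1(2)[OF this(1)] d2(2)[OF this(2)] n1[of x] n2[of "x + \<gamma>"]
    show "\<bar>?u t x - ?w t x\<bar> < \<epsilon> \<and> \<bar>(deriv (fst (\<Phi> t y)) x - deriv (fst (\<Phi> t y')) (x + \<gamma>)) - ?wx t x\<bar> < \<epsilon>"
      unfolding y_def[symmetric] y'_def[symmetric] by linarith
  qed
  \<comment> \<open>Four sign changes at time 0 go back to the earlier time \<open>t\<close>, where
    closeness to the limit pair with its simple zeros excludes them.\<close>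
  moreover have "alt4 P (?u t)"
  proof (rule alt4_decreasing[OF q K P wper[OF yy] t(1)])
    show "\<exists>x. ?u \<tau> x \<noteq> 0" for \<tau> using no_shifted_order[OF \<gamma> pair_\<Phi>[OF yy], of \<tau>] by (metis eq_iff_diff_eq_0 less_irrefl)
    show "alt4 P (?u 0)" using p(2)[of "r n"] \<Phi>_0 yy by (simp add: y_def y'_def \<gamma>_def pair_def)
  qed auto
  ultimately show False by blast
qed

text \<open>Four sign changes form an open condition, so they would persist for small positive
  shifts.\<close>

lemma no_alt4:
  assumes zz: "pair z z'"
  shows "\<not> alt4 P (\<lambda>x. fst z x - fst z' x)"
proof
  assume alt: "alt4 P (\<lambda>x. fst z x - fst z' x)"
  have M: "z' \<in> M" using zz by (simp add: pair_def)
  have "((\<lambda>c. fst z x - fst z' (x + c)) \<longlongrightarrow> fst z x - fst z' x) (at_right 0)" for x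
  proof -
    have "isCont (fst z') (x + 0)" using C1_perD(2)[OF M_C1[OF M]] DERIV_isCont by blast
    then have "((\<lambda>c. fst z' (x + c)) \<longlongrightarrow> fst z' (x + 0)) (at_right 0)"
      by (rule isCont_tendsto_compose) (intro tendsto_intros)
    then have "((\<lambda>c. fst z x - fst z' (x + c)) \<longlongrightarrow> fst z x - fst z' (x + 0)) (at_right 0)" by (intro tendsto_intros)
    then show ?thesis by simp
  qed
  from alt4_limit[OF this alt] have "\<forall>\<^sub>F c in at_right 0. alt4 P (\<lambda>x. fst z x - fst z' (x + c))" .
  moreover have "\<forall>\<^sub>F c in at_right 0. c \<in> {0<..<l}" by (rule eventually_at_right_real[OF l])
  ultimately have "\<forall>\<^sub>F c in at_right (0::real). False"
  proof eventually_elim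
    case (elim c)
    then show ?case using no_alt4_shift[of c z z'] zz by auto
  qed
  then show False using eventually_happens' trivial_limit_at_right_real by blast
qed

text \<open>By \<open>no_order\<close> each state exceeds the other somewhere, and symmetry places
  both points in the half period to the right of \<open>x0\<close>. At the nearer point
  \<open>a\<close> and at its mirror image the difference has one sign, at the farther point
  \<open>b\<close> the other one. Having at most two sign changes then fixes the sign on the whole
  interval around \<open>x0\<close>.\<close>

lemma minimum_separates:
  assumes zz: "pair z z'" and eq: "fst z x0 = fst z' x0"
  shows "z = z'"
proof (rule ccontr)
  assume ne: "z \<noteq> z'"
  have main: False if zz: "pair z z'" and eq: "fst z x0 = fst z' x0"
    and ab: "x0 < a" "a < b" "b \<le> x0 + l" "fst z a > fst z' a" "fst z b < fst z' b" for z z' a b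
  proof -
    have M: "z \<in> M" "z' \<in> M" using zz by (auto simp: pair_def)
    obtain K v r where K: "K \<ge> 0" and ls: "lsol K 0 UNIV (\<lambda>t x. fst (\<Phi> t z) x - fst (\<Phi> t z') (x + 0))
       (\<lambda>t x. deriv (fst (\<Phi> t z)) x - deriv (fst (\<Phi> t z')) (x + 0)) v r" using shift_lsol zz by blast
    let ?w = "\<lambda>t x. fst (\<Phi> t z) x - fst (\<Phi> t z') (x + 0)"
    note D = evolD[OF lsolD(1)[OF ls]]
    note Dm = evolD[OF lsolD(1)[OF lsol_minus[OF ls]]]
    have "?w 0 a > 0" "- ?w 0 b > 0" using ab \<Phi>_0 M by auto
    from continuous_time_sign[OF D(2,1) UNIV_I this(1)] continuous_time_sign[OF Dm(2,1) UNIV_I this(2)]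
    obtain d1 d2 where d1: "d1 > 0" "\<And>t'. \<bar>t' - 0\<bar> < d1 \<Longrightarrow> ?w t' a > 0" and d2: "d2 > 0" "\<And>t'. \<bar>t' - 0\<bar> < d2 \<Longrightarrow> - ?w t' b > 0" by blast
    define d where "d = min d1 d2 / 2"
    have d: "d > 0" "d < d1" "d < d2" using d1(1) d2(1) by (auto simp: d_def)
    have sym: "?w t (2 * x0 - x) = ?w t x" for t x using refl[OF \<Phi>_char(1)[OF M(1)]] refl[OF \<Phi>_char(1)[OF M(2)]] by simp
    have "?w 0 x0 > 0"
    proof (rule strong_positivity_right(1)[OF ls K d(1), of 0 "2 * x0 - a" a])
      show wa: "?w t a > 0" if "t \<in> {0 - d..0}" for t using d1(2)[of t] that d by auto
      show "?w t x \<ge> 0" if t: "t \<in> {0 - d..0}" and x: "x \<in> {2 * x0 - a..a}" for t x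
      proof (rule ccontr)
        assume neg: "\<not> ?w t x \<ge> 0"
        have wa': "?w t (2 * x0 - a) > 0" using wa[OF t] sym[of t a] by simp
        have "x \<noteq> a" using neg wa[OF t] by auto
        moreover have "x \<noteq> 2 * x0 - a" using neg wa' by auto
        moreover have "?w t b < 0" using d2(2)[of t] t d by auto
        \<comment> \<open>The signs at \<open>2 * x0 - a\<close>, \<open>x\<close>,
          \<open>a\<close>, \<open>b\<close> would be +, -, +, -, and these points lie within one
          period because \<open>a < b\<close> and \<open>b \<le> x0 + l\<close>.\<close>
        ultimately have "alt4 P (?w t)" using x ab wa[OF t] wa' neg
          by (intro alt4I[of "2 * x0 - a" x a b]) (auto simp: P_def)
        then show False using no_alt4[OF pair_\<Phi>[OF zz], of t] by simp
      qed
    qed (use ab in auto)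
    then show False using eq \<Phi>_0 M by simp
  qed
  have M: "z \<in> M" "z' \<in> M" using zz by (auto simp: pair_def)
  \<comment> \<open>Periodicity moves the point into the period that starts at \<open>x0\<close>,
    and reflection moves it into the first half.\<close>
  have fold: "\<exists>a. x0 < a \<and> a \<le> x0 + l \<and> fst z a > fst z' a" if zz: "pair z z'" and eq: "fst z x0 = fst z' x0" and ne: "z \<noteq> z'" for z z'
  proof -
    have M: "z \<in> M" "z' \<in> M" using zz by (auto simp: pair_def)
    obtain x where x: "fst z x > fst z' x" using no_order[OF zz ne] by blast
    obtain n :: int where n: "x0 \<le> x + of_int n * P" "x + of_int n * P < x0 + P" using periodic_representative[OF P, of x0 x] by auto
    define a where "a = x + of_int n * P"
    have a: "fst z a > fst z' a" using x periodic_int[of "fst z" P x n, OF per[OF M(1)]] periodic_int[of "fst z'" P x n, OF per[OF M(2)]]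
      by (simp add: a_def)
    have "a \<noteq> x0" using a eq by auto
    then have a0: "x0 < a" "a < x0 + P" using n by (auto simp: a_def)
    show ?thesis
    proof (cases "a \<le> x0 + l")
      case True
      then show ?thesis using a a0 by blast
    next
      case False
      have f: "fst u (2 * x0 - a + P) = fst u a" if "u \<in> M" for u using per[OF that, of "2 * x0 - a"] refl[OF that, of a] by simp
      show ?thesis
        by (intro exI[of _ "2 * x0 - a + P"]) (use False a a0 f[OF M(1)] f[OF M(2)] in \<open>auto simp: P_def\<close>)
    qed
  qed
  obtain a where a: "x0 < a" "a \<le> x0 + l" "fst z a > fst z' a" using fold[OF zz eq ne] by blast
  obtain b where b: "x0 < b" "b \<le> x0 + l" "fst z' b > fst z b" using fold[OF pair_sym[OF zz]] eq ne by metis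
  have "a \<noteq> b" using a b by auto
  then consider "a < b" | "b < a" by linarith
  then show False
  proof cases
    case 1
    show False by (rule main[OF zz eq a(1) 1 b(2) a(3) b(3)])
  next
    case 2
    show False by (rule main[OF pair_sym[OF zz] eq[symmetric] b(1) 2 a(2) b(3) a(3)])
  qed
qed

end

section \<open>The flow on the image\<close>

context minimal_setting
begin

text \<open>For constant states any point serves; otherwise the common minimum is translated by a
  multiple of \<open>L\<close> into \<open>{0..<L}\<close>.\<close>

lemma minimum_determines_state:
  "\<exists>x0\<in>{0..<L}. \<forall>z\<in>M. \<forall>z'\<in>M. snd z = snd z' \<longrightarrow> fst z x0 = fst z' x0 \<longrightarrow> z = z'"
  using profile
proof
  assume const: "\<forall>z\<in>M. \<forall>x y. fst z x = fst z y"
  have "z = z'" if "z \<in> M" "z' \<in> M" "snd z = snd z'" "fst z 0 = fst z' 0" for z z'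
  proof -
    have "fst z x = fst z' x" for x using const that by metis
    then show ?thesis using that(3) by (simp add: prod_eq_iff fun_eq_iff)
  qed
  then show ?thesis using L by (intro bexI[of _ 0]) auto
next
  assume "\<exists>x0 l. l > 0 \<and> sym_axis x0 \<and> sym_axis (x0 + l) \<and> (\<forall>z\<in>M. \<forall>x. x0 < x \<and> x < x0 + l \<longrightarrow> deriv (fst z) x > 0)"
  then obtain x0 l where x0: "l > 0" "sym_axis x0" "sym_axis (x0 + l)"
    "\<And>z x. z \<in> M \<Longrightarrow> x0 < x \<Longrightarrow> x < x0 + l \<Longrightarrow> deriv (fst z) x > 0" by blast
  interpret even_profile L \<alpha> f M x0 l by unfold_locales (use x0 in auto)
  obtain n :: int where n: "0 \<le> x0 + of_int n * L" "x0 + of_int n * L < 0 + L"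
    using periodic_representative[OF L, of 0 x0] by auto
  have e: "fst z (x0 + of_int n * L) = fst z x0" if "z \<in> M" for z
    by (rule periodic_int[of "fst z"]) (rule C1_perD(1)[OF M_C1[OF that]])
  show ?thesis
  proof (intro bexI[of _ "x0 + of_int n * L"] ballI impI)
    fix z z' assume "z \<in> M" "z' \<in> M" "snd z = snd z'" "fst z (x0 + of_int n * L) = fst z' (x0 + of_int n * L)"
    then show "z = z'" using e by (intro minimum_separates) (auto simp: pair_def)
  qed (use n in auto)
qed

lemma \<Phi>_continuous_map: "continuous_map (prod_topology euclideanreal T) T (\<lambda>(t, z). \<Phi> t z)"
proof (rule metrizable_sequentially_continuous)
  show "metrizable_space (prod_topology euclideanreal T)"
    using metrizable_T metrizable_space_euclidean[where 'a = real] by (simp add: metrizable_space_prod_topology)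
  show "(\<lambda>(t, z). \<Phi> t z) \<in> topspace (prod_topology euclideanreal T) \<rightarrow> topspace T"
    using \<Phi>_char(1) by (auto simp: topspace_T)
  fix \<sigma> p assume \<sigma>: "range \<sigma> \<subseteq> topspace (prod_topology euclideanreal T)" "limitin (prod_topology euclideanreal T) \<sigma> p sequentially"
  have "(\<lambda>n. fst (\<sigma> n)) \<longlonglongrightarrow> fst p" "limitin T (\<lambda>n. snd (\<sigma> n)) (snd p) sequentially"
    using \<sigma>(2) by (auto simp: limitin_pairwise o_def)
  moreover have "range (\<lambda>n. snd (\<sigma> n)) \<subseteq> M" using \<sigma>(1) by (auto simp: topspace_T mem_Times_iff)
  ultimately show "limitin T (\<lambda>n. case \<sigma> n of (t, z) \<Rightarrow> \<Phi> t z) (case p of (t, z) \<Rightarrow> \<Phi> t z) sequentially"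
    unfolding split_beta by (intro \<Phi>_continuous)
qed

text \<open>A continuous injection of a compact space into a Hausdorff space is a homeomorphism onto
  its image, and conjugation carries the flow over. A compact invariant subset of the image has a
  closed invariant preimage in \<open>M\<close>, to which \<open>minimality\<close> applies.\<close>

lemma image_flow:
  assumes sep: "\<And>z z'. z \<in> M \<Longrightarrow> z' \<in> M \<Longrightarrow> snd z = snd z' \<Longrightarrow> fst z x0 = fst z' x0 \<Longrightarrow> z = z'"
  defines "Y \<equiv> subtopology (prod_topology euclideanreal (hull_topology f)) (eval_map x0 ` M)"
  shows "homeomorphic_map T Y (eval_map x0)"
    and "\<exists>\<Psi>. (\<forall>t. \<forall>(u, g)\<in>M. \<Psi> t (u x0, g) = (phi_on L \<alpha> M t u g x0, shift t g)) \<and>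
         minimal_flow Y \<Psi> \<and> (\<forall>t. \<forall>z\<in>M. eval_map x0 (skew_product_on L \<alpha> M t z) = \<Psi> t (eval_map x0 z))"
proof -
  let ?h = "eval_map x0"
  have h: "?h z = (fst z x0, snd z)" for z by (simp add: eval_map_def split_beta)
  have "snd z \<in> topspace (hull_topology f)" if "z \<in> M" for z
    using M_subset(2)[OF that] time_hull_approx(1)[OF M_subset(2)[OF that]]
    by (simp add: hull_topology_def topspace_compact_open)
  then have topY: "topspace Y = ?h ` M" unfolding Y_def topspace_subtopology by (auto simp: h)
  have "continuous_map T (prod_topology euclideanreal (hull_topology f)) ?h"
    unfolding continuous_map_pairwise o_def h fst_conv snd_conv
  proof
    show "continuous_map T euclideanreal (\<lambda>z. fst z x0)"
      by (rule metrizable_sequentially_continuous[OF metrizable_T]) (auto intro: limitin_T_eval(1))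
    have "continuous_map (phase_topology L \<alpha> f) (hull_topology f) snd" unfolding phase_topology_def by (rule continuous_map_snd)
    then show "continuous_map T (hull_topology f) snd" unfolding T_def by (rule continuous_map_from_subtopology)
  qed
  then have hc: "continuous_map T Y ?h" unfolding Y_def by (simp add: continuous_map_in_subtopology topspace_T)
  have HY: "Hausdorff_space Y" unfolding Y_def hull_topology_def
    by (intro Hausdorff_space_subtopology) (simp add: Hausdorff_space_prod_topology Hausdorff_space_subtopology Hausdorff_compact_open)
  have inj: "inj_on ?h M" by (rule inj_onI) (simp add: h sep)
  show hom: "homeomorphic_map T Y ?h"
    by (rule continuous_imp_homeomorphic_map[OF hc compact_T HY]) (use topY topspace_T inj in auto)
  then obtain k where k: "homeomorphic_maps T Y ?h k" unfolding homeomorphic_map_maps by blast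
  have kc: "continuous_map Y T k" and kh: "\<And>z. z \<in> M \<Longrightarrow> k (?h z) = z" and hk: "\<And>y. y \<in> topspace Y \<Longrightarrow> ?h (k y) = y"
    using k unfolding homeomorphic_maps_def by (auto simp: topspace_T)
  have kM: "k y \<in> M" if "y \<in> topspace Y" for y using that kh unfolding topY by auto
  define \<Psi> where "\<Psi> = (\<lambda>t y. ?h (\<Phi> t (k y)))"
  have \<Psi>h: "\<Psi> t (?h z) = ?h (\<Phi> t z)" if "z \<in> M" for t z using kh[OF that] by (simp add: \<Psi>_def)
  have "\<Psi> t (u x0, g) = (phi_on L \<alpha> M t u g x0, shift t g)" if "(u, g) \<in> M" for t u g
    using \<Psi>h[OF that, of t] snd_\<Phi>[OF that, of t] by (simp add: h phi_on_def \<Phi>_def)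
  moreover have "?h (skew_product_on L \<alpha> M t z) = \<Psi> t (?h z)" if "z \<in> M" for t z
    using \<Psi>h[OF that] by (simp add: \<Phi>_def)
  moreover have "minimal_flow Y \<Psi>"
    unfolding minimal_flow_def flow_def
  proof (intro conjI ballI allI impI)
    show "compact_space Y" using homeomorphic_compact_space[OF homeomorphic_map_imp_homeomorphic_space[OF hom]] compact_T by simp
    have "continuous_map (prod_topology euclideanreal Y) (prod_topology euclideanreal T) (\<lambda>p. (fst p, k (snd p)))"
      unfolding continuous_map_pairwise o_def fst_conv snd_conv
      using continuous_map_compose[OF continuous_map_snd kc, of euclideanreal] by (simp add: continuous_map_fst o_def)
    from continuous_map_compose[OF continuous_map_compose[OF this \<Phi>_continuous_map] hc]
    show "continuous_map (prod_topology euclideanreal Y) Y (\<lambda>(t, y). \<Psi> t y)"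
      by (simp add: o_def case_prod_unfold \<Psi>_def)
    show "\<Psi> 0 y = y" if y: "y \<in> topspace Y" for y using hk[OF y] \<Phi>_0[OF kM[OF y]] by (simp add: \<Psi>_def)
    show "\<Psi> (s + t) y = \<Psi> s (\<Psi> t y)" if y: "y \<in> topspace Y" for s t y
      using \<Phi>_add[OF kM[OF y]] kh[OF \<Phi>_char(1)[OF kM[OF y]]] by (simp add: \<Psi>_def)
    fix A assume A: "A \<noteq> {} \<and> compactin Y A \<and> (\<forall>t. \<Psi> t ` A = A)"
    then have AY: "A \<subseteq> ?h ` M" using compactin_subset_topspace topY by blast
    define N where "N = {z \<in> topspace T. ?h z \<in> A}"
    have "closedin T N" unfolding N_def
      by (rule closedin_continuous_map_preimage[OF hc compactin_imp_closedin[OF HY]]) (use A in blast)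
    have "N = M"
    proof (rule minimality)
      show "N \<subseteq> M" by (auto simp: N_def topspace_T)
      show "N \<noteq> {}" using A AY unfolding N_def topspace_T by blast
      show "Pi_map t ` N \<subseteq> N" if t: "0 \<le> t" for t
      proof (rule image_subsetI)
        fix z assume z: "z \<in> N"
        then have zM: "z \<in> M" by (simp add: N_def topspace_T)
        have "\<Psi> t (?h z) \<in> A" using A z unfolding N_def by blast
        then show "Pi_map t z \<in> N" using \<Psi>h[OF zM, of t] Pi_map_M[OF zM t] t by (simp add: N_def topspace_T \<Phi>_nonneg)
      qed
      show "y \<in> N" if "range \<sigma> \<subseteq> N" "limitin T \<sigma> y sequentially" for \<sigma> y
        by (rule limitin_closedin[OF that(2) \<open>closedin T N\<close>]) (use that(1) in \<open>auto intro!: always_eventually\<close>)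
    qed
    then have "?h ` M \<subseteq> A" unfolding N_def topspace_T by blast
    then show "A = topspace Y" using AY topY by blast
  qed
  ultimately show "\<exists>\<Psi>. (\<forall>t. \<forall>(u, g)\<in>M. \<Psi> t (u x0, g) = (phi_on L \<alpha> M t u g x0, shift t g)) \<and>
         minimal_flow Y \<Psi> \<and> (\<forall>t. \<forall>z\<in>M. ?h (skew_product_on L \<alpha> M t z) = \<Psi> t (?h z))"
    by (intro exI[of _ \<Psi>]) blast
qed

end

theorem theorem1p3:
  fixes L \<alpha> :: real
    and f :: "real \<times> real \<times> real \<Rightarrow> real"
    and M :: "((real \<Rightarrow> real) \<times> (real \<times> real \<times> real \<Rightarrow> real)) set"
  assumes "L > 0"
    and "0 < \<alpha>" and "\<alpha> < 1" and "compactly_embedded_C1 L \<alpha>"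
    and "standing_assumption f"
    and "\<And>t u p. f (t, u, p) = f (t, u, - p)"
    and "minimal_set L \<alpha> f M"
  shows "\<exists>x0\<in>{0..<L}.
    homeomorphic_map
      (subtopology (phase_topology L \<alpha> f) M)
      (subtopology (prod_topology euclideanreal (hull_topology f)) (eval_map x0 ` M))
      (eval_map x0) \<and>
    (\<exists>\<Psi>. (\<forall>t. \<forall>(u, g)\<in>M. \<Psi> t (u x0, g) = (phi_on L \<alpha> M t u g x0, shift t g)) \<and>
         minimal_flow
           (subtopology (prod_topology euclideanreal (hull_topology f)) (eval_map x0 ` M)) \<Psi> \<and>
         (\<forall>t. \<forall>z\<in>M. eval_map x0 (skew_product_on L \<alpha> M t z) = \<Psi> t (eval_map x0 z)))"
proof -
  interpret minimal_setting L \<alpha> f M by unfold_locales (fact assms)+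
  obtain x0 where "x0 \<in> {0..<L}" and sep: "\<And>z z'. z \<in> M \<Longrightarrow> z' \<in> M \<Longrightarrow> snd z = snd z' \<Longrightarrow> fst z x0 = fst z' x0 \<Longrightarrow> z = z'"
    using minimum_determines_state by blast
  then show ?thesis using image_flow[of x0, OF sep] unfolding T_def by blast
qed

end
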